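(* Let $T>0$. Assume that $b\in L^1(0,T;W^{1,1}_{loc})$ is a vector field satisfying $$\frac{|b(t,x)|}{1+|x|}\in L^1(0,T;L^1)+L^1(0,T;L^\infty)$$ and $$\operatorname{div} b\in L^1(0,T;L^\infty)+L^1(0,T;\operatorname{Exp}L).$$ Then for each $u_0\in L^\infty$ there exists a unique weak solution $u\in L^\infty(0,T;L^\infty)$ of the Cauchy problem $$\begin{cases}\dfrac{\partial u}{\partial t}+b\cdot\nabla u=0 & \text{in }(0,T)\times\mathbb{R}^n,\\ u(0,\cdot)=u_0 & \text{in }\mathbb{R}^n.\end{cases}$$
   Context: All function spaces in the space variable are over $\mathbb{R}^n$ (e.g. $L^p=L^p(\mathbb{R}^n)$), $b=b(t,x)$ takes values in $\mathbb{R}^n$, and $\operatorname{div}$, $\nabla$ are with respect to $x$. $L^q(0,T;X)$ denotes the usual space of (classes of) functions $t\mapsto f(t,\cdot)\in X$ whose $X$-norm is in $L^q(0,T)$; for local spaces such as $W^{1,1}_{loc}$ this is required on every ball of $\mathbb{R}^n$. For spaces $A,B$, $A+B$ is the set of sums $a+b'$ with $a\in A$, $b'\in B$. Orlicz space: $\operatorname{Exp}L$ is the Orlicz space associated with $P(t)=e^t-1$, i.e. the set of measurable $f$ on $\mathbb{R}^n$ for which $$\|f\|_{\operatorname{Exp}L}=\inf\left\{\lambda>0:\int_{\mathbb{R}^n}\left(\exp\left(\frac{|f(x)|}{\lambda}\right)-1\right)dx\le1\right\}$$ is finite. Weak solution: $u\in L^1(0,T;L^1_{loc})$ is a weak solution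 of the problem if for each $\varphi\in C^\infty([0,T]\times\mathbb{R}^n)$ with compact support in $[0,T)\times\mathbb{R}^n$, $$-\int_0^T\int_{\mathbb{R}^n}u\,\frac{\partial\varphi}{\partial t}\,dx\,dt-\int_{\mathbb{R}^n}u_0\,\varphi(0,\cdot)\,dx-\int_0^T\int_{\mathbb{R}^n}u\,\operatorname{div}(b\varphi)\,dx\,dt=0.$$ *)

theory Defs
  imports
    "HOL-Probability.Essential_Supremum"
    "HOL-Library.Function_Algebras"
    "HOL-Library.Set_Algebras"
begin

section \<open>Norms in the space variable\<close>

text \<open>All norms take values in the extended nonnegative reals.\<close>

definition L1_norm :: "'a::euclidean_space set \<Rightarrow> ('a \<Rightarrow> 'b::euclidean_space) \<Rightarrow> ennreal" where
  "L1_norm S f = (\<integral>\<^sup>+x. ennreal (norm (f x)) \<partial>lebesgue_on S)"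

definition Linf_norm :: "('a::euclidean_space \<Rightarrow> 'b::euclidean_space) \<Rightarrow> ennreal" where
  "Linf_norm f = esssup lebesgue (\<lambda>x. ennreal (norm (f x)))"

definition ExpL_norm :: "('a::euclidean_space \<Rightarrow> real) \<Rightarrow> ennreal" where
  "ExpL_norm f =
     Inf (ennreal ` {l. 0 < l \<and> (\<integral>\<^sup>+x. ennreal (exp (\<bar>f x\<bar> / l) - 1) \<partial>lebesgue) \<le> 1})"

definition Linf_space :: "('a::euclidean_space \<Rightarrow> 'b::euclidean_space) set" where
  "Linf_space = {f. f \<in> borel_measurable lebesgue \<and> Linf_norm f < \<infinity>}"


section \<open>Spaces of time-dependent functions\<close>

text \<open>
  The spaces \<open>L\<^sup>q(0,T;X)\<close>, where \<open>X\<close> is the space of functions on which the norm \<open>N\<close> is finite.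
  Measurability means Lebesgue measurability in \<open>(t,x)\<close>: for the nonseparable spaces \<open>L\<^sup>\<infinity>\<close>
  and \<open>Exp L\<close>, strong measurability into \<open>X\<close> would be far too restrictive.  Elements are functions;
  the values outside \<open>(0,T)\<close> are irrelevant, and membership only depends on the class modulo null
  sets of \<open>(0,T) \<times> \<real>\<^sup>n\<close>.
\<close>

definition time_measurable ::
    "real \<Rightarrow> (('a::euclidean_space \<Rightarrow> 'b::euclidean_space) \<Rightarrow> ennreal)
      \<Rightarrow> (real \<Rightarrow> 'a \<Rightarrow> 'b) \<Rightarrow> bool" where
  "time_measurable T N f \<longleftrightarrow>
     (\<lambda>(t, x). f t x) \<in> borel_measurable (lebesgue_on ({0<..<T} \<times> UNIV)) \<and>
     (AE t in lebesgue_on {0<..<T}. f t \<in> borel_measurable lebesgue) \<and>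
     (\<lambda>t. N (f t)) \<in> borel_measurable (lebesgue_on {0<..<T})"

definition L1_time ::
    "real \<Rightarrow> (('a::euclidean_space \<Rightarrow> 'b::euclidean_space) \<Rightarrow> ennreal)
      \<Rightarrow> (real \<Rightarrow> 'a \<Rightarrow> 'b) set" where
  "L1_time T N =
     {f. time_measurable T N f \<and> (\<integral>\<^sup>+t. N (f t) \<partial>lebesgue_on {0<..<T}) < \<infinity>}"

definition Linf_time ::
    "real \<Rightarrow> (('a::euclidean_space \<Rightarrow> 'b::euclidean_space) \<Rightarrow> ennreal)
      \<Rightarrow> (real \<Rightarrow> 'a \<Rightarrow> 'b) set" where
  "Linf_time T N =
     {f. time_measurable T N f \<and> esssup (lebesgue_on {0<..<T}) (\<lambda>t. N (f t)) < \<infinity>}"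

definition L1_L1loc ::
    "real \<Rightarrow> (real \<Rightarrow> 'a::euclidean_space \<Rightarrow> 'b::euclidean_space) set" where
  "L1_L1loc T = {f. \<forall>a r. f \<in> L1_time T (L1_norm (ball a r))}"


section \<open>Smooth functions and weak derivatives\<close>

text \<open>
  Derivatives are taken within \<open>S\<close>, hence one-sided at boundary points.  They are unique for the
  two kinds of sets used below, the whole space and \<open>[0,T] \<times> \<real>\<^sup>n\<close> with \<open>T > 0\<close>.
\<close>

primrec Ck_on :: "nat \<Rightarrow> 'a::euclidean_space set \<Rightarrow> ('a \<Rightarrow> real) \<Rightarrow> bool" where
  "Ck_on 0 S f \<longleftrightarrow> continuous_on S f"
| "Ck_on (Suc k) S f \<longleftrightarrow>
     (\<exists>f'. (\<forall>x\<in>S. (f has_derivative f' x) (at x within S)) \<and>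
           (\<forall>i\<in>Basis. Ck_on k S (\<lambda>x. f' x i)))"

definition smooth_on :: "'a::euclidean_space set \<Rightarrow> ('a \<Rightarrow> real) \<Rightarrow> bool" where
  "smooth_on S f \<longleftrightarrow> (\<forall>k. Ck_on k S f)"

definition test_function :: "('a::euclidean_space \<Rightarrow> real) \<Rightarrow> bool" where
  "test_function \<psi> \<longleftrightarrow>
     smooth_on UNIV \<psi> \<and> (\<exists>K. compact K \<and> (\<forall>x. x \<notin> K \<longrightarrow> \<psi> x = 0))"

definition L1loc :: "('a::euclidean_space \<Rightarrow> 'b::euclidean_space) set" where
  "L1loc = {f. \<forall>a r. f absolutely_integrable_on ball a r}"

definition has_weak_deriv ::
    "'a::euclidean_space \<Rightarrow> ('a \<Rightarrow> 'b::euclidean_space) \<Rightarrow> ('a \<Rightarrow> 'b) \<Rightarrow> bool" where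
  "has_weak_deriv e f g \<longleftrightarrow>
     f \<in> L1loc \<and> g \<in> L1loc \<and>
     (\<forall>\<psi>. test_function \<psi> \<longrightarrow>
        (LINT x|lebesgue. frechet_derivative \<psi> (at x) e *\<^sub>R f x)
          = - (LINT x|lebesgue. \<psi> x *\<^sub>R g x))"

text \<open>\<open>frechet_derivative \<psi> (at x) (v x)\<close> is \<open>v(x) \<cdot> \<nabla>\<psi>(x)\<close>.\<close>

definition has_weak_div ::
    "('a::euclidean_space \<Rightarrow> 'a) \<Rightarrow> ('a \<Rightarrow> real) \<Rightarrow> bool" where
  "has_weak_div v d \<longleftrightarrow>
     v \<in> L1loc \<and> d \<in> L1loc \<and>
     (\<forall>\<psi>. test_function \<psi> \<longrightarrow>
        (LINT x|lebesgue. frechet_derivative \<psi> (at x) (v x))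
          = - (LINT x|lebesgue. \<psi> x * d x))"

text \<open>
  The divergence in \<open>x\<close> of a time-dependent vector field.  It is determined up to a null set
  of \<open>(0,T) \<times> \<real>\<^sup>n\<close>.
\<close>

definition has_time_div ::
    "real \<Rightarrow> (real \<Rightarrow> 'a::euclidean_space \<Rightarrow> 'a) \<Rightarrow> (real \<Rightarrow> 'a \<Rightarrow> real) \<Rightarrow> bool" where
  "has_time_div T v d \<longleftrightarrow>
     (\<lambda>(t, x). d t x) \<in> borel_measurable (lebesgue_on ({0<..<T} \<times> UNIV)) \<and>
     (AE t in lebesgue_on {0<..<T}. has_weak_div (v t) (d t))"

definition L1_W11loc ::
    "real \<Rightarrow> (real \<Rightarrow> 'a::euclidean_space \<Rightarrow> 'b::euclidean_space) set" where
  "L1_W11loc T =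
     {f \<in> L1_L1loc T. \<forall>i\<in>Basis. \<exists>g\<in>L1_L1loc T.
        AE t in lebesgue_on {0<..<T}. has_weak_deriv i (f t) (g t)}"


section \<open>Weak solutions of the transport equation\<close>

text \<open>Only the values of \<open>\<phi>\<close> on \<open>[0,T] \<times> \<real>\<^sup>n\<close> matter.\<close>

definition transport_test_function ::
    "real \<Rightarrow> (real \<times> 'a::euclidean_space \<Rightarrow> real) \<Rightarrow> bool" where
  "transport_test_function T \<phi> \<longleftrightarrow>
     smooth_on ({0..T} \<times> UNIV) \<phi> \<and>
     (\<exists>K. compact K \<and> K \<subseteq> {0..<T} \<times> UNIV \<and> (\<forall>p\<in>{0..T} \<times> UNIV - K. \<phi> p = 0))"

text \<open>
  Here \<open>d\<close> is the function \<open>div (b \<phi>)\<close>; since it is unique up to a null set, the choice is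
  immaterial.  Its product with \<open>u\<close> is required to be integrable, because the Bochner integral of
  a nonintegrable function is 0 by convention; the other two integrands are integrable
  if \<open>u\<^sub>0\<close> is locally integrable.
\<close>

definition weak_solution ::
    "real \<Rightarrow> (real \<Rightarrow> 'a::euclidean_space \<Rightarrow> 'a) \<Rightarrow> ('a \<Rightarrow> real) \<Rightarrow> (real \<Rightarrow> 'a \<Rightarrow> real) \<Rightarrow> bool"
  where
  "weak_solution T b u\<^sub>0 u \<longleftrightarrow>
     u \<in> L1_L1loc T \<and>
     (\<forall>\<phi>. transport_test_function T \<phi> \<longrightarrow>
        (\<exists>d. has_time_div T (\<lambda>t x. \<phi> (t, x) *\<^sub>R b t x) d \<and>
             integrable (lebesgue_on ({0<..<T} \<times> UNIV)) (\<lambda>(t, x). u t x * d t x) \<and>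
             - (LINT t|lebesgue_on {0<..<T}. LINT x|lebesgue. u t x * deriv (\<lambda>s. \<phi> (s, x)) t)
             - (LINT x|lebesgue. u\<^sub>0 x * \<phi> (0, x))
             - (LINT t|lebesgue_on {0<..<T}. LINT x|lebesgue. u t x * d t x) = 0))"

end

theory Submission
  imports Defs "HOL-Computational_Algebra.Polynomial" "HOL-Probability.Probability" "HOL-Real_Asymp.Real_Asymp"
begin

text \<open>
  Existence: for a locally bounded field, the monotone upwind difference scheme has solutions bounded by the
  data; approximate limits in the convex hull of the sequence replace weak-* compactness, and mollifying the
  field in space removes the local boundedness.
  Uniqueness follows DiPerna and Lions.  By linearity consider \<open>u\<^sub>0 = 0\<close>.  The commutator of
  mollification with \<open>b \<cdot> \<nabla>\<close> tends to 0 in \<open>L\<^sup>1\<^sub>l\<^sub>o\<^sub>c\<close>, so \<open>v\<^sup>2\<close> solves the equation as well.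
  Testing with \<open>(1 + |x|\<^sup>2/R\<^sup>2)\<^sup>-\<^sup>n\<close> and splitting \<open>div b = O(\<alpha> + \<beta>\<sigma>)\<close>, \<open>\<integral>(e\<^sup>\<sigma> - 1) \<le> 1\<close>, at \<open>\<sigma> = k\<close>
  by \<open>\<sigma> \<le> k + e\<^sup>-\<^sup>k\<^sup>/\<^sup>2 (e\<^sup>\<sigma> - 1)\<close>, Gronwall's inequality gives
  \<open>\<integral>v\<^sup>2 \<le> C e\<^sup>-\<^sup>k\<^sup>/\<^sup>2 exp (k \<integral>\<beta>)\<close> after \<open>R \<rightarrow> \<infinity>\<close>.  For \<open>k \<rightarrow> \<infinity>\<close> this vanishes as long as
  \<open>\<integral>\<beta> \<le> 1/4\<close>, and finitely many such time steps cover \<open>(0,T)\<close>.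
\<close>

text \<open>Three obstacles shape the proof. The hypotheses on \<open>b\<close> hold for almost
  every time only; \<open>b\<close> is therefore replaced by a Borel field that is zero outside a
  Borel set of good times, so that its weak gradient identity holds at every time. A weak solution
  has no regularity in time; test functions \<open>th t * psi x\<close> show that each spatial
  moment agrees almost everywhere with a primitive, and calculus in time is done with primitives of
  integrable functions, by Fubini. The divergence may be unbounded; truncating it at height
  \<open>k\<close> gains \<open>exp (- k / 2)\<close> because \<open>s <= 2 sinh (s / 2)\<close>,
  and while the integral of \<open>\<beta>\<close> is at most 1/4 the loss is at most
  \<open>exp (k / 4)\<close>. For existence, the rates of the scheme are nonnegative and their total
  does not depend on \<open>x\<close>, so the bound on the solution comes from the data alone and
  survives both limits. The exponent \<open>n\<close> makes the weight integrable, while its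
  gradient, even multiplied by \<open>1 + norm x\<close>, is at most \<open>4 n\<close> times the
  weight for \<open>R >= 1\<close> and tends to 0 as \<open>R\<close> grows.\<close>

text \<open>Measurability, integrability and integrals are with respect to Lebesgue measure on Borel sets, and
  \<open>FD f x\<close> is the derivative of \<open>f\<close> at \<open>x\<close>.  A function \<open>F\<close> of \<open>t\<close> and \<open>x\<close> is evaluated at a pair \<open>p\<close>
  by \<open>F@@p\<close>, and \<open>jm F\<close> says that it is jointly measurable.\<close>

abbreviation (input) BM where "BM == borel_measurable borel"
abbreviation (input) bm where "bm == borel_measurable"
abbreviation (input) Lint where "Lint == integrable lborel"
abbreviation (input) FD where "FD == frechet_derivative"
abbreviation (input) en where "en == ennreal"
abbreviation (input) ind where "ind == indicator"
abbreviation (input) indc where "indc r == indicator (cball 0 r)"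
abbreviation (input) tf where "tf == test_function"
abbreviation (input) jm where "jm F == case_prod F : borel_measurable borel"
abbreviation (input) nn_lborel (binder "NN " [0] 10) where "nn_lborel f == integral\<^sup>N lborel f"
abbreviation (input) int_lborel (binder "LB " [60] 60) where "int_lborel f == integral\<^sup>L lborel f"
abbreviation (input) AE_lborel (binder "AEL " [0] 10) where "AE_lborel P == almost_everywhere lborel P"
abbreviation (input) at_pair (infixl "@@" 95) where "F@@p == F (fst p) (snd p)"
abbreviation (input) seq_tendsto (infixr "---->" 60) where "X ----> L == X \<longlonglongrightarrow> L"
notation (input) scaleR (infixr "*R" 75)

lemmas I_add = Bochner_Integration.integrable_add
  and I_bound = Bochner_Integration.integrable_bound
  and I_diff = Bochner_Integration.integrable_diff
  and I_minus = Bochner_Integration.integrable_minus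
  and I_sum = Bochner_Integration.integrable_sum
  and L_add = Bochner_Integration.integral_add
  and L_cong = Bochner_Integration.integral_cong
  and L_diff = Bochner_Integration.integral_diff
  and L_mono = Bochner_Integration.integral_mono
  and L_mono' = Bochner_Integration.integral_mono'
  and L_nonneg = Bochner_Integration.integral_nonneg
  and L_scaleR_left = Bochner_Integration.integral_scaleR_left
  and L_sum = Bochner_Integration.integral_sum
  and Lint_meas = borel_measurable_integrable

section \<open>Smooth functions and test functions\<close>

lemma Ck_on_SucD: "Ck_on (Suc k) S f ==> Ck_on k S f"
proof (induction k arbitrary: f)
 case 0
 then show ?case by (auto intro: has_derivative_continuous_on)
next
 case (Suc k)
 then obtain f' where "ALL x:S. (f has_derivative f' x) (at x within S)"
  "ALL i:Basis. Ck_on (Suc k) S (%x. f' x i)"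
  by (subst (asm) Ck_on.simps(2)) blast
 with Suc.IH show ?case unfolding Ck_on.simps by blast
qed

lemma Ck_on_cong: "Ck_on k S f ==> (!!x. x : S ==> f x = g x) ==> Ck_on k S g"
proof (induction k arbitrary: f g)
 case 0
 then show ?case by (simp cong: continuous_on_cong)
next
 case (Suc k)
 then obtain f' where f': "ALL x:S. (f has_derivative f' x) (at x within S)"
  "ALL i:Basis. Ck_on k S (%x. f' x i)" by auto
 have "ALL x:S. (g has_derivative f' x) (at x within S)"
  using f'(1) Suc.prems(2) by (auto intro: has_derivative_transform[of _ S g f])
 with f'(2) show ?case by auto
qed

lemma Ck_on_const: "Ck_on k S (%_. c)"
proof (induction k arbitrary: c)
 case (Suc k)
 have "ALL x:S. ((%_. c) has_derivative (%_. 0)) (at x within S)" by auto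
 then show ?case using Suc by (auto intro!: exI[of _ "%_ _. 0"])
qed simp

lemma Ck_on_add: "Ck_on k S f ==> Ck_on k S g ==> Ck_on k S (%x. f x + g x)"
proof (induction k arbitrary: f g)
 case 0
 then show ?case by (auto intro: continuous_intros)
next
 case (Suc k)
 then obtain f' g' where f': "ALL x:S. (f has_derivative f' x) (at x within S)"
  "ALL i:Basis. Ck_on k S (%x. f' x i)" and g': "ALL x:S. (g has_derivative g' x) (at x within S)"
  "ALL i:Basis. Ck_on k S (%x. g' x i)" by auto
 show ?case unfolding Ck_on.simps
  by (rule exI[of _ "%x h. f' x h + g' x h"]) (use f' g' Suc.IH in \<open>auto intro!: has_derivative_add\<close>)
qed

lemma Ck_on_mult: "Ck_on k S f ==> Ck_on k S g ==> Ck_on k S (%x. f x*g x)"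
proof (induction k arbitrary: f g)
 case 0
 then show ?case by (auto intro: continuous_intros)
next
 case (Suc k)
 have fk: "Ck_on k S f" and gk: "Ck_on k S g" using Suc.prems Ck_on_SucD by blast+
 from Suc.prems obtain f' g' where f': "ALL x:S. (f has_derivative f' x) (at x within S)"
  "ALL i:Basis. Ck_on k S (%x. f' x i)" and g': "ALL x:S. (g has_derivative g' x) (at x within S)"
  "ALL i:Basis. Ck_on k S (%x. g' x i)" by auto
 show ?case unfolding Ck_on.simps
  by (rule exI[of _ "%x h. f x*g' x h + f' x h*g x"])
  (use f' g' in \<open>auto intro!: has_derivative_mult Ck_on_add Suc.IH fk gk\<close>)
qed

lemma Ck_on_sum: "finite A ==> (!!a. a : A ==> Ck_on k S (f a)) ==> Ck_on k S (%x. SUM a:A. f a x)"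
 by (induction A rule: finite_induct) (auto intro: Ck_on_const Ck_on_add)

lemma Ck_on_power: "Ck_on k S f ==> Ck_on k S (%x. f x ^ m)"
 by (induction m) (auto intro: Ck_on_const Ck_on_mult)

lemma Ck_on_bounded_linear:
 assumes "bounded_linear L" shows "Ck_on k S L"
proof (cases k)
 case 0
 then show ?thesis using assms by (simp add: linear_continuous_on)
next
 case (Suc m)
 have "ALL x:S. (L has_derivative L) (at x within S)"
  using assms by (auto intro: bounded_linear_imp_has_derivative)
 then show ?thesis unfolding Suc Ck_on.simps
  by (intro exI[of _ "%_. L"]) (auto intro: Ck_on_const)
qed

lemma Ck_on_compose_affine:
 fixes L :: "'b::euclidean_space => 'a::euclidean_space"
 assumes "Ck_on k S f" "bounded_linear L" "!!x. x : S' ==> L x + c : S"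
 shows "Ck_on k S' (%x. f (L x + c))"
 using assms(1)
proof (induction k arbitrary: f)
 case 0
 have "continuous_on S' (%x. L x + c)"
  using assms(2) by (intro continuous_intros linear_continuous_on)
 with 0 show ?case using assms(3) by (auto intro!: continuous_on_compose2[of S f S'])
next
 case (Suc k)
 then obtain f' where f': "!!x. x:S ==> (f has_derivative f' x) (at x within S)"
  "!!i. i:Basis ==> Ck_on k S (%x. f' x i)" by auto
 have d: "((%x. f (L x + c)) has_derivative (%h. f' (L x + c) (L h))) (at x within S')"
  if "x : S'" for x
 proof -
  have "((%x. L x + c) has_derivative L) (at x within S')"
  using bounded_linear_imp_has_derivative[OF assms(2)] by (auto intro!: derivative_eq_intros)
  moreover have "(f has_derivative f' (L x + c)) (at (L x + c) within (%x. L x + c) ` S')"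
  by (rule has_derivative_subset[OF f'(1)]) (use assms(3) that in auto)
  ultimately show ?thesis by (rule has_derivative_in_compose)
 qed
 \<comment> \<open>\<open>Ck_on\<close> speaks only of derivatives along basis vectors, so the
   derivative along \<open>L i\<close> is expanded in the basis; the coefficients are
   constants.\<close>
 have "Ck_on k S' (%x. f' (L x + c) (L i))" for i
 proof (rule Ck_on_cong)
  show "Ck_on k S' (%x. SUM j:Basis. (L i \<bullet> j)*f' (L x + c) j)"
  by (intro Ck_on_sum Ck_on_mult Ck_on_const Suc.IH f'(2)) auto
  fix x assume "x : S'"
  then have "linear (f' (L x + c))"
  using f'(1) assms(3) by (blast intro: has_derivative_linear)
  then have "f' (L x + c) (SUM j:Basis. (L i \<bullet> j) *R j) = (SUM j:Basis. (L i \<bullet> j)*f' (L x + c) j)"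
  by (simp add: linear_sum linear_cmul)
  then show "(SUM j:Basis. (L i \<bullet> j)*f' (L x + c) j) = f' (L x + c) (L i)"
  by (simp add: euclidean_representation)
 qed
 with d show ?case unfolding Ck_on.simps by (intro exI[of _ "%x h. f' (L x + c) (L h)"]) auto
qed

lemma Ck_on_compose_real:
 fixes f :: "real => real"
 assumes "Ck_on k UNIV f" "Ck_on k S g"
 shows "Ck_on k S (%x. f (g x))"
 using assms
proof (induction k arbitrary: f g)
 case 0
 then show ?case by (auto intro: continuous_on_compose2)
next
 case (Suc k)
 have gk: "Ck_on k S g" using Suc.prems Ck_on_SucD by blast
 from Suc.prems obtain f' g' where f': "!!x. (f has_derivative f' x) (at x)"
  "Ck_on k UNIV (%x. f' x 1)" and g': "!!x. x:S ==> (g has_derivative g' x) (at x within S)"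
  "!!i. i:Basis ==> Ck_on k S (%x. g' x i)" by simp blast
 have lin: "f' x h = h*f' x 1" for x h
  using has_derivative_linear[OF f'(1), of x] linear_cmul[of "f' x" h 1] by simp
 have "((%x. f (g x)) has_derivative (%h. g' x h*f' (g x) 1)) (at x within S)" if "x : S" for x
  using has_derivative_compose[OF g'(1)[OF that] f'(1)[of "g x"]] by (subst (asm) lin)
 moreover have "Ck_on k S (%x. g' x i*f' (g x) 1)" if "i : Basis" for i
  using Ck_on_mult[OF g'(2)[OF that] Suc.IH[OF f'(2) gk]] by simp
 ultimately show ?case unfolding Ck_on.simps by (intro exI[of _ "%x h. g' x h*f' (g x) 1"]) auto
qed

text \<open>The derivative involves only \<open>1 / g\<close> and the derivative of
  \<open>g\<close>, so the induction hypothesis for \<open>1 / g\<close> and the product rule close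
  the induction.\<close>

lemma Ck_on_inverse:
 assumes "Ck_on k S g" "!!x. x : S ==> g x ~= 0"
 shows "Ck_on k S (%x. inverse (g x))"
 using assms(1)
proof (induction k)
 case 0
 then show ?case using assms(2) by (auto intro: continuous_intros)
next
 case (Suc k)
 then have gk: "Ck_on k S (%x. inverse (g x))" using Ck_on_SucD by blast
 from Suc.prems obtain g' where g': "!!x. x:S ==> (g has_derivative g' x) (at x within S)"
  "!!i. i:Basis ==> Ck_on k S (%x. g' x i)" by auto
 have "((%x. inverse (g x)) has_derivative (%h. - (inverse (g x)*g' x h*inverse (g x)))) (at x within S)"
  if "x : S" for x
  by (rule Deriv.has_derivative_inverse[OF assms(2) g'(1)]) (use that in auto)
 moreover have "Ck_on k S (%x. - (inverse (g x)*g' x i*inverse (g x)))" if "i : Basis" for i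
  using Ck_on_mult[OF Ck_on_const[of k S "-1"] Ck_on_mult[OF Ck_on_mult[OF gk g'(2)[OF that]] gk]] by simp
 ultimately show ?case unfolding Ck_on.simps
  by (intro exI[of _ "%x h. - (inverse (g x)*g' x h*inverse (g x))"]) auto
qed

text \<open>On the whole space derivatives are unique, so the existential witness in
  \<open>Ck_on\<close> can be replaced by \<open>frechet_derivative\<close>. This is what makes
  derivatives of smooth functions smooth again.\<close>

lemma Ck_on_Suc_UNIV:
 "Ck_on (Suc k) UNIV f \<longleftrightarrow> (ALL x. (f has_derivative FD f (at x)) (at x)) &
  (ALL i:Basis. Ck_on k UNIV (%x. FD f (at x) i))" (is "?L \<longleftrightarrow> ?R")
proof
 assume ?L
 then obtain f' where f': "!!x. (f has_derivative f' x) (at x)" "!!i. i:Basis ==> Ck_on k UNIV (%x. f' x i)"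
  by auto
 have "f' x = FD f (at x)" for x using frechet_derivative_at[OF f'(1)] .
 then show ?R using f' by simp
qed auto

lemma smooth_on_const: "smooth_on S (%_. c)" by (simp add: smooth_on_def Ck_on_const)
lemma smooth_on_mult: "smooth_on S f ==> smooth_on S g ==> smooth_on S (%x. f x*g x)"
 by (simp add: smooth_on_def Ck_on_mult)
lemma smooth_on_sum: "finite A ==> (!!a. a : A ==> smooth_on S (f a)) ==> smooth_on S (%x. SUM a:A. f a x)"
 by (simp add: smooth_on_def Ck_on_sum)

lemma smooth_has_derivative:
 "smooth_on UNIV f ==> (f has_derivative FD f (at x)) (at x)"
 using Ck_on_Suc_UNIV[of 0 f] by (auto simp: smooth_on_def)

lemma FD_Basis:
 assumes "smooth_on UNIV f"
 shows "FD f (at x) h = (SUM i:Basis. (h \<bullet> i)*FD f (at x) i)"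
proof -
 have "linear (FD f (at x))"
  using smooth_has_derivative[OF assms] by (rule has_derivative_linear)
 then have "FD f (at x) (SUM i:Basis. (h \<bullet> i) *R i) = (SUM i:Basis. (h \<bullet> i)*FD f (at x) i)"
  by (simp add: linear_sum linear_cmul)
 then show ?thesis by (simp add: euclidean_representation)
qed

lemma smooth_on_frechet:
 assumes "smooth_on UNIV f" shows "smooth_on UNIV (%x. FD f (at x) h)"
proof -
 have "smooth_on UNIV (%x. FD f (at x) i)" if "i : Basis" for i
  using assms that Ck_on_Suc_UNIV[THEN iffD1] unfolding smooth_on_def by blast
 then show ?thesis
  by (subst FD_Basis[OF assms]) (intro smooth_on_sum smooth_on_mult smooth_on_const, auto)
qed

text \<open>A radius is easier to carry through reflections, rescalings and products than a compact
  set.\<close>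

lemma tf_alt: "tf psi \<longleftrightarrow> smooth_on UNIV psi & (EX r>0. ALL x. r <= norm x --> psi x = 0)"
proof -
 have "EX r>0. ALL x. r <= norm x --> psi x = 0" if K: "compact K" "!!x. x ~: K ==> psi x = 0" for K
 proof -
  from compact_imp_bounded[OF K(1)] obtain B where "0 < B" "!!x. x : K ==> norm x <= B"
  unfolding bounded_pos by auto
  then show ?thesis using K(2) by (intro exI[of _ "B + 1"]) force
 qed
 moreover have "EX K. compact K & (ALL x. x ~: K --> psi x = 0)" if "ALL x. r <= norm x --> psi x = 0" for r
  by (rule exI[of _ "cball 0 r"]) (use that in auto)
 ultimately show ?thesis unfolding test_function_def by blast
qed

lemma tf_FD:
 assumes "tf psi" shows "tf (%x. FD psi (at x) h)"
proof -
 from assms obtain r where r: "r > 0" "!!x. r <= norm x ==> psi x = 0" and s: "smooth_on UNIV psi"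
  unfolding tf_alt by auto
 have "FD psi (at x) h = 0" if "r + 1 <= norm x" for x
 proof -
  have "(psi has_derivative (%_. 0)) (at x)"
  proof (rule has_derivative_transform_within_open)
  show "((%_. 0) has_derivative (%_. 0)) (at x)" by simp
  show "open (- cball 0 r)" by auto
  show "x : - cball 0 r" using that by auto
  qed (use r in auto)
  then show ?thesis using frechet_derivative_at by metis
 qed
 with r smooth_on_frechet[OF s] show ?thesis unfolding tf_alt
  by (intro conjI exI[of _ "r + 1"]) auto
qed

lemma FD_eq_0:
 assumes "!!x. r <= norm x ==> psi x = (0::real)" "r < norm x"
 shows "FD psi (at x) = (%_. 0)"
proof -
 have "(psi has_derivative (%_. 0)) (at x)"
 proof (rule has_derivative_transform_within_open)
  show "((%_. 0) has_derivative (%_. 0)) (at x)" by simp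
  show "open (- cball 0 r)" by auto
  show "x : - cball 0 r" using assms(2) by auto
 qed (use assms in auto)
 then show ?thesis using frechet_derivative_at by metis
qed

lemma tf_mult_smooth:
 "tf psi ==> smooth_on UNIV f ==> tf (%x. f x*psi x)"
 unfolding tf_alt by (auto intro: smooth_on_mult)

lemma FD_mult:
 assumes "smooth_on UNIV f" "smooth_on UNIV g"
 shows "FD (%x. f x*g x) (at x) h
  = f x*FD g (at x) h + FD f (at x) h*g x"
 using frechet_derivative_at[OF has_derivative_mult[OF smooth_has_derivative[OF assms(1)]
  smooth_has_derivative[OF assms(2)]], of x]
 by (metis (no_types, lifting))

lemma smooth_on_reflect:
 fixes psi :: "'a::euclidean_space => real"
 assumes "smooth_on UNIV psi" shows "smooth_on UNIV (%y. psi (x - y))"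
proof -
 have "Ck_on k UNIV (%y. psi (- y + x))" for k
  using Ck_on_compose_affine[of k UNIV psi uminus UNIV x] assms
  by (simp add: smooth_on_def bounded_linear_minus[OF bounded_linear_ident])
 then show ?thesis by (simp add: smooth_on_def)
qed

lemma tf_reflect:
 fixes psi :: "'a::euclidean_space => real"
 assumes "tf psi" shows "tf (%y. psi (x - y))"
proof -
 from assms obtain r where r: "r > 0" "!!x. r <= norm x ==> psi x = 0" and s: "smooth_on UNIV psi"
  unfolding tf_alt by auto
 have "psi (x - y) = 0" if "r + norm x <= norm y" for y
  using r(2)[of "x - y"] that norm_triangle_ineq2[of y x] by (auto simp: norm_minus_commute)
 then show ?thesis using r smooth_on_reflect[OF s]
  unfolding tf_alt by (intro conjI exI[of _ "r + norm x"]) (auto intro: add_pos_nonneg)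
qed

lemma FD_reflect:
 assumes "smooth_on UNIV psi"
 shows "FD (%y. psi (x - y)) (at y) h = - FD psi (at (x - y)) h"
proof -
 have "((%y. x - y) has_derivative (%h. - h)) (at y)" by (auto intro!: derivative_eq_intros)
 from has_derivative_compose[OF this smooth_has_derivative[OF assms]]
 have "((%y. psi (x - y)) has_derivative (%h. FD psi (at (x - y)) (- h))) (at y)" .
 from frechet_derivative_at[OF this]
 have "FD (%y. psi (x - y)) (at y) h = FD psi (at (x - y)) (- h)" by metis
 also have "... = - FD psi (at (x - y)) h"
  using has_derivative_linear[OF smooth_has_derivative[OF assms]] by (rule linear_neg)
 finally show ?thesis .
qed

lemma tf_translate:
 fixes psi :: "'a::euclidean_space => real"
 assumes "tf psi" shows "tf (%y. psi (y + x))"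
 using tf_reflect[OF tf_reflect[OF assms, of 0], of "- x"]
 by (simp add: add.commute)

lemma FD_translate:
 assumes "smooth_on UNIV psi"
 shows "FD (%y. psi (y + x)) (at y) h = FD psi (at (y + x)) h"
proof -
 have "((%y. y + x) has_derivative (%h. h)) (at y)" by (auto intro!: derivative_eq_intros)
 from has_derivative_compose[OF this smooth_has_derivative[OF assms]]
 have "((%y. psi (y + x)) has_derivative (%h. FD psi (at (y + x)) h)) (at y)" .
 from frechet_derivative_at[OF this] show ?thesis by metis
qed

lemma tf_continuous: "tf psi ==> continuous_on UNIV psi"
 unfolding test_function_def smooth_on_def by (metis Ck_on.simps(1))

lemma tf_measurable [measurable_dest]: "tf psi ==> psi : BM"
 by (simp add: tf_continuous borel_measurable_continuous_onI)

lemma tf_bounded: assumes "tf psi" obtains C where "C > 0" "!!x. \<bar>psi x\<bar> <= C"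
proof -
 from assms obtain K where K: "compact K" "!!x. x ~: K ==> psi x = 0" unfolding test_function_def by auto
 have "compact (psi ` K)"
  using K(1) tf_continuous[OF assms] continuous_on_subset compact_continuous_image by blast
 then obtain B where B: "B > 0" "!!x. x : K ==> \<bar>psi x\<bar> <= B"
  using compact_imp_bounded bounded_pos by (metis image_eqI real_norm_def)
 have "\<bar>psi x\<bar> <= B" for x using B K(2)[of x] by (cases "x : K") auto
 with B that show ?thesis by auto
qed

lemma tf_FD_bounded:
 fixes psi :: "'a::euclidean_space => real"
 assumes "tf psi" obtains C where "C > 0" "!!x h. \<bar>FD psi (at x) h\<bar> <= C*norm h"
proof -
 have "EX C>0. ALL x. \<bar>FD psi (at x) i\<bar> <= C" for i
  using tf_bounded[OF tf_FD[OF assms, of i]] by metis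
 then obtain C where C: "!!i. C i > 0" "!!i x. \<bar>FD psi (at x) i\<bar> <= C i" by metis
 show ?thesis
 proof (rule that)
  show "0 < (SUM i:(Basis::'a set). C i)" using C by (simp add: sum_pos)
  fix x h
  have "\<bar>FD psi (at x) h\<bar> <= (SUM i:Basis. \<bar>(h \<bullet> i)*FD psi (at x) i\<bar>)"
  using assms by (subst FD_Basis) (auto simp: test_function_def)
  also have "... <= (SUM i:Basis. C i*norm h)"
  unfolding abs_mult by (intro sum_mono, subst mult.commute) (auto intro!: mult_mono C Basis_le_norm less_imp_le[OF C(1)])
  finally show "\<bar>FD psi (at x) h\<bar> <= (SUM i:(Basis::'a set). C i)*norm h" by (simp add: sum_distrib_right)
 qed
qed

lemma tf_lipschitz:
 fixes psi :: "'a::euclidean_space => real"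
 assumes "tf psi" obtains C where "C > 0" "!!x y. \<bar>psi x - psi y\<bar> <= C*norm (x - y)"
proof -
 obtain C where C: "C > 0" "!!x h. \<bar>FD psi (at x) h\<bar> <= C*norm h"
  using tf_FD_bounded[OF assms] by blast
 have "norm (psi x - psi y) <= C*norm (x - y)" for x y
 proof (rule differentiable_bound[of UNIV])
  show "(psi has_derivative FD psi (at x)) (at x within UNIV)" for x
  using assms by (auto simp: test_function_def intro: smooth_has_derivative)
  show "onorm (FD psi (at x)) <= C" for x
  using C by (intro onorm_le) auto
 qed auto
 with C that show ?thesis by auto
qed

text \<open>Mean value inequality for \<open>f - f' a\<close> on the ball of radius
  \<open>norm h\<close> about \<open>a\<close>, where its derivative has operator norm at most
  \<open>C * norm h\<close>.\<close>

lemma taylor2_bound: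
 fixes f :: "'a::euclidean_space => real"
 assumes "!!x. (f has_derivative f' x) (at x)"
  "!!x y h. \<bar>f' x h - f' y h\<bar> <= C*norm (x - y)*norm h" "0 <= C"
 shows "\<bar>f (a + h) - f a - f' a h\<bar> <= C*(norm h)^2"
proof -
 have "norm (f (a + h) - f a - f' a (a + h - a)) <= norm (a + h - a)*(C*norm h)"
 proof (rule differentiable_bound_linearization[of a "a + h" "cball a (norm h)"])
  show "a + t *R (a + h - a) : cball a (norm h)" if "t : {0..1}" for t
  using that by (auto simp: dist_norm mult_left_le_one_le)
  show "(f has_derivative f' x) (at x within cball a (norm h))" for x
  using assms(1) by (rule has_derivative_at_withinI)
  show "onorm (f' x - f' a) <= C*norm h" if "x : cball a (norm h)" for x
  proof (rule onorm_le)
  fix v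
  have "norm (f' x v - f' a v) <= C*norm (x - a)*norm v" using assms(2) by simp
  also have "... <= C*norm h*norm v"
  using that assms(3) by (auto simp: dist_norm norm_minus_commute intro!: mult_right_mono mult_left_mono)
  finally show "norm ((f' x - f' a) v) <= C*norm h*norm v" by simp
  qed
 qed auto
 then show ?thesis by (simp add: power2_eq_square mult_ac)
qed

lemma tf_taylor2:
 fixes psi :: "'a::euclidean_space => real"
 assumes "tf psi"
 obtains C where "C > 0" "!!a h. \<bar>psi (a + h) - psi a - FD psi (at a) h\<bar> <= C*(norm h)^2"
proof -
 have "EX C>0. ALL x y. \<bar>FD psi (at x) i - FD psi (at y) i\<bar> <= C*norm (x - y)" for i
  using tf_lipschitz[OF tf_FD[OF assms, of i]] by metis
 then obtain C where C: "!!i. C i > 0"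
  "!!i x y. \<bar>FD psi (at x) i - FD psi (at y) i\<bar> <= C i*norm (x - y)" by metis
 define D where "D = (SUM i:(Basis::'a set). C i)"
 have D: "0 < D" using C by (simp add: sum_pos D_def)
 have s: "smooth_on UNIV psi" using assms by (simp add: test_function_def)
 have "\<bar>FD psi (at x) h - FD psi (at y) h\<bar> <= D*norm (x - y)*norm h" for x y h
 proof -
  have "FD psi (at x) h - FD psi (at y) h
  = (SUM i:Basis. (h \<bullet> i)*(FD psi (at x) i - FD psi (at y) i))"
  using FD_Basis[OF s, of x h] FD_Basis[OF s, of y h]
  by (simp add: right_diff_distrib sum_subtractf)
  also have "\<bar>...\<bar> <= (SUM i:Basis. \<bar>h \<bullet> i\<bar>*\<bar>FD psi (at x) i - FD psi (at y) i\<bar>)"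
  by (rule order_trans[OF sum_abs]) (simp add: abs_mult)
  also have "... <= (SUM i:Basis. norm h*(C i*norm (x - y)))"
  by (intro sum_mono mult_mono C Basis_le_norm) auto
  finally show ?thesis by (simp add: D_def sum_distrib_right sum_distrib_left mult_ac)
 qed
 from taylor2_bound[OF smooth_has_derivative[OF s] this less_imp_le[OF D]]
 show ?thesis using that D by blast
qed

section \<open>A smooth bump and the mollifiers built from it\<close>

text \<open>The polynomial factor makes the family closed under differentiation, so that smoothness
  of \<open>exp (- 1 / x)\<close> extended by zero is a single induction over all
  \<open>p\<close>.\<close>

definition flat_bump :: "real poly => real => real" where
 "flat_bump p x = (if x > 0 then poly p (1 / x)*exp (- (1 / x)) else 0)"

lemma poly_exp_tendsto_0: "((%s. poly p s*exp (- s)) \<longlongrightarrow> 0) (at_top :: real filter)"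
proof -
 have "((%s. SUM i<=degree p. coeff p i*(s ^ i / exp s)) \<longlongrightarrow> (SUM i<=degree p. coeff p i*0)) (at_top :: real filter)"
  by (intro tendsto_intros tendsto_power_div_exp_0)
 then show ?thesis
  by (simp add: poly_altdef exp_minus divide_inverse sum_distrib_right mult.assoc)
qed

text \<open>For \<open>x > 0\<close> the chain rule produces the factor \<open>1 / x^2\<close>,
  which is the polynomial \<open>[:0, 0, 1:]\<close> at \<open>1 / x\<close>. At 0 the difference
  quotient is again a polynomial times an exponential in \<open>1 / h\<close>.\<close>

lemma flat_bump_deriv:
 "(flat_bump p has_real_derivative flat_bump ([:0, 0, 1:]*(p - pderiv p)) x) (at x)"
proof -
 consider "x > 0" | "x < 0" | "x = 0" by linarith
 then show ?thesis
 proof cases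
  case 1
  have "((%x. poly p (1 / x)*exp (- (1 / x))) has_real_derivative
  flat_bump ([:0, 0, 1:]*(p - pderiv p)) x) (at x)"
  using 1 by (auto intro!: derivative_eq_intros DERIV_chain2[OF poly_DERIV]
  simp: flat_bump_def field_simps power2_eq_square)
  then show ?thesis
  by (rule has_field_derivative_transform_within_open[of _ _ _ "{0<..}"]) (use 1 in \<open>auto simp: flat_bump_def\<close>)
 next
  case 2
  have "((%x. 0) has_real_derivative 0) (at x)" by simp
  then have "(flat_bump p has_real_derivative 0) (at x)"
  by (rule has_field_derivative_transform_within_open[of _ _ _ "{..<0}"]) (use 2 in \<open>auto simp: flat_bump_def\<close>)
  then show ?thesis using 2 by (simp add: flat_bump_def)
 next
  case 3
  \<comment> \<open>\<open>pCons 0 p\<close> is \<open>X * p\<close>: dividing by \<open>h\<close>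
    means multiplying by the variable \<open>1 / h\<close>.\<close>
  have r: "((%h. poly (pCons 0 p) (1 / h)*exp (- (1 / h))) \<longlongrightarrow> 0) (at_right (0::real))"
  using filterlim_compose[OF poly_exp_tendsto_0[of "pCons 0 p"] filterlim_inverse_at_top_right]
  unfolding divide_inverse mult_1 .
  have "((%h. flat_bump p h / h) \<longlongrightarrow> 0) (at_right (0::real))"
  by (rule Lim_transform_eventually[OF r])
  (auto simp: flat_bump_def eventually_at_right_less eventually_at_filter)
  moreover have "((%h. flat_bump p h / h) \<longlongrightarrow> 0) (at_left (0::real))"
  by (rule Lim_transform_eventually[OF tendsto_const])
  (auto simp: flat_bump_def eventually_at_filter)
  ultimately have "((%h. flat_bump p h / h) \<longlongrightarrow> 0) (at (0::real))"
  using filterlim_split_at by blast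
  then show ?thesis unfolding 3 by (simp add: has_field_derivative_iff flat_bump_def)
 qed
qed

lemma Ck_on_flat_bump: "Ck_on k UNIV (flat_bump p)"
proof (induction k arbitrary: p)
 case 0
 have "continuous (at x) (flat_bump p)" for x
  using flat_bump_deriv DERIV_isCont by blast
 then show ?case by (simp add: continuous_at_imp_continuous_on)
next
 case (Suc k)
 let ?q = "[:0, 0, 1:]*(p - pderiv p)"
 have "Ck_on k UNIV (%x. flat_bump ?q x*i)" for i by (intro Ck_on_mult Suc Ck_on_const)
 moreover have "(flat_bump p has_derivative (%h. flat_bump ?q x*h)) (at x)" for x
  using flat_bump_deriv[of p x] unfolding has_field_derivative_def .
 ultimately show ?case unfolding Ck_on.simps by (intro exI[of _ "%x h. flat_bump ?q x*h"]) blast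
qed

lemma smooth_on_norm_sq: "smooth_on S (%x::'a::euclidean_space. (norm x)^2)"
proof -
 have "Ck_on k S (%x::'a. SUM i:Basis. (x \<bullet> i)*(x \<bullet> i))" for k
  by (intro Ck_on_sum Ck_on_mult Ck_on_bounded_linear bounded_linear_inner_left) auto
 moreover have "(norm x)^2 = (SUM i:Basis. (x \<bullet> i)*(x \<bullet> i))" for x :: 'a
  by (simp add: power2_norm_eq_inner euclidean_inner[of x x])
 ultimately show ?thesis unfolding smooth_on_def by simp
qed

lemma bump_exists:
 obtains eta :: "'a::euclidean_space => real"
 where "tf eta" "!!x. 0 <= eta x" "!!x. 1 <= norm x ==> eta x = 0" "!!x. norm x < 1 ==> 0 < eta x"
proof
 let ?e = "%x::'a. flat_bump 1 (1 + (-1)*(norm x)^2)"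
 have z: "?e x = 0" if "1 <= norm x" for x proof -
  have "1 <= (norm x)^2" using that by (rule one_le_power)
  then have "\<not> 1 + - 1*(norm x)^2 > 0" by linarith
  then show ?thesis unfolding flat_bump_def by (rule if_not_P)
 qed
 have "smooth_on UNIV ?e"
  unfolding smooth_on_def
 proof
  fix k
  have "Ck_on k UNIV (%x::'a. 1 + (-1)*(norm x)^2)"
  using smooth_on_norm_sq[of "UNIV :: 'a set"] unfolding smooth_on_def
  by (intro Ck_on_add Ck_on_mult Ck_on_const) blast
  then show "Ck_on k UNIV ?e" by (rule Ck_on_compose_real[OF Ck_on_flat_bump])
 qed
 with z show "tf ?e" unfolding tf_alt by (auto intro!: exI[of _ 1])
 show "0 <= ?e x" for x by (auto simp: flat_bump_def)
 show "0 < ?e x" if "norm x < 1" for x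
 proof -
  have "(norm x)^2 < 1" using that by (simp add: abs_square_less_1)
  then show ?thesis by (simp add: flat_bump_def)
 qed
 show "?e x = 0" if "1 <= norm x" for x using z[OF that] .
qed

text \<open>The last clause bounds the first moment of the gradient. It is invariant under
  rescaling, so one \<open>C\<close> serves all \<open>eps\<close>; through it the commutator
  estimate is uniform as \<open>eps\<close> tends to 0, although the gradient of a rescaled bump has
  integral of order \<open>1 / eps\<close>.\<close>

definition mollifier :: "real => real => ('a::euclidean_space => real) => bool" where
 "mollifier eps C rho \<longleftrightarrow> tf rho & (ALL x. 0 <= rho x) & (ALL x. eps <= norm x --> rho x = 0) &
  (LB x. rho x) = 1 & (ALL i:Basis. (LB x. norm x*\<bar>FD rho (at x) i\<bar>) <= C)"

lemma integrable_bounded_support: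
 fixes f :: "'a::euclidean_space => 'b::{banach, second_countable_topology}"
 assumes [measurable]: "f : BM" and "!!x. norm (f x) <= C" "!!x. r <= norm x ==> f x = 0"
 shows "Lint f"
proof (rule I_bound)
 show "Lint (%x. C*indc r x :: real)"
  by (intro integrable_mult_right integrable_real_indicator) (auto intro!: emeasure_lborel_cball_finite[unfolded infinity_ennreal_def])
 have "norm (f x) <= norm (C*indc r x :: real)" for x
  using assms(2)[of x] assms(3)[of x] by (auto simp: indicator_def)
 then show "AEL x. norm (f x) <= norm (C*indc r x :: real)" by simp
qed simp

lemma tf_integrable_mult:
 fixes psi :: "'a::euclidean_space => real"
 assumes "tf psi" and [measurable]: "f : BM" and "!!x. \<bar>f x\<bar> <= K"
 shows "Lint (%x. psi x*f x)"
proof -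
 obtain C where C: "C > 0" "!!x. \<bar>psi x\<bar> <= C" using tf_bounded[OF assms(1)] by blast
 obtain r where r: "!!x. r <= norm x ==> psi x = 0" using assms(1) unfolding tf_alt by auto
 note [measurable] = tf_measurable[OF assms(1)]
 show ?thesis
  by (rule integrable_bounded_support[where C="C*K" and r=r])
  (use C r assms(3) in \<open>auto simp: abs_mult intro!: mult_mono order_trans[OF abs_ge_zero C(2)]\<close>)
qed

lemma tf_integrable:
 fixes psi :: "'a::euclidean_space => real"
 assumes "tf psi" shows "Lint psi"
 using tf_integrable_mult[OF assms, of "%_. 1" 1] by simp

lemma integral_lborel_scale:
 fixes f :: "'a::euclidean_space => real"
 assumes [measurable]: "f : BM" and "0 < eps"
 shows "(LB x. f (x /\<^sub>R eps)) = eps ^ DIM('a)*(LB x. f x)"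
proof -
 have "(LB x. f (x /\<^sub>R eps)) =
  (LINT x|density (distr lborel borel (%x. 0 + eps *R x)) (%_. en (\<bar>eps\<bar> ^ DIM('a))). f (x /\<^sub>R eps))"
  using assms(2) by (subst lborel_affine[of eps 0]) auto
 also have "... = (LB x. eps ^ DIM('a)*f x)"
  using assms(2) by (subst integral_real_density) (auto simp: integral_distr)
 finally show ?thesis by simp
qed

text \<open>The mollifiers are rescaled bumps. On the support \<open>norm x <= eps\<close>, which
  cancels the factor \<open>1 / eps\<close> of the derivative; the moment bound is therefore that of
  the bump at scale one.\<close>

lemma mollifier_exists:
 obtains C where "!!eps. eps > 0 ==> EX rho::'a::euclidean_space => real. mollifier eps C rho"
proof -
 obtain eta :: "'a => real" where eta: "tf eta" "!!x. 0 <= eta x" "!!x. 1 <= norm x ==> eta x = 0"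
  "!!x. norm x < 1 ==> 0 < eta x" using bump_exists by blast
 have s: "smooth_on UNIV eta" using eta(1) by (simp add: test_function_def)
 note [measurable] = tf_measurable[OF eta(1)] tf_measurable[OF tf_FD[OF eta(1)]]
 define Z where "Z = (LB x. eta x)"
 have "Z > 0"
 proof -
  have "\<not> (AEL x. eta x = 0)"
  proof
  assume "AEL x. eta x = 0"
  then have "AEL x. x ~: ball (0::'a) 1" by eventually_elim (use eta(4) in force)
  then have "emeasure lborel (ball (0::'a) 1) = 0"
  by (subst (asm) AE_iff_measurable[of "ball (0::'a) 1"]) auto
  moreover have "measure lborel (ball (0::'a) 1) > 0" by (simp add: content_ball_pos)
  ultimately show False by (simp add: measure_def)
  qed
  then show ?thesis unfolding Z_def
  using integral_nonneg_eq_0_iff_AE[OF tf_integrable[OF eta(1)]] eta(2)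
  L_nonneg[of lborel eta] by (force simp: less_le)
 qed
 define C where "C = (SUM i:(Basis::'a set). (LB x. \<bar>FD eta (at x) i\<bar>)) / Z"
 show thesis
 proof (rule that)
  fix eps :: real assume e: "eps > 0"
  define rho :: "'a => real" where "rho = (%x. inverse (eps ^ DIM('a)*Z)*eta (x /\<^sub>R eps))"
  have bl: "bounded_linear (%x::'a. x /\<^sub>R eps)" by (rule bounded_linear_scaleR_right)
  have sm: "smooth_on UNIV (%x. eta (x /\<^sub>R eps))"
  using s Ck_on_compose_affine[OF _ bl, of _ UNIV eta UNIV 0] by (simp add: smooth_on_def)
  have t: "tf rho" unfolding tf_alt rho_def
  using e eta(3) sm by (intro conjI smooth_on_mult smooth_on_const exI[of _ eps]) (auto simp: field_simps)
  have z: "rho x = 0" if "eps <= norm x" for x using that e by (auto simp: rho_def intro!: eta(3) simp: field_simps)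
  have d: "FD rho (at x) h = inverse (eps ^ DIM('a)*Z)*FD eta (at (x /\<^sub>R eps)) h / eps" for x h
  proof -
  have "(rho has_derivative (%h. inverse (eps ^ DIM('a)*Z)*FD eta (at (x /\<^sub>R eps)) (h /\<^sub>R eps))) (at x)"
  unfolding rho_def
  by (intro has_derivative_mult_right has_derivative_compose[OF bounded_linear_imp_has_derivative[OF bl]]
  smooth_has_derivative[OF s])
  from frechet_derivative_at[OF this]
  have "FD rho (at x) h = inverse (eps ^ DIM('a)*Z)*FD eta (at (x /\<^sub>R eps)) (h /\<^sub>R eps)"
  by metis
  then show ?thesis
  using linear_cmul[OF has_derivative_linear[OF smooth_has_derivative[OF s, of "x /\<^sub>R eps"]], of "inverse eps" h]
  by (simp add: divide_inverse)
  qed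
  have "(LB x. norm x*\<bar>FD rho (at x) i\<bar>) <= C" if i: "i : Basis" for i
  proof -
  have "(LB x. norm x*\<bar>FD rho (at x) i\<bar>)
  <= (LB x. inverse (eps ^ DIM('a)*Z)*\<bar>FD eta (at (x /\<^sub>R eps)) i\<bar>)"
  proof (rule L_mono')
  have "tf (%x. eps*FD rho (at x) i)"
  using tf_FD[OF t, of i] by (intro tf_mult_smooth smooth_on_const)
  from integrable_abs[OF tf_integrable[OF this]]
  show "Lint (%x. inverse (eps ^ DIM('a)*Z)*\<bar>FD eta (at (x /\<^sub>R eps)) i\<bar>)"
  using e \<open>Z > 0\<close> by (simp add: d abs_mult divide_inverse mult.assoc mult.left_commute)
  fix x :: 'a
  show "0 <= inverse (eps ^ DIM('a)*Z)*\<bar>FD eta (at (x /\<^sub>R eps)) i\<bar>"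
  using e \<open>Z > 0\<close> by simp
  show "norm x*\<bar>FD rho (at x) i\<bar> <= inverse (eps ^ DIM('a)*Z)*\<bar>FD eta (at (x /\<^sub>R eps)) i\<bar>"
  proof (cases "norm x <= eps")
  case True
  then have "norm x*\<bar>FD rho (at x) i\<bar> <= eps*\<bar>FD rho (at x) i\<bar>"
  by (intro mult_right_mono) auto
  also have "... = inverse (eps ^ DIM('a)*Z)*\<bar>FD eta (at (x /\<^sub>R eps)) i\<bar>"
  using e \<open>Z > 0\<close> by (simp add: d abs_mult)
  finally show ?thesis .
  next
  case False
  then show ?thesis using FD_eq_0[of eps rho x] z e \<open>Z > 0\<close> by auto
  qed
  qed
  also have "... = (LB x. \<bar>FD eta (at x) i\<bar>) / Z"
  using e by (simp add: integral_lborel_scale[of "%x. \<bar>FD eta (at x) i\<bar>"] divide_inverse)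
  also have "... <= C" unfolding C_def
  using \<open>Z > 0\<close> i by (intro divide_right_mono member_le_sum) auto
  finally show ?thesis .
  qed
  moreover have "(LB x. rho x) = 1"
  using e \<open>Z > 0\<close> unfolding rho_def
  by (simp add: integral_lborel_scale Z_def[symmetric]) (simp add: field_simps)
  moreover have "0 <= rho x" for x using e \<open>Z > 0\<close> eta(2) by (auto simp: rho_def)
  ultimately show "EX rho::'a => real. mollifier eps C rho" unfolding mollifier_def using t z by blast
 qed
qed

section \<open>Convolution of a test function with a bounded function\<close>

lemma has_derivative_quadratic:
 fixes f :: "'a::euclidean_space => real"
 assumes "linear L" "!!h. norm h <= 1 ==> \<bar>f (x + h) - f x - L h\<bar> <= D*(norm h)^2"
 shows "(f has_derivative L) (at x)"
proof -
 have "((%h. norm (f (x + h) - f x - L h) / norm h) \<longlongrightarrow> 0) (at 0)"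
 proof (rule tendsto_sandwich[where f="%_. 0" and h="%h. D*norm h"])
  show "\<forall>\<^sub>F h in at 0. norm (f (x + h) - f x - L h) / norm h <= D*norm h"
  proof -
  have "norm (f (x + h) - f x - L h) / norm h <= D*norm h" if "h ~= 0" "dist h 0 < 1" for h
  using assms(2)[of h] that by (simp add: field_simps power2_eq_square)
  then have "ALL h:UNIV. h ~= 0 & dist h 0 < 1 --> norm (f (x + h) - f x - L h) / norm h <= D*norm h" by blast
  then show ?thesis unfolding eventually_at using zero_less_one by blast
  qed
  show "((%h. D*norm h) \<longlongrightarrow> 0) (at 0)" by (auto intro!: tendsto_eq_intros)
 qed (auto intro!: always_eventually)
 then show ?thesis unfolding has_derivative_at using assms(1) by (simp add: linear_conv_bounded_linear)
qed

lemma integrable_convolution: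
 fixes psi :: "'a::euclidean_space => real"
 assumes "tf psi" "v : BM" "!!y. \<bar>v y\<bar> <= K"
 shows "Lint (%y. psi (x - y) * v y)"
 using tf_integrable_mult[OF tf_reflect[OF assms(1)] assms(2,3)] .

text \<open>The second-order Taylor bound for \<open>rho\<close> is uniform in the base point and
  can be integrated against the bounded \<open>v\<close>, so the remainder of the convolution is
  quadratic in \<open>h\<close>.\<close>

lemma conv_has_derivative:
 fixes rho :: "'a::euclidean_space => real"
 assumes rho: "tf rho" and v: "v : BM" and K: "!!y. \<bar>v y\<bar> <= K"
 shows "((%x. LB y. rho (x - y) * v y) has_derivative
  (%h. LB y. FD rho (at (x - y)) h * v y)) (at x)"
proof -
 note [measurable] = v tf_measurable[OF rho] tf_measurable[OF tf_FD[OF rho]]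
 have s: "smooth_on UNIV rho" using rho by (simp add: test_function_def)
 obtain C where C: "C > 0" "!!a h. \<bar>rho (a + h) - rho a - FD rho (at a) h\<bar> <= C*(norm h)^2"
  using tf_taylor2[OF rho] by blast
 obtain r where r: "r > 0" "!!x. r <= norm x ==> rho x = 0" using rho unfolding tf_alt by auto
 have K0: "0 <= K" using K[of 0] by linarith
 note I1 = integrable_convolution[OF rho v K] and I2 = integrable_convolution[OF tf_FD[OF rho] v K]
 have lin: "linear (FD rho (at a))" for a
  using smooth_has_derivative[OF s] by (rule has_derivative_linear)
 show ?thesis
 proof (rule has_derivative_quadratic)
  show "linear (%h. LB y. FD rho (at (x - y)) h * v y)"
  by (rule linearI)
  (simp_all add: linear_add[OF lin] linear_cmul[OF lin] distrib_right I2 mult.assoc)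
  fix h :: 'a assume h: "norm h <= 1"
  \<comment> \<open>For \<open>norm h <= 1\<close> all three terms vanish when \<open>y\<close> is
    outside this ball: one unit allows for the shift by \<open>h\<close>, the other for the strict
    inequality that \<open>FD_eq_0\<close> asks for.\<close>
  let ?B = "ind (cball x (r + 2)) :: 'a => real"
  have eq: "(LB y. rho (x + h - y) * v y) - (LB y. rho (x - y) * v y)
  - (LB y. FD rho (at (x - y)) h * v y)
  = (LB y. (rho ((x - y) + h) - rho (x - y) - FD rho (at (x - y)) h) * v y)"
  proof -
  have e: "(x - y) + h = x + h - y" for y by simp
  show ?thesis unfolding e left_diff_distrib
  by (simp only: L_diff I_diff I1 I2)
  qed
  have "\<bar>LB y. (rho ((x - y) + h) - rho (x - y) - FD rho (at (x - y)) h) * v y\<bar>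
  <= (LB y. \<bar>(rho ((x - y) + h) - rho (x - y) - FD rho (at (x - y)) h) * v y\<bar>)"
  by (rule integral_abs_bound)
  also have "... <= (LB y. C*(norm h)^2*K*?B y)"
  proof (rule L_mono')
  show "Lint (%y. C*(norm h)^2*K*?B y)"
  by (rule integrable_mult_right, rule integrable_real_indicator) (simp_all add: emeasure_lborel_cball_finite[unfolded infinity_ennreal_def])
  fix y :: 'a
  show "0 <= C*(norm h)^2*K*?B y" using less_imp_le[OF C(1)] K0 by simp
  show "\<bar>(rho ((x - y) + h) - rho (x - y) - FD rho (at (x - y)) h) * v y\<bar> <= C*(norm h)^2*K*?B y"
  proof (cases "y : cball x (r + 2)")
  case True
  have "\<bar>rho ((x - y) + h) - rho (x - y) - FD rho (at (x - y)) h\<bar>*\<bar>v y\<bar> <= C*(norm h)^2*K"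
  by (rule mult_mono[OF C(2) K]) (use C(1) in auto)
  with True show ?thesis by (simp add: abs_mult)
  next
  case False
  then have a: "r + 2 < norm (x - y)" by (simp add: dist_norm)
  moreover have "norm (x - y) <= norm (x - y + h) + norm h" using norm_triangle_ineq4[of "x - y + h" h] by simp
  ultimately have b: "r <= norm (x - y + h)" "r <= norm (x - y)" "r < norm (x - y)" using h by linarith+
  have "rho (x - y + h) = 0" "rho (x - y) = 0" "FD rho (at (x - y)) = (%_. 0)"
  by (rule r(2)[OF b(1)], rule r(2)[OF b(2)], rule FD_eq_0[OF r(2) b(3)])
  then show ?thesis using False by simp
  qed
  qed
  also have "... = (C*K*measure lborel (cball x (r + 2)))*(norm h)^2"
  by simp
  finally show "\<bar>(LB y. rho (x + h - y) * v y) - (LB y. rho (x - y) * v y)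
  - (LB y. FD rho (at (x - y)) h * v y)\<bar> <= (C*K*measure lborel (cball x (r + 2)))*(norm h)^2"
  by (simp only: eq)
 qed
qed

lemma convolution_smooth:
 fixes rho :: "'a::euclidean_space => real"
 assumes rho: "tf rho" and v: "v : BM" and K: "!!y. \<bar>v y\<bar> <= K"
 shows "smooth_on UNIV (%x. LB y. rho (x - y) * v y)"
proof -
 have "Ck_on k UNIV (%x. LB y. rho (x - y) * v y)" for k
  using rho
 proof (induction k arbitrary: rho)
  case 0
  have "isCont (%x. LB y. rho (x - y) * v y) x" for x
  using conv_has_derivative[OF 0 v K] has_derivative_continuous by blast
  then show ?case by (simp add: continuous_at_imp_continuous_on)
 next
  case (Suc k)
  have "Ck_on k UNIV (%x. LB y. FD rho (at (x - y)) i * v y)" for i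
  by (rule Suc.IH[OF tf_FD[OF Suc.prems]])
  moreover note conv_has_derivative[OF Suc.prems v K]
  ultimately show ?case unfolding Ck_on.simps
  by (intro exI[of _ "%x h. LB y. FD rho (at (x - y)) h * v y"] conjI ballI) blast+
 qed
 then show ?thesis by (simp add: smooth_on_def)
qed

section \<open>Lebesgue measure and weak derivatives\<close>

text \<open>Its instances are declared \<open>measurable (raw)\<close>; they let the
  \<open>measurable\<close> method treat a curried function of time and space as an operation on two
  measurable arguments.\<close>

lemma meas2:
 assumes "jm f" "g : bm M" "h : bm M"
 shows "(%w. f (g w :: 'b::second_countable_topology) (h w :: 'c::second_countable_topology)) : bm M"
proof -
 have "(%w. case_prod f (g w, h w)) : bm M"
  by (rule measurable_compose[OF borel_measurable_Pair[OF assms(2,3)] assms(1)])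
 then show ?thesis by simp
qed

lemma meas2_iff:
 "jm f \<longleftrightarrow>
 (%p. f (fst p :: 'b::second_countable_topology) (snd p :: 'c::second_countable_topology)) : bm (borel \<Otimes>\<^sub>M borel)"
 by (simp add: borel_prod case_prod_beta')

lemma cball_measurable [measurable]: "cball a r : sets borel" by (simp add: borel_closed)

lemma distr_lborel_translate: "distr lborel borel (%x. x + w) = (lborel :: 'a::euclidean_space measure)"
proof -
 have "(%x. x + w) = (+) w" by (auto simp: add.commute)
 then show ?thesis using lborel_distr_plus[of w] by simp
qed

lemma distr_lborel_reflect: "distr lborel borel (%x. w - x) = (lborel :: 'a::euclidean_space measure)"
 using lborel_affine[of "-1" w, symmetric] by (simp add: density_1)

lemma
 fixes f :: "'a::euclidean_space => ennreal"
 assumes [measurable]: "f : BM"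
 shows nn_integral_lborel_translate: "(NN x. f (x + w)) = (NN x. f x)"
  and nn_integral_lborel_reflect: "(NN x. f (w - x)) = (NN x. f x)"
 by (subst (2) distr_lborel_translate[of w, symmetric], simp add: nn_integral_distr)
  (subst (2) distr_lborel_reflect[of w, symmetric], simp add: nn_integral_distr)

lemma
 fixes f :: "'a::euclidean_space => 'b::{banach, second_countable_topology}"
 assumes [measurable]: "f : BM"
 shows integral_lborel_translate: "(LB x. f (x + w)) = (LB x. f x)"
  and integral_lborel_reflect: "(LB x. f (w - x)) = (LB x. f x)"
  and integrable_lborel_translate_iff: "Lint (%x. f (x + w)) \<longleftrightarrow> Lint f"
  and integrable_lborel_reflect_iff: "Lint (%x. f (w - x)) \<longleftrightarrow> Lint f"
 by (subst (2) distr_lborel_translate[of w, symmetric], simp add: integral_distr)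
  (subst (2) distr_lborel_reflect[of w, symmetric], simp add: integral_distr,
  subst (2) distr_lborel_translate[of w, symmetric], simp add: integrable_distr_eq,
  subst (2) distr_lborel_reflect[of w, symmetric], simp add: integrable_distr_eq)

section \<open>Continuity of translations in the mean\<close>

text \<open>Outer regularity gives \<open>U\<close>, inner regularity a closed \<open>T\<close>, and
  cutting \<open>T\<close> with a large ball makes it compact; each of the three losses costs
  \<open>e / 3\<close>.\<close>

lemma lborel_compact_open_approx:
 fixes A :: "'a::euclidean_space set"
 assumes A: "A : sets borel" "emeasure lborel A < \<infinity>" and e: "0 < (e::real)"
 obtains K U where "compact K" "open U" "K \<subseteq> A" "A \<subseteq> U" "emeasure lborel (U - K) < en e"
proof -
 have e3: "e / 3 > 0" using e by simp
 have Am [measurable]: "A : sets lborel" using A by simp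
 obtain U where U: "open U" "A \<subseteq> U" "emeasure lborel (U - A) < en (e / 3)"
  using outer_regular_lborel[OF A(1) e3] by blast
 have AL: "A : sets lebesgue" using A(1) by simp
 obtain T where T: "closed T" "T \<subseteq> A" and T3: "emeasure lebesgue (A - T) < en (e / 3)"
  by (rule sets_lebesgue_inner_closed[OF AL e3])
 have Tm [measurable]: "T : sets lborel" and Um [measurable]: "U : sets lborel" using T(1) U(1) by (simp_all add: borel_closed borel_open)
 have T3': "emeasure lborel (A - T) < en (e / 3)"
 proof -
  have "A - T : sets lborel" by (rule sets.Diff[OF Am Tm])
  then have "emeasure lebesgue (A - T) = emeasure lborel (A - T)"
  by (simp only: emeasure_completion[OF sets_completionI_sets] main_part)
  with T3 show ?thesis by (simp only:)
 qed
 have "(%n. emeasure lborel (A - cball 0 (real n))) ----> emeasure lborel (\<Inter>n. A - cball 0 (real n))"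
 proof (rule Lim_emeasure_decseq)
  show "emeasure lborel (A - cball 0 (real n)) ~= \<infinity>" for n
  using A(2) emeasure_mono[OF Diff_subset Am, of "cball 0 (real n)"] by (auto simp: top_unique)
 qed (auto simp: decseq_def intro!: sets.Diff[OF Am, simplified])
 moreover have "(\<Inter>n. A - cball 0 (real n)) = {}" by (auto simp: real_arch_simple)
 ultimately have "(%n. emeasure lborel (A - cball 0 (real n))) ----> 0"
  by (simp only: emeasure_empty)
 then have "\<forall>\<^sub>F n in sequentially. emeasure lborel (A - cball 0 (real n)) < en (e / 3)"
  using e3 by (intro order_tendstoD(2)[of _ 0]) auto
 then obtain n where n: "emeasure lborel (A - cball 0 (real n)) < en (e / 3)"
  by (auto simp: eventually_sequentially)
 define K where "K = T \<inter> cball 0 (real n)"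
 have Km [measurable]: "K : sets lborel" unfolding K_def by measurable
 have "compact K" unfolding K_def using T(1) by (intro closed_Int_compact) auto
 moreover have "emeasure lborel (U - K) < en e"
 proof -
  have "U - K \<subseteq> (U - A) \<union> ((A - T) \<union> (A - cball 0 (real n)))" using T(2) by (auto simp: K_def)
  then have "emeasure lborel (U - K) <= emeasure lborel ((U - A) \<union> ((A - T) \<union> (A - cball 0 (real n))))"
  by (rule emeasure_mono) measurable
  also have "... <= emeasure lborel (U - A) + emeasure lborel ((A - T) \<union> (A - cball 0 (real n)))"
  by (rule emeasure_subadditive) measurable
  also have "... <= emeasure lborel (U - A) + (emeasure lborel (A - T) + emeasure lborel (A - cball 0 (real n)))"
  by (intro add_left_mono emeasure_subadditive) measurable
  also have "... < en (e / 3) + (en (e / 3) + en (e / 3))"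
  by (intro add_strict_mono T3' n U(3))
  also have "... = en e" using e by (simp flip: ennreal_plus)
  finally show ?thesis .
 qed
 ultimately show thesis using that[of K U] U T(2) by (auto simp: K_def)
qed

lemma nn_integral_norm_triangle:
 fixes f g :: "'a => 'b::{banach, second_countable_topology}"
 assumes [measurable]: "f : bm M" "g : bm M" and "!!x. norm (h x) <= norm (f x) + norm (g x)"
 shows "(\<integral>\<^sup>+x. norm (h x) \<partial>M) <= (\<integral>\<^sup>+x. norm (f x) \<partial>M) + (\<integral>\<^sup>+x. norm (g x) \<partial>M)"
proof -
 have "(\<integral>\<^sup>+x. norm (h x) \<partial>M) <= (\<integral>\<^sup>+x. en (norm (f x)) + en (norm (g x)) \<partial>M)"
  using assms(3) by (intro nn_integral_mono) (simp flip: ennreal_plus)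
 then show ?thesis by (simp add: nn_integral_add)
qed

text \<open>Induction over integrable functions. If \<open>K\<close> is compact in \<open>A\<close>
  and \<open>U\<close> an open set around \<open>A\<close>, a shift shorter than the distance from
  \<open>K\<close> to the complement of \<open>U\<close> changes the indicator of \<open>A\<close>
  only where \<open>x\<close> or \<open>x + w\<close> lies in \<open>U - K\<close>.\<close>

lemma L1_translation_continuous:
 fixes F :: "'a::euclidean_space => 'b::{banach, second_countable_topology}"
 assumes "Lint F" "0 < e"
 shows "EX del0>0. ALL w. norm w < del0 --> (NN x. norm (F (x + w) - F x)) <= en e"
 using assms
proof (induction arbitrary: e rule: integrable_induct)
 case (base A c)
 have [measurable]: "A : sets borel" using base(1) by simp
 \<comment> \<open>\<open>m\<close> is \<open>norm c\<close> made positive, and \<open>k\<close>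
   doubles it because both the point and its translate may lie in \<open>U - K\<close>.\<close>
 define m where "m = norm c + 1"
 define k where "k = 2*m"
 have m: "m > 0" by (auto simp: m_def intro: add_nonneg_pos)
 then have k: "k > 0" by (auto simp: k_def)
 obtain K U where KU: "compact K" "open U" "K \<subseteq> A" "A \<subseteq> U" "emeasure lborel (U - K) < en (e / k)"
  using lborel_compact_open_approx[of A "e / k"] base k by auto
 have [measurable]: "K : sets borel" "U : sets borel" using KU by (auto intro: borel_compact)
 obtain del0 where d: "del0 > 0" "!!x y. x : K ==> dist x y < del0 ==> y : U"
 proof (cases "K = {} \<or> - U = {}")
  case True
  then show ?thesis by (intro that[of 1]) auto
 next
  case False
  then have "setdist K (- U) > 0"
  using KU setdist_gt_0_compact_closed[of K "- U"] by auto
  moreover have "y : U" if "x : K" "dist x y < setdist K (- U)" for x y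
  using that setdist_le_dist[of x K y "- U"] by auto
  ultimately show ?thesis using that by blast
 qed
 have "(NN x. norm (ind A (x + w) *R c - indicat_real A x *R c)) <= en e" if w: "norm w < del0" for w
 proof -
  let ?D = "ind (U - K) :: 'a => ennreal"
  have pt: "en (norm (ind A (x + w) *R c - indicat_real A x *R c)) <= en (norm c)*(?D (x + w) + ?D x)" for x
  proof -
  have "x : U" if "x + w : K" using d(2)[OF that, of x] w by (simp add: dist_norm)
  moreover have "x + w : U" if "x : K" using d(2)[OF that, of "x + w"] w by (simp add: dist_norm)
  moreover have "x : A ==> x : U" "x + w : A ==> x + w : U" using KU by auto
  moreover have "x ~: A ==> x ~: K" "x + w ~: A ==> x + w ~: K" using KU by auto
  ultimately show ?thesis by (cases "x : A"; cases "x + w : A"; cases "x : K"; cases "x + w : K")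
  (auto simp: indicator_def distrib_left)
  qed
  have "(NN x. norm (ind A (x + w) *R c - indicat_real A x *R c))
  <= (NN x. en (norm c)*(?D (x + w) + ?D x))"
  using pt by (rule nn_integral_mono)
  also have "... = en (norm c)*(emeasure lborel (U - K) + emeasure lborel (U - K))"
  by (simp add: nn_integral_cmult nn_integral_add nn_integral_lborel_translate[of ?D])
  also have "... <= en m*(en (e / k) + en (e / k))"
  using KU(5) unfolding m_def by (intro mult_mono add_mono ennreal_leI) auto
  also have "... = en e"
  using base(3) m unfolding k_def by (simp add: field_simps flip: ennreal_plus ennreal_mult)
  finally show ?thesis .
 qed
 with d(1) show ?case by blast
next
 case (add f g)
 obtain del01 where 1: "del01 > 0" "!!w. norm w < del01 ==> (NN x. norm (f (x + w) - f x)) <= en (e/2)"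
  using add.IH(1)[of "e/2"] add.prems by auto
 obtain del02 where 2: "del02 > 0" "!!w. norm w < del02 ==> (NN x. norm (g (x + w) - g x)) <= en (e/2)"
  using add.IH(2)[of "e/2"] add.prems by auto
 have [measurable]: "f : BM" "g : BM"
  using add.hyps by (auto dest: Lint_meas)
 have "(NN x. norm ((f (x + w) + g (x + w)) - (f x + g x))) <= en e" if "norm w < min del01 del02" for w
 proof -
  have "(NN x. norm ((f (x + w) + g (x + w)) - (f x + g x)))
  <= (NN x. norm (f (x + w) - f x)) + (NN x. norm (g (x + w) - g x))"
  by (rule nn_integral_norm_triangle) (auto simp: norm_triangle_ineq add_diff_add)
  also have "... <= en (e/2) + en (e/2)" using 1 2 that by (intro add_mono) auto
  also have "... = en e" using add.prems by (simp flip: ennreal_plus)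
  finally show ?thesis .
 qed
 with 1(1) 2(1) show ?case by (intro exI[of _ "min del01 del02"]) auto
next
 case (lim f s)
 have [measurable]: "f : BM" "!!i. s i : BM"
  using lim.hyps by (auto dest!: Lint_meas)
 have "(%i. (NN x. norm (s i x - f x))) ----> 0"
  unfolding norm_minus_commute[of "s _ _"]
 proof (rule nn_integral_dominated_convergence_norm[where w="%x. 2*norm (f x)"])
  show "(NN x. en (2*norm (f x))) < \<infinity>"
  using lim.hyps(4) integrable_iff_bounded[of lborel "%x. 2*norm (f x)"] by simp
 qed (use lim.hyps in auto)
 then have "\<forall>\<^sub>F i in sequentially. (NN x. norm (s i x - f x)) < en (e / 3)"
  using lim.prems by (intro order_tendstoD(2)[of _ 0]) auto
 then obtain i where i: "(NN x. norm (s i x - f x)) < en (e / 3)"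
  by (auto simp: eventually_sequentially)
 obtain del0 where d: "del0 > 0" "!!w. norm w < del0 ==> (NN x. norm (s i (x + w) - s i x)) <= en (e/3)"
  using lim.IH[of "e/3" i] lim.prems by auto
 have "(NN x. norm (f (x + w) - f x)) <= en e" if w: "norm w < del0" for w
 proof -
  have "(NN x. norm (f (x + w) - f x))
  <= (NN x. en (norm (s i (x + w) - s i x)) + (en (norm (s i (x + w) - f (x + w))) + en (norm (s i x - f x))))"
  proof (rule nn_integral_mono)
  fix x
  have "norm (f (x + w) - f x) <= norm (s i (x + w) - s i x) + (norm (s i (x + w) - f (x + w)) + norm (s i x - f x))"
  using norm_triangle_ineq4[of "s i (x + w) - s i x" "(s i (x + w) - f (x + w)) - (s i x - f x)"]
  norm_triangle_ineq4[of "s i (x + w) - f (x + w)" "s i x - f x"] by (simp add: algebra_simps)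
  then show "en (norm (f (x + w) - f x)) <= en (norm (s i (x + w) - s i x)) +
  (en (norm (s i (x + w) - f (x + w))) + en (norm (s i x - f x)))"
  by (simp flip: ennreal_plus)
  qed
  also have "... = (NN x. norm (s i (x + w) - s i x)) +
  ((NN x. norm (s i x - f x)) + (NN x. norm (s i x - f x)))"
  using nn_integral_lborel_translate[of "%x. en (norm (s i x - f x))" w]
  by (simp add: nn_integral_add)
  also have "... <= en (e/3) + (en (e/3) + en (e/3))"
  using d(2)[OF w] i by (intro add_mono) auto
  also have "... = en e" using lim.prems by (simp flip: ennreal_plus)
  finally show ?thesis .
 qed
 with d(1) show ?case by blast
qed

lemma nn_st:
 fixes F :: "'a::euclidean_space => 'b::euclidean_space => ennreal"
 assumes "jm F"
 shows "(NN p. case_prod F p) = (NN t. NN x. F t x)"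
  and "(NN t. NN x. F t x) = (NN x. NN t. F t x)"
 using lborel.nn_integral_fst[of "case_prod F" lborel] lborel_pair.Fubini'[of F] assms
 by (simp_all add: lborel_prod)

text \<open>A spatial shift by \<open>w\<close> is the shift by \<open>(0, w)\<close> of the product
  space.\<close>

lemma st_translation:
 fixes F :: "real => 'a::euclidean_space => 'b::{banach, second_countable_topology}"
 assumes F: "Lint (case_prod F)" and "0 < e"
 shows "EX del0>0. ALL w. norm w < del0 --> (NN t. NN x. norm (F t (x + w) - F t x)) <= en e"
proof -
 have Fm: "jm F" using F by (auto dest: Lint_meas)
 note [measurable (raw)] = meas2[OF Fm]
 have eq: "(NN t. NN x. norm (F t (x + w) - F t x))
  = (NN p. norm (case_prod F (p + (0, w)) - case_prod F p))" for w
  by (subst nn_st(1)[symmetric])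
  (auto simp: borel_prod[symmetric] intro!: nn_integral_cong)
 obtain del0 where "del0 > 0" "!!w. norm w < del0 ==> (NN p. norm (case_prod F (p + w) - case_prod F p)) <= en e"
  using L1_translation_continuous[OF assms] by blast
 then show ?thesis unfolding eq by (intro exI[of _ del0]) (auto simp: norm_Pair)
qed

text \<open>The increments of a merely bounded \<open>v\<close> are small only against an integrable
  weight: \<open>(v (x + w) - v x) F x\<close> is the increment of \<open>v F\<close> minus
  \<open>v (x + w)\<close> times the increment of \<open>F\<close>, and both \<open>v F\<close> and
  \<open>F\<close> are integrable.\<close>

lemma st_bounded_translation:
 fixes F :: "real => 'a::euclidean_space => 'b::{banach, second_countable_topology}"
 assumes F: "Lint (case_prod F)" and v: "jm v"
  and K: "!!t x. \<bar>v t x :: real\<bar> <= K" and e: "0 < e"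
 shows "EX del0>0. ALL w. norm w < del0 -->
  (NN t. NN x. norm ((v t (x + w) - v t x) *R F t x)) <= en e"
proof -
 have Fm: "jm F" using F by (auto dest: Lint_meas)
 note [measurable (raw)] = meas2[OF Fm] meas2[OF v]
 have K0: "0 <= K" using K[of 0 0] by linarith
 have vF: "Lint (%(t, x). v t x *R F t x)"
 proof (rule I_bound)
  show "Lint (%p. K*norm (case_prod F p))" using F by (intro integrable_mult_right integrable_norm)
  show "(%(t, x). v t x *R F t x) : bm lborel" by (simp add: borel_prod[symmetric])
  show "AEL p. norm (case p of (t, x) => v t x *R F t x) <= norm (K*norm (case_prod F p))"
  using K K0 by (intro AE_I2) (auto simp: abs_mult intro!: mult_right_mono split: prod.split)
 qed
 obtain del01 where 1: "del01 > 0" "!!w. norm w < del01 ==>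
  (NN t. NN x. norm (v t (x + w) *R F t (x + w) - v t x *R F t x)) <= en (e/2)"
  using st_translation[OF vF, of "e/2"] e by auto
 have "e / (2*(K + 1)) > 0" using e K0 by simp
 from st_translation[OF F this]
 obtain del02 where 2: "del02 > 0" "!!w. norm w < del02 ==>
  (NN t. NN x. norm (F t (x + w) - F t x)) <= en (e / (2*(K + 1)))"
  by auto
 have "(NN t. NN x. norm ((v t (x + w) - v t x) *R F t x)) <= en e"
  if w: "norm w < min del01 del02" for w
 proof -
  have "(NN t. NN x. norm ((v t (x + w) - v t x) *R F t x))
  <= (NN t. NN x. en (norm (v t (x + w) *R F t (x + w) - v t x *R F t x))
  + en K*en (norm (F t (x + w) - F t x)))"
  proof (intro nn_integral_mono)
  fix t x
  have "norm ((v t (x + w) - v t x) *R F t x) <= norm (v t (x + w) *R F t (x + w) - v t x *R F t x)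
  + norm (v t (x + w) *R (F t (x + w) - F t x))"
  using norm_triangle_ineq4[of "v t (x + w) *R F t (x + w) - v t x *R F t x" "v t (x + w) *R (F t (x + w) - F t x)"]
  by (simp add: algebra_simps)
  also have "... <= norm (v t (x + w) *R F t (x + w) - v t x *R F t x) + K*norm (F t (x + w) - F t x)"
  using K by (auto intro!: mult_right_mono)
  finally show "en (norm ((v t (x + w) - v t x) *R F t x)) <= en (norm (v t (x + w) *R F t (x + w) - v t x *R F t x))
  + en K*en (norm (F t (x + w) - F t x))"
  using K0 by (simp flip: ennreal_plus ennreal_mult)
  qed
  also have "... = (NN t. NN x. norm (v t (x + w) *R F t (x + w) - v t x *R F t x))
  + en K*(NN t. NN x. norm (F t (x + w) - F t x))"
  by (simp add: nn_integral_add nn_integral_cmult)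
  also have "... <= en (e/2) + en (K + 1)*en (e / (2*(K + 1)))"
  using 1(2)[of w] 2(2)[of w] w by (intro add_mono mult_mono ennreal_leI) auto
  also have "... = en e" using e K0 by (simp add: field_simps flip: ennreal_plus ennreal_mult)
  finally show ?thesis .
 qed
 with 1(1) 2(1) show ?thesis by (intro exI[of _ "min del01 del02"]) auto
qed

section \<open>Local integrability, the fundamental lemma and weak gradients\<close>

text \<open>The Borel counterpart of \<open>L1loc\<close>; balls about the origin contain all other
  balls.\<close>

definition loc_int :: "('a::euclidean_space => 'b::euclidean_space) => bool" where
 "loc_int f \<longleftrightarrow> f : BM & (ALL r. Lint (%x. indc r x *R f x))"

lemma loc_int_mult:
 assumes f: "loc_int f" and [measurable]: "psi : BM" and "!!x. \<bar>psi x\<bar> <= C" "!!x. r <= norm x ==> psi x = 0"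
 shows "Lint (%x. psi x *R f x)"
proof (rule I_bound)
 have [measurable]: "f : BM" using f by (simp add: loc_int_def)
 show "(%x. psi x *R f x) : bm lborel" by simp
 show "Lint (%x. C *R (indc r x *R f x))"
  using f by (intro integrable_scaleR_right) (auto simp: loc_int_def)
 have "norm (psi x *R f x) <= norm (C *R (indc r x *R f x))" for x
  using assms(3)[of x] assms(4)[of x] by (cases "norm x <= r") (auto intro!: mult_right_mono)
 then show "AEL x. norm (psi x *R f x) <= norm (C *R (indc r x *R f x))" by simp
qed

lemma loc_int_tf:
 fixes f :: "'a::euclidean_space => 'b::euclidean_space"
 assumes f: "loc_int f" and t: "tf psi"
 shows "Lint (%x. psi x *R f x)"
proof -
 obtain C where "!!x. \<bar>psi x\<bar> <= C" using tf_bounded[OF t] by blast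
 moreover obtain r where "!!x. r <= norm x ==> psi x = 0" using t unfolding tf_alt by auto
 ultimately show ?thesis using loc_int_mult[OF f tf_measurable[OF t]] by blast
qed

lemma mollifier_nn_integral:
 assumes "mollifier eps C rho" shows "(NN x. en (rho x)) = 1"
 using assms nn_integral_eq_integral[of lborel rho] tf_integrable[of rho] by (simp add: mollifier_def)

lemma integral_tf_reflect:
 assumes "loc_int f" "tf psi"
 shows "(LB w. psi w *R f (x - w)) = (LB y. psi (x - y) *R f y)"
proof -
 have [measurable]: "f : BM" "psi : BM"
  using assms tf_measurable by (auto simp: loc_int_def)
 show ?thesis using integral_lborel_reflect[of "%y. psi (x - y) *R f y" x] by simp
qed

lemma ennreal_eq_0I:
 fixes X :: ennreal
 assumes "!!e. e > 0 ==> X <= en e" shows "X = 0"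
proof (cases X)
 case (real r)
 then show ?thesis using assms[of "r / 2"] by (cases "r = 0") auto
next
 case top
 then show ?thesis using assms[of 1] by (simp add: top_unique)
qed

text \<open>Convolutions of \<open>f\<close> with test functions vanish, so \<open>f x\<close> is an
  average of \<open>f x - f (x - w)\<close> over small \<open>w\<close>, and the \<open>L1\<close>
  norm of these increments on balls is small by continuity of translations.\<close>

lemma fundamental_lemma:
 fixes f :: "'a::euclidean_space => 'b::euclidean_space"
 assumes f: "loc_int f" and 0: "!!psi. tf psi ==> (LB x. psi x *R f x) = 0"
 shows "AEL x. f x = 0"
proof -
 have [measurable]: "f : BM" using f by (simp add: loc_int_def)
 have "AEL x. x : cball 0 (real n) --> f x = 0" for n
 proof -
  define F where "F = (%x. ind (cball 0 (real n + 1)) x *R f x)"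
  have Fi: "Lint F" using f by (simp add: loc_int_def F_def)
  have [measurable]: "F : BM" by (simp add: F_def)
  have "(NN x. norm (ind (cball 0 (real n)) x *R f x)) <= en e" if "e > 0" for e
  proof -
  obtain del0 where d: "del0 > 0" "!!w. norm w < del0 ==> (NN x. norm (F (x + w) - F x)) <= en e"
  using L1_translation_continuous[OF Fi \<open>e > 0\<close>] by blast
  obtain C where "!!eps. eps > 0 ==> EX rho::'a => real. mollifier eps C rho" using mollifier_exists by blast
  then obtain rho :: "'a => real" where rho: "mollifier (min del0 1) C rho" using d(1) by (metis min_less_iff_conj zero_less_one)
  then have rhot: "tf rho" and rho0: "!!x. 0 <= rho x" and rho1: "!!x. min del0 1 <= norm x ==> rho x = 0"
  and rhoI: "(LB x. rho x) = 1" by (auto simp: mollifier_def)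
  note [measurable] = tf_measurable[OF rhot]
  have "en (norm (ind (cball 0 (real n)) x *R f x)) <= (NN w. en (rho w)*en (norm (F (x - w) - F x)))" for x
  proof (cases "x : cball 0 (real n)")
  case True
  have eq: "rho w *R f (x - w) = rho w *R F (x - w)" for w
  proof (cases "norm w < 1")
  case True
  then have "x - w : cball 0 (real n + 1)" using \<open>x : cball 0 (real n)\<close> norm_triangle_ineq4[of x w] by simp
  then show ?thesis by (simp add: F_def)
  qed (use rho1[of w] in simp)
  have Fx: "F x = f x" using True by (simp add: F_def)
  have "(LB w. rho w *R f (x - w)) = (LB y. rho (x - y) *R f y)"
  by (rule integral_tf_reflect[OF f rhot])
  also have "... = 0" by (rule 0[OF tf_reflect[OF rhot]])
  finally have z: "(LB w. rho w *R F (x - w)) = 0" by (simp add: eq)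
  have "Lint (%y. rho (x - y) *R f y)"
  by (rule loc_int_tf[OF f tf_reflect[OF rhot]])
  then have i1: "Lint (%w. rho w *R F (x - w))"
  using integrable_lborel_reflect_iff[of "%y. rho (x - y) *R f y" x] by (simp add: eq)
  have i2: "Lint (%w. rho w *R F x)"
  using tf_integrable[OF rhot] by simp
  have "(LB w. rho w *R (F (x - w) - F x)) = - F x"
  using i1 i2 z rhoI tf_integrable[OF rhot] by (simp add: scaleR_diff_right)
  then have "en (norm (f x)) = en (norm (LB w. rho w *R (F (x - w) - F x)))"
  by (simp add: Fx)
  also have "... <= (NN w. norm (rho w *R (F (x - w) - F x)))"
  using i1 i2 by (intro integral_norm_bound_ennreal) (simp add: scaleR_diff_right)
  also have "... = (NN w. en (rho w)*en (norm (F (x - w) - F x)))"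
  using rho0 by (simp add: ennreal_mult)
  finally show ?thesis using True by simp
  qed simp
  then have "(NN x. norm (ind (cball 0 (real n)) x *R f x))
  <= (NN x. NN w. en (rho w)*en (norm (F (x - w) - F x)))"
  by (rule nn_integral_mono)
  also have "... = (NN w. NN x. en (rho w)*en (norm (F (x - w) - F x)))"
  by (rule lborel_pair.Fubini') simp
  also have "... = (NN w. en (rho w)*(NN x. norm (F (x + - w) - F x)))"
  by (simp add: nn_integral_cmult)
  also have "... <= (NN w. en (rho w)*en e)"
  proof (rule nn_integral_mono)
  fix w :: 'a
  show "en (rho w)*(NN x. norm (F (x + - w) - F x)) <= en (rho w)*en e"
  by (cases "norm w < del0") (use d(2)[of "- w"] rho1[of w] in \<open>auto intro!: mult_left_mono\<close>)
  qed
  also have "... = en e" using mollifier_nn_integral[OF rho] by (simp add: nn_integral_multc)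
  finally show ?thesis .
  qed
  then have "(NN x. norm (ind (cball 0 (real n)) x *R f x)) = 0"
  by (rule ennreal_eq_0I)
  then have "AEL x. indicat_real (cball 0 (real n)) x *R f x = 0"
  by (simp add: nn_integral_0_iff_AE)
  then show ?thesis by eventually_elim (auto simp: indicator_def split: if_splits)
 qed
 then have "AEL x. ALL n. x : cball 0 (real n) --> f x = 0" by (subst AE_all_countable) auto
 then show ?thesis by eventually_elim (auto simp: real_arch_simple)
qed

definition weak_grad :: "('a::euclidean_space => 'b::euclidean_space) => ('a => 'a => 'b) => bool" where
 "weak_grad f g \<longleftrightarrow> loc_int f & (ALL i:Basis. loc_int (g i) &
  (ALL psi. tf psi -->
  (LB x. FD psi (at x) i *R f x) = - (LB x. psi x *R g i x)))"

lemma tf_FTC: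
 fixes psi :: "'a::euclidean_space => real"
 assumes t: "tf psi"
 shows "(LB s. ind {0..1} s*FD psi (at (x - s *R w)) w) = psi x - psi (x - w)"
proof -
 have s: "smooth_on UNIV psi" using t by (simp add: test_function_def)
 have lin: "linear (FD psi (at a))" for a
  using smooth_has_derivative[OF s] by (rule has_derivative_linear)
 have "((%s. psi (x - s *R w)) has_vector_derivative - FD psi (at (x - s *R w)) w) (at s within {0..1})" for s
 proof -
  have "((%s. x - s *R w) has_derivative (%h. - (h *R w))) (at s within {0..1})"
  by (auto intro!: derivative_eq_intros)
  from has_derivative_compose[OF this smooth_has_derivative[OF s]]
  show ?thesis unfolding has_vector_derivative_def
  by (rule back_subst[where P="%f. (_ has_derivative f) _"])
  (auto simp: linear_neg[OF lin] linear_cmul[OF lin])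
 qed
 moreover have "continuous_on {0..1} (%s. - FD psi (at (x - s *R w)) w)"
  by (intro continuous_on_minus continuous_on_compose2[OF tf_continuous[OF tf_FD[OF t]]] continuous_intros) auto
 ultimately have "(LB s. ind {0..1} s *R - FD psi (at (x - s *R w)) w) = psi (x - 1 *R w) - psi (x - 0 *R w)"
  by (intro integral_FTC_atLeastAtMost) auto
 then show ?thesis by simp
qed

lemma integrable_lborel_product:
 fixes f :: "real => real" and g :: "'a::euclidean_space => real"
 assumes "Lint f" "Lint g"
 shows "integrable (lborel \<Otimes>\<^sub>M lborel) (%(s, x). f s*g x)"
proof (rule lborel_pair.Fubini_integrable)
 have [measurable]: "f : BM" "g : BM"
  using assms by (auto dest: Lint_meas)
 show "(%(s, x). f s*g x) : bm (lborel \<Otimes>\<^sub>M lborel)" by measurable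
 show "Lint (%s. LB x. norm (case (s, x) of (s, x) => f s*g x))"
  using assms by (simp add: abs_mult)
 show "AEL s. Lint (%x. case (s, x) of (s, x) => f s*g x)"
  using assms by simp
qed

lemma loc_int_segment_integrable:
 fixes g :: "'a::euclidean_space => 'b::euclidean_space"
 assumes g: "loc_int g" and [measurable]: "psi : BM" and C: "!!x. \<bar>psi x\<bar> <= C"
  and r: "!!x. r <= norm x ==> psi x = 0"
 shows "integrable (lborel \<Otimes>\<^sub>M lborel) (%(s, x). (ind {0..1::real} s*psi x) *R g (x + s *R w))"
proof -
 have [measurable]: "g : BM" using g by (simp add: loc_int_def)
 let ?R = "r + norm w"
 have C0: "0 <= C" using C[of 0] by linarith
 have gi: "Lint (%x. ind (cball 0 ?R) x *R g x)" using g by (simp add: loc_int_def)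
 have "(\<integral>\<^sup>+p. norm (case p of (s, x) => (ind {0..1::real} s*psi x) *R g (x + s *R w)) \<partial>(lborel \<Otimes>\<^sub>M lborel))
  = (NN s. NN x. norm ((ind {0..1::real} s*psi x) *R g (x + s *R w)))"
  by (subst lborel.nn_integral_fst[symmetric]) simp_all
 also have "... <= (NN s. ind {0..1::real} s*(en C*(NN x. norm (ind (cball 0 ?R) x *R g x))))"
 proof (rule nn_integral_mono)
  fix s :: real
  show "(NN x. norm ((ind {0..1::real} s*psi x) *R g (x + s *R w)))
  <= ind {0..1::real} s*(en C*(NN x. norm (ind (cball 0 ?R) x *R g x)))"
  proof (cases "s : {0..1}")
  case True
  have "(NN x. norm ((ind {0..1::real} s*psi x) *R g (x + s *R w)))
  <= (NN x. en C*en (norm (ind (cball 0 ?R) (x + s *R w) *R g (x + s *R w))))"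
  proof (rule nn_integral_mono)
  fix x :: 'a
  have "norm (s *R w) <= norm w" using True by (simp add: mult_left_le_one_le)
  then have "norm x <= r ==> x + s *R w : cball 0 ?R" using norm_triangle_ineq[of x "s *R w"] by simp
  then show "en (norm ((ind {0..1::real} s*psi x) *R g (x + s *R w)))
  <= en C*en (norm (ind (cball 0 ?R) (x + s *R w) *R g (x + s *R w)))"
  using C[of x] C0 r[of x] True by (cases "norm x <= r") (auto intro!: ennreal_leI mult_right_mono simp flip: ennreal_mult)
  qed
  also have "... = en C*(NN x. norm (ind (cball 0 ?R) x *R g x))"
  using nn_integral_lborel_translate[of "%x. en (norm (ind (cball 0 ?R) x *R g x))" "s *R w"]
  by (simp add: nn_integral_cmult)
  finally show ?thesis using True by simp
  qed simp
 qed
 also have "... = en C*(NN x. norm (ind (cball 0 ?R) x *R g x))"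
  by (simp add: nn_integral_multc)
 also have "... < \<infinity>"
  using gi by (simp add: integrable_iff_bounded ennreal_mult_less_top)
 finally show ?thesis by (auto simp: integrable_iff_bounded)
qed

lemma integral_lincomb:
 fixes F :: "'i => 'a => 'b::{banach, second_countable_topology}"
 assumes "!!i. i : A ==> integrable M (F i)"
 shows "(LINT x|M. (SUM i:A. c i *R F i x)) = (SUM i:A. c i *R (LINT x|M. F i x))"
 using assms by (subst L_sum) auto

text \<open>The line integral is moved to the test function, where the fundamental theorem of
  calculus holds. For each \<open>s\<close> the weak derivative is applied to the translate
  \<open>psi (x - s w)\<close>, and the fundamental lemma turns the tested identity into a pointwise
  one.\<close>

lemma weak_grad_difference:
 fixes f :: "'a::euclidean_space => 'b::euclidean_space"
 assumes fg: "weak_grad f g"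
 defines "D \<equiv> %w x. SUM i:Basis. (w \<bullet> i) *R g i x"
 shows "AEL x. f (x + w) - f x = (LB s. ind {0..1} s *R D w (x + s *R w))"
proof -
 have lf: "loc_int f" and lg: "!!i. i : Basis ==> loc_int (g i)" using fg by (auto simp: weak_grad_def)
 have [measurable]: "f : BM" using lf by (simp add: loc_int_def)
 have [measurable]: "!!i. i : Basis ==> g i : BM" using lg by (simp add: loc_int_def)
 have Dm [measurable]: "D w : BM" unfolding D_def by measurable
 have lD: "loc_int (D w)" unfolding loc_int_def
 proof (intro conjI allI)
  fix r
  have "Lint (%x. SUM i:Basis. (w \<bullet> i) *R (indc r x *R g i x))"
  using lg by (intro I_sum integrable_scaleR_right) (auto simp: loc_int_def)
  then show "Lint (%x. indc r x *R D w x)"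
  by (simp add: D_def scaleR_sum_right mult.commute)
 qed simp
 define h where "h = (%x. LB s. ind {0..1} s *R D w (x + s *R w))"
 have [measurable]: "h : BM" unfolding h_def by measurable
 have seg: "integrable (lborel \<Otimes>\<^sub>M lborel) (%(s, x). (ind {0..1::real} s*psi x) *R D w (x + s *R w))"
  if "psi : BM" "!!x. \<bar>psi x\<bar> <= C" "!!x. r <= norm x ==> psi x = 0" for psi :: "'a => real" and C r
  by (rule loc_int_segment_integrable[OF lD that])
 have hi: "(LB s. (ind {0..1::real} s*psi x) *R D w (x + s *R w)) = psi x *R h x" for psi :: "'a => real" and x
 proof -
  show ?thesis unfolding h_def
  by (subst integral_scaleR_right[symmetric]) (auto simp: mult.commute intro!: L_cong)
 qed
 have lh: "loc_int h" unfolding loc_int_def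
 proof (intro conjI allI)
  fix r
  have "integrable (lborel \<Otimes>\<^sub>M lborel) (%(s, x). (ind {0..1::real} s*indc r x) *R D w (x + s *R w))"
  by (rule seg[where C=1 and r="r + 1"]) (auto simp: indicator_def)
  from lborel_pair.integrable_snd[OF this]
  show "Lint (%x. indc r x *R h x)" by (simp add: hi)
 qed simp
 have lt: "loc_int (%x. f (x + w))" unfolding loc_int_def
 proof (intro conjI allI)
  fix r
  have "Lint (%x. indc r (x - w) *R f x)"
  proof (rule loc_int_mult[OF lf, where C=1 and r="r + norm w + 1"])
  show "indc r (x - w) = (0::real)" if "r + norm w + 1 <= norm x" for x
  using norm_triangle_ineq2[of x w] that by (simp add: indicator_def)
  qed (auto simp: indicator_def)
  then show "Lint (%x. indc r x *R f (x + w))"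
  using integrable_lborel_translate_iff[of "%x. indc r (x - w) *R f x" w] by simp
 qed simp
 have "AEL x. f (x + w) - f x - h x = 0"
 proof (rule fundamental_lemma)
  show "loc_int (%x. f (x + w) - f x - h x)"
  using lf lh lt by (auto simp: loc_int_def scaleR_diff_right)
  fix psi :: "'a => real" assume t: "tf psi"
  note [measurable] = tf_measurable[OF t] tf_measurable[OF tf_FD[OF t]]
  have s: "smooth_on UNIV psi" using t by (simp add: test_function_def)
  obtain C where C: "!!x. \<bar>psi x\<bar> <= C" using tf_bounded[OF t] by blast
  obtain r where r: "!!x. r <= norm x ==> psi x = 0" using t unfolding tf_alt by auto
  obtain C' where C': "!!x. \<bar>FD psi (at x) w\<bar> <= C'" using tf_bounded[OF tf_FD[OF t]] by blast
  obtain r' where r': "!!x. r' <= norm x ==> FD psi (at x) w = 0"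
  using tf_FD[OF t, of w] unfolding tf_alt by auto
  have tw: "tf (%x. psi (x - w))" for w using tf_translate[OF t, of "- w"] by simp
  have fd: "FD (%x. psi (x - s *R w)) (at x) i = FD psi (at (x - s *R w)) i" for s x i
  using FD_translate[OF s, of "- s *R w"] by simp
  let ?G = "%s x. (ind {0..1::real} s*FD psi (at (x - s *R w)) w) *R f x"
  have G: "integrable (lborel \<Otimes>\<^sub>M lborel) (%(s, x). ?G s x)"
  proof (rule I_bound)
  have lf': "Lint (%x. norm (ind (cball 0 (r' + norm w)) x *R f x))"
  using lf by (intro integrable_norm) (auto simp: loc_int_def)
  have li: "Lint (ind {0..1::real} :: real => real)" by simp
  show "integrable (lborel \<Otimes>\<^sub>M lborel) (%p. C'*(case p of (s, x) =>
  ind {0..1::real} s*norm (ind (cball 0 (r' + norm w)) x *R f x)))"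
  by (intro integrable_mult_right integrable_lborel_product li lf')
  show "(%(s, x). ?G s x) : bm (lborel \<Otimes>\<^sub>M lborel)" by measurable
  have "norm (?G s x) <= norm (C'*(ind {0..1::real} s*norm (ind (cball 0 (r' + norm w)) x *R f x)))" for s x
  proof (cases "s : {0..1} & norm (x - s *R w) < r'")
  case True
  have "norm (s *R w) <= norm w" using True by (simp add: mult_left_le_one_le)
  then have "x : cball 0 (r' + norm w)" using True norm_triangle_ineq2[of x "s *R w"] by simp
  then show ?thesis using True C'[of "x - s *R w"] by (auto simp: abs_mult intro!: mult_right_mono)
  next
  case False
  then show ?thesis using r'[of "x - s *R w"] by (auto simp: indicator_def)
  qed
  then show "AE p in lborel \<Otimes>\<^sub>M lborel. norm (case p of (s, x) => ?G s x)
  <= norm (C'*(case p of (s, x) => ind {0..1::real} s*norm (ind (cball 0 (r' + norm w)) x *R f x)))"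
  by (intro AE_I2) (auto split: prod.split)
  qed
  have "(LB x. (psi x - psi (x - w)) *R f x) = (LB x. LB s. ?G s x)"
  proof (rule L_cong[OF refl])
  fix x
  have "Lint (%s. ind {0..1::real} s*FD psi (at (x - s *R w)) w)"
  proof (rule integrable_bounded_support[where r=2])
  show "norm (ind {0..1::real} s*FD psi (at (x - s *R w)) w) <= C'" for s
  using C'[of "x - s *R w"] by (auto simp: indicator_def)
  qed (auto simp: indicator_def)
  then show "(psi x - psi (x - w)) *R f x = (LB s. ?G s x)"
  unfolding tf_FTC[OF t, symmetric] by (subst L_scaleR_left) simp_all
  qed
  also have "... = (LB s. LB x. ?G s x)"
  by (rule lborel_pair.Fubini_integral[OF G])
  also have "... = (LB s. - (LB x. (ind {0..1::real} s*psi x) *R D w (x + s *R w)))"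
  proof (rule L_cong[OF refl])
  fix s :: real
  have "(LB x. FD psi (at (x - s *R w)) w *R f x)
  = (LB x. (SUM i:Basis. (w \<bullet> i) *R (FD (%x. psi (x - s *R w)) (at x) i *R f x)))"
  by (simp add: FD_Basis[OF s, of _ w] fd scaleR_sum_left)
  also have "... = (SUM i:Basis. (w \<bullet> i) *R (LB x. FD (%x. psi (x - s *R w)) (at x) i *R f x))"
  by (intro integral_lincomb loc_int_tf[OF lf] tf_FD tw)
  also have "... = (SUM i:Basis. (w \<bullet> i) *R - (LB x. psi (x - s *R w) *R g i x))"
  using fg tw by (auto simp: weak_grad_def intro!: sum.cong)
  also have "... = - (LB x. (SUM i:Basis. (w \<bullet> i) *R (psi (x - s *R w) *R g i x)))"
  by (subst integral_lincomb) (auto intro!: loc_int_tf[OF lg] tw simp: sum_negf)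
  also have "(LB x. (SUM i:Basis. (w \<bullet> i) *R (psi (x - s *R w) *R g i x)))
  = (LB x. psi (x - s *R w) *R D w x)"
  by (simp add: D_def scaleR_sum_right mult.commute)
  also have "... = (LB x. psi x *R D w (x + s *R w))"
  using integral_lborel_translate[of "%x. psi (x - s *R w) *R D w x" "s *R w"] by simp
  finally show "(LB x. ?G s x) = - (LB x. (ind {0..1::real} s*psi x) *R D w (x + s *R w))"
  by (cases "s : {0..1}") auto
  qed
  also have "... = - (LB s. LB x. (ind {0..1::real} s*psi x) *R D w (x + s *R w))"
  by simp
  also have "... = - (LB x. LB s. (ind {0..1::real} s*psi x) *R D w (x + s *R w))"
  using lborel_pair.Fubini_integral[OF seg[OF tf_measurable[OF t] C r]] by simp
  also have "... = - (LB x. psi x *R h x)" by (simp add: hi)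
  finally have 1: "(LB x. (psi x - psi (x - w)) *R f x) = - (LB x. psi x *R h x)" .
  have i1: "Lint (%x. psi x *R f x)" by (rule loc_int_tf[OF lf t])
  have i2: "Lint (%x. psi (x - w) *R f x)" by (rule loc_int_tf[OF lf tw])
  have i3: "Lint (%x. psi x *R f (x + w))" by (rule loc_int_tf[OF lt t])
  have i4: "Lint (%x. psi x *R h x)" by (rule loc_int_tf[OF lh t])
  have "(LB x. psi x *R f (x + w)) = (LB x. psi (x - w) *R f x)"
  using integral_lborel_translate[of "%x. psi (x - w) *R f x" w] by simp
  moreover have "(LB x. psi x *R (f (x + w) - f x - h x))
  = (LB x. psi x *R f (x + w)) - (LB x. psi x *R f x) - (LB x. psi x *R h x)"
  unfolding scaleR_diff_right
  by (simp only: L_diff I_diff i1 i3 i4)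
  moreover have "(LB x. (psi x - psi (x - w)) *R f x) = (LB x. psi x *R f x) - (LB x. psi (x - w) *R f x)"
  unfolding scaleR_diff_left by (rule L_diff[OF i1 i2])
  ultimately show "(LB x. psi x *R (f (x + w) - f x - h x)) = 0"
  using arg_cong[OF 1, of uminus] by (simp only: minus_diff_eq minus_minus) simp
 qed
 then show ?thesis by (simp add: h_def)
qed

section \<open>Difference quotients of Sobolev fields\<close>

text \<open>Here \<open>g i\<close> is the weak derivative along \<open>i\<close>. The gradient
  identity is asked for at every \<open>t\<close>; exceptional times are removed by setting both
  \<open>b\<close> and \<open>g\<close> to zero there.\<close>

definition W11_field :: "(real => 'a::euclidean_space => 'b::euclidean_space) => ('a => real => 'a => 'b) => bool" where
 "W11_field b g \<longleftrightarrow>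
  jm b & (ALL i:Basis. jm (g i)) &
  (ALL r. Lint (%(t, x). indc r x *R b t x)) &
  (ALL i:Basis. ALL r. Lint (%(t, x). indc r x *R g i t x)) &
  (ALL t. weak_grad (b t) (%i. g i t))"

text \<open>If \<open>F - c\<close> is not integrable over the segment, the right-hand side is
  infinite, so the conventional value of the integral does no harm.\<close>

lemma norm_segment_average_le:
 fixes F :: "real => 'b::euclidean_space"
 assumes [measurable]: "F : BM"
 shows "en (norm ((LB s. ind {0..1} s *R F s) - c)) <= (NN s. ind {0..1} s*en (norm (F s - c)))"
proof -
 have ci: "Lint (%s. ind {0..1::real} s *R c)" by simp
 have eq: "en (norm (ind {0..1} s *R (F s - c))) = ind {0..1} s*en (norm (F s - c))" for s :: real
  by (simp add: indicator_def)
 show ?thesis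
 proof (cases "Lint (%s. ind {0..1::real} s *R (F s - c))")
  case True
  from I_add[OF this ci]
  have Fi: "Lint (%s. ind {0..1} s *R F s)"
  by (simp add: scaleR_diff_right)
  have "(LB s. ind {0..1} s *R F s) - c = (LB s. ind {0..1} s *R (F s - c))"
  using Fi ci by (simp add: scaleR_diff_right)
  then have "en (norm ((LB s. ind {0..1} s *R F s) - c)) <= (NN s. norm (ind {0..1} s *R (F s - c)))"
  using integral_norm_bound_ennreal[OF True] by simp
  then show ?thesis by (simp only: eq)
 next
  case False
  then have "(NN s. norm (ind {0..1} s *R (F s - c))) = \<infinity>"
  by (simp add: integrable_iff_bounded less_top[symmetric] del: norm_scaleR)
  then show ?thesis by (simp add: eq del: norm_scaleR)
 qed
qed

text \<open>The remainder is the average over the segment of \<open>D w (x + s w) - D w x\<close>,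
  and translations of the gradient are continuous in \<open>L1\<close>. The gained factor
  \<open>norm w\<close> later compensates the gradient of a mollifier in the commutator and the
  division by \<open>h\<close> in the difference scheme.\<close>

lemma W11_field_difference:
 fixes b :: "real => 'a::euclidean_space => 'b::euclidean_space"
 assumes bg: "W11_field b g" and e: "0 < e"
 shows "EX del0>0. ALL w. norm w < del0 --> (NN t. NN x. norm (indc R x *R
  (b t (x + w) - b t x - (SUM i:Basis. (w \<bullet> i) *R g i t x)))) <= en (e*norm w)"
proof -
 have bm: "jm b" and gm: "!!i. i : Basis ==> jm (g i)"
  using bg by (auto simp: W11_field_def)
 note [measurable (raw)] = meas2[OF bm]
 have gm' [measurable (raw)]: "!!i M p q. i : Basis ==> p : bm M ==> q : bm M ==> (%w. g i (p w) (q w)) : bm M"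
  using meas2[OF gm] by blast
 define G where "G = (%i t x. ind (cball 0 (R + 1)) x *R g i t x)"
 have Gi: "Lint (case_prod (G i))" if "i : Basis" for i
  using bg that by (auto simp: W11_field_def G_def)
 have Gm: "jm (G i)" if "i : Basis" for i
  using Gi[OF that] by (auto dest: Lint_meas)
 have [measurable (raw)]: "!!i M p q. i : Basis ==> p : bm M ==> q : bm M ==> (%w. G i (p w) (q w)) : bm M"
  using meas2[OF Gm] by blast
 let ?n = "real DIM('a)"
 have n0: "?n > 0" by simp
 have "ALL i:Basis. EX del0>0. ALL w. norm w < del0 --> (NN t. NN x. norm (G i t (x + w) - G i t x)) <= en (e / ?n)"
 proof
  fix i :: 'a assume i: "i : Basis"
  have "e / ?n > 0" using e by simp
  from st_translation[OF Gi[OF i] this]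
  show "EX del0>0. ALL w. norm w < del0 --> (NN t. NN x. norm (G i t (x + w) - G i t x)) <= en (e / ?n)" .
 qed
 from bchoice[OF this] obtain d where d: "!!i. i : Basis ==> d i > 0"
  "!!i w. i : Basis ==> norm w < d i ==> (NN t. NN x. norm (G i t (x + w) - G i t x)) <= en (e / ?n)"
  by blast
 \<comment> \<open>The bound 1 keeps \<open>x + s w\<close> inside the ball on which
   \<open>G\<close> agrees with \<open>g\<close>; the minimum serves all directions at once.\<close>
 define del0 where "del0 = min 1 (Min (d ` Basis))"
 have d0: "del0 > 0" using d(1) by (auto simp: del0_def)
 have d1: "del0 <= 1" "!!i. i : Basis ==> del0 <= d i" by (auto simp: del0_def intro: min.coboundedI2)
 show ?thesis
 proof (intro exI[of _ del0] conjI allI impI d0)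
  fix w :: 'a assume w: "norm w < del0"
  let ?S = "ind {0..1} :: real => ennreal"
  have pt: "AEL x. en (norm (indc R x *R (b t (x + w) - b t x - (SUM i:Basis. (w \<bullet> i) *R g i t x))))
  <= (NN s. ?S s*(SUM i:Basis. en \<bar>w \<bullet> i\<bar>*en (norm (G i t (x + s *R w) - G i t x))))" for t
  proof -
  have "weak_grad (b t) (%i. g i t)" using bg by (simp add: W11_field_def)
  from weak_grad_difference[OF this, of w] show ?thesis
  proof eventually_elim
  case (elim x)
  show ?case
  proof (cases "x : cball 0 R")
  case True
  have "(%s. SUM i:Basis. (w \<bullet> i) *R g i t (x + s *R w)) : BM" by measurable
  from norm_segment_average_le[OF this, of "SUM i:Basis. (w \<bullet> i) *R g i t x"]
  have "en (norm (b t (x + w) - b t x - (SUM i:Basis. (w \<bullet> i) *R g i t x)))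
  <= (NN s. ?S s*en (norm ((SUM i:Basis. (w \<bullet> i) *R g i t (x + s *R w)) - (SUM i:Basis. (w \<bullet> i) *R g i t x))))"
  unfolding elim .
  also have "... <= (NN s. ?S s*(SUM i:Basis. en \<bar>w \<bullet> i\<bar>*en (norm (G i t (x + s *R w) - G i t x))))"
  proof (rule nn_integral_mono)
  fix s :: real
  show "?S s*en (norm ((SUM i:Basis. (w \<bullet> i) *R g i t (x + s *R w)) - (SUM i:Basis. (w \<bullet> i) *R g i t x)))
  <= ?S s*(SUM i:Basis. en \<bar>w \<bullet> i\<bar>*en (norm (G i t (x + s *R w) - G i t x)))"
  proof (cases "s : {0..1}")
  case s: True
  have "norm (s *R w) <= norm w" using s by (simp add: mult_left_le_one_le)
  then have "x + s *R w : cball 0 (R + 1)" "x : cball 0 (R + 1)"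
  using True w d1(1) norm_triangle_ineq[of x "s *R w"] by simp_all
  then have G: "G i t (x + s *R w) = g i t (x + s *R w)" "G i t x = g i t x" for i by (auto simp: G_def)
  have "norm ((SUM i:Basis. (w \<bullet> i) *R g i t (x + s *R w)) - (SUM i:Basis. (w \<bullet> i) *R g i t x))
  <= (SUM i:Basis. norm ((w \<bullet> i) *R (g i t (x + s *R w) - g i t x)))"
  unfolding sum_subtractf[symmetric] scaleR_diff_right[symmetric] by (rule norm_sum)
  also have "... = (SUM i:Basis. \<bar>w \<bullet> i\<bar>*norm (G i t (x + s *R w) - G i t x))" by (simp add: G)
  finally show ?thesis using s by (simp add: sum_ennreal ennreal_leI flip: ennreal_mult)
  qed simp
  qed
  finally show ?thesis using True by simp
  qed simp
  qed
  qed
  have "(NN t. NN x. norm (indc R x *R (b t (x + w) - b t x - (SUM i:Basis. (w \<bullet> i) *R g i t x))))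
  <= (NN t. NN x. NN s. ?S s*(SUM i:Basis. en \<bar>w \<bullet> i\<bar>*en (norm (G i t (x + s *R w) - G i t x))))"
  using pt by (intro nn_integral_mono nn_integral_mono_AE)
  also have "... = (NN t. NN s. NN x. ?S s*(SUM i:Basis. en \<bar>w \<bullet> i\<bar>*en (norm (G i t (x + s *R w) - G i t x))))"
  by (intro nn_integral_cong lborel_pair.Fubini') measurable
  also have "... = (NN s. NN t. NN x. ?S s*(SUM i:Basis. en \<bar>w \<bullet> i\<bar>*en (norm (G i t (x + s *R w) - G i t x))))"
  by (intro lborel_pair.Fubini') measurable
  also have "... = (NN s. ?S s*(SUM i:Basis. en \<bar>w \<bullet> i\<bar>*(NN t. NN x. norm (G i t (x + s *R w) - G i t x))))"
  by (simp add: nn_integral_cmult nn_integral_sum)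
  also have "... <= (NN s. ?S s*en (e*norm w))"
  proof (rule nn_integral_mono)
  fix s :: real
  show "?S s*(SUM i:Basis. en \<bar>w \<bullet> i\<bar>*(NN t. NN x. norm (G i t (x + s *R w) - G i t x))) <= ?S s*en (e*norm w)"
  proof (cases "s : {0..1}")
  case s: True
  have "norm (s *R w) <= norm w" using s by (simp add: mult_left_le_one_le)
  then have sw: "norm (s *R w) < d i" if "i : Basis" for i using w d1(2)[OF that] by linarith
  have "(SUM i:Basis. en \<bar>w \<bullet> i\<bar>*(NN t. NN x. norm (G i t (x + s *R w) - G i t x)))
  <= (SUM i:(Basis::'a set). en (norm w)*en (e / ?n))"
  by (intro sum_mono mult_mono d(2) sw ennreal_leI Basis_le_norm) auto
  also have "... = en (?n*(norm w*(e / ?n)))"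
  using e by (simp add: ennreal_of_nat_eq_real_of_nat flip: ennreal_mult)
  also have "?n*(norm w*(e / ?n)) = e*norm w" using n0 by simp
  finally show ?thesis using s by simp
  qed simp
  qed
  also have "... = en (e*norm w)" by (simp add: nn_integral_multc)
  finally show "(NN t. NN x. norm (indc R x *R
  (b t (x + w) - b t x - (SUM i:Basis. (w \<bullet> i) *R g i t x)))) <= en (e*norm w)" .
 qed
qed

section \<open>Primitives, Gronwall's inequality and the lemma of du Bois-Reymond\<close>

text \<open>The integrands of the transport problem vanish for nonpositive times, so this is the
  integral from 0, without case distinctions on the sign of \<open>t\<close>.\<close>

definition prim :: "(real => real) => real => real" where
 "prim f t = (LB s. ind {..t} s*f s)"

lemma integrable_indicator_mult:
 fixes f :: "'a => real"
 assumes "integrable M f" "A : sets M" shows "integrable M (%s. ind A s*f s)"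
 using integrable_mult_indicator[OF assms(2,1)] by simp

lemma prim_integrable: "Lint f ==> Lint (%s. ind {..t::real} s*f s :: real)"
 by (rule integrable_indicator_mult) simp_all

lemma borel_measurable_prim_raw:
 assumes [measurable]: "f : BM" shows "prim f : BM"
proof -
 have "prim f = (%t. LB s. (if s <= t then f s else 0))"
  unfolding prim_def by (intro ext L_cong) (auto simp: indicator_def)
 also have "... : BM" by measurable
 finally show ?thesis .
qed

lemma borel_measurable_prim [measurable (raw)]:
 assumes "f : BM" "g : bm M"
 shows "(%x. prim f (g x)) : bm M"
 using measurable_compose[OF assms(2) borel_measurable_prim_raw[OF assms(1)]] .

lemma abs_prim_le: "\<bar>prim f t\<bar> <= (LB s. \<bar>f s\<bar>)" if "Lint f"
proof -
 have "\<bar>prim f t\<bar> <= (LB s. \<bar>ind {..t} s*f s\<bar>)" unfolding prim_def by (rule integral_abs_bound)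
 also have "... <= (LB s. \<bar>f s\<bar>)"
  by (rule L_mono[OF integrable_abs[OF prim_integrable[OF that]] integrable_abs[OF that]])
  (simp add: indicator_def)
 finally show ?thesis .
qed

lemma prim_mono_AE:
 assumes "Lint f" "Lint g" "AEL s. f s <= g s"
 shows "prim f t <= prim g t"
 unfolding prim_def
 by (rule integral_mono_AE[OF prim_integrable prim_integrable])
  (use assms in \<open>auto intro: mult_left_mono elim: eventually_mono\<close>)

lemma prim_cong_AE:
 assumes "f : BM" "g : BM" "AEL s. f s = g s"
 shows "prim f t = prim g t"
proof -
 have "AEL s. ind {..t} s*f s = ind {..t} s*g s"
  using assms(3) by eventually_elim simp
 then show ?thesis unfolding prim_def using assms(1,2) by (intro integral_cong_AE) auto
qed

lemma prim_nonneg: "(!!s. 0 <= f s) ==> 0 <= prim f t"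
 unfolding prim_def by (intro L_nonneg) auto

lemma prim_add: "Lint f ==> Lint g ==> prim (%s. f s + g s) t = prim f t + prim g t"
 unfolding prim_def distrib_left by (intro L_add prim_integrable)

lemma prim_cmult: "prim (%s. c*f s) t = c*prim f t"
 unfolding prim_def by (simp add: mult.left_commute)

lemma integrable_mult_prim:
 assumes "Lint f" and [measurable]: "g : BM" and "!!s. \<bar>g s\<bar> <= C"
 shows "Lint (%s. f s*g s :: real)"
proof (rule I_bound)
 have [measurable]: "f : BM" using assms(1) by (auto dest: Lint_meas)
 show "Lint (%s. C*f s)" using assms(1) by simp
 show "(%s. f s*g s) : bm lborel" by simp
 have "0 <= C" using assms(3)[of 0] by linarith
 then have "norm (f s*g s) <= norm (C*f s)" for s
  using mult_left_mono[OF assms(3)[of s], of "\<bar>f s\<bar>"] by (simp add: abs_mult mult.commute)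
 then show "AEL s. norm (f s*g s) <= norm (C*f s)" by simp
qed

lemma integrable_mult_prim':
 "Lint f ==> Lint g ==> Lint (%s. f s*prim g s)"
 by (rule integrable_mult_prim[OF _ borel_measurable_prim_raw abs_prim_le]) (auto dest: Lint_meas)

text \<open>Integration by parts for absolutely continuous functions, obtained from Fubini by
  cutting the square below \<open>t\<close> along its diagonal.\<close>

lemma prim_mult:
 assumes f: "Lint f" and g: "Lint g"
 shows "prim f t*prim g t = prim (%s. f s*prim g s + prim f s*g s) t"
proof -
 have [measurable]: "f : BM" "g : BM"
  using f g by (auto dest: Lint_meas)
 let ?I = "%s. ind {..t} s :: real"
 have I: "integrable (lborel \<Otimes>\<^sub>M lborel) (%(s, r). (?I s*f s)*(?I r*g r))"
  by (intro integrable_lborel_product prim_integrable f g)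
 let ?A = "%s r. (?I s*f s)*(?I r*g r)*(if r <= s then 1 else 0)"
 let ?B = "%s r. (?I s*f s)*(?I r*g r)*(if r <= s then 0 else 1)"
 have A: "integrable (lborel \<Otimes>\<^sub>M lborel) (%(s, r). ?A s r)"
  by (rule I_bound[OF I]) (auto intro!: AE_I2)
 have B: "integrable (lborel \<Otimes>\<^sub>M lborel) (%(s, r). ?B s r)"
  by (rule I_bound[OF I]) (auto intro!: AE_I2)
 have "prim f t*prim g t = (LB s. LB r. (?I s*f s)*(?I r*g r))"
  by (simp add: prim_def)
 also have "... = (LINT p|(lborel \<Otimes>\<^sub>M lborel). (case p of (s, r) => (?I s*f s)*(?I r*g r)))"
  by (rule lborel_pair.integral_fst[OF I])
 also have "... = (LINT p|(lborel \<Otimes>\<^sub>M lborel). (case p of (s, r) => ?A s r) + (case p of (s, r) => ?B s r))"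
  by (intro L_cong) auto
 also have "... = (LINT p|(lborel \<Otimes>\<^sub>M lborel). (case p of (s, r) => ?A s r)) + (LINT p|(lborel \<Otimes>\<^sub>M lborel). (case p of (s, r) => ?B s r))"
  by (rule L_add[OF A B])
 also have "(LINT p|(lborel \<Otimes>\<^sub>M lborel). (case p of (s, r) => ?A s r)) = (LB s. LB r. ?A s r)"
  by (rule lborel_pair.integral_fst[OF A, symmetric])
 also have "... = prim (%s. f s*prim g s) t" unfolding prim_def
 proof (rule L_cong[OF refl])
  fix s
  have "(LB r. ?A s r) = (LB r. (?I s*f s)*(ind {..s} r*g r))"
  by (rule L_cong) (auto simp: indicator_def)
  then show "(LB r. ?A s r) = ?I s*(f s*(LB r. ind {..s} r*g r))" by simp
 qed
 also have "(LINT p|(lborel \<Otimes>\<^sub>M lborel). (case p of (s, r) => ?B s r)) = (LB r. LB s. ?B s r)"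
  by (rule lborel_pair.integral_snd[OF B, symmetric])
 also have "... = prim (%s. prim f s*g s) t" unfolding prim_def
 proof (rule L_cong[OF refl])
  fix r
  \<comment> \<open>The open and the closed triangle differ in the null set
    \<open>s = r\<close>.\<close>
  have "(LB s. ?B s r) = (LB s. (?I r*g r)*(ind {..r} s*f s))"
  by (rule integral_cong_AE, simp, simp, use AE_lborel_singleton[of r] in eventually_elim) (auto simp: indicator_def)
  then show "(LB s. ?B s r) = ?I r*((LB s. ind {..r} s*f s)*g r)" by simp
 qed
 also have "prim (%s. f s*prim g s) t + prim (%s. prim f s*g s) t = prim (%s. f s*prim g s + prim f s*g s) t"
  using integrable_mult_prim'[OF f g] integrable_mult_prim'[OF g f] by (subst prim_add) (simp_all add: mult.commute)
 finally show ?thesis .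
qed

lemma prim_power:
 assumes f: "Lint f"
 shows "prim f t ^ Suc k = real (Suc k)*prim (%s. f s*prim f s ^ k) t"
proof (induction k arbitrary: t)
 case (Suc k)
 have [measurable]: "f : BM" using f by (auto dest: Lint_meas)
 have i: "Lint (%s. f s*prim f s ^ k)" for k
  by (rule integrable_mult_prim[OF f, where C="(LB s. \<bar>f s\<bar>) ^ k"])
  (auto simp: power_abs intro!: power_mono abs_prim_le f)
 have "prim f t ^ Suc (Suc k) = real (Suc k)*(prim f t*prim (%s. f s*prim f s ^ k) t)"
  using Suc.IH[of t] by simp
 also have "prim f t*prim (%s. f s*prim f s ^ k) t
  = prim (%s. f s*prim (%s. f s*prim f s ^ k) s + prim f s*(f s*prim f s ^ k)) t"
  by (rule prim_mult[OF f i])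
 also have "(%s. f s*prim (%s. f s*prim f s ^ k) s + prim f s*(f s*prim f s ^ k))
  = (%s. (1 / real (Suc k) + 1)*(f s*prim f s ^ Suc k))"
 proof
  fix s
  have "prim (%s. f s*prim f s ^ k) s = prim f s ^ Suc k / real (Suc k)" using Suc.IH[of s] by simp
  then show "f s*prim (%s. f s*prim f s ^ k) s + prim f s*(f s*prim f s ^ k)
  = (1 / real (Suc k) + 1)*(f s*prim f s ^ Suc k)" by (simp add: field_simps)
 qed
 finally have "prim f t ^ Suc (Suc k) = real (Suc k)*((1 / real (Suc k) + 1)*prim (%s. f s*prim f s ^ Suc k) t)"
  unfolding prim_cmult .
 moreover have "c*((1 / c + 1)*P) = (1 + c)*P" if "c ~= 0" for c P :: real using that by (simp add: field_simps)
 ultimately show ?case by (simp only: of_nat_Suc of_nat_neq_0 not_False_eq_True)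
qed simp

lemma prim_sum:
 assumes "!!k. k : A ==> Lint (F k)"
 shows "prim (%s. SUM k:A. F k s) t = (SUM k:A. prim (F k) t)"
 unfolding prim_def sum_distrib_left using assms by (intro L_sum prim_integrable)

lemma prim_power_fact:
 "Lint f ==> prim f t ^ Suc k / fact (Suc k) = prim (%s. f s*prim f s ^ k) t / fact k"
 by (simp only: prim_power fact_Suc) (simp del: of_nat_Suc)

text \<open>The chain rule for the exponential without differentiating anywhere: the partial sums of
  the series satisfy \<open>S (Suc n) t = 1 + prim (f * S n) t\<close>, and dominated convergence
  passes to the limit.\<close>

lemma exp_prim:
 assumes f: "Lint f"
 shows "exp (prim f t) = 1 + prim (%s. f s*exp (prim f s)) t"
proof -
 have [measurable]: "f : BM" using f by (auto dest: Lint_meas)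
 define B where "B = (LB s. \<bar>f s\<bar>)"
 have pB: "\<bar>prim f s\<bar> <= B" for s unfolding B_def by (rule abs_prim_le[OF f])
 define S where "S = (%n s. \<Sum>k<n. prim f s ^ k / fact k)"
 have Slim: "(%n. S n s) ----> exp (prim f s)" for s
  unfolding S_def using exp_converges[of "prim f s"] by (simp add: sums_def divide_inverse mult.commute)
 have Sb: "\<bar>S n s\<bar> <= exp B" for n s
 proof -
  have "\<bar>S n s\<bar> <= (\<Sum>k<n. \<bar>prim f s\<bar> ^ k / fact k)"
  unfolding S_def by (rule order_trans[OF sum_abs]) (simp add: power_abs)
  also have "... <= (\<Sum>k<n. B ^ k / fact k)" by (intro sum_mono divide_right_mono power_mono pB) auto
  also have "... <= exp B"
  using exp_converges[of B] pB[of 0]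
  by (intro sum_le_suminf[THEN order_trans]) (auto simp: sums_iff divide_inverse mult.commute intro: order_trans[OF abs_ge_zero])
  finally show ?thesis .
 qed
 have i: "Lint (%s. f s*prim f s ^ k)" for k
  by (rule integrable_mult_prim[OF f, where C="B ^ k"]) (auto simp: power_abs intro!: power_mono pB)
 have "S (Suc n) t = 1 + prim (%s. f s*S n s) t" for n
 proof -
  have "S (Suc n) t = 1 + (\<Sum>k<n. prim f t ^ Suc k / fact (Suc k))"
  unfolding S_def by (subst sum.lessThan_Suc_shift) simp
  also have "(\<Sum>k<n. prim f t ^ Suc k / fact (Suc k)) = (\<Sum>k<n. prim (%s. (1 / fact k)*(f s*prim f s ^ k)) t)"
  by (simp only: prim_power_fact[OF f] prim_cmult) simp
  also have "... = prim (%s. f s*S n s) t"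
  proof (induction n)
  case 0
  then show ?case by (simp add: S_def prim_def)
  next
  case (Suc n)
  have Sn: "Lint (%s. f s*S n s)"
  by (rule integrable_mult_prim[OF f _ Sb]) (simp add: S_def)
  have "prim (%s. f s*S (Suc n) s) t = prim (%s. f s*S n s + (1 / fact n)*(f s*prim f s ^ n)) t"
  by (simp add: S_def distrib_left)
  also have "... = prim (%s. f s*S n s) t + prim (%s. (1 / fact n)*(f s*prim f s ^ n)) t"
  by (rule prim_add[OF Sn integrable_mult_right[OF i]])
  finally show ?case using Suc by simp
  qed
  finally show ?thesis .
 qed
 moreover have "(%n. prim (%s. f s*S n s) t) ----> prim (%s. f s*exp (prim f s)) t"
  unfolding prim_def[of _ t]
 proof (rule integral_dominated_convergence[where w="%s. exp B*\<bar>f s\<bar>"])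
  show "Lint (%s. exp B*\<bar>f s\<bar>)" using f by simp
  show "(%s. ind {..t} s*(f s*S n s)) : bm lborel" for n by (simp add: S_def)
  show "AEL s. (%n. ind {..t} s*(f s*S n s)) ----> ind {..t} s*(f s*exp (prim f s))"
  by (intro AE_I2 tendsto_intros Slim)
  have "norm (ind {..t} s*(f s*S n s)) <= exp B*\<bar>f s\<bar>" for n s
  using mult_left_mono[OF Sb[of n s], of "\<bar>f s\<bar>"] by (auto simp: indicator_def abs_mult mult.commute)
  then show "AEL s. norm (ind {..t} s*(f s*S n s)) <= exp B*\<bar>f s\<bar>" for n by simp
 qed simp
 ultimately have "(%n. S (Suc n) t) ----> 1 + prim (%s. f s*exp (prim f s)) t"
  by (simp add: tendsto_add)
 then show ?thesis using LIMSEQ_Suc[OF Slim[of t]] LIMSEQ_unique by blast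
qed

text \<open>The inequality holds almost everywhere and the coefficient is only integrable, so the
  inequality is iterated: \<open>n\<close> substitutions give \<open>del0\<close> times a partial
  sum of the exponential series of \<open>prim a t\<close>, plus a remainder that is a term of that
  series times \<open>Y\<close>.\<close>

lemma gronwall:
 assumes a: "Lint a" "!!s. 0 <= a s" and [measurable]: "y : BM"
  and y: "!!s. 0 <= y s" "!!s. y s <= Y" and del0: "0 <= del0"
  and ineq: "AEL t. y t <= del0 + prim (%s. a s*y s) t"
 shows "AEL t. y t <= del0*exp (prim a t)"
proof -
 have [measurable]: "a : BM" using a(1) by (auto dest: Lint_meas)
 define S where "S = (%n s. \<Sum>k<n. prim a s ^ k / fact k)"
 have Y0: "0 <= Y" using y[of 0] by linarith
 have p0: "0 <= prim a s" for s by (rule prim_nonneg[OF a(2)])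
 have i: "Lint (%s. a s*prim a s ^ k)" for k
  by (rule integrable_mult_prim[OF a(1), where C="(LB s. \<bar>a s\<bar>) ^ k"])
  (auto simp: power_abs intro!: power_mono abs_prim_le a)
 have "AEL t. y t <= del0*S n t + Y*(prim a t ^ n / fact n)" for n
 proof (induction n)
  case 0
  then show ?case using y by (simp add: S_def)
 next
  case (Suc n)
  have iS: "Lint (%s. a s*S n s)"
  proof -
  have "Lint (%s. \<Sum>k<n. (1 / fact k)*(a s*prim a s ^ k))"
  by (intro I_sum integrable_mult_right i)
  then show ?thesis by (simp add: S_def sum_distrib_left)
  qed
  have pS: "1 + prim (%s. a s*S n s) t = S (Suc n) t" for t
  proof -
  have "prim (%s. a s*S n s) t = (\<Sum>k<n. prim (%s. (1 / fact k)*(a s*prim a s ^ k)) t)"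
  by (subst prim_sum[symmetric]) (simp_all add: i S_def sum_distrib_left)
  also have "... = (\<Sum>k<n. prim a t ^ Suc k / fact (Suc k))"
  by (simp only: prim_power_fact[OF a(1)] prim_cmult) simp
  finally show ?thesis unfolding S_def by (subst sum.lessThan_Suc_shift) simp
  qed
  have iy: "Lint (%s. a s*y s)"
  by (rule integrable_mult_prim[OF a(1), where C=Y]) (use y in auto)
  have ir: "Lint (%s. del0*(a s*S n s) + (Y / fact n)*(a s*prim a s ^ n))"
  by (intro I_add integrable_mult_right iS i)
  have le: "prim (%s. a s*y s) t <= prim (%s. del0*(a s*S n s) + (Y / fact n)*(a s*prim a s ^ n)) t" for t
  proof (rule prim_mono_AE[OF iy ir])
  show "AEL s. a s*y s <= del0*(a s*S n s) + (Y / fact n)*(a s*prim a s ^ n)"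
  using Suc.IH
  proof eventually_elim
  case (elim s)
  from mult_left_mono[OF elim a(2)[of s]] show ?case by (simp add: algebra_simps)
  qed
  qed
  have eq: "prim (%s. del0*(a s*S n s) + (Y / fact n)*(a s*prim a s ^ n)) t
  = del0*prim (%s. a s*S n s) t + Y*(prim a t ^ Suc n / fact (Suc n))" for t
  by (subst prim_add[OF integrable_mult_right[OF iS] integrable_mult_right[OF i]])
  (simp only: prim_power_fact[OF a(1)] prim_cmult, simp)
  show ?case using ineq
  proof eventually_elim
  case (elim t)
  have "y t <= del0*(1 + prim (%s. a s*S n s) t) + Y*(prim a t ^ Suc n / fact (Suc n))"
  using elim le[of t] unfolding eq by (simp add: distrib_left)
  then show ?case unfolding pS .
  qed
 qed
 then have "AEL t. ALL n. y t <= del0*S n t + Y*(prim a t ^ n / fact n)"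
  by (simp add: AE_all_countable)
 then show ?thesis
 proof eventually_elim
  case (elim t)
  have "(%n. S n t) ----> exp (prim a t)"
  unfolding S_def using exp_converges[of "prim a t"] by (simp add: sums_def divide_inverse mult.commute)
  moreover have "(%n. prim a t ^ n / fact n) ----> 0"
  using summable_LIMSEQ_zero[OF sums_summable[OF exp_converges[of "prim a t"]]] by (simp add: divide_inverse mult.commute)
  ultimately have "(%n. del0*S n t + Y*(prim a t ^ n / fact n)) ----> del0*exp (prim a t) + Y*0"
  by (intro tendsto_intros)
  then show ?case using elim by (intro LIMSEQ_le_const[where X="%n. del0*S n t + Y*(prim a t ^ n / fact n)"]) auto
 qed
qed

lemma prim_continuous:
 assumes f: "Lint f" shows "continuous_on UNIV (prim f)"
proof -
 have [measurable]: "f : BM" using f by (auto dest: Lint_meas)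
 have "(%n. prim f (X n)) ----> prim f t" if X: "X ----> t" for X t
  unfolding prim_def
 proof (rule integral_dominated_convergence[where w="%s. \<bar>f s\<bar>"])
  show "AEL s. (%n. ind {..X n} s*f s) ----> ind {..t} s*f s"
  using AE_lborel_singleton[of t]
  proof eventually_elim
  case (elim s)
  consider "s < t" | "t < s" using elim by linarith
  then have "\<forall>\<^sub>F n in sequentially. ind {..X n} s*f s = ind {..t} s*f s"
  proof cases
  case 1
  from order_tendstoD(1)[OF X 1] show ?thesis by eventually_elim (use 1 in auto)
  next
  case 2
  from order_tendstoD(2)[OF X 2] show ?thesis by eventually_elim (use 2 in auto)
  qed
  then show ?case by (rule tendsto_eventually)
  qed
 qed (use f in \<open>auto simp: indicator_def\<close>)
 then show ?thesis unfolding continuous_on_sequentially by (auto simp: o_def)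
qed

lemma prim_test_function:
 assumes t: "tf eta"
 shows "(prim eta has_real_derivative eta t) (at t)"
proof -
 obtain C where C: "C > 0" "!!x y. \<bar>eta x - eta y\<bar> <= C*norm (x - y)" using tf_lipschitz[OF t] by blast
 have i: "Lint eta" by (rule tf_integrable[OF t])
 note [measurable] = tf_measurable[OF t]
 have "(prim eta has_derivative (%h. eta t*h)) (at t)"
 proof (rule has_derivative_quadratic)
  show "linear (%h. eta t*h)" by (simp add: linear_iff algebra_simps)
  fix h :: real
  let ?J = "%s. ind {..t + h} s - ind {..t} s :: real"
  have Jeq: "?J s = (if h >= 0 then ind {t<..t + h} s else - ind {t + h<..t} s)" for s
  by (auto simp: indicator_def)
  have Ji: "Lint ?J" unfolding Jeq by (cases "h >= 0") auto
  have JI: "(LB s. ?J s) = h" unfolding Jeq by (cases "h >= 0") auto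
  have Jabs: "(LB s. \<bar>?J s\<bar>) = \<bar>h\<bar>" unfolding Jeq by (cases "h >= 0") auto
  have i1: "Lint (%s. ?J s*eta s)"
  unfolding left_diff_distrib by (intro I_diff prim_integrable i)
  have "prim eta (t + h) - prim eta t = (LB s. ?J s*eta s)"
  unfolding prim_def left_diff_distrib by (rule L_diff[symmetric, OF prim_integrable[OF i] prim_integrable[OF i]])
  moreover have "eta t*h = (LB s. ?J s*eta t)" using JI by simp
  ultimately have "prim eta (t + h) - prim eta t - eta t*h = (LB s. ?J s*(eta s - eta t))"
  using i1 Ji by (simp only: right_diff_distrib) (subst L_diff, auto)
  then have "\<bar>prim eta (t + h) - prim eta t - eta t*h\<bar> <= (LB s. \<bar>?J s*(eta s - eta t)\<bar>)"
  by (simp only: integral_abs_bound)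
  also have "... <= (LB s. (C*\<bar>h\<bar>)*\<bar>?J s\<bar>)"
  proof (rule L_mono')
  show "Lint (%s. (C*\<bar>h\<bar>)*\<bar>?J s\<bar>)" using Ji by (intro integrable_mult_right integrable_abs)
  show "\<bar>?J s*(eta s - eta t)\<bar> <= (C*\<bar>h\<bar>)*\<bar>?J s\<bar>" for s
  proof (cases "?J s = 0")
  case False
  then have "\<bar>s - t\<bar> <= \<bar>h\<bar>" unfolding Jeq by (auto simp: indicator_def split: if_splits)
  then have "\<bar>eta s - eta t\<bar> <= C*\<bar>h\<bar>" using C(2)[of s t] mult_left_mono[OF \<open>\<bar>s - t\<bar> <= \<bar>h\<bar>\<close> less_imp_le[OF C(1)]] by simp
  then show ?thesis unfolding abs_mult by (subst mult.commute) (rule mult_right_mono, auto)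
  qed simp
  show "0 <= (C*\<bar>h\<bar>)*\<bar>?J s\<bar>" for s using C(1) by simp
  qed
  also have "... = C*(norm h)^2" using Jabs by (simp add: power2_eq_square del: abs_mult_self_eq)
  finally show "\<bar>prim eta (t + h) - prim eta t - eta t*h\<bar> <= C*(norm h)^2" .
 qed
 then show ?thesis by (simp add: has_field_derivative_def)
qed

lemma smooth_on_antiderivative:
 assumes "!!t. (th has_real_derivative eta t) (at t)" "smooth_on UNIV eta"
 shows "smooth_on UNIV th"
proof -
 have "Ck_on (Suc k) UNIV th" for k
 proof -
  have "(th has_derivative (%h. eta t*h)) (at t)" for t using assms(1)[of t] by (simp add: has_field_derivative_def)
  moreover have "Ck_on k UNIV (%t. eta t*i)" for i
  using assms(2) unfolding smooth_on_def by (intro Ck_on_mult Ck_on_const) blast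
  ultimately show ?thesis unfolding Ck_on.simps by (intro exI[of _ "%t h. eta t*h"]) blast
 qed
 then show ?thesis unfolding smooth_on_def using Ck_on_SucD by blast
qed

text \<open>\<open>th\<close> is the time factor of a test function and \<open>eta\<close> its
  derivative. Every \<open>eta\<close> supported in \<open>(0, T - e)\<close> has a primitive that
  vanishes near \<open>T\<close>, and the value of this primitive at 0 is minus the integral of
  \<open>eta\<close>. The hypothesis thus says that \<open>F - c - prim G\<close> is orthogonal to
  all such \<open>eta\<close>.\<close>

lemma du_Bois_Reymond:
 fixes F G :: "real => real"
 assumes F: "Lint F" and G: "Lint G" "!!t. t <= 0 ==> G t = 0"
  and T: "0 < T"
  and eq: "!!th eta e. smooth_on UNIV th ==> (!!t. (th has_real_derivative eta t) (at t)) ==> 0 < e ==> (!!t. T - e <= t ==> th t = 0) ==>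
  tf eta ==> (LB t. F t*eta t) + c*th 0 + (LB t. G t*th t) = 0"
 shows "AEL t. t : {0<..<T} --> F t = c + prim G t"
proof -
 have [measurable]: "F : BM" "G : BM"
  using F G by (auto dest: Lint_meas)
 obtain B where B: "!!t. \<bar>prim G t\<bar> <= B" using abs_prim_le[OF G(1)] by blast
 have main: "(LB t. eta t*(F t - (c + prim G t))) = 0"
  if t: "tf eta" and e: "0 < e" and sup: "!!t. eta t ~= 0 ==> 0 < t & t < T - e" for eta e
 proof -
  have i: "Lint eta" by (rule tf_integrable[OF t])
  note [measurable] = tf_measurable[OF t]
  define th where "th = (%t. prim eta t - (LB s. eta s))"
  have der: "(th has_real_derivative eta t) (at t)" for t
  unfolding th_def using prim_test_function[OF t] by (auto intro!: derivative_eq_intros)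
  have sm: "smooth_on UNIV th" using smooth_on_antiderivative[OF der] t by (simp add: test_function_def)
  have z: "th t = 0" if "T - e <= t" for t
  proof -
  have "prim eta t = (LB s. eta s)" unfolding prim_def
  proof (rule L_cong[OF refl])
  show "ind {..t} s*eta s = eta s" for s using sup[of s] that by (cases "eta s = 0") (auto simp: indicator_def)
  qed
  then show ?thesis by (simp add: th_def)
  qed
  have th0: "th 0 = - (LB s. eta s)"
  proof -
  have "ind {..0} s*eta s = 0" for s using sup[of s] by (cases "eta s = 0") auto
  then have z: "(%s. ind {..0} s*eta s) = (%_. 0)" by (rule ext)
  have "prim eta 0 = 0" unfolding prim_def z by simp
  then show ?thesis by (simp add: th_def)
  qed
  have I: "integrable (lborel \<Otimes>\<^sub>M lborel) (%(t, s). G t*eta s)" by (rule integrable_lborel_product[OF G(1) i])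
  have I2: "integrable (lborel \<Otimes>\<^sub>M lborel) (%(t, s). G t*eta s*(if t <= s then 1 else 0))"
  by (rule I_bound[OF I]) (auto intro!: AE_I2)
  have "(LB t. G t*th t) = (LB t. - (LB s. G t*eta s*(if t <= s then 1 else 0)))"
  proof (rule L_cong[OF refl])
  fix t
  have "(LB s. eta s) = (LB s. ind {..t} s*eta s + ind {t<..} s*eta s)"
  by (rule L_cong) (auto simp: indicator_def)
  also have "... = prim eta t + (LB s. ind {t<..} s*eta s)"
  unfolding prim_def by (intro L_add integrable_indicator_mult i) auto
  also have "(LB s. ind {t<..} s*eta s) = (LB s. eta s*(if t <= s then 1 else 0))"
  by (rule integral_cong_AE, simp, simp, use AE_lborel_singleton[of t] in eventually_elim) (auto simp: indicator_def)
  finally show "G t*th t = - (LB s. G t*eta s*(if t <= s then 1 else 0))"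
  unfolding th_def mult.assoc by (simp del: if_distrib)
  qed
  also have "... = - (LB s. LB t. G t*eta s*(if t <= s then 1 else 0))"
  using lborel_pair.Fubini_integral[OF I2] by simp
  also have "(LB s. LB t. G t*eta s*(if t <= s then 1 else 0)) = (LB s. eta s*prim G s)"
  proof (rule L_cong[OF refl])
  fix s
  have "(LB t. G t*eta s*(if t <= s then 1 else 0)) = (LB t. eta s*(ind {..s} t*G t))"
  by (rule L_cong) (auto simp: indicator_def)
  then show "(LB t. G t*eta s*(if t <= s then 1 else 0)) = eta s*prim G s" by (simp add: prim_def)
  qed
  finally have Gt: "(LB t. G t*th t) = - (LB s. eta s*prim G s)" .
  obtain C where C: "!!s. \<bar>eta s\<bar> <= C" using tf_bounded[OF t] by blast
  have i1: "Lint (%t. eta t*F t)"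
  using integrable_mult_prim[OF F _ C] by (simp add: mult.commute)
  have i2: "Lint (%t. eta t*prim G t)"
  by (rule integrable_mult_prim[OF i _ B]) simp
  from eq[OF sm der e z t] have "(LB t. F t*eta t) - c*(LB s. eta s) - (LB s. eta s*prim G s) = 0"
  by (simp add: th0 Gt)
  then show ?thesis using i i1 i2 by (simp add: right_diff_distrib distrib_left mult.commute)
 qed
 obtain beta :: "real => real" where beta: "tf beta" "!!x. 1 <= norm x ==> beta x = 0" "!!x. norm x < 1 ==> 0 < beta x"
  using bump_exists by metis
 have "AEL t. \<bar>t - T / 2\<bar> < T / 2 - T / (real n + 3) --> F t = c + prim G t" for n
 proof -
  \<comment> \<open>Intervals of radius \<open>rho\<close> about \<open>T / 2\<close> exhaust
    \<open>(0, T)\<close> and keep the margin \<open>T / (n + 3)\<close> at both ends; the 3 makes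
    the radius positive already for \<open>n = 0\<close>.\<close>
  define rho where "rho = T / 2 - T / (real n + 3)"
  have rho: "rho > 0" using T unfolding rho_def by (simp add: field_simps add_pos_nonneg)
  define kap where "kap = (%t. beta ((1 / rho)*t + (- (T / (2*rho)))))"
  have arg: "(1 / rho)*t + (- (T / (2*rho))) = (t - T / 2) / rho" for t using rho by (simp add: field_simps)
  have kap0: "kap t = 0" if "rho <= \<bar>t - T / 2\<bar>" for t unfolding kap_def arg
  by (rule beta(2)) (use that rho in \<open>simp add: field_simps\<close>)
  have kaps: "smooth_on UNIV kap"
  using beta(1) unfolding kap_def test_function_def smooth_on_def
  by (intro allI Ck_on_compose_affine[of _ UNIV beta "%t. (1 / rho)*t" UNIV] bounded_linear_mult_right) auto
  have kapt: "tf kap" unfolding tf_alt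
  proof (intro conjI kaps exI[of _ "rho + T"] allI impI)
  show "kap x = 0" if "rho + T <= norm x" for x using kap0[of x] that T by auto
  qed (use rho T in auto)
  note [measurable] = tf_measurable[OF kapt]
  obtain C where C: "!!s. \<bar>kap s\<bar> <= C" using tf_bounded[OF kapt] by blast
  have "AEL t. kap t*(F t - (c + prim G t)) = 0"
  proof (rule fundamental_lemma)
  have "Lint (%t. kap t*F t)" using integrable_mult_prim[OF F _ C] by (simp add: mult.commute)
  moreover have "Lint (%t. kap t*(c + prim G t))"
  by (rule integrable_mult_prim[OF tf_integrable[OF kapt], where C="\<bar>c\<bar> + B"])
  (auto intro: order_trans[OF abs_triangle_ineq add_left_mono[OF B]])
  ultimately have "Lint (%t. kap t*(F t - (c + prim G t)))" by (simp add: right_diff_distrib)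
  then show "loc_int (%t. kap t*(F t - (c + prim G t)))" unfolding loc_int_def
  by (auto intro: integrable_indicator_mult)
  fix psi :: "real => real" assume psi: "tf psi"
  have "tf (%t. psi t*kap t)" using psi by (intro tf_mult_smooth kapt) (simp add: test_function_def)
  moreover have "0 < T / (real n + 3)" using T by simp
  moreover have "0 < t & t < T - T / (real n + 3)" if "psi t*kap t ~= 0" for t
  proof -
  have a: "\<bar>t - T / 2\<bar> < rho" using that kap0[of t] by force
  then show ?thesis using \<open>0 < T / (real n + 3)\<close> unfolding rho_def abs_less_iff by linarith
  qed
  ultimately have "(LB t. psi t*kap t*(F t - (c + prim G t))) = 0" by (rule main)
  then show "(LB t. psi t *R (kap t*(F t - (c + prim G t)))) = 0" by (simp add: mult.assoc)
  qed
  then show ?thesis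
  proof eventually_elim
  case (elim t)
  have "kap t ~= 0" if "\<bar>t - T / 2\<bar> < rho"
  unfolding kap_def arg using beta(3)[of "(t - T / 2) / rho"] that rho by (auto simp: field_simps)
  then show ?case using elim by (auto simp: rho_def)
  qed
 qed
 then have "AEL t. ALL n. \<bar>t - T / 2\<bar> < T / 2 - T / (real n + 3) --> F t = c + prim G t"
  by (subst AE_all_countable) blast
 then show ?thesis
 proof eventually_elim
  case (elim t)
  show ?case
  proof
  assume t: "t : {0<..<T}"
  have "(%n. T / 2 - T / (real n + 3)) ----> T / 2 - 0" by real_asymp
  moreover have "\<bar>t - T / 2\<bar> < T / 2 - 0" using t unfolding greaterThanLessThan_iff abs_less_iff by linarith
  ultimately have "\<forall>\<^sub>F n in sequentially. \<bar>t - T / 2\<bar> < T / 2 - T / (real n + 3)" by (rule order_tendstoD(1))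
  then show "F t = c + prim G t" using elim by (auto simp: eventually_sequentially)
  qed
 qed
qed

lemma borel_measurable_prim2 [measurable (raw)]:
 fixes F :: "real => 'b::second_countable_topology => real"
 assumes F: "jm F" and [measurable]: "g : bm M" "h : bm M"
 shows "(%w. prim (%s. F s (g w)) (h w)) : bm M"
proof -
 note [measurable (raw)] = meas2[OF F]
 have "(%w. prim (%s. F s (g w)) (h w)) = (%w. LB s. (if s <= h w then F s (g w) else 0))"
  unfolding prim_def by (intro ext L_cong) (auto simp: indicator_def)
 also have "... : bm M" by measurable
 finally show ?thesis .
qed

section \<open>A linear averaging equation solved by monotone iteration\<close>

text \<open>The total rate \<open>l t\<close> does not depend on \<open>x\<close>, so the loss term
  is removed by the integrating factor \<open>E = exp (prim l)\<close>, which commutes with shifts.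
  The equation for \<open>V = E u\<close> has only nonnegative terms; its iteration from 0 increases
  and stays below \<open>C E\<close>.\<close>

lemma averaging_scheme_exists:
 fixes w :: "'j => real => 'a::euclidean_space => real"
 assumes J: "finite J" and wm: "!!j. j : J ==> jm (w j)"
  and w0: "!!j t x. j : J ==> 0 <= w j t x" and wl: "!!t x. (SUM j:J. w j t x) = l t"
  and l: "Lint l" and u0 [measurable]: "u0 : BM" "!!x. 0 <= u0 x" "!!x. u0 x <= C"
 obtains u where "jm u" "!!t x. 0 <= u t x" "!!t x. u t x <= C"
  "!!t x. u t x = u0 x + prim (%s. SUM j:J. w j s x*(u s (x + y j) - u s x)) t"
proof -
 have [measurable]: "l : BM" using l by (auto dest: Lint_meas)
 have l0: "0 <= l t" for t using wl[of t undefined] sum_nonneg[of J "%j. w j t undefined"] w0 by simp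
 have C0: "0 <= C" using u0(2,3) by (rule order_trans)
 have [measurable (raw)]: "!!i M p q. i : J ==> p : bm M ==> q : bm M ==> (%z. w i (p z) (q z)) : bm M"
  using meas2[OF wm] by blast
 have wl': "w j t x <= l t" if "j : J" for j t x
  unfolding wl[of t x, symmetric] by (rule member_le_sum[OF that _ J]) (use w0 in auto)
 define E where "E = (%t. exp (prim l t))"
 define L where "L = (LB s. \<bar>l s\<bar>)"
 have EL: "E t <= exp L" "0 < E t" for t using abs_prim_le[OF l, of t] by (auto simp: E_def L_def)
 have [measurable]: "E : BM" unfolding E_def by measurable
 have iE: "Lint (%s. l s*E s)"
  by (rule integrable_mult_prim[OF l, where C="exp L"]) (use EL in \<open>auto simp: less_imp_le\<close>)
 define v where "v = rec_nat (%t x. 0) (%n v t x. u0 x + prim (%s. SUM j:J. w j s x * v s (x + y j)) t)"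
 have v0: "v 0 t x = 0" and vS: "v (Suc n) t x = u0 x + prim (%s. SUM j:J. w j s x * v n s (x + y j)) t" for n t x
  by (simp_all add: v_def)
 have vm: "jm (v n)" for n
 proof (induction n)
  case 0
  then show ?case by (simp add: v_def)
 next
  case (Suc n)
  note [measurable (raw)] = meas2[OF Suc]
  have m: "(%p. SUM j:J. w j@@p * v n (fst p) (snd p + y j)) : bm (borel \<Otimes>\<^sub>M borel)" by measurable
  have [measurable]: "case_prod (%s x. SUM j:J. w j s x * v n s (x + y j)) : BM"
  using m by (subst meas2_iff)
  have "(%p. u0 (snd p) + prim (%s. SUM j:J. w j s (snd p) * v n s (snd p + y j)) (fst p)) : bm (borel \<Otimes>\<^sub>M borel)"
  by measurable
  then show ?case by (subst meas2_iff) (simp add: vS)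
 qed
 note [measurable (raw)] = meas2[OF vm]
 have slice: "(%s. SUM j:J. w j s x*f s (x + y j)) : BM" if "jm f" for f :: "real => 'a => real" and x
 proof -
  note [measurable (raw)] = meas2[OF that]
  show ?thesis by measurable
 qed
 have int: "Lint (%s. SUM j:J. w j s x*f s (x + y j))"
  if "jm f" "!!t x. \<bar>f t x\<bar> <= K" for f :: "real => 'a => real" and x K
 proof (rule I_bound)
  show "Lint (%s. K*l s)" using l by simp
  show "(%s. SUM j:J. w j s x*f s (x + y j)) : bm lborel" using slice[OF that(1)] by simp
  have K0: "0 <= K" using that(2)[of 0 0] by linarith
  have "\<bar>SUM j:J. w j s x*f s (x + y j)\<bar> <= (SUM j:J. w j s x*K)" for s
  by (rule order_trans[OF sum_abs], rule sum_mono) (use w0 that(2) in \<open>auto simp: abs_mult intro!: mult_left_mono\<close>)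
  then have "norm (SUM j:J. w j s x*f s (x + y j)) <= norm (K*l s)" for s
  using K0 l0[of s] unfolding sum_distrib_right[symmetric] wl by (simp add: abs_mult mult.commute)
  then show "AEL s. norm (SUM j:J. w j s x*f s (x + y j)) <= norm (K*l s)" by simp
 qed
 have bnd: "0 <= v n t x & v n t x <= C*E t" for n t x
 proof (induction n arbitrary: t x)
  case 0
  then show ?case using C0 EL by (simp add: v0 less_imp_le)
 next
  case (Suc n)
  have K: "\<bar>v n t x\<bar> <= C*exp L" for t x
  using Suc.IH[of t x] EL[of t] C0 mult_left_mono[of "E t" "exp L" C] by auto
  have "0 <= prim (%s. SUM j:J. w j s x * v n s (x + y j)) t"
  by (rule prim_nonneg) (use w0 Suc.IH in \<open>auto intro!: sum_nonneg\<close>)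
  moreover have "prim (%s. SUM j:J. w j s x * v n s (x + y j)) t <= prim (%s. C*(l s*E s)) t"
  proof (rule prim_mono_AE[OF int[OF vm K] integrable_mult_right[OF iE]], intro AE_I2)
  fix s
  have "(SUM j:J. w j s x * v n s (x + y j)) <= (SUM j:J. w j s x*(C*E s))"
  by (intro sum_mono mult_left_mono) (use w0 Suc.IH in auto)
  then show "(SUM j:J. w j s x * v n s (x + y j)) <= C*(l s*E s)"
  unfolding sum_distrib_right[symmetric] wl by (simp add: mult_ac)
  qed
  \<comment> \<open>\<open>E\<close> is 1 plus the primitive of \<open>l E\<close>; this is why the
    bound \<open>C E\<close> reproduces itself in the induction.\<close>
  moreover have "prim (%s. C*(l s*E s)) t = C*(E t - 1)"
  unfolding prim_cmult using exp_prim[OF l, of t] by (simp add: E_def)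
  ultimately show ?case using u0(2)[of x] u0(3)[of x] unfolding vS by (simp add: right_diff_distrib)
 qed
 have K: "\<bar>v n t x\<bar> <= C*exp L" for n t x
  using bnd[of n t x] EL[of t] C0 mult_left_mono[of "E t" "exp L" C] by auto
 have inc: "v n t x <= v (Suc n) t x" for n t x
 proof (induction n arbitrary: t x)
  case 0
  then show ?case using bnd[of 1 t x] by (simp add: v0)
 next
  case (Suc n)
  have "prim (%s. SUM j:J. w j s x * v n s (x + y j)) t <= prim (%s. SUM j:J. w j s x * v (Suc n) s (x + y j)) t"
  by (rule prim_mono_AE[OF int[OF vm K] int[OF vm K]], intro AE_I2 sum_mono mult_left_mono Suc.IH w0)
  then show ?case by (simp add: vS)
 qed
 define V where "V = (%t x. lim (%n. v n t x))"
 have Vlim: "(%n. v n t x) ----> V t x" for t x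
 proof -
  have "Bseq (%n. v n t x)" by (rule BseqI') (use K in auto)
  moreover have "monoseq (%n. v n t x)" by (auto simp: monoseq_Suc inc)
  ultimately have "convergent (%n. v n t x)" by (rule Bseq_monoseq_convergent)
  then show ?thesis by (simp add: V_def convergent_LIMSEQ_iff)
 qed
 have Vm: "jm V"
  by (rule borel_measurable_LIMSEQ_metric[OF vm]) (use Vlim in auto)
 note [measurable (raw)] = meas2[OF Vm]
 have Vb: "0 <= V t x" "V t x <= C*E t" for t x
  using LIMSEQ_le_const[OF Vlim[of t x], of 0] LIMSEQ_le_const2[OF Vlim[of t x], of "C*E t"] bnd[of _ t x] by auto
 have VK: "\<bar>V t x\<bar> <= C*exp L" for t x
  using Vb[of t x] EL[of t] C0 mult_left_mono[of "E t" "exp L" C] by auto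
 have VV: "V t x = u0 x + prim (%s. SUM j:J. w j s x*V s (x + y j)) t" for t x
 proof -
  have "(%n. prim (%s. SUM j:J. w j s x * v n s (x + y j)) t) ----> prim (%s. SUM j:J. w j s x*V s (x + y j)) t"
  unfolding prim_def
  proof (rule integral_dominated_convergence[where w="%s. C*exp L*l s"])
  show "Lint (%s. C*exp L*l s)" using l by simp
  show "AEL s. (%n. ind {..t} s*(SUM j:J. w j s x * v n s (x + y j))) ----> ind {..t} s*(SUM j:J. w j s x*V s (x + y j))"
  by (intro AE_I2 tendsto_intros Vlim)
  have "\<bar>SUM j:J. w j s x * v n s (x + y j)\<bar> <= C*exp L*l s" for s n
  proof -
  have "\<bar>SUM j:J. w j s x * v n s (x + y j)\<bar> <= (SUM j:J. w j s x*(C*exp L))"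
  by (rule order_trans[OF sum_abs], rule sum_mono) (use w0 K in \<open>auto simp: abs_mult intro!: mult_left_mono\<close>)
  then show ?thesis unfolding sum_distrib_right[symmetric] wl by (simp add: mult_ac)
  qed
  then show "AEL s. norm (ind {..t} s*(SUM j:J. w j s x * v n s (x + y j))) <= C*exp L*l s" for n
  using C0 l0 by (intro AE_I2) (auto simp: indicator_def)
  qed (use slice[OF Vm] slice[OF vm] in auto)
  then have "(%n. v (Suc n) t x) ----> u0 x + prim (%s. SUM j:J. w j s x*V s (x + y j)) t"
  unfolding vS by (intro tendsto_intros)
  then show ?thesis using LIMSEQ_Suc[OF Vlim[of t x]] LIMSEQ_unique by blast
 qed
 \<comment> \<open>Division by \<open>E\<close> undoes the integrating factor; the equation for
   \<open>u\<close> is the product rule \<open>prim_mult\<close> for \<open>1 / E\<close> and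
   \<open>V\<close>.\<close>
 define u where "u = (%t x. V t x / E t)"
 have il: "Lint (%s. - l s)" using l by simp
 have pl: "prim (%s. - l s) t = - prim l t" for t using prim_cmult[of "-1" l t] by simp
 have invE: "1 / E t = 1 + prim (%s. - l s*(1 / E s)) t" for t
  using exp_prim[OF il, of t] by (simp add: pl E_def exp_minus divide_inverse)
 have iIE: "Lint (%s. - l s*(1 / E s))"
  by (rule integrable_mult_prim[OF il, where C="exp L"])
  (use abs_prim_le[OF l] in \<open>auto simp: E_def L_def exp_minus[symmetric] inverse_eq_divide[symmetric] abs_le_iff\<close>)
 have eq: "u t x = u0 x + prim (%s. SUM j:J. w j s x*(u s (x + y j) - u s x)) t" for t x
 proof -
  let ?f = "%s. - l s*(1 / E s)" and ?g = "%s. SUM j:J. w j s x*V s (x + y j)"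
  have ig: "Lint ?g" by (rule int[OF Vm VK])
  have "u t x = (1 + prim ?f t)*(u0 x + prim ?g t)"
  by (simp only: invE[of t, symmetric] VV[of t x, symmetric] u_def) simp
  also have "... = u0 x + (u0 x*prim ?f t + prim ?g t + prim ?f t*prim ?g t)" by (simp add: algebra_simps)
  also have "prim ?f t*prim ?g t = prim (%s. ?f s*prim ?g s + prim ?f s*?g s) t" by (rule prim_mult[OF iIE ig])
  also have "u0 x*prim ?f t = prim (%s. u0 x*?f s) t" by (simp only: prim_cmult)
  also have "prim (%s. u0 x*?f s) t + prim ?g t = prim (%s. u0 x*?f s + ?g s) t"
  by (rule prim_add[symmetric, OF integrable_mult_right[OF iIE] ig])
  also have "prim (%s. u0 x*?f s + ?g s) t + prim (%s. ?f s*prim ?g s + prim ?f s*?g s) t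
  = prim (%s. (u0 x*?f s + ?g s) + (?f s*prim ?g s + prim ?f s*?g s)) t"
  using integrable_mult_prim'[OF iIE ig] integrable_mult_prim'[OF ig iIE]
  by (intro prim_add[symmetric] I_add integrable_mult_right iIE ig) (simp_all add: mult.commute)
  also have "(%s. (u0 x*?f s + ?g s) + (?f s*prim ?g s + prim ?f s*?g s))
  = (%s. SUM j:J. w j s x*(u s (x + y j) - u s x))"
  proof
  fix s
  have "(u0 x*?f s + ?g s) + (?f s*prim ?g s + prim ?f s*?g s) = ?f s*(u0 x + prim ?g s) + ?g s*(1 + prim ?f s)"
  by (simp add: algebra_simps)
  also have "... = ?f s*V s x + ?g s*(1 / E s)" by (simp only: invE[of s, symmetric] VV[of s x, symmetric])
  also have "... = (SUM j:J. w j s x*u s (x + y j)) - l s*u s x"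
  by (simp add: u_def sum_divide_distrib)
  also have "... = (SUM j:J. w j s x*(u s (x + y j) - u s x))"
  by (simp add: wl[of s x, symmetric] sum_distrib_right right_diff_distrib sum_subtractf)
  finally show "(u0 x*?f s + ?g s) + (?f s*prim ?g s + prim ?f s*?g s) = (SUM j:J. w j s x*(u s (x + y j) - u s x))" .
  qed
  finally show ?thesis .
 qed
 have um: "jm u"
  by (subst meas2_iff) (simp add: u_def)
 show thesis
  by (rule that[OF um _ _ eq]) (use Vb EL in \<open>auto simp: u_def field_simps less_imp_le\<close>)
qed

section \<open>Limits of bounded sequences\<close>

text \<open>Comparison with a product of one-dimensional weights: \<open>1 + (norm x)^2\<close> is
  at least \<open>1 + (x \<bullet> b)^2\<close> for each coordinate, and the exponent provides one
  factor per coordinate.\<close>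

lemma weight_integrable:
 "Lint (%x::'a::euclidean_space. inverse ((1 + (norm x)^2) ^ DIM('a)))"
proof -
 have "(NN x. en (inverse (1 + x^2))) < \<infinity>"
  using integrable_inverse_1_plus_square by (simp add: set_integrable_def integrable_iff_bounded)
 then have fin: "(PROD b:(Basis::'a set). (NN x. en (inverse (1 + x^2)))) < \<infinity>"
  by (simp add: power_less_top_ennreal)
 have "(NN x. en (inverse ((1 + (norm (x::'a))^2) ^ DIM('a))))
  <= (NN x. (PROD b:Basis. en (inverse (1 + ((x::'a) \<bullet> b)^2))))"
 proof (rule nn_integral_mono)
  fix x :: 'a
  have "inverse ((1 + (norm x)^2) ^ DIM('a)) = (PROD b:(Basis::'a set). inverse (1 + (norm x)^2))" by (simp add: power_inverse)
  also have "... <= (PROD b:(Basis::'a set). inverse (1 + (x \<bullet> b)^2))"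
  proof (intro prod_mono conjI le_imp_inverse_le)
  fix b :: 'a assume "b : Basis"
  then have "\<bar>x \<bullet> b\<bar> <= norm x" by (rule Basis_le_norm)
  then show "1 + (x \<bullet> b)^2 <= 1 + (norm x)^2" using abs_le_square_iff[of "x \<bullet> b" "norm x"] by simp
  qed (auto intro: add_pos_nonneg)
  finally show "en (inverse ((1 + (norm x)^2) ^ DIM('a))) <= (PROD b:Basis. en (inverse (1 + (x \<bullet> b)^2)))"
  by (subst prod_ennreal) (auto intro: ennreal_leI)
 qed
 also have "... = (PROD b:(Basis::'a set). (NN x. en (inverse (1 + x^2))))"
  by (rule nn_integral_lborel_prod) auto
 finally have "(NN x. en (inverse ((1 + (norm (x::'a))^2) ^ DIM('a)))) < \<infinity>" using fin by (rule le_less_trans)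
 then show ?thesis by (simp add: integrable_iff_bounded)
qed

text \<open>Midpoints are the only convex combinations that the parallelogram identity uses, and the
  induction rule gives measurability and bounds for all elements.\<close>

inductive_set midpoint_hull :: "(nat => 'a => real) => nat => ('a => real) set" for u k where
 base: "k <= n ==> u n : midpoint_hull u k"
| mid: "f : midpoint_hull u k ==> g : midpoint_hull u k ==> (%x. (f x + g x) / 2) : midpoint_hull u k"

lemma midpoint_hull_antimono: "f : midpoint_hull u k ==> j <= k ==> f : midpoint_hull u j"
 by (induction rule: midpoint_hull.induct) (auto intro: midpoint_hull.intros)

text \<open>
 This replaces weak-star compactness: near-minimisers of a strictly convex functional over the tails of
 the midpoint hulls converge strongly, and averaging does not destroy linear limits.
\<close>

lemma bounded_sequence_limit:
 fixes u :: "nat => 'a::euclidean_space => real"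
 assumes um: "!!n. u n : BM" and uC: "!!n x. \<bar>u n x\<bar> <= C"
 obtains v where "v : BM" "!!x. \<bar>v x\<bar> <= C"
  "!!f c. Lint f ==> (%n. LB x. u n x*f x) ----> c ==> (LB x. v x*f x) = c"
proof -
 have C0: "0 <= C" using uC[of 0 0] by linarith
 let ?H = "midpoint_hull u"
 have Hm: "f : BM" if "f : ?H k" for f k
  using that by induction (auto intro: um)
 have HC: "\<bar>f x\<bar> <= C" if "f : ?H k" for f k x
  using that
 proof induction
  case (mid f g)
  then show ?case using abs_triangle_ineq[of "f x" "g x"] by simp
 qed (rule uC)
 define w :: "'a => real" where "w = (%x. inverse ((1 + (norm x)^2) ^ DIM('a)))"
 have wi: "Lint w" unfolding w_def by (rule weight_integrable)
 have w0: "0 < w x" for x unfolding w_def by (intro positive_imp_inverse_positive zero_less_power) (auto intro: add_pos_nonneg)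
 have [measurable]: "w : BM" using wi by (auto dest: Lint_meas)
 define W where "W = (LB x. w x)"
 have W0: "0 <= W" unfolding W_def by (rule L_nonneg) (simp add: w0 less_imp_le)
 define N where "N = (%f :: 'a => real. LB x. w x*(f x)^2)"
 have Ni: "Lint (%x. w x*(f x*g x))"
  if "f : BM" "!!x. \<bar>f x\<bar> <= A" "g : BM" "!!x. \<bar>g x\<bar> <= B" for f g A B
 proof (rule I_bound)
  note [measurable] = that(1,3)
  show "Lint (%x. A*B*w x)" using wi by simp
  show "(%x. w x*(f x*g x)) : bm lborel" by simp
  have "norm (w x*(f x*g x)) <= norm (A*B*w x)" for x
  proof -
  have "\<bar>f x\<bar>*\<bar>g x\<bar> <= A*B" by (rule mult_mono[OF that(2,4)]) (use that(2)[of x] in auto)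
  also have "... <= \<bar>A*B\<bar>" by simp
  finally have "w x*(\<bar>f x\<bar>*\<bar>g x\<bar>) <= w x*\<bar>A*B\<bar>" using w0[of x] by (intro mult_left_mono) auto
  then show ?thesis using w0[of x] by (simp add: abs_mult mult.commute)
  qed
  then show "AEL x. norm (w x*(f x*g x)) <= norm (A*B*w x)" by simp
 qed
 have N0: "0 <= N f" for f unfolding N_def by (rule L_nonneg) (simp add: w0 less_imp_le)
 have NC: "N f <= C^2*W" if "f : ?H k" for f k
 proof -
  have "N f <= (LB x. C^2*w x)" unfolding N_def
  proof (rule L_mono')
  show "Lint (%x. C^2*w x)" using wi by simp
  fix x
  have "(f x)^2 <= C^2" using HC[OF that, of x] C0 by (simp add: abs_le_square_iff[symmetric])
  then show "w x*(f x)^2 <= C^2*w x" using w0[of x] by (subst mult.commute) (rule mult_right_mono, auto)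
  show "0 <= C^2*w x" using w0[of x] by simp
  qed
  then show ?thesis by (simp add: W_def)
 qed
 \<comment> \<open>The parallelogram identity: two near-minimisers are close to each other because
   their midpoint competes for the minimum as well.\<close>
 have par: "N (%x. f x - g x) = 2*N f + 2*N g - 4*N (%x. (f x + g x) / 2)" if "f : ?H k" "g : ?H k" for f g k
 proof -
  have i: "Lint (%x. w x*(f x*f x))" "Lint (%x. w x*(g x*g x))" "Lint (%x. w x*(f x*g x))"
  using that by (auto intro!: Ni Hm HC)
  have 1: "N (%x. f x - g x) = (LB x. w x*(f x*f x) + w x*(g x*g x) - 2*(w x*(f x*g x)))"
  unfolding N_def by (intro L_cong) (auto simp: power2_eq_square algebra_simps)
  have 2: "4*N (%x. (f x + g x) / 2) = (LB x. w x*(f x*f x) + w x*(g x*g x) + 2*(w x*(f x*g x)))"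
  unfolding N_def integral_mult_right_zero[symmetric] by (intro L_cong) (auto simp: power2_eq_square field_simps)
  have 3: "N f = (LB x. w x*(f x*f x))" "N g = (LB x. w x*(g x*g x))" by (auto simp: N_def power2_eq_square)
  show ?thesis unfolding 1 2 3 using i by simp
 qed
 \<comment> \<open>The hulls of the tails shrink with \<open>k\<close>, so these infima increase;
   being bounded by \<open>C^2 * W\<close> they converge.\<close>
 define m where "m = (%k. Inf (N ` ?H k))"
 have ne: "N ` ?H k ~= {}" for k using midpoint_hull.base[of k k u] by blast
 have bd: "bdd_below (N ` ?H k)" for k by (rule bdd_belowI[of _ 0]) (use N0 in auto)
 have mle: "m k <= N f" if "f : ?H k" for f k unfolding m_def using that by (intro cInf_lower bd) auto
 have minc: "m j <= m k" if "j <= k" for j k unfolding m_def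
  using midpoint_hull_antimono[OF _ that] by (intro cInf_superset_mono ne bd) auto
 have mC: "m k <= C^2*W" for k using mle[OF midpoint_hull.base[of k k u]] NC[OF midpoint_hull.base[of k k u]] by simp
 have "convergent m"
 proof (rule Bseq_monoseq_convergent)
  have "0 <= m k" for k unfolding m_def by (rule cInf_greatest[OF ne]) (use N0 in auto)
  then show "Bseq m" by (intro BseqI'[of _ "C^2*W"]) (use mC in auto)
  show "monoseq m" using minc by (auto simp: monoseq_def)
 qed
 then obtain M where M: "m ----> M" by (auto simp: convergent_def)
 have mM: "m k <= M" for k using minc by (intro LIMSEQ_le_const[OF M]) auto
 have "EX f. f : ?H k & N f < m k + 1 / (real k + 1)" for k
 proof -
  have "EX z:N ` ?H k. z < m k + 1 / (real k + 1)"
  using cInf_lessD[OF ne, of k "m k + 1 / (real k + 1)"] by (auto simp: m_def)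
  then show ?thesis by auto
 qed
 then obtain V where V: "!!k. V k : ?H k" "!!k. N (V k) < m k + 1 / (real k + 1)" by metis
 \<comment> \<open>From the parallelogram identity: \<open>N (V j)\<close> is at most
   \<open>M + 1 / (k + 1)\<close>, \<open>N (V k)\<close> at most \<open>m k + 1 / (k + 1)\<close>,
   and the midpoint has value at least \<open>m k\<close>.\<close>
 define eps where "eps = (%k. 2*(M - m k) + 4 / (real k + 1))"
 have eps: "N (%x. V j x - V k x) <= eps k" if "k <= j" for j k
 proof -
  have Vj: "V j : ?H k" using midpoint_hull_antimono[OF V(1) that] .
  have "m k <= N (%x. (V j x + V k x) / 2)" by (rule mle[OF midpoint_hull.mid[OF Vj V(1)]])
  moreover have "1 / (real j + 1) <= 1 / (real k + 1)" using that by (simp add: frac_le)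
  ultimately show ?thesis using par[OF Vj V(1)] V(2)[of j] V(2)[of k] mM[of j] by (simp add: eps_def)
 qed
 have "eps ----> 2*(M - M) + 0" unfolding eps_def by (intro tendsto_intros M) real_asymp
 then have eps0: "eps ----> 0" by simp
 have "EX K. ALL k>=K. eps k < (1 / 4) ^ i" for i :: nat
  using order_tendstoD(2)[OF eps0, of "(1 / 4) ^ i"] by (simp add: eventually_sequentially)
 then obtain K where K: "!!i k. K i <= k ==> eps k < (1 / 4) ^ i" by metis
 define r where "r = rec_nat (K 0) (%i r. max (K (Suc i)) (Suc r))"
 have rS: "r (Suc i) = max (K (Suc i)) (Suc (r i))" for i by (simp add: r_def)
 have rK: "K i <= r i" for i by (cases i) (simp_all add: r_def)
 have sm: "strict_mono r" by (rule strict_monoI_Suc) (simp add: rS)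
 define d where "d = (%i x. V (r (Suc i)) x - V (r i) x)"
 have dN: "N (d i) <= (1 / 4) ^ i" for i
 proof -
  have "r i <= r (Suc i)" unfolding rS by linarith
  from eps[OF this] K[OF rK[of i]] show ?thesis unfolding d_def by linarith
 qed
 have [measurable]: "V k : BM" for k by (rule Hm[OF V(1)])
 have dm [measurable]: "d i : BM" for i unfolding d_def by measurable
 have dC: "\<bar>d i x\<bar> <= 2*C" for i x using HC[OF V(1), of "r (Suc i)" x] HC[OF V(1), of "r i" x] by (simp add: d_def)
 \<comment> \<open>The inequality \<open>\<bar>d\<bar> <= a + d^2 / a\<close> with
   \<open>a = (1 / 2) ^ i\<close> turns the quadratic bound \<open>(1 / 4) ^ i\<close> into a
   summable bound in the mean, hence the telescoping series converges almost everywhere.\<close>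
 have di: "(NN x. en (w x*\<bar>d i x\<bar>)) <= en ((W + 1)*(1 / 2) ^ i)" for i
 proof -
  have ii: "Lint (%x. w x*(d i x)^2)" unfolding power2_eq_square by (rule Ni[OF dm dC dm dC])
  have "(NN x. en (w x*\<bar>d i x\<bar>)) <= (NN x. en ((1 / 2) ^ i*w x + 2 ^ i*(w x*(d i x)^2)))"
  proof (intro nn_integral_mono ennreal_leI)
  fix x
  let ?a = "(1 / 2) ^ i :: real"
  have a: "?a > 0" "2 ^ i = 1 / ?a" by (simp_all add: power_one_over)
  have "\<bar>d i x\<bar> <= ?a + (1 / ?a)*(d i x)^2"
  proof (cases "\<bar>d i x\<bar> <= ?a")
  case False
  then have "?a*\<bar>d i x\<bar> <= \<bar>d i x\<bar>*\<bar>d i x\<bar>" by (intro mult_right_mono) auto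
  then have "\<bar>d i x\<bar> <= (1 / ?a)*(d i x)^2" using a(1) by (simp add: field_simps power2_eq_square abs_mult_self_eq)
  then show ?thesis using a(1) by linarith
  qed (use a in \<open>auto intro: order_trans\<close>)
  from mult_left_mono[OF this less_imp_le[OF w0[of x]]]
  show "w x*\<bar>d i x\<bar> <= ?a*w x + 2 ^ i*(w x*(d i x)^2)" unfolding a(2) by (simp add: algebra_simps)
  qed
  also have "... = en (LB x. (1 / 2) ^ i*w x + 2 ^ i*(w x*(d i x)^2))"
  using w0 by (intro nn_integral_eq_integral I_add integrable_mult_right wi ii) (auto intro!: AE_I2 add_nonneg_nonneg mult_nonneg_nonneg simp: less_imp_le)
  also have "(LB x. (1 / 2) ^ i*w x + 2 ^ i*(w x*(d i x)^2)) = (1 / 2) ^ i*W + 2 ^ i*N (d i)"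
  using wi ii by (simp add: W_def N_def)
  also have "... <= (1 / 2) ^ i*W + 2 ^ i*(1 / 4) ^ i" using dN[of i] by simp
  also have "2 ^ i*(1 / 4) ^ i = (1 / 2 :: real) ^ i" by (simp add: power_mult_distrib[symmetric])
  finally show ?thesis by (simp add: algebra_simps ennreal_leI)
 qed
 have "(NN x. (\<Sum>i. en (w x*\<bar>d i x\<bar>))) = (\<Sum>i. (NN x. en (w x*\<bar>d i x\<bar>)))"
  by (rule nn_integral_suminf) simp
 also have "... <= (\<Sum>i. en ((W + 1)*(1 / 2) ^ i))" by (intro suminf_le di) auto
 also have "... = en (\<Sum>i. (W + 1)*(1 / 2) ^ i)"
  using W0 by (intro suminf_ennreal_eq summable_sums summable_mult summable_geometric) auto
 also have "... < \<infinity>" by simp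
 finally have "AEL x. (\<Sum>i. en (w x*\<bar>d i x\<bar>)) ~= \<infinity>"
  by (intro nn_integral_PInf_AE) auto
 then have conv: "AEL x. convergent (%i. V (r i) x)"
 proof eventually_elim
  case (elim x)
  have "summable (%i. w x*\<bar>d i x\<bar>)"
  using elim w0[of x] by (intro summable_suminf_not_top) (auto simp: less_imp_le)
  then have "summable (%i. \<bar>d i x\<bar>)" using w0[of x] by (simp add: summable_cmult_iff)
  then have "summable (%i. d i x)" by (rule summable_rabs_cancel)
  then have "convergent (%n. \<Sum>i<n. d i x)" by (simp add: summable_iff_convergent)
  then have "convergent (%n. V (r n) x - V (r 0) x)"
  unfolding d_def sum_lessThan_telescope[of "%n. V (r n) x"] .
  then show ?case using convergent_diff_const_right_iff by blast
 qed
 \<comment> \<open>Clamping makes the bound hold everywhere, also where the limit does not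
   exist.\<close>
 define v where "v = (%x. max (- C) (min C (lim (%i. V (r i) x))))"
 have [measurable]: "(%x. lim (%i. V (r i) x)) : BM" by (rule borel_measurable_lim_metric) simp
 have vm: "v : BM" unfolding v_def by measurable
 have vlim: "AEL x. (%i. V (r i) x) ----> v x"
  using conv
 proof eventually_elim
  case (elim x)
  then have l: "(%i. V (r i) x) ----> lim (%i. V (r i) x)" by (simp add: convergent_LIMSEQ_iff)
  have "- C <= lim (%i. V (r i) x)" "lim (%i. V (r i) x) <= C"
  using HC[OF V(1)] by (auto intro!: LIMSEQ_le_const[OF l] LIMSEQ_le_const2[OF l] simp: abs_le_iff minus_le_iff)
  with l show ?case by (simp add: v_def)
 qed
 show thesis
 proof (rule that[OF vm])
  show "\<bar>v x\<bar> <= C" for x using C0 by (auto simp: v_def abs_le_iff)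
  fix f :: "'a => real" and c
  assume f: "Lint f" and lim: "(%n. LB x. u n x*f x) ----> c"
  have [measurable]: "f : BM" using f by (auto dest: Lint_meas)
  have hi: "Lint (%x. h x*f x)" if "h : ?H k" for h k
  proof (rule I_bound)
  show "Lint (%x. C*f x)" using f by simp
  show "(%x. h x*f x) : bm lborel" using Hm[OF that] by simp
  show "AEL x. norm (h x*f x) <= norm (C*f x)"
  using HC[OF that] C0 by (auto simp: abs_mult intro!: AE_I2 mult_right_mono)
  qed
  have "(%i. LB x. V (r i) x*f x) ----> c"
  proof (rule LIMSEQ_I)
  fix e :: real assume "0 < e"
  from LIMSEQ_D[OF lim this] obtain n0 where n0: "!!n. n0 <= n ==> \<bar>(LB x. u n x*f x) - c\<bar> < e" by auto
  \<comment> \<open>The condition is preserved by midpoints, so it passes from a tail of the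
    sequence to the hull of this tail.\<close>
  have hull: "\<bar>(LB x. h x*f x) - c\<bar> < e" if "h : ?H n0" for h
  using that
  proof induction
  case (mid h g)
  have "(LB x. (h x + g x) / 2*f x) = ((LB x. h x*f x) + (LB x. g x*f x)) / 2"
  using hi[OF mid.hyps(1)] hi[OF mid.hyps(2)] by (simp add: add_divide_distrib distrib_right)
  moreover have "\<bar>(a + b) / 2 - c\<bar> < e" if "\<bar>a - c\<bar> < e" "\<bar>b - c\<bar> < e" for a b
  using that by (auto simp: abs_less_iff field_simps)
  ultimately show ?case using mid.IH by simp
  qed (rule n0)
  show "EX no. ALL i>=no. norm ((LB x. V (r i) x*f x) - c) < e"
  proof (intro exI allI impI)
  fix i assume "n0 <= i"
  then have "n0 <= r i" using seq_suble[OF sm, of i] by linarith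
  then show "norm ((LB x. V (r i) x*f x) - c) < e" using hull[OF midpoint_hull_antimono[OF V(1)]] by simp
  qed
  qed
  moreover have "(%i. LB x. V (r i) x*f x) ----> (LB x. v x*f x)"
  proof (rule integral_dominated_convergence[where w="%x. C*\<bar>f x\<bar>"])
  show "Lint (%x. C*\<bar>f x\<bar>)" using f by simp
  show "AEL x. (%i. V (r i) x*f x) ----> v x*f x"
  using vlim by eventually_elim (intro tendsto_intros)
  show "AEL x. norm (V (r i) x*f x) <= C*\<bar>f x\<bar>" for i
  using HC[OF V(1)] by (auto simp: abs_mult intro!: AE_I2 mult_right_mono)
  qed (use vm in auto)
  ultimately show "(LB x. v x*f x) = c" by (rule LIMSEQ_unique[symmetric])
 qed
qed

lemma borel_measurable_fst_snd [measurable]: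
 "(fst :: 'a::second_countable_topology \<times> 'b::second_countable_topology => 'a) : BM"
 "(snd :: 'a \<times> 'b => 'b) : BM"
 by (simp_all add: borel_measurable_continuous_onI continuous_on_fst continuous_on_snd)

lemma ball_measurable [measurable]: "ball a r : sets borel" by (simp add: borel_open)

section \<open>Integration over time and space\<close>

lemma st_bound:
 fixes F :: "real => 'a::euclidean_space => 'b::{banach, second_countable_topology}"
 assumes F: "jm F" and a: "Lint a" and c: "Lint c"
  and le: "!!t x. norm (F t x) <= a t * c x"
 shows "Lint (%p. F@@p)"
proof (rule I_bound)
 note [measurable (raw)] = meas2[OF F]
 show "Lint (%p. a (fst p) * c (snd p))"
  using integrable_lborel_product[OF a c] by (simp add: lborel_prod case_prod_beta')
 show "(%p. F@@p) : bm lborel" by measurable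
 show "AEL p. norm (F@@p) <= norm (a (fst p) * c (snd p))"
  by (intro AE_I2) (auto intro: order_trans[OF le abs_ge_self])
qed

lemma
 fixes F :: "real => 'a::euclidean_space => 'b::{banach, second_countable_topology}"
 assumes F: "Lint (%p. F@@p)"
 shows st_tx: "(LB p. F@@p) = (LB t. LB x. F t x)"
  and st_xt: "(LB p. F@@p) = (LB x. LB t. F t x)"
  and st_t: "Lint (%t. LB x. F t x)"
  and st_x: "Lint (%x. LB t. F t x)"
  and st_AE: "AEL t. Lint (%x. F t x)"
  and st_AE': "AEL x. Lint (%t. F t x)"
proof -
 have F': "integrable (lborel \<Otimes>\<^sub>M lborel) (case_prod F)" using F by (simp add: lborel_prod case_prod_beta')
 show "(LB p. F@@p) = (LB t. LB x. F t x)"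
  using lborel_pair.integral_fst[OF F'] by (simp add: lborel_prod case_prod_beta')
 show "(LB p. F@@p) = (LB x. LB t. F t x)"
  using lborel_pair.integral_snd[OF F'] by (simp add: lborel_prod case_prod_beta')
 show "Lint (%t. LB x. F t x)" by (rule lborel_pair.integrable_fst[OF F'])
 show "Lint (%x. LB t. F t x)" by (rule lborel_pair.integrable_snd[OF F'])
 show "AEL t. Lint (%x. F t x)" by (rule lborel_pair.AE_integrable_fst[OF F'])
 show "AEL x. Lint (%t. F t x)" by (rule lborel_pair.AE_integrable_snd[OF F'])
qed

lemma st_nn:
 fixes F :: "real => 'a::euclidean_space => ennreal"
 assumes "jm F"
 shows "(NN p. F@@p) = (NN t. NN x. F t x)"
 using nn_st(1)[OF assms] by (simp add: case_prod_beta')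

section \<open>The difference scheme\<close>

text \<open>A test function together with the data used for existence: \<open>phi\<close> cut off
  outside \<open>(0, T)\<close>, its time derivative \<open>phit\<close>, its spatial derivatives
  \<open>D i\<close> and its initial value \<open>phi0\<close>. The time derivative enters through
  its primitive, whose value at \<open>T\<close> encodes the vanishing at \<open>T\<close>; the
  bound on second differences is for the viscosity.\<close>

definition admissible ::
  "real => (real => 'a::euclidean_space => real) => (real => 'a => real) => ('a => real => 'a => real) => ('a => real)
  => real => real => bool" where
 "admissible T phi phit D phi0 R C \<longleftrightarrow>
  jm phi & jm phit &
  (ALL i:Basis. jm (D i)) & phi0 : BM &
  (ALL t x. t ~: {0<..<T} --> phi t x = 0 & phit t x = 0 & (ALL i:Basis. D i t x = 0)) &
  (ALL t:{0<..<T}. tf (phi t) & (ALL x. ALL i:Basis. FD (phi t) (at x) i = D i t x)) &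
  (ALL t:{0<..<T}. ALL x. phi t x = phi0 x + prim (%s. phit s x) t) & (ALL x. phi0 x + prim (%s. phit s x) T = 0) &
  (ALL t x. \<bar>phi t x\<bar> <= C & \<bar>phit t x\<bar> <= C & \<bar>phi0 x\<bar> <= C & (ALL i:Basis. \<bar>D i t x\<bar> <= C) &
  (ALL w. \<bar>phi t (x + w) + phi t (x - w) - 2*phi t x\<bar> <= C*(norm w)^2) &
  (R <= norm x --> phi t x = 0 & phit t x = 0 & phi0 x = 0 & (ALL i:Basis. D i t x = 0)))"

text \<open>This is \<open>div (phi b)\<close> by the product rule, with \<open>D\<close> the
  gradient of \<open>phi\<close>.\<close>

definition div_prod ::
  "(real => 'a::euclidean_space => 'a) => ('a => real => 'a => 'a) => (real => 'a => real) => ('a => real => 'a => real)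
  => real => 'a => real" where
 "div_prod b g phi D t x = (SUM i:Basis. phi t x*(g i t x \<bullet> i) + D i t x*(b t x \<bullet> i))"

text \<open>The adjoint of the upwind difference operator with viscosity \<open>M h\<close>, applied to \<open>phi\<close>.\<close>

definition scheme_adjoint ::
  "real => (real => real) => (real => 'a::euclidean_space => 'a) => (real => 'a => real) => real => 'a => real" where
 "scheme_adjoint h M b phi t x = (SUM i:Basis.
  (M t*(phi t (x + h *R i) + phi t (x - h *R i) - 2*phi t x)
  + (phi t (x + h *R i)*(b t (x + h *R i) \<bullet> i) - phi t (x - h *R i)*(b t (x - h *R i) \<bullet> i))) / (2*h))"

text \<open>Both integrands vanish from \<open>T\<close> on, so the full integrals are primitives at
  \<open>T\<close>; the claim is \<open>prim_mult\<close> there, with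
  \<open>prim a T = - c\<close>.\<close>

lemma time_integration_by_parts:
 assumes a: "Lint a" and f: "Lint f"
  and 0: "!!s. T <= s ==> a s = 0" "!!s. T <= s ==> f s = 0" and c: "c + prim a T = 0"
 shows "(LB s. (u + prim f s)*a s) = - u * c - (LB s. (c + prim a s)*f s)"
proof -
 have P: "prim k T = (LB s. k s)" if "!!s. T <= s ==> k s = 0" for k
  unfolding prim_def by (rule L_cong) (use that in \<open>auto simp: indicator_def\<close>)
 have i1: "Lint (%s. a s*prim f s)" by (rule integrable_mult_prim'[OF a f])
 have i2: "Lint (%s. prim a s*f s)" using integrable_mult_prim'[OF f a] by (simp add: mult.commute)
 have "prim a T*prim f T = prim (%s. a s*prim f s + prim a s*f s) T" by (rule prim_mult[OF a f])
 also have "... = (LB s. a s*prim f s + prim a s*f s)" by (rule P) (simp add: 0)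
 also have "... = (LB s. a s*prim f s) + (LB s. prim a s*f s)" using i1 i2 by simp
 finally have 1: "prim a T*prim f T = (LB s. a s*prim f s) + (LB s. prim a s*f s)" .
 have Pa: "(LB s. a s) = - c" using P[of a] 0 c by simp
 have Pf: "(LB s. f s) = prim f T" using P[of f] 0 by simp
 have e: "(%s. (u + prim f s)*a s) = (%s. u*a s + a s*prim f s)" by (simp add: algebra_simps)
 have "(LB s. (u + prim f s)*a s) = u*(LB s. a s) + (LB s. a s*prim f s)"
  unfolding e using a i1 by simp
 moreover have "(LB s. (c + prim a s)*f s) = c*(LB s. f s) + (LB s. prim a s*f s)"
  using f i2 by (simp add: distrib_right)
 moreover have "prim a T = - c" using c by simp
 ultimately show ?thesis using 1 unfolding Pa Pf by simp
qed

text \<open>The jump rates \<open>(M - s * (b \<bullet> i)) / (2 * h)\<close>, for the two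
  directions \<open>s = 1\<close> and \<open>s = -1\<close>, are nonnegative because
  \<open>M\<close> dominates \<open>norm b\<close>; this gives the bounds on \<open>u\<close>. Their
  antisymmetric part is a central difference for \<open>- b \<bullet> grad u\<close>, their
  symmetric part a viscosity of order \<open>M h\<close>.\<close>

lemma scheme_solution:
 fixes b :: "real => 'a::euclidean_space => 'a"
 assumes b: "jm b" and M: "Lint M" "!!t. 0 <= M t" "!!t. t ~: {0<..<T} ==> M t = 0"
  and bM: "!!t x. norm x < r ==> norm (b t x) <= M t" and h: "0 < h"
  and u0: "u0 : BM" "!!x. 0 <= u0 x" "!!x. u0 x <= K"
 obtains u where "jm u" "!!t x. 0 <= u t x" "!!t x. u t x <= K"
  "!!phi phit D phi0 R C. admissible T phi phit D phi0 R C ==> R <= r ==>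
  (LB p. u@@p*(phit@@p + scheme_adjoint h M b phi@@p))
  = - (LB x. u0 x*phi0 x)"
proof -
 note [measurable (raw)] = meas2[OF b]
 have [measurable]: "M : BM" using M(1) by (auto dest: Lint_meas)
 \<comment> \<open>The bound \<open>M\<close> is available only in the ball of radius
   \<open>r\<close>. The test functions are supported there, so the weak formulation does not see
   the truncation.\<close>
 define B where "B = (%t x. ind (ball 0 r) x *R b t x)"
 define J where "J = (Basis :: 'a set) \<times> {1, -1 :: real}"
 define y where "y = (%j :: 'a \<times> real. (snd j*h) *R fst j)"
 define w where "w = (%j t x. (M t - snd j*(B t x \<bullet> fst j)) / (2*h))"
 \<comment> \<open>The sum of the \<open>2 n\<close> rates: the drift cancels in each pair of
   opposite directions, which makes the total independent of \<open>x\<close>.\<close>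
 define l where "l = (%t. real DIM('a)*M t / h)"
 have li: "Lint l" unfolding l_def using M(1) by simp
 have J: "finite J" by (simp add: J_def)
 have Jsum: "(SUM j:J. F j) = (SUM i:Basis. F (i, 1) + F (i, -1))" for F :: "'a \<times> real => real"
  unfolding J_def by (subst sum.cartesian_product[symmetric, of "%i s. F (i, s)", simplified]) simp
 have wm: "jm (w j)" for j
  unfolding meas2_iff w_def B_def by measurable
 note [measurable (raw)] = meas2[OF wm]
 have w0: "0 <= w j t x" if "j : J" for j t x
 proof -
  have "\<bar>B t x \<bullet> fst j\<bar> <= M t"
  proof (cases "norm x < r")
  case True
  have "\<bar>b t x \<bullet> fst j\<bar> <= norm (b t x)" using that by (auto simp: J_def intro: Basis_le_norm)
  then show ?thesis using True bM[OF True, of t] by (simp add: B_def)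
  qed (use M(2) in \<open>simp add: B_def\<close>)
  moreover have "snd j = 1 \<or> snd j = -1" using that by (auto simp: J_def)
  ultimately show ?thesis unfolding w_def using h by (intro divide_nonneg_nonneg) (auto simp: abs_le_iff)
 qed
 have wl: "(SUM j:J. w j t x) = l t" for t x
  unfolding Jsum w_def l_def using h by (simp add: field_simps add_divide_distrib[symmetric])
 have "EX u. jm u & (ALL t x. 0 <= u t x) & (ALL t x. u t x <= K) &
  (ALL t x. u t x = u0 x + prim (%s. SUM j:J. w j s x*(u s (x + y j) - u s x)) t)"
 proof (rule averaging_scheme_exists[OF J wm w0 wl li u0, where y=y])
  fix u assume "jm u" "!!t x. 0 <= u t x" "!!t x. u t x <= K"
  "!!t x. u t x = u0 x + prim (%s. SUM j:J. w j s x*(u s (x + y j) - u s x)) t"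
  then show ?thesis by (intro exI[of _ u] conjI allI)
 qed
 then obtain u where um: "jm u" and ub: "!!t x. 0 <= u t x" "!!t x. u t x <= K"
  and eq: "!!t x. u t x = u0 x + prim (%s. SUM j:J. w j s x*(u s (x + y j) - u s x)) t"
  by blast
 note [measurable (raw)] = meas2[OF um] and [measurable] = u0(1)
 define f where "f = (%s x. SUM j:J. w j s x*(u s (x + y j) - u s x))"
 have fm: "jm f" unfolding meas2_iff f_def by measurable
 note [measurable (raw)] = meas2[OF fm]
 have l0: "0 <= l t" for t unfolding l_def using M(2) h by simp
 have K0: "0 <= K" using u0(2,3) by (rule order_trans)
 have fb: "\<bar>f t x\<bar> <= K*l t" for t x
 proof -
  have "\<bar>f t x\<bar> <= (SUM j:J. w j t x*K)" unfolding f_def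
  proof (rule order_trans[OF sum_abs], rule sum_mono)
  fix j assume "j : J"
  have "\<bar>u t (x + y j) - u t x\<bar> <= K" using ub[of t x] ub[of t "x + y j"] by linarith
  from mult_left_mono[OF this w0[OF \<open>j : J\<close>]] show "\<bar>w j t x*(u t (x + y j) - u t x)\<bar> <= w j t x*K"
  using w0[OF \<open>j : J\<close>] by (simp add: abs_mult)
  qed
  then show ?thesis unfolding sum_distrib_right[symmetric] wl by (simp add: mult.commute)
 qed
 have fz: "f t x = 0" if "t ~: {0<..<T}" for t x using fb[of t x] M(3)[OF that] by (simp add: l_def)
 have fx: "Lint (%s. f s x)" for x
 proof (rule I_bound)
  show "Lint (%s. K*l s)" using li by simp
  show "(%s. f s x) : bm lborel" by measurable
  show "AEL s. norm (f s x) <= norm (K*l s)" using fb K0 l0 by (intro AE_I2) (auto intro: order_trans)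
 qed
 show thesis
 proof (rule that[OF um ub])
  fix phi phit :: "real => 'a => real" and D phi0 R C
  assume adm: "admissible T phi phit D phi0 R C" and R: "R <= r"
  have phim: "jm phi" "jm phit"
  and [measurable]: "phi0 : BM" using adm by (auto simp: admissible_def)
  note [measurable (raw)] = meas2[OF phim(1)] meas2[OF phim(2)]
  have C: "\<bar>phi t x\<bar> <= C" "\<bar>phit t x\<bar> <= C" "\<bar>phi0 x\<bar> <= C" and R0: "R <= norm x ==> phi t x = 0 & phit t x = 0 & phi0 x = 0" for t x
  using adm by (auto simp: admissible_def)
  have z: "phi t x = 0 & phit t x = 0" if "t ~: {0<..<T}" for t x using adm that by (auto simp: admissible_def)
  have ph: "phi t x = phi0 x + prim (%s. phit s x) t" if "t : {0<..<T}" for t x using adm that by (auto simp: admissible_def)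
  have phT: "phi0 x + prim (%s. phit s x) T = 0" for x using adm by (auto simp: admissible_def)
  have C0: "0 <= C" using C(1)[of 0 0] by linarith
  let ?c = "%x. indc R x :: real" and ?i = "%t. ind {0<..<T} t :: real"
  have ci: "Lint (?c :: 'a => real)"
  by (rule integrable_real_indicator) (simp_all add: emeasure_lborel_cball_finite[unfolded infinity_ennreal_def])
  have ii: "Lint ?i" by (cases "0 <= T") auto
  have iphit: "Lint (%p. u@@p*phit@@p)"
  proof (rule st_bound[where F="%t x. u t x*phit t x" and a="%t. (K*C)*?i t" and c="?c"])
  show "norm (u t x*phit t x) <= (K*C)*?i t*?c x" for t x
  using ub[of t x] C(2)[of t x] R0[of x t] z[of t x] K0 C0
  by (cases "norm x <= R"; cases "t : {0<..<T}") (auto simp: abs_mult intro!: mult_mono)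
  qed (use ii ci in \<open>auto simp: meas2_iff\<close>)
  have iphif: "Lint (%p. phi@@p*f@@p)"
  proof (rule st_bound[where F="%t x. phi t x*f t x" and a="%t. (C*K)*l t" and c="?c"])
  show "norm (phi t x*f t x) <= (C*K)*l t*?c x" for t x
  using fb[of t x] C(1)[of t x] R0[of x t] C0 mult_mono[OF C(1)[of t x] fb[of t x] C0 abs_ge_zero]
  by (cases "norm x <= R") (auto simp: abs_mult mult.assoc)
  qed (use li ci in \<open>auto simp: meas2_iff\<close>)
  have per_x: "(LB t. u t x*phit t x) = - u0 x*phi0 x - (LB t. phi t x*f t x)" for x
  proof -
  have ai: "Lint (%s. phit s x)"
  proof (rule integrable_bounded_support[where C=C and r="\<bar>T\<bar>"])
  show "phit s x = 0" if "\<bar>T\<bar> <= norm s" for s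
  proof -
  have "s ~: {0<..<T}" using that by auto
  then show ?thesis using z by blast
  qed
  qed (use C in auto)
  have "(LB s. (u0 x + prim (%s. f s x) s)*phit s x) = - u0 x*phi0 x - (LB s. (phi0 x + prim (%s. phit s x) s)*f s x)"
  proof (rule time_integration_by_parts[OF ai fx _ _ phT])
  show "phit s x = 0" "f s x = 0" if "T <= s" for s
  proof -
  have "s ~: {0<..<T}" using that by auto
  then show "phit s x = 0" "f s x = 0" using z fz by blast+
  qed
  qed
  moreover have "(LB s. (phi0 x + prim (%s. phit s x) s)*f s x) = (LB s. phi s x*f s x)"
  proof (rule L_cong[OF refl])
  show "(phi0 x + prim (%s. phit s x) s)*f s x = phi s x*f s x" for s
  by (cases "s : {0<..<T}") (use ph[of s x] fz[of s x] in auto)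
  qed
  moreover have "u0 x + prim (%s. f s x) s = u s x" for s using eq[of s x] by (simp add: f_def)
  ultimately show ?thesis by simp
  qed
  have i0: "Lint (%x. u0 x*phi0 x)"
  by (rule integrable_bounded_support[where C="K*C" and r=R])
  (use u0 C R0 K0 in \<open>auto simp: abs_mult intro!: mult_mono\<close>)
  have "(LB p. u@@p*phit@@p) = (LB x. LB t. u t x*phit t x)"
  by (rule st_xt[OF iphit])
  also have "... = (LB x. - (u0 x*phi0 x) - (LB t. phi t x*f t x))" unfolding per_x by simp
  also have "... = - (LB x. u0 x*phi0 x) - (LB x. LB t. phi t x*f t x)"
  using i0 st_x[OF iphif] by simp
  also have "(LB x. LB t. phi t x*f t x) = (LB p. phi@@p*f@@p)"
  by (rule st_xt[OF iphif, symmetric])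
  finally have A: "(LB p. u@@p*phit@@p)
  = - (LB x. u0 x*phi0 x) - (LB p. phi@@p*f@@p)" .
  define H where "H = (%j t x. phi t x*w j t x)"
  have Hm: "jm (H j)" for j unfolding meas2_iff H_def by measurable
  note [measurable (raw)] = meas2[OF Hm]
  have wle: "w j t x <= l t" if "j : J" for j t x
  unfolding wl[of t x, symmetric] by (rule member_le_sum[OF that _ J]) (use w0 in auto)
  have Hb: "\<bar>H j t x\<bar> <= C*l t*?c x" if "j : J" for j t x
  using R0[of x t] mult_mono[OF C(1)[of t x] wle[OF that, of t x] C0 w0[OF that]] w0[OF that, of t x]
  by (cases "norm x <= R") (auto simp: H_def abs_mult)
  have Hi: "Lint (%p. H j@@p * v@@p)"
  if j: "j : J" and v: "jm v" "!!t x. \<bar>v t x\<bar> <= K" for j v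
  proof (rule st_bound[where F="%t x. H j t x * v t x" and a="%t. (C*K)*l t" and c="?c"])
  note [measurable (raw)] = meas2[OF v(1)]
  show "jm (%t x. H j t x * v t x)" unfolding meas2_iff by measurable
  show "norm (H j t x * v t x) <= (C*K)*l t*?c x" for t x
  proof -
  have "\<bar>H j t x\<bar>*\<bar>v t x\<bar> <= (C*l t*?c x)*K"
  by (rule mult_mono[OF Hb[OF j] v(2)]) (use C0 l0[of t] in auto)
  then show ?thesis by (simp add: abs_mult mult_ac)
  qed
  qed (use li ci in auto)
  have uK: "\<bar>u t x\<bar> <= K" for t x using ub[of t x] by simp
  have us: "case_prod (%t x. u t (x + z)) : BM" for z
  unfolding meas2_iff by measurable
  \<comment> \<open>Summation by parts: translation invariance moves the shift from \<open>u\<close>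
    to the test function.\<close>
  have tr: "(LB p. H j@@p*u (fst p) (snd p + y j)) = (LB p. H j (fst p) (snd p - y j)*u@@p)"
  and tri: "Lint (%p. H j (fst p) (snd p - y j)*u@@p)" if "j : J" for j
  proof -
  have m: "(%p. H j (fst p) (snd p - y j)*u@@p) : BM" by measurable
  show "(LB p. H j@@p*u (fst p) (snd p + y j)) = (LB p. H j (fst p) (snd p - y j)*u@@p)"
  using integral_lborel_translate[OF m, of "(0, y j)"] by simp
  show "Lint (%p. H j (fst p) (snd p - y j)*u@@p)"
  using integrable_lborel_translate_iff[OF m, of "(0, y j)"] Hi[OF that us uK] by simp
  qed
  have adj: "(SUM j:J. H j t (x - y j) - H j t x) = scheme_adjoint h M b phi t x" for t x
  proof -
  have phiB: "phi t x*(B t x \<bullet> i) = phi t x*(b t x \<bullet> i)" for x i using R0[of x t] R by (cases "norm x < r") (auto simp: B_def)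
  have H: "H j t x = (M t*phi t x - snd j*(phi t x*(b t x \<bullet> fst j))) / (2*h)" for j x
  unfolding H_def w_def phiB[symmetric] by (simp add: right_diff_distrib mult_ac)
  show ?thesis unfolding Jsum scheme_adjoint_def H y_def
  by (intro sum.cong refl) (simp add: add_divide_distrib[symmetric] diff_divide_distrib[symmetric] algebra_simps)
  qed
  have "(LB p. phi@@p*f@@p)
  = (LB p. (SUM j:J. H j@@p*u (fst p) (snd p + y j) - H j@@p*u@@p))"
  by (intro L_cong refl) (simp add: f_def H_def sum_distrib_left algebra_simps)
  also have "... = (SUM j:J. (LB p. H j@@p*u (fst p) (snd p + y j)) - (LB p. H j@@p*u@@p))"
  using Hi[OF _ us uK] Hi[OF _ um uK] by (subst L_sum) auto
  also have "... = (SUM j:J. (LB p. H j (fst p) (snd p - y j)*u@@p) - (LB p. H j@@p*u@@p))"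
  using tr by (intro sum.cong) auto
  also have "... = (LB p. (SUM j:J. H j (fst p) (snd p - y j)*u@@p - H j@@p*u@@p))"
  using tri Hi[OF _ um uK] by (subst L_sum) auto
  also have "... = (LB p. u@@p * scheme_adjoint h M b phi@@p)"
  unfolding adj[symmetric] by (intro L_cong refl) (simp add: sum_distrib_left algebra_simps)
  finally have Beq: "(LB p. phi@@p*f@@p) = (LB p. u@@p * scheme_adjoint h M b phi@@p)" .
  have "Lint (%p. SUM j:J. H j (fst p) (snd p - y j)*u@@p - H j@@p*u@@p)"
  using tri Hi[OF _ um uK] by (intro I_sum I_diff) auto
  moreover have "(%p. SUM j:J. H j (fst p) (snd p - y j)*u@@p - H j@@p*u@@p)
  = (%p. u@@p * scheme_adjoint h M b phi@@p)"
  unfolding adj[symmetric] by (simp add: sum_distrib_left algebra_simps)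
  ultimately have iS: "Lint (%p. u@@p * scheme_adjoint h M b phi@@p)" by simp
  show "(LB p. u@@p*(phit@@p + scheme_adjoint h M b phi@@p))
  = - (LB x. u0 x*phi0 x)"
  unfolding distrib_left using iphit iS A Beq by simp
 qed
qed

section \<open>Products of fields with test functions\<close>

lemma loc_int_mult_inner:
 fixes f :: "'a::euclidean_space => 'b::euclidean_space"
 assumes f: "loc_int f" and [measurable]: "a : BM" and a: "!!x. \<bar>a x\<bar> <= C"
 shows "loc_int (%x. a x*(f x \<bullet> k))"
 unfolding loc_int_def
proof (intro conjI allI)
 have [measurable]: "f : BM" using f by (simp add: loc_int_def)
 show "(%x. a x*(f x \<bullet> k)) : BM" by measurable
 fix r
 have "Lint (%x. (indc r x*a x) *R f x)"
  by (rule loc_int_mult[OF f, where C=C and r="r + 1"])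
  (use a order_trans[OF abs_ge_zero a] in \<open>auto simp: indicator_def\<close>)
 then have "Lint (%x. ((indc r x*a x) *R f x) \<bullet> k)" by (rule integrable_inner_left)
 then show "Lint (%x. indc r x *R (a x*(f x \<bullet> k)))" by (simp add: mult.assoc)
qed

lemma loc_int_add: "loc_int f ==> loc_int g ==> loc_int (%x. f x + g x)"
 by (auto simp: loc_int_def scaleR_add_right)

text \<open>The weak gradient of \<open>f\<close> is tested with \<open>psi * phi\<close>, and the
  term containing the derivative of \<open>phi\<close> is moved to the other side.\<close>

lemma weak_grad_mult:
 fixes f :: "'a::euclidean_space => 'b::euclidean_space"
 assumes fg: "weak_grad f g" and t: "tf phi"
 shows "weak_grad (%x. phi x*(f x \<bullet> k)) (%i x. phi x*(g i x \<bullet> k) + FD phi (at x) i*(f x \<bullet> k))"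
proof -
 have lf: "loc_int f" and lg: "!!i. i : Basis ==> loc_int (g i)" using fg by (auto simp: weak_grad_def)
 obtain C where C: "!!x. \<bar>phi x\<bar> <= C" using tf_bounded[OF t] by blast
 have C': "EX C'. ALL x. \<bar>FD phi (at x) i\<bar> <= C'" for i
  using tf_bounded[OF tf_FD[OF t]] by blast
 note m = tf_measurable[OF t] and m' = tf_measurable[OF tf_FD[OF t]]
 have s: "smooth_on UNIV phi" using t by (simp add: test_function_def)
 have l1: "loc_int (%x. phi x*(f x \<bullet> k))" by (rule loc_int_mult_inner[OF lf m C])
 have l2: "loc_int (%x. phi x*(g i x \<bullet> k))" if "i : Basis" for i by (rule loc_int_mult_inner[OF lg[OF that] m C])
 have l3: "loc_int (%x. FD phi (at x) i*(f x \<bullet> k))" for i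
  using C'[of i] loc_int_mult_inner[OF lf m'] by blast
 have ibp: "(LB x. FD psi (at x) i *R (phi x*(f x \<bullet> k)))
  = - (LB x. psi x *R (phi x*(g i x \<bullet> k) + FD phi (at x) i*(f x \<bullet> k)))"
  if i: "i : Basis" and psi: "tf psi" for i psi
 proof -
  have spsi: "smooth_on UNIV psi" using psi by (simp add: test_function_def)
  have t2: "tf (%x. psi x*phi x)" by (rule tf_mult_smooth[OF t spsi])
  have J1: "Lint (%x. FD psi (at x) i *R (phi x*(f x \<bullet> k)))"
  by (rule loc_int_tf[OF l1 tf_FD[OF psi]])
  have J2: "Lint (%x. psi x *R (phi x*(g i x \<bullet> k)))" by (rule loc_int_tf[OF l2[OF i] psi])
  have J3: "Lint (%x. psi x *R (FD phi (at x) i*(f x \<bullet> k)))" by (rule loc_int_tf[OF l3 psi])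
  have e1: "(FD (%x. psi x*phi x) (at x) i *R f x) \<bullet> k
  = FD psi (at x) i *R (phi x*(f x \<bullet> k)) + psi x *R (FD phi (at x) i*(f x \<bullet> k))" for x
  unfolding FD_mult[OF spsi s] by (simp add: algebra_simps)
  have "(LB x. FD (%x. psi x*phi x) (at x) i *R f x) = - (LB x. (psi x*phi x) *R g i x)"
  using fg i t2 by (simp add: weak_grad_def)
  then have "(LB x. FD (%x. psi x*phi x) (at x) i *R f x) \<bullet> k = - ((LB x. (psi x*phi x) *R g i x) \<bullet> k)"
  by simp
  then have "(LB x. (FD (%x. psi x*phi x) (at x) i *R f x) \<bullet> k) = - (LB x. ((psi x*phi x) *R g i x) \<bullet> k)"
  using integral_inner_left[of k lborel "%x. FD (%x. psi x*phi x) (at x) i *R f x"]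
  integral_inner_left[of k lborel "%x. (psi x*phi x) *R g i x"]
  loc_int_tf[OF lf tf_FD[OF t2]] loc_int_tf[OF lg[OF i] t2] by simp
  then have "(LB x. FD psi (at x) i *R (phi x*(f x \<bullet> k)) + psi x *R (FD phi (at x) i*(f x \<bullet> k)))
  = - (LB x. psi x *R (phi x*(g i x \<bullet> k)))"
  unfolding e1 by (simp add: mult.assoc)
  then have "(LB x. FD psi (at x) i *R (phi x*(f x \<bullet> k))) + (LB x. psi x *R (FD phi (at x) i*(f x \<bullet> k)))
  = - (LB x. psi x *R (phi x*(g i x \<bullet> k)))"
  by (simp only: L_add[OF J1 J3])
  then show ?thesis unfolding scaleR_add_right L_add[OF J2 J3] by linarith
 qed
 show ?thesis unfolding weak_grad_def using l1 loc_int_add[OF l2 l3] ibp by blast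
qed

lemma st_mult_inner_integrable:
 fixes G :: "real => 'a::euclidean_space => 'b::euclidean_space"
 assumes G: "Lint (%(t, x). indc R x *R G t x)" and Gm: "jm G"
  and a: "jm a" "!!t x. \<bar>a t x\<bar> <= C" "!!t x. R <= norm x ==> a t x = 0"
 shows "Lint (%p. a@@p*(G@@p \<bullet> k))"
proof (rule I_bound)
 note [measurable (raw)] = meas2[OF Gm] meas2[OF a(1)]
 show "Lint (%p. (C*norm k) *R (case p of (t, x) => indc R x *R G t x))"
  by (rule integrable_scaleR_right) (rule G)
 show "(%p. a@@p*(G@@p \<bullet> k)) : bm lborel" by measurable
 have C0: "0 <= C" using a(2)[of 0 0] by linarith
 have "norm (a t x*(G t x \<bullet> k)) <= norm ((C*norm k) *R (indc R x *R G t x))" for t x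
 proof (cases "norm x <= R")
  case True
  have "\<bar>a t x\<bar>*\<bar>G t x \<bullet> k\<bar> <= C*(norm (G t x)*norm k)"
  by (rule mult_mono[OF a(2) Cauchy_Schwarz_ineq2 C0]) simp
  then show ?thesis using True C0 by (simp add: abs_mult mult_ac)
 qed (use a(3) in simp)
 then show "AEL p. norm (a@@p*(G@@p \<bullet> k)) <= norm ((C*norm k) *R (case p of (t, x) => indc R x *R G t x))"
  by (intro AE_I2) (auto simp: case_prod_beta')
qed

lemma W11_fieldD:
 assumes "W11_field b g"
 shows "jm b" "!!i. i : Basis ==> jm (g i)"
  "Lint (%(t, x). indc r x *R b t x)"
  "!!i. i : Basis ==> Lint (%(t, x). indc r x *R g i t x)"
  "!!t. weak_grad (b t) (%i. g i t)"
 using assms by (auto simp: W11_field_def)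

lemma admissibleD:
 assumes "admissible T phi phit D phi0 R C"
 shows "jm phi" "jm phit"
  "!!i. i : Basis ==> jm (D i)" "phi0 : BM"
  "!!t x. t ~: {0<..<T} ==> phi t x = 0" "!!t x. t ~: {0<..<T} ==> phit t x = 0"
  "!!t x i. t ~: {0<..<T} ==> i : Basis ==> D i t x = 0"
  "!!t. t : {0<..<T} ==> tf (phi t)"
  "!!t x i. t : {0<..<T} ==> i : Basis ==> FD (phi t) (at x) i = D i t x"
  "!!t x. \<bar>phi t x\<bar> <= C" "!!t x. \<bar>phit t x\<bar> <= C" "!!t x i. i : Basis ==> \<bar>D i t x\<bar> <= C"
  "!!t x w. \<bar>phi t (x + w) + phi t (x - w) - 2*phi t x\<bar> <= C*(norm w)^2"
  "!!t x. R <= norm x ==> phi t x = 0" "!!t x. R <= norm x ==> phit t x = 0" "!!t x i. R <= norm x ==> i : Basis ==> D i t x = 0"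
 using assms unfolding admissible_def by blast+

lemma div_prod_measurable:
 assumes "W11_field b g" "admissible T phi phit D phi0 R C"
 shows "jm (div_prod b g phi D)"
proof -
 note b = W11_fieldD[OF assms(1)] and a = admissibleD[OF assms(2)]
 have [measurable (raw)]: "!!i M p q. i : Basis ==> p : bm M ==> q : bm M ==> (%w. g i (p w) (q w)) : bm M"
  "!!i M p q. i : Basis ==> p : bm M ==> q : bm M ==> (%w. D i (p w) (q w)) : bm M"
  using meas2[OF b(2)] meas2[OF a(3)] by blast+
 note [measurable (raw)] = meas2[OF b(1)] meas2[OF a(1)]
 show ?thesis unfolding meas2_iff div_prod_def by measurable
qed

lemma admissible_integrable:
 assumes bg: "W11_field b g" and adm: "admissible T phi phit D phi0 R C"
 shows "Lint (%p. div_prod b g phi D@@p)" "Lint (%p. phit@@p)"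
proof -
 note b = W11_fieldD[OF bg] and a = admissibleD[OF adm]
 show "Lint (%p. div_prod b g phi D@@p)" unfolding div_prod_def
  by (intro I_sum I_add
  st_mult_inner_integrable[OF b(4) b(2) a(1) a(10) a(14)] st_mult_inner_integrable[OF b(3) b(1) a(3) a(12) a(16)])
 have C0: "0 <= C" using a(10)[of 0 0] by linarith
 show "Lint (%p. phit@@p)"
 proof (rule st_bound[where a="%t. C*ind {0<..<T} t" and c="%x. indc R x", OF a(2)])
  show "Lint (%t. C*ind {0<..<T} t)" by (cases "0 <= T") auto
  show "Lint (%x. indc R x :: real)"
  by (rule integrable_real_indicator) (simp_all add: emeasure_lborel_cball_finite[unfolded infinity_ennreal_def])
  show "norm (phit t x) <= C*ind {0<..<T} t*indc R x" for t x
  using a(11)[of t x] a(6)[of t x] a(15)[of x t] by (cases "norm x <= R"; cases "t : {0<..<T}") auto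
 qed
qed

text \<open>The adjoint scheme takes differences of the product \<open>phi b\<close>; knowing that
  its components are Sobolev fields, the expansion of difference quotients applies to them
  directly.\<close>

lemma W11_field_product:
 fixes b :: "real => 'a::euclidean_space => 'a"
 assumes bg: "W11_field b g" and adm: "admissible T phi phit D phi0 R C"
 shows "W11_field (%t x. phi t x*(b t x \<bullet> k)) (%i t x. phi t x*(g i t x \<bullet> k) + D i t x*(b t x \<bullet> k))"
proof -
 note b = W11_fieldD[OF bg] and a = admissibleD[OF adm]
 have [measurable (raw)]: "!!i M p q. i : Basis ==> p : bm M ==> q : bm M ==> (%w. g i (p w) (q w)) : bm M"
  "!!i M p q. i : Basis ==> p : bm M ==> q : bm M ==> (%w. D i (p w) (q w)) : bm M"
  using meas2[OF b(2)] meas2[OF a(3)] by blast+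
 note [measurable (raw)] = meas2[OF b(1)] meas2[OF a(1)]
 have m1: "case_prod (%t x. phi t x*(b t x \<bullet> k)) : BM" unfolding meas2_iff by measurable
 have m2: "case_prod (%t x. phi t x*(g i t x \<bullet> k) + D i t x*(b t x \<bullet> k)) : BM" if "i : Basis" for i
  unfolding meas2_iff using that by measurable
 have i1: "Lint (%p. phi@@p*(b@@p \<bullet> k))"
  by (rule st_mult_inner_integrable[OF b(3) b(1) a(1) a(10) a(14)])
 have i2: "Lint (%p. phi@@p*(g i@@p \<bullet> k) + D i@@p*(b@@p \<bullet> k))" if "i : Basis" for i
  by (intro I_add st_mult_inner_integrable[OF b(4)[OF that] b(2)[OF that] a(1) a(10) a(14)]
  st_mult_inner_integrable[OF b(3) b(1) a(3)[OF that] a(12)[OF that] a(16)[OF _ that]])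
 have inte: "Lint (%(t, x). indc r x *R F t x)"
  if F: "Lint (%p. F@@p :: real)" for F r
 proof -
  have [measurable]: "(%p. F@@p) : BM" using F by (auto dest: Lint_meas)
  have "Lint (%p. indc r (snd p)*F@@p)"
  by (rule I_bound[OF F]) (auto simp: indicator_def)
  then show ?thesis by (simp add: case_prod_beta')
 qed
 have w: "weak_grad (%x. phi t x*(b t x \<bullet> k)) (%i x. phi t x*(g i t x \<bullet> k) + D i t x*(b t x \<bullet> k))" for t
 proof (cases "t : {0<..<T}")
  case True
  from weak_grad_mult[OF b(5) a(8)[OF True], of t k] a(9)[OF True]
  show ?thesis unfolding weak_grad_def by auto
 next
  case False
  have 1: "(%x. phi t x*(b t x \<bullet> k)) = (%x. 0)" using a(5)[OF False] by simp
  have 2: "!!i. i : Basis ==> (%x. phi t x*(g i t x \<bullet> k) + D i t x*(b t x \<bullet> k)) = (%x. 0)" using a(5,7)[OF False] by simp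
  have l0: "loc_int (%x::'a. 0::real)" by (simp add: loc_int_def)
  show ?thesis unfolding weak_grad_def 1
  proof (intro conjI ballI l0)
  fix i :: 'a assume "i : Basis"
  from 2[OF this] show "loc_int (%x. phi t x*(g i t x \<bullet> k) + D i t x*(b t x \<bullet> k))"
  "ALL psi. tf psi --> (LB x. FD psi (at x) i *R 0)
  = - (LB x. psi x *R (phi t x*(g i t x \<bullet> k) + D i t x*(b t x \<bullet> k)))"
  using l0 by (simp_all add: fun_eq_iff)
  qed
 qed
 show ?thesis unfolding W11_field_def
  using m1 m2 inte[OF i1] inte[OF i2] w by blast
qed

section \<open>Consistency of the scheme\<close>

text \<open>The first-order expansions at \<open>h\<close> and \<open>- h\<close> along
  \<open>i\<close> are subtracted; two errors of size \<open>e * h\<close> are divided by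
  \<open>2 * h\<close>.\<close>

lemma central_difference_converges:
 fixes p :: "real => 'a::euclidean_space => real"
 assumes pq: "W11_field p q" and i: "i : Basis" and R: "!!t x. R <= norm x ==> p t x = 0" "!!t x. R <= norm x ==> q i t x = 0"
  and e: "0 < e"
 shows "EX del0>0. ALL h. 0 < h & h < del0 --> (NN t. NN x. en \<bar>q i t x - (p t (x + h *R i) - p t (x - h *R i)) / (2*h)\<bar>) <= en e"
proof -
 note b = W11_fieldD[OF pq]
 note [measurable (raw)] = meas2[OF b(1)] meas2[OF b(2)[OF i]]
 obtain del0 where d: "del0 > 0" "!!w. norm w < del0 ==> (NN t. NN x. norm (ind (cball 0 (R + 1)) x *R
  (p t (x + w) - p t x - (SUM j:Basis. (w \<bullet> j) *R q j t x)))) <= en (e*norm w)"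
  using W11_field_difference[OF pq e, of "R + 1"] by blast
 have sm: "(SUM j:Basis. ((c *R i) \<bullet> j) *R q j t x) = c*q i t x" for c t x
 proof -
  have "(SUM j:Basis. ((c *R i) \<bullet> j) *R q j t x) = (SUM j:Basis. if j = i then c*q i t x else 0)"
  using i by (intro sum.cong) (auto simp: inner_Basis)
  then show ?thesis using i by simp
 qed
 show ?thesis
 proof (intro exI[of _ "min del0 1"] conjI allI impI)
  fix h assume h: "0 < h & h < min del0 1"
  let ?n = "%c t x. norm (ind (cball 0 (R + 1)) x *R (p t (x + c *R i) - p t x - c*q i t x))"
  have N: "(NN t. NN x. ?n c t x) <= en (e*h)" if "c = h \<or> c = - h" for c
  using d(2)[of "c *R i"] that h i unfolding sm by auto
  have "(NN t. NN x. en \<bar>q i t x - (p t (x + h *R i) - p t (x - h *R i)) / (2*h)\<bar>)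
  <= (NN t. NN x. en (1 / (2*h))*(en (?n h t x) + en (?n (- h) t x)))"
  proof (intro nn_integral_mono)
  fix t x
  have "\<bar>q i t x - (p t (x + h *R i) - p t (x - h *R i)) / (2*h)\<bar> <= (1 / (2*h))*(?n h t x + ?n (- h) t x)"
  proof (cases "x : cball 0 (R + 1)")
  case True
  have "\<bar>2*h*q i t x - (p t (x + h *R i) - p t (x - h *R i))\<bar> <= ?n h t x + ?n (- h) t x"
  using True by (simp add: abs_if split: if_splits)
  moreover have "q i t x - (p t (x + h *R i) - p t (x - h *R i)) / (2*h) = (1 / (2*h))*(2*h*q i t x - (p t (x + h *R i) - p t (x - h *R i)))"
  using h by (simp add: field_simps)
  ultimately show ?thesis using h by (simp only: abs_mult) (auto intro!: divide_right_mono)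
  next
  case False
  have "norm x <= norm (x + h *R i) + h" "norm x <= norm (x - h *R i) + h"
  using norm_triangle_ineq4[of "x + h *R i" "h *R i"] norm_triangle_ineq[of "x - h *R i" "h *R i"] i h by simp_all
  then have "R <= norm (x + h *R i)" "R <= norm (x - h *R i)" "R <= norm x" using False h by simp_all
  then show ?thesis using False h R by simp
  qed
  then show "en \<bar>q i t x - (p t (x + h *R i) - p t (x - h *R i)) / (2*h)\<bar> <= en (1 / (2*h))*(en (?n h t x) + en (?n (- h) t x))"
  using h by (simp flip: ennreal_plus ennreal_mult)
  qed
  also have "... = en (1 / (2*h))*((NN t. NN x. ?n h t x) + (NN t. NN x. ?n (- h) t x))"
  by (simp add: nn_integral_cmult nn_integral_add)
  also have "... <= en (1 / (2*h))*(en (e*h) + en (e*h))"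
  by (intro mult_left_mono add_mono N) auto
  also have "... = en e" using h e by (simp flip: ennreal_plus ennreal_mult)
  finally show "(NN t. NN x. en \<bar>q i t x - (p t (x + h *R i) - p t (x - h *R i)) / (2*h)\<bar>) <= en e" .
 qed (use d(1) in auto)
qed

text \<open>Central differences of \<open>phi b\<close> converge. The viscosity contributes at most
  \<open>C * h * M t\<close> per direction, because second differences of \<open>phi\<close> are of
  order \<open>h^2\<close> and are divided by \<open>2 * h\<close>; \<open>A\<close> collects the
  dimension, \<open>C\<close> and the volume of the enlarged support.\<close>

lemma scheme_adjoint_converges:
 fixes b :: "real => 'a::euclidean_space => 'a"
 assumes bg: "W11_field b g" and adm: "admissible T phi phit D phi0 R C" and e: "0 < e"
 shows "EX del0>0. EX A>=0. ALL h M. 0 < h & h < del0 & Lint M & (ALL t. 0 <= M t) -->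
  (NN t. NN x. en \<bar>div_prod b g phi D t x - scheme_adjoint h M b phi t x\<bar>) <= en (e + A*(h*(LB t. M t)))"
proof -
 note b = W11_fieldD[OF bg] and a = admissibleD[OF adm]
 let ?n = "real DIM('a)"
 define p where "p = (%i t x. phi t x*(b t x \<bullet> i))"
 define q where "q = (%i j t x. phi t x*(g j t x \<bullet> i) + D j t x*(b t x \<bullet> i))"
 have pq: "W11_field (p i) (q i)" for i unfolding p_def q_def by (rule W11_field_product[OF bg adm])
 have [measurable (raw)]: "!!i M f g. f : bm M ==> g : bm M ==> (%w. p i (f w) (g w)) : bm M"
  using meas2[OF W11_fieldD(1)[OF pq]] by blast
 have [measurable (raw)]: "!!i M f g. i : Basis ==> f : bm M ==> g : bm M ==> (%w. q i i (f w) (g w)) : bm M"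
  using meas2[OF W11_fieldD(2)[OF pq]] by blast
 have "ALL i:Basis. EX del0>0. ALL h. 0 < h & h < del0 --> (NN t. NN x. en \<bar>q i i t x - (p i t (x + h *R i) - p i t (x - h *R i)) / (2*h)\<bar>) <= en (e / ?n)"
 proof
  fix i :: 'a assume i: "i : Basis"
  show "EX del0>0. ALL h. 0 < h & h < del0 --> (NN t. NN x. en \<bar>q i i t x - (p i t (x + h *R i) - p i t (x - h *R i)) / (2*h)\<bar>) <= en (e / ?n)"
  by (rule central_difference_converges[OF pq i, where R=R]) (use a(14,16) e i in \<open>auto simp: p_def q_def\<close>)
 qed
 from bchoice[OF this] obtain d where d: "!!i. i : Basis ==> d i > 0"
  "!!i h. i : Basis ==> 0 < h ==> h < d i ==> (NN t. NN x. en \<bar>q i i t x - (p i t (x + h *R i) - p i t (x - h *R i)) / (2*h)\<bar>) <= en (e / ?n)"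
  by blast
 define del0 where "del0 = min 1 (Min (d ` Basis))"
 have d0: "del0 > 0" using d(1) by (auto simp: del0_def)
 have d1: "del0 <= 1" "!!i. i : Basis ==> del0 <= d i" by (auto simp: del0_def intro: min.coboundedI2)
 have C0: "0 <= C" using a(10)[of 0 0] by linarith
 let ?cb = "cball (0::'a) (R + 1)"
 define A where "A = ?n*(C*measure lborel ?cb)"
 have A0: "0 <= A" unfolding A_def using C0 by simp
 show ?thesis
 proof (rule exI[of _ del0], rule conjI[OF d0], rule exI[of _ A], rule conjI[OF A0], intro allI impI)
  fix h :: real and M :: "real => real" assume hM: "0 < h & h < del0 & Lint M & (ALL t. 0 <= M t)"
  then have h: "0 < h" "h < del0" and M: "Lint M" "!!t. 0 <= M t" by auto
  have [measurable]: "M : BM" using M(1) by (auto dest: Lint_meas)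
  have split: "s - (A + B) / c = s - B / c - A / c" for s A B c :: real by (simp add: add_divide_distrib)
  have pt: "\<bar>div_prod b g phi D t x - scheme_adjoint h M b phi t x\<bar>
  <= (SUM i:Basis. \<bar>q i i t x - (p i t (x + h *R i) - p i t (x - h *R i)) / (2*h)\<bar> + C*h*(M t*ind ?cb x))" for t x
  proof -
  have deq: "div_prod b g phi D t x - scheme_adjoint h M b phi t x
  = (SUM i:Basis. (q i i t x - (p i t (x + h *R i) - p i t (x - h *R i)) / (2*h)) - M t*(phi t (x + h *R i) + phi t (x - h *R i) - 2*phi t x) / (2*h))" (is "_ = ?S")
  unfolding div_prod_def scheme_adjoint_def sum_subtractf[symmetric] p_def q_def
  by (intro sum.cong refl) (rule split)
  have "\<bar>?S\<bar> <= (SUM i:Basis. \<bar>q i i t x - (p i t (x + h *R i) - p i t (x - h *R i)) / (2*h)\<bar> + C*h*(M t*ind ?cb x))"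
  proof (rule order_trans[OF sum_abs], rule sum_mono)
  fix i :: 'a assume i: "i : Basis"
  have "\<bar>M t*(phi t (x + h *R i) + phi t (x - h *R i) - 2*phi t x) / (2*h)\<bar> <= C*h*(M t*ind ?cb x)"
  proof (cases "x : ?cb")
  case True
  have "\<bar>phi t (x + h *R i) + phi t (x - h *R i) - 2*phi t x\<bar> <= C*h^2"
  using a(13)[of t x "h *R i"] i h by simp
  then have "M t*\<bar>phi t (x + h *R i) + phi t (x - h *R i) - 2*phi t x\<bar> <= M t*(C*h^2)"
  using M(2) by (intro mult_left_mono) auto
  then have "\<bar>M t*(phi t (x + h *R i) + phi t (x - h *R i) - 2*phi t x) / (2*h)\<bar> <= M t*(C*h^2) / (2*h)"
  using h M(2)[of t] by (simp add: abs_mult divide_right_mono)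
  also have "... = C*h*M t / 2" using h by (simp add: field_simps power2_eq_square)
  also have "... <= C*h*M t" using C0 h M(2)[of t] by simp
  finally show ?thesis using True by simp
  next
  case False
  have "norm x <= norm (x + h *R i) + h" "norm x <= norm (x - h *R i) + h"
  using norm_triangle_ineq4[of "x + h *R i" "h *R i"] norm_triangle_ineq[of "x - h *R i" "h *R i"] i h by simp_all
  then have "R <= norm (x + h *R i)" "R <= norm (x - h *R i)" "R <= norm x" using False h d1(1) by simp_all
  then show ?thesis using False a(14) by simp
  qed
  then show "\<bar>(q i i t x - (p i t (x + h *R i) - p i t (x - h *R i)) / (2*h)) - M t*(phi t (x + h *R i) + phi t (x - h *R i) - 2*phi t x) / (2*h)\<bar>
  <= \<bar>q i i t x - (p i t (x + h *R i) - p i t (x - h *R i)) / (2*h)\<bar> + C*h*(M t*ind ?cb x)"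
  by linarith
  qed
  then show ?thesis unfolding deq .
  qed
  let ?I = "%i t x. en \<bar>q i i t x - (p i t (x + h *R i) - p i t (x - h *R i)) / (2*h)\<bar>"
  have "(NN t. NN x. en \<bar>div_prod b g phi D t x - scheme_adjoint h M b phi t x\<bar>)
  <= (NN t. NN x. (SUM i:Basis. ?I i t x + en (C*h)*(en (M t)*ind ?cb x)))"
  proof (intro nn_integral_mono)
  fix t x
  have "en \<bar>div_prod b g phi D t x - scheme_adjoint h M b phi t x\<bar> <= en (SUM i:Basis. \<bar>q i i t x - (p i t (x + h *R i) - p i t (x - h *R i)) / (2*h)\<bar> + C*h*(M t*ind ?cb x))"
  by (rule ennreal_leI[OF pt])
  also have "... = (SUM i:Basis. en (\<bar>q i i t x - (p i t (x + h *R i) - p i t (x - h *R i)) / (2*h)\<bar> + C*h*(M t*ind ?cb x)))"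
  using C0 h M(2) by (intro sum_ennreal[symmetric] add_nonneg_nonneg) auto
  also have "... = (SUM i:Basis. ?I i t x + en (C*h)*(en (M t)*ind ?cb x))"
  using C0 h M(2)[of t] by (intro sum.cong refl) (auto simp: ennreal_plus ennreal_mult indicator_def)
  finally show "en \<bar>div_prod b g phi D t x - scheme_adjoint h M b phi t x\<bar> <= (SUM i:Basis. ?I i t x + en (C*h)*(en (M t)*ind ?cb x))" .
  qed
  also have "... = (SUM i:Basis. (NN t. NN x. ?I i t x) + en (C*h)*((NN t. en (M t))*emeasure lborel ?cb))"
  by (simp add: nn_integral_sum nn_integral_add nn_integral_cmult nn_integral_multc)
  also have "... <= (SUM i:(Basis::'a set). en (e / ?n) + en (C*h)*((NN t. en (M t))*emeasure lborel ?cb))"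
  using h d1(2) by (intro sum_mono add_right_mono d(2)) force+
  also have "(NN t. en (M t)) = en (LB t. M t)"
  using M by (intro nn_integral_eq_integral) auto
  also have "emeasure lborel ?cb = en (measure lborel ?cb)"
  using emeasure_lborel_cball_finite[of "0::'a" "R + 1"] by (intro emeasure_eq_ennreal_measure) auto
  also have "(SUM i:(Basis::'a set). en (e / ?n) + en (C*h)*(en (LB t. M t)*en (measure lborel ?cb)))
  = en (?n*(e / ?n + C*h*((LB t. M t)*measure lborel ?cb)))"
  proof -
  have m0: "0 <= (LB t. M t)" using M by (intro L_nonneg) auto
  show ?thesis using e h C0 m0
  by (simp add: ennreal_of_nat_eq_real_of_nat flip: ennreal_mult ennreal_plus)
  qed
  also have "?n*(e / ?n + C*h*((LB t. M t)*measure lborel ?cb)) = e + A*(h*(LB t. M t))"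
  by (simp add: A_def algebra_simps)
  finally show "(NN t. NN x. en \<bar>div_prod b g phi D t x - scheme_adjoint h M b phi t x\<bar>) <= en (e + A*(h*(LB t. M t)))" .
 qed
qed

section \<open>Solutions in Borel form and passage to the limit\<close>

text \<open>One space-time integral of \<open>u\<close> against explicit integrable functions that
  do not depend on \<open>u\<close>. It is linear in \<open>u\<close> and therefore survives the
  limit of \<open>bounded_sequence_limit\<close>.\<close>

definition clean_solution ::
  "real => (real => 'a::euclidean_space => 'a) => ('a => real => 'a => 'a) => ('a => real) => (real => 'a => real) => bool" where
 "clean_solution T b g u0 u \<longleftrightarrow> (ALL phi phit D phi0 R C. admissible T phi phit D phi0 R C -->
  (LB p. u@@p*(phit@@p + div_prod b g phi D@@p))
  = - (LB x. u0 x*phi0 x))"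

lemma Lint_mult:
 fixes f v :: "'a::euclidean_space => real"
 assumes f: "Lint f" and [measurable]: "v : BM" and v: "!!x. \<bar>v x\<bar> <= K"
 shows "Lint (%x. v x*f x)"
proof (rule I_bound)
 have [measurable]: "f : BM" using f by (auto dest: Lint_meas)
 show "Lint (%x. K*f x)" using f by simp
 show "(%x. v x*f x) : bm lborel" by measurable
 have "norm (v x*f x) <= norm (K*f x)" for x
  using mult_right_mono[OF v[of x], of "\<bar>f x\<bar>"] order_trans[OF abs_ge_zero v[of x]] by (simp add: abs_mult)
 then show "AEL x. norm (v x*f x) <= norm (K*f x)" by simp
qed

lemma clean_solution_limit:
 fixes b :: "real => 'a::euclidean_space => 'a"
 assumes bg: "W11_field b g" and um: "!!n. jm (u n)" and uK: "!!n t x. \<bar>u n t x\<bar> <= K"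
  and lim: "!!phi phit D phi0 R C. admissible T phi phit D phi0 R C ==>
  (%n. LB p. u n@@p*(phit@@p + div_prod b g phi D@@p))
  ----> - (LB x. u0 x*phi0 x)"
 shows "EX v. jm v & (ALL t x. \<bar>v t x\<bar> <= K) & clean_solution T b g u0 v"
proof -
 have m: "jm (u n)" for n by (rule um)
 have k: "\<bar>case_prod (u n) p\<bar> <= K" for n p using uK by (cases p) simp
 show ?thesis
 proof (rule bounded_sequence_limit[of "%n. case_prod (u n)" K, OF m k])
  fix v assume v: "v : BM" "!!x. \<bar>v x\<bar> <= K"
  "!!f c. Lint f ==> (%n. LB x. case_prod (u n) x*f x) ----> c ==> (LB x. v x*f x) = c"
 show ?thesis
 proof (intro exI[of _ "%t x. v (t, x)"] conjI allI)
  show "case_prod (%t x. v (t, x)) : BM" using v(1) by simp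
  show "\<bar>v (t, x)\<bar> <= K" for t x by (rule v(2))
  show "clean_solution T b g u0 (%t x. v (t, x))" unfolding clean_solution_def
  proof (intro allI impI)
  fix phi phit :: "real => 'a => real" and D phi0 R C assume adm: "admissible T phi phit D phi0 R C"
  have "(LB p. v p*(phit@@p + div_prod b g phi D@@p)) = - (LB x. u0 x*phi0 x)"
  by (rule v(3)) (use lim[OF adm] admissible_integrable[OF bg adm] in \<open>auto simp: case_prod_beta'\<close>)
  then show "(LB p. v (fst p, snd p)*(phit@@p + div_prod b g phi D@@p)) = - (LB x. u0 x*phi0 x)"
  by simp
  qed
 qed
 qed
qed

lemma spacetime_integral_diff_le:
 fixes F G u :: "real => 'a::euclidean_space => real"
 assumes u: "jm u" "!!t x. \<bar>u t x\<bar> <= K"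
  and F: "Lint (%p. F@@p)" and G: "jm G"
  and le: "(NN t. NN x. en \<bar>F t x - G t x\<bar>) <= en e" and e: "0 <= e"
 shows "Lint (%p. G@@p)"
  "\<bar>(LB p. u@@p*F@@p) - (LB p. u@@p*G@@p)\<bar> <= K*e"
proof -
 have Fm: "jm F" using F by (auto dest: Lint_meas simp: case_prod_beta')
 note [measurable (raw)] = meas2[OF u(1)] meas2[OF G] meas2[OF Fm]
 have le': "(NN p. en \<bar>F@@p - G@@p\<bar>) <= en e"
  using le by (subst st_nn[of "%t x. en \<bar>F t x - G t x\<bar>"]) (auto simp: meas2_iff)
 have i: "Lint (%p. F@@p - G@@p)"
  using le' by (auto simp: integrable_iff_bounded intro: le_less_trans)
 from I_diff[OF F i] show Gi: "Lint (%p. G@@p)" by simp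
 have um: "(%p. u@@p) : BM" by measurable
 have K0: "0 <= K" using u(2)[of 0 0] by linarith
 have "(LB p. u@@p*F@@p) - (LB p. u@@p*G@@p)
  = (LB p. u@@p*(F@@p - G@@p))"
  using Lint_mult[OF F um u(2)] Lint_mult[OF Gi um u(2)]
  unfolding right_diff_distrib by (rule L_diff[symmetric])
 moreover have "en \<bar>LB p. u@@p*(F@@p - G@@p)\<bar> <= en (K*e)"
 proof -
  have "en (norm (LB p. u@@p*(F@@p - G@@p)))
  <= (NN p. norm (u@@p*(F@@p - G@@p)))"
  by (rule integral_norm_bound_ennreal[OF Lint_mult[OF i um u(2)]])
  also have "... <= (NN p. en K*en \<bar>F@@p - G@@p\<bar>)"
  using u(2) K0 by (intro nn_integral_mono) (auto simp: abs_mult ennreal_mult[symmetric] intro!: ennreal_leI mult_right_mono)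
  also have "... = en K*(NN p. en \<bar>F@@p - G@@p\<bar>)"
  by (rule nn_integral_cmult) measurable
  also have "... <= en K*en e" by (rule mult_left_mono[OF le']) simp
  finally show ?thesis using K0 e by (simp add: ennreal_mult)
 qed
 ultimately show "\<bar>(LB p. u@@p*F@@p) - (LB p. u@@p*G@@p)\<bar> <= K*e"
  using K0 e by simp
qed

lemma scheme_adjoint_measurable:
 assumes b: "jm b" and [measurable]: "M : BM" and phi: "jm phi"
 shows "jm (scheme_adjoint h M b phi)"
proof -
 note [measurable (raw)] = meas2[OF b] meas2[OF phi]
 show ?thesis unfolding meas2_iff scheme_adjoint_def by measurable
qed

text \<open>The mesh is adapted to the size of the field: on the ball of radius \<open>n\<close> the
  field has its own majorant \<open>M\<close>, and \<open>h n\<close> is taken so small that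
  \<open>h n\<close> times the integral of \<open>M\<close>, hence the viscosity, still tends to
  0.\<close>

lemma existence_locally_bounded:
 fixes b :: "real => 'a::euclidean_space => 'a"
 assumes bg: "W11_field b g" and bz: "!!t x. t ~: {0<..<T} ==> b t x = 0"
  and bM: "!!r. EX M. Lint M & (ALL t. 0 <= M t) & (ALL t x. norm x < r --> norm (b t x) <= M t)"
  and u0: "u0 : BM" "!!x. 0 <= u0 x" "!!x. u0 x <= K"
 shows "EX u. jm u & (ALL t x. \<bar>u t x\<bar> <= K) & clean_solution T b g u0 u"
proof -
 note b = W11_fieldD[OF bg]
 have K0: "0 <= K" using u0(2,3) by (rule order_trans)
 have "EX M. Lint M & (ALL t. 0 <= M t) & (ALL t. t ~: {0<..<T} --> M t = 0) & (ALL t x. norm x < r --> norm (b t x) <= M t)" for r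
 proof -
  obtain M where M: "Lint M" "!!t. 0 <= M t" "!!t x. norm x < r ==> norm (b t x) <= M t" using bM[of r] by blast
  have "norm (b t x) <= ind {0<..<T} t*M t" if "norm x < r" for t x
  using M(3)[OF that, of t] bz[of t x] by (cases "t : {0<..<T}") auto
  then show ?thesis using M
  by (intro exI[of _ "%t. ind {0<..<T} t*M t"]) (auto intro: integrable_indicator_mult)
 qed
 then have "EX M. ALL r. Lint (M r) & (ALL t. 0 <= M r t) & (ALL t. t ~: {0<..<T} --> M r t = 0) & (ALL t x. norm x < r --> norm (b t x) <= M r t)"
  by (intro choice) blast
 then obtain M where M: "!!r. Lint (M r)" "!!r t. 0 <= M r t" "!!r t. t ~: {0<..<T} ==> M r t = 0"
  "!!r t x. norm x < r ==> norm (b t x) <= M r t" by blast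
 define m where "m = (%n::nat. LB t. M (real n) t)"
 have m0: "0 <= m n" for n unfolding m_def using M(2) by (intro L_nonneg) auto
 define h where "h = (%n::nat. 1 / ((real n + 1)*(1 + m n)))"
 have h0: "0 < h n" for n unfolding h_def using m0[of n] by (intro divide_pos_pos mult_pos_pos) auto
 have h1: "h n <= 1 / (real n + 1)" "h n*m n <= 1 / (real n + 1)" for n
 proof -
  have "h n = (1 / (real n + 1))*(1 / (1 + m n))" "h n*m n = (1 / (real n + 1))*(m n / (1 + m n))"
  by (simp_all add: h_def)
  moreover have "(1 / (real n + 1))*(1 / (1 + m n)) <= (1 / (real n + 1))*1" "(1 / (real n + 1))*(m n / (1 + m n)) <= (1 / (real n + 1))*1"
  using m0[of n] by (intro mult_left_mono; simp add: divide_le_eq)+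
  ultimately show "h n <= 1 / (real n + 1)" "h n*m n <= 1 / (real n + 1)" by simp_all
 qed
 \<comment> \<open>The \<open>n\<close>-th scheme is tested only with functions supported in the
   ball of radius \<open>n\<close>; a given test function qualifies for all large
   \<open>n\<close>.\<close>
 have "EX u. jm u & (ALL t x. \<bar>u t x\<bar> <= K) & (ALL phi phit D phi0 R C. admissible T phi phit D phi0 R C --> R <= real n -->
  (LB p. u@@p*(phit@@p + scheme_adjoint (h n) (M (real n)) b phi@@p))
  = - (LB x. u0 x*phi0 x))" for n
 proof (rule scheme_solution[OF b(1) M(1)[where r="real n"] M(2)[where r="real n"] M(3)[where r="real n"] M(4)[where r="real n"] h0[where n=n] u0])
  fix u assume u: "jm u" "!!t x. 0 <= u t x" "!!t x. u t x <= K"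
  "!!phi phit D phi0 R C. admissible T phi phit D phi0 R C ==> R <= real n ==>
  (LB p. u@@p*(phit@@p + scheme_adjoint (h n) (M (real n)) b phi@@p))
  = - (LB x. u0 x*phi0 x)"
  have "\<bar>u t x\<bar> <= K" for t x using u(2,3)[of t x] by simp
  with u(1,4) show ?thesis by (intro exI[of _ u] conjI allI impI)
 qed
 then have "EX u. ALL n. jm (u n) & (ALL t x. \<bar>u n t x\<bar> <= K) & (ALL phi phit D phi0 R C. admissible T phi phit D phi0 R C --> R <= real n -->
  (LB p. u n@@p*(phit@@p + scheme_adjoint (h n) (M (real n)) b phi@@p))
  = - (LB x. u0 x*phi0 x))"
  by (intro choice allI)
 then obtain u where u: "!!n. jm (u n)" "!!n t x. \<bar>u n t x\<bar> <= K"
  "!!n phi phit D phi0 R C. admissible T phi phit D phi0 R C ==> R <= real n ==>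
  (LB p. u n@@p*(phit@@p + scheme_adjoint (h n) (M (real n)) b phi@@p))
  = - (LB x. u0 x*phi0 x)" by blast
 show ?thesis
 proof (rule clean_solution_limit[OF bg u(1,2)])
  fix phi phit :: "real => 'a => real" and D phi0 R C assume adm: "admissible T phi phit D phi0 R C"
  show "(%n. LB p. u n@@p*(phit@@p + div_prod b g phi D@@p))
  ----> - (LB x. u0 x*phi0 x)"
  proof (rule LIMSEQ_I)
  fix e :: real assume e: "0 < e"
  define e' where "e' = e / (4*(K + 1))"
  have e': "0 < e'" using e K0 by (simp add: e'_def)
  obtain del0 A where d: "del0 > 0" "A >= 0" "!!h M. 0 < h ==> h < del0 ==> Lint M ==> (!!t. 0 <= M t) ==>
  (NN t. NN x. en \<bar>div_prod b g phi D t x - scheme_adjoint h M b phi t x\<bar>) <= en (e' + A*(h*(LB t. M t)))"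
  using scheme_adjoint_converges[OF bg adm e'] by blast
  have "(%n. 1 / (real n + 1)) ----> 0" by real_asymp
  then have "\<forall>\<^sub>F n in sequentially. 1 / (real n + 1) < min del0 (e' / (A + 1))"
  using d e' by (intro order_tendstoD(2)) auto
  then obtain n0 where n0: "!!n. n0 <= n ==> 1 / (real n + 1) < min del0 (e' / (A + 1))" by (auto simp: eventually_sequentially)
  show "EX no. ALL n>=no. norm ((LB p. u n@@p*(phit@@p + div_prod b g phi D@@p)) - - (LB x. u0 x*phi0 x)) < e"
  proof (intro exI[of _ "max n0 (nat \<lceil>R\<rceil>)"] allI impI)
  fix n assume n: "max n0 (nat \<lceil>R\<rceil>) <= n"
  then have Rn: "R <= real n" by linarith
  have nn: "1 / (real n + 1) < del0" "1 / (real n + 1) < e' / (A + 1)" using n0[of n] n by auto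
  have "A*(h n*m n) <= A*(e' / (A + 1))" using h1(2)[of n] nn(2) d(2) by (intro mult_left_mono) auto
  also have "... <= e'" using d(2) e' by (simp add: field_simps)
  finally have Ah: "e' + A*(h n*m n) <= 2*e'" by simp
  have "(NN t. NN x. en \<bar>(phit t x + div_prod b g phi D t x) - (phit t x + scheme_adjoint (h n) (M (real n)) b phi t x)\<bar>)
  <= en (e' + A*(h n*m n))"
  using d(3)[OF h0[of n] _ M(1) M(2), of "real n"] h1(1)[of n] nn(1) by (simp add: m_def)
  also have "... <= en (2*e')" by (rule ennreal_leI[OF Ah])
  finally have le: "(NN t. NN x. en \<bar>(phit t x + div_prod b g phi D t x) - (phit t x + scheme_adjoint (h n) (M (real n)) b phi t x)\<bar>) <= en (2*e')" .
  have Mm: "M (real n) : BM" using M(1)[of "real n"] by (auto dest: Lint_meas)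
  have i: "Lint (%p. phit@@p + div_prod b g phi D@@p)"
  using admissible_integrable[OF bg adm] by simp
  have Gm: "case_prod (%t x. phit t x + scheme_adjoint (h n) (M (real n)) b phi t x) : BM"
  proof -
  note [measurable (raw)] = meas2[OF scheme_adjoint_measurable[OF b(1) Mm admissibleD(1)[OF adm]]]
  meas2[OF admissibleD(2)[OF adm]]
  show ?thesis unfolding meas2_iff by measurable
  qed
  have e2: "0 <= 2*e'" using e' by simp
  have "\<bar>(LB p. u n@@p*(phit@@p + div_prod b g phi D@@p))
  - (LB p. u n@@p*(phit@@p + scheme_adjoint (h n) (M (real n)) b phi@@p))\<bar> <= K*(2*e')"
  by (rule spacetime_integral_diff_le(2)[where F="%t x. phit t x + div_prod b g phi D t x" and G="%t x. phit t x + scheme_adjoint (h n) (M (real n)) b phi t x", OF u(1,2) i Gm le e2])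
  also have "K*(2*e') < e" unfolding e'_def using K0 e by (simp add: field_simps add_strict_increasing)
  finally show "norm ((LB p. u n@@p*(phit@@p + div_prod b g phi D@@p)) - - (LB x. u0 x*phi0 x)) < e"
  unfolding u(3)[OF adm Rn] by simp
  qed
  qed
 qed
qed

section \<open>Existence\<close>

definition mollify :: "('a::euclidean_space => real) => ('a => 'b::euclidean_space) => 'a => 'b" where
 "mollify rho f x = (LB w. rho w *R f (x - w))"

lemma mollify_product_integrable:
 fixes f :: "'a::euclidean_space => 'b::euclidean_space"
 assumes f: "loc_int f" and rho: "tf rho" and psi: "psi : BM" "!!x. \<bar>psi x\<bar> <= C" "!!x. r <= norm x ==> psi x = 0"
 shows "integrable (lborel \<Otimes>\<^sub>M lborel) (%(w, x). (rho w*psi x) *R f (x - w))"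
proof -
 have [measurable]: "f : BM" "psi : BM" using f psi(1) by (auto simp: loc_int_def)
 note [measurable] = tf_measurable[OF rho]
 obtain r' where r': "r' > 0" "!!w. r' <= norm w ==> rho w = 0" using rho unfolding tf_alt by blast
 have C0: "0 <= C" using psi(2)[of 0] by linarith
 let ?F = "%y. norm (ind (cball 0 (r + r')) y *R f y)"
 have gi: "Lint (%x. ind (cball 0 (r + r')) x *R f x)" using f by (simp add: loc_int_def)
 have "(\<integral>\<^sup>+p. norm (case p of (w, x) => (rho w*psi x) *R f (x - w)) \<partial>(lborel \<Otimes>\<^sub>M lborel))
  = (NN w. NN x. norm ((rho w*psi x) *R f (x - w)))"
  by (subst lborel.nn_integral_fst[symmetric]) simp_all
 also have "... <= (NN w. NN x. (en C*en \<bar>rho w\<bar>)*en (?F (x + - w)))"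
 proof (intro nn_integral_mono)
  fix w x :: 'a
  have "norm ((rho w*psi x) *R f (x - w)) <= C*\<bar>rho w\<bar>*?F (x + - w)"
  proof (cases "norm x < r & norm w < r'")
  case True
  then have "x - w : cball 0 (r + r')" using norm_triangle_ineq4[of x w] by simp
  then show ?thesis using psi(2)[of x] by (auto simp: abs_mult mult.commute[of C] intro!: mult_right_mono mult_left_mono)
  next
  case False
  then have z: "rho w*psi x = 0" using r'(2)[of w] psi(3)[of x] by (auto simp: not_less)
  show ?thesis unfolding z using C0 by (simp add: mult_nonneg_nonneg)
  qed
  then show "en (norm ((rho w*psi x) *R f (x - w))) <= (en C*en \<bar>rho w\<bar>)*en (?F (x + - w))"
  using C0 by (simp add: ennreal_leI flip: ennreal_mult)
 qed
 also have "... = (NN w. (en C*en \<bar>rho w\<bar>)*(NN x. en (?F x)))"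
 proof -
  have tr: "(NN x. en (?F (x + - w))) = (NN x. en (?F x))" for w
  by (rule nn_integral_lborel_translate[of "%x. en (?F x)"]) simp
  show ?thesis
  proof (rule nn_integral_cong)
  fix w :: 'a
  have "(NN x. (en C*en \<bar>rho w\<bar>)*en (?F (x + - w))) = (en C*en \<bar>rho w\<bar>)*(NN x. en (?F (x + - w)))"
  by (rule nn_integral_cmult) measurable
  then show "(NN x. (en C*en \<bar>rho w\<bar>)*en (?F (x + - w))) = (en C*en \<bar>rho w\<bar>)*(NN x. en (?F x))"
  unfolding tr .
  qed
 qed
 also have "... = en C*(NN w. en \<bar>rho w\<bar>)*(NN x. en (?F x))"
  by (simp add: nn_integral_multc nn_integral_cmult del: norm_scaleR)
 also have "... < \<infinity>"
  using gi tf_integrable[OF rho] by (simp add: integrable_iff_bounded ennreal_mult_less_top del: norm_scaleR)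
 finally show ?thesis by (auto simp: integrable_iff_bounded)
qed

lemma mollify_integral:
 fixes f :: "'a::euclidean_space => 'b::euclidean_space"
 assumes f: "loc_int f" and rho: "tf rho" and psi: "psi : BM" "!!x. \<bar>psi x\<bar> <= C" "!!x. r <= norm x ==> psi x = 0"
 shows "Lint (%x. psi x *R mollify rho f x)"
  and "(LB x. psi x *R mollify rho f x) = (LB w. rho w *R (LB x. psi x *R f (x - w)))"
proof -
 note I = mollify_product_integrable[OF assms]
 have eq: "(LB w. (rho w*psi x) *R f (x - w)) = psi x *R mollify rho f x" for x
  unfolding mollify_def by (subst integral_scaleR_right[symmetric]) (simp add: mult.commute)
 from lborel_pair.integrable_snd[OF I] show "Lint (%x. psi x *R mollify rho f x)" unfolding eq .
 have "(LB x. psi x *R mollify rho f x) = (LB x. LB w. (rho w*psi x) *R f (x - w))" unfolding eq ..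
 also have "... = (LB w. LB x. (rho w*psi x) *R f (x - w))" by (rule lborel_pair.Fubini_integral[OF I])
 also have "... = (LB w. rho w *R (LB x. psi x *R f (x - w)))"
  by (subst integral_scaleR_right[symmetric]) simp
 finally show "(LB x. psi x *R mollify rho f x) = (LB w. rho w *R (LB x. psi x *R f (x - w)))" .
qed

lemma mollify_measurable:
 assumes [measurable]: "f : BM" "rho : BM"
 shows "mollify rho f : BM"
 unfolding mollify_def[abs_def] by measurable

lemma mollify_loc_int:
 assumes f: "loc_int f" and rho: "tf rho" shows "loc_int (mollify rho f)"
proof -
 have "Lint (%x. indc r x *R mollify rho f x)" for r
  by (rule mollify_integral(1)[OF f rho, where C=1 and r="r + 1"]) (auto simp: indicator_def)
 then show ?thesis unfolding loc_int_def
  using mollify_measurable[OF _ tf_measurable[OF rho]] f by (auto simp: loc_int_def)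
qed

text \<open>By Fubini, testing a mollified function averages over \<open>w\<close> the tests of the
  original one with the translates \<open>psi (x + w)\<close>, which are test functions too.\<close>

lemma weak_grad_mollify:
 fixes f :: "'a::euclidean_space => 'b::euclidean_space"
 assumes fg: "weak_grad f g" and rho: "tf rho"
 shows "weak_grad (mollify rho f) (%i. mollify rho (g i))"
proof -
 have lf: "loc_int f" and lg: "!!i. i : Basis ==> loc_int (g i)" using fg by (auto simp: weak_grad_def)
 have "(LB x. FD psi (at x) i *R mollify rho f x) = - (LB x. psi x *R mollify rho (g i) x)"
  if i: "i : Basis" and psi: "tf psi" for i psi
 proof -
  have s: "smooth_on UNIV psi" using psi by (simp add: test_function_def)
  have B: "EX C r. (ALL x. \<bar>eta x\<bar> <= C) & (ALL x. r <= norm x --> eta x = 0)" if t: "tf eta" for eta :: "'a => real"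
  using tf_bounded[OF t] t unfolding tf_alt by meson
  have M: "(LB x. eta x *R mollify rho k x) = (LB w. rho w *R (LB x. eta (x + w) *R k x))"
  if t: "tf eta" and k: "loc_int k" for eta :: "'a => real" and k :: "'a => 'b"
  proof -
  have km [measurable]: "k : BM" "eta : BM" using k tf_measurable[OF t] by (auto simp: loc_int_def)
  have "(LB x. eta x *R k (x - w)) = (LB x. eta (x + w) *R k x)" for w
  using integral_lborel_translate[of "%x. eta x *R k (x - w)" w] by simp
  moreover obtain C r where C: "!!x. \<bar>eta x\<bar> <= C" "!!x. r <= norm x ==> eta x = 0" using B[OF t] by blast
  ultimately show ?thesis using mollify_integral(2)[OF k rho tf_measurable[OF t] C] by simp
  qed
  have "(LB x. FD psi (at (x + w)) i *R f x) = - (LB x. psi (x + w) *R g i x)" for w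
  proof -
  have "(LB x. FD (%y. psi (y + w)) (at x) i *R f x) = - (LB x. psi (x + w) *R g i x)"
  using fg i tf_translate[OF psi, of w] unfolding weak_grad_def by blast
  then show ?thesis unfolding FD_translate[OF s] .
  qed
  then show ?thesis using M[OF tf_FD[OF psi] lf] M[OF psi lg[OF i]] by simp
 qed
 then show ?thesis unfolding weak_grad_def using mollify_loc_int[OF lf rho] mollify_loc_int[OF lg rho] by blast
qed

text \<open>The mollification error is an average of translation increments. Of \<open>rho\<close>
  only the sign, the unit mass and the radius of the support enter, so one \<open>del0\<close>
  serves all mollifiers.\<close>

lemma mollify_close:
 fixes F :: "real => 'a::euclidean_space => 'b::euclidean_space"
 assumes Fm: "jm F" and Fi: "!!r. Lint (%(t, x). indc r x *R F t x)"
  and Fl: "!!t. loc_int (F t)" and e: "0 < e"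
 shows "EX del0>0. ALL eps C rho. eps < del0 & mollifier eps C rho -->
  (NN t. NN x. norm (indc R x *R (mollify rho (F t) x - F t x))) <= en e"
proof -
 define G where "G = (%t x. ind (cball 0 (R + 1)) x *R F t x)"
 have Gi: "Lint (case_prod G)" using Fi[of "R + 1"] by (simp add: G_def)
 have Gm: "jm G" using Gi by (auto dest: Lint_meas)
 note [measurable (raw)] = meas2[OF Fm] meas2[OF Gm]
 obtain del0 where d: "del0 > 0" "!!w. norm w < del0 ==> (NN t. NN x. norm (G t (x + w) - G t x)) <= en e"
  using st_translation[OF Gi e] by blast
 show ?thesis
 proof (rule exI[of _ "min del0 1"], intro conjI allI impI)
  fix eps C and rho :: "'a => real" assume H: "eps < min del0 1 & mollifier eps C rho"
  then have rhot: "tf rho" and rho0: "!!x. 0 <= rho x" and rho1: "!!x. eps <= norm x ==> rho x = 0"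
  and rhoI: "(LB x. rho x) = 1" and eps: "eps < del0" "eps < 1" by (auto simp: mollifier_def)
  note [measurable] = tf_measurable[OF rhot]
  have pt: "en (norm (indc R x *R (mollify rho (F t) x - F t x))) <= (NN w. en (rho w)*en (norm (G t (x - w) - G t x)))" for t x
  proof (cases "x : cball 0 R")
  case True
  have eq: "rho w *R (F t (x - w) - F t x) = rho w *R (G t (x - w) - G t x)" for w
  proof (cases "norm w < eps")
  case w: True
  then have "x - w : cball 0 (R + 1)" "x : cball 0 (R + 1)" using True norm_triangle_ineq4[of x w] eps by simp_all
  then show ?thesis by (simp add: G_def)
  qed (use rho1[of w] in simp)
  have [measurable]: "F t : BM" using Fl by (simp add: loc_int_def)
  have i1: "Lint (%w. rho w *R F t (x - w))"
  using integrable_lborel_reflect_iff[of "%y. rho (x - y) *R F t y" x] loc_int_tf[OF Fl tf_reflect[OF rhot]] by simp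
  have i2: "Lint (%w. rho w *R F t x)" using tf_integrable[OF rhot] by simp
  have "mollify rho (F t) x - F t x = (LB w. rho w *R (F t (x - w) - F t x))"
  using i1 i2 rhoI tf_integrable[OF rhot] by (simp add: mollify_def scaleR_diff_right)
  also have "... = (LB w. rho w *R (G t (x - w) - G t x))" unfolding eq ..
  finally have meq: "mollify rho (F t) x - F t x = (LB w. rho w *R (G t (x - w) - G t x))" .
  have i3: "Lint (%w. rho w *R (G t (x - w) - G t x))"
  proof -
  have "Lint (%w. rho w *R (F t (x - w) - F t x))"
  unfolding scaleR_diff_right using i1 i2 by (rule I_diff)
  then show ?thesis unfolding eq .
  qed
  have "en (norm (mollify rho (F t) x - F t x)) <= (NN w. norm (rho w *R (G t (x - w) - G t x)))"
  unfolding meq by (rule integral_norm_bound_ennreal[OF i3])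
  also have "... = (NN w. en (rho w)*en (norm (G t (x - w) - G t x)))"
  using rho0 by (simp add: ennreal_mult)
  finally show ?thesis using True by simp
  qed simp
  have "(NN t. NN x. norm (indc R x *R (mollify rho (F t) x - F t x)))
  <= (NN t. NN x. NN w. en (rho w)*en (norm (G t (x - w) - G t x)))"
  by (intro nn_integral_mono pt)
  also have "... = (NN t. NN w. NN x. en (rho w)*en (norm (G t (x - w) - G t x)))"
  by (intro nn_integral_cong lborel_pair.Fubini') measurable
  also have "... = (NN w. NN t. NN x. en (rho w)*en (norm (G t (x - w) - G t x)))"
  by (intro lborel_pair.Fubini') measurable
  also have "... = (NN w. en (rho w)*(NN t. NN x. norm (G t (x + - w) - G t x)))"
  by (simp add: nn_integral_cmult)
  also have "... <= (NN w. en (rho w)*en e)"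
  proof (rule nn_integral_mono)
  fix w :: 'a
  show "en (rho w)*(NN t. NN x. norm (G t (x + - w) - G t x)) <= en (rho w)*en e"
  by (cases "norm w < eps") (use d(2)[of "- w"] eps rho1[of w] in \<open>auto intro!: mult_left_mono\<close>)
  qed
  also have "... = en e" using mollifier_nn_integral[of eps C rho] H by (simp add: nn_integral_multc)
  finally show "(NN t. NN x. norm (indc R x *R (mollify rho (F t) x - F t x))) <= en e" .
 qed (use d(1) in auto)
qed

text \<open>For a nonintegrable \<open>f\<close> the left-hand side is 0 by convention.\<close>

lemma norm_LB_le:
 fixes f :: "'a => 'b::{banach, second_countable_topology}"
 shows "en (norm (LINT x|M. f x)) <= (\<integral>\<^sup>+x. norm (f x) \<partial>M)"
 by (cases "integrable M f") (auto simp: integral_norm_bound_ennreal not_integrable_integral_eq)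

lemma mollify_st_integrable:
 fixes F :: "real => 'a::euclidean_space => 'b::euclidean_space"
 assumes Fm: "jm F" and Fi: "!!r. Lint (%(t, x). indc r x *R F t x)"
  and rho: "tf rho"
 shows "case_prod (%t. mollify rho (F t)) : BM"
  "Lint (%(t, x). indc r x *R mollify rho (F t) x)"
proof -
 note [measurable (raw)] = meas2[OF Fm] and [measurable] = tf_measurable[OF rho]
 show m: "case_prod (%t. mollify rho (F t)) : BM"
  unfolding meas2_iff mollify_def by measurable
 note [measurable (raw)] = meas2[OF m]
 obtain r' where r': "r' > 0" "!!w. r' <= norm w ==> rho w = 0" using rho unfolding tf_alt by blast
 define G where "G = (%t x. ind (cball 0 (r + r')) x *R F t x)"
 have Gi: "Lint (case_prod G)" using Fi[of "r + r'"] by (simp add: G_def)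
 have Gm: "jm G" using Gi by (auto dest: Lint_meas)
 note [measurable (raw)] = meas2[OF Gm]
 have pt: "en (norm (indc r x *R mollify rho (F t) x)) <= (NN w. en \<bar>rho w\<bar>*en (norm (G t (x - w))))" for t x
 proof (cases "x : cball 0 r")
  case True
  have eq: "rho w *R F t (x - w) = rho w *R G t (x - w)" for w
  proof (cases "norm w < r'")
  case w: True
  then have "x - w : cball 0 (r + r')" using True norm_triangle_ineq4[of x w] by simp
  then show ?thesis by (simp add: G_def)
  qed (use r'(2)[of w] in simp)
  have "en (norm (mollify rho (F t) x)) <= (NN w. norm (rho w *R G t (x - w)))"
  unfolding mollify_def eq by (rule norm_LB_le)
  then show ?thesis using True by (simp add: ennreal_mult)
 qed simp
 have "(NN t. NN x. norm (indc r x *R mollify rho (F t) x))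
  <= (NN t. NN x. NN w. en \<bar>rho w\<bar>*en (norm (G t (x - w))))"
  by (intro nn_integral_mono pt)
 also have "... = (NN t. NN w. NN x. en \<bar>rho w\<bar>*en (norm (G t (x - w))))"
  by (intro nn_integral_cong lborel_pair.Fubini') measurable
 also have "... = (NN t. NN w. en \<bar>rho w\<bar>*(NN x. norm (G t x)))"
 proof (intro nn_integral_cong)
  fix t :: real and w :: 'a
  have "(NN x. en \<bar>rho w\<bar>*en (norm (G t (x - w)))) = en \<bar>rho w\<bar>*(NN x. en (norm (G t (x - w))))"
  by (rule nn_integral_cmult) measurable
  also have "(NN x. en (norm (G t (x - w)))) = (NN x. en (norm (G t x)))"
  using nn_integral_lborel_translate[of "%x. en (norm (G t x))" "- w"] by simp
  finally show "(NN x. en \<bar>rho w\<bar>*en (norm (G t (x - w)))) = en \<bar>rho w\<bar>*(NN x. en (norm (G t x)))" .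
 qed
 also have "... = (NN w. en \<bar>rho w\<bar>)*(NN t. NN x. norm (G t x))"
  by (simp add: nn_integral_multc nn_integral_cmult)
 also have "(NN t. NN x. norm (G t x)) = (NN p. norm (case_prod G p))"
  by (subst nn_st(1)[symmetric]) (auto simp: meas2_iff case_prod_beta')
 also have "(NN w. en \<bar>rho w\<bar>)*(NN p. norm (case_prod G p)) < \<infinity>"
  using Gi tf_integrable[OF rho] by (simp add: integrable_iff_bounded ennreal_mult_less_top)
 finally have fin: "(NN t. NN x. norm (indc r x *R mollify rho (F t) x)) < \<infinity>" .
 have "(NN p. norm (indc r (snd p) *R mollify rho (F (fst p)) (snd p))) < \<infinity>"
  using fin by (subst st_nn[of "%t x. en (norm (indc r x *R mollify rho (F t) x))"])
  (auto simp: meas2_iff)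
 moreover have "(%p. indc r (snd p) *R mollify rho (F (fst p)) (snd p)) : BM" by measurable
 ultimately show "Lint (%(t, x). indc r x *R mollify rho (F t) x)"
  by (simp add: integrable_iff_bounded case_prod_beta')
qed

lemma W11_field_mollify:
 assumes bg: "W11_field b g" and rho: "tf rho"
 shows "W11_field (%t. mollify rho (b t)) (%i t. mollify rho (g i t))"
proof -
 note b = W11_fieldD[OF bg]
 have "Lint (%(t, x). indc r x *R mollify rho (b t) x)" for r
  by (rule mollify_st_integrable(2)[OF b(1) b(3) rho])
 moreover have "Lint (%(t, x). indc r x *R mollify rho (g i t) x)" if "i : Basis" for r i
  by (rule mollify_st_integrable(2)[OF b(2) b(4) rho]) (rule that)+
 moreover note mollify_st_integrable(1)[OF b(1) b(3) rho] mollify_st_integrable(1)[OF b(2) b(4) rho]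
  weak_grad_mollify[OF b(5) rho]
 ultimately show ?thesis unfolding W11_field_def by blast
qed

text \<open>The supremum of the kernel times the \<open>L1\<close> norm of \<open>b t\<close> over
  an enlarged ball is the majorant; it is integrable in time by Fubini.\<close>

lemma mollify_locally_bounded:
 fixes b :: "real => 'a::euclidean_space => 'b::euclidean_space"
 assumes bm: "jm b" and bi: "!!r. Lint (%(t, x). indc r x *R b t x)"
  and bl: "!!t. loc_int (b t)" and rho: "tf rho"
 shows "EX M. Lint M & (ALL t. 0 <= M t) & (ALL t x. norm x < r --> norm (mollify rho (b t) x) <= M t)"
proof -
 obtain C where C: "C > 0" "!!x. \<bar>rho x\<bar> <= C" using tf_bounded[OF rho] by blast
 obtain r' where r': "r' > 0" "!!w. r' <= norm w ==> rho w = 0" using rho unfolding tf_alt by blast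
 let ?n = "%t y. norm (ind (cball 0 (r + r')) y *R b t y)"
 have i: "Lint (%p. ?n@@p)"
  using integrable_norm[OF bi[of "r + r'"]] by (simp only: case_prod_beta')
 have ni: "Lint (?n t)" for t using bl by (intro integrable_norm) (auto simp: loc_int_def)
 have "norm (mollify rho (b t) x) <= C*(LB y. ?n t y)" if x: "norm x < r" for t x
 proof -
  have "norm (mollify rho (b t) x) = norm (LB y. rho (x - y) *R b t y)"
  unfolding mollify_def by (simp only: integral_tf_reflect[OF bl rho])
  also have "... <= (LB y. norm (rho (x - y) *R b t y))" by (rule integral_norm_bound)
  also have "... <= (LB y. C*?n t y)"
  proof (rule L_mono')
  show "Lint (%y. C*?n t y)" by (intro integrable_mult_right ni)
  show "norm (rho (x - y) *R b t y) <= C*?n t y" for y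
  proof (cases "norm (x - y) < r'")
  case True
  then have "y : cball 0 (r + r')" using x norm_triangle_ineq2[of y x] by (simp add: norm_minus_commute)
  then show ?thesis using C(2)[of "x - y"] by (auto intro!: mult_right_mono)
  next
  case False
  then have "rho (x - y) = 0" using r'(2) by simp
  then show ?thesis using C(1) by (simp add: mult_nonneg_nonneg)
  qed
  show "0 <= C*?n t y" for y using C(1) by (intro mult_nonneg_nonneg) auto
  qed
  finally show ?thesis by simp
 qed
 moreover have "Lint (%t. C*(LB y. ?n t y))"
  by (intro integrable_mult_right st_t[OF i])
 moreover have "0 <= C*(LB y. ?n t y)" for t
  using C(1) by (intro mult_nonneg_nonneg L_nonneg) auto
 ultimately show ?thesis by (intro exI[of _ "%t. C*(LB y. ?n t y)"]) blast
qed

lemma div_prod_close: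
 fixes b :: "real => 'a::euclidean_space => 'a"
 assumes bg: "W11_field b g" and bg': "W11_field b' g'" and adm: "admissible T phi phit D phi0 R C"
  and b': "(NN t. NN x. norm (indc R x *R (b' t x - b t x))) <= en e"
  and g': "!!i. i : Basis ==> (NN t. NN x. norm (indc R x *R (g' i t x - g i t x))) <= en e"
  and e: "0 <= e"
 shows "(NN t. NN x. en \<bar>div_prod b g phi D t x - div_prod b' g' phi D t x\<bar>) <= en (2*real DIM('a)*C*e)"
proof -
 note b = W11_fieldD[OF bg] and b1 = W11_fieldD[OF bg'] and a = admissibleD[OF adm]
 have [measurable (raw)]: "!!i M p q. i : Basis ==> p : bm M ==> q : bm M ==> (%w. g i (p w) (q w)) : bm M"
  "!!i M p q. i : Basis ==> p : bm M ==> q : bm M ==> (%w. g' i (p w) (q w)) : bm M"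
  using meas2[OF b(2)] meas2[OF b1(2)] by blast+
 note [measurable (raw)] = meas2[OF b(1)] meas2[OF b1(1)]
 have C0: "0 <= C" using a(10)[of 0 0] by linarith
 let ?nb = "%t x. norm (indc R x *R (b' t x - b t x))"
 let ?ng = "%i t x. norm (indc R x *R (g' i t x - g i t x))"
 have "(NN t. NN x. en \<bar>div_prod b g phi D t x - div_prod b' g' phi D t x\<bar>)
  <= (NN t. NN x. (SUM i:Basis. en C*(en (?ng i t x) + en (?nb t x))))"
 proof (intro nn_integral_mono)
  fix t x
  have ip: "\<bar>c*((y::'a) \<bullet> i)\<bar> <= C*norm y" if "\<bar>c\<bar> <= C" "i : Basis" for c y i
  unfolding abs_mult using that C0 by (intro mult_mono) (auto intro: Basis_le_norm)
  have deq: "div_prod b g phi D t x - div_prod b' g' phi D t x = (SUM i:Basis. phi t x*((g i t x - g' i t x) \<bullet> i) + D i t x*((b t x - b' t x) \<bullet> i))"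
  unfolding div_prod_def sum_subtractf[symmetric] by (intro sum.cong refl) (simp add: inner_diff_left algebra_simps)
  have "\<bar>div_prod b g phi D t x - div_prod b' g' phi D t x\<bar> <= (SUM i:Basis. C*(?ng i t x + ?nb t x))"
  unfolding deq
  proof (rule order_trans[OF sum_abs], rule sum_mono)
  fix i :: 'a assume i: "i : Basis"
  show "\<bar>phi t x*((g i t x - g' i t x) \<bullet> i) + D i t x*((b t x - b' t x) \<bullet> i)\<bar> <= C*(?ng i t x + ?nb t x)"
  proof (cases "norm x <= R")
  case True
  have "\<bar>phi t x*((g i t x - g' i t x) \<bullet> i) + D i t x*((b t x - b' t x) \<bullet> i)\<bar> <= C*norm (g i t x - g' i t x) + C*norm (b t x - b' t x)"
  by (rule order_trans[OF abs_triangle_ineq add_mono[OF ip[OF a(10) i] ip[OF a(12)[OF i] i]]])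
  then show ?thesis using True by (simp add: norm_minus_commute distrib_left)
  next
  case False
  then show ?thesis using a(14)[of x t] a(16)[OF _ i, of x t] C0 by simp
  qed
  qed
  then have "en \<bar>div_prod b g phi D t x - div_prod b' g' phi D t x\<bar> <= en (SUM i:Basis. C*(?ng i t x + ?nb t x))" by (rule ennreal_leI)
  also have "... = (SUM i:Basis. en (C*(?ng i t x + ?nb t x)))" using C0 by (intro sum_ennreal[symmetric] mult_nonneg_nonneg add_nonneg_nonneg) auto
  also have "... = (SUM i:Basis. en C*(en (?ng i t x) + en (?nb t x)))"
  using C0 by (intro sum.cong refl) (simp only: ennreal_mult ennreal_plus norm_ge_zero add_nonneg_nonneg)
  finally show "en \<bar>div_prod b g phi D t x - div_prod b' g' phi D t x\<bar> <= (SUM i:Basis. en C*(en (?ng i t x) + en (?nb t x)))" .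
 qed
 also have "... = (SUM i:Basis. en C*((NN t. NN x. en (?ng i t x)) + (NN t. NN x. en (?nb t x))))"
  by (simp add: nn_integral_sum nn_integral_add nn_integral_cmult del: norm_scaleR)
 also have "... <= (SUM i:(Basis::'a set). en C*(en e + en e))"
  by (intro sum_mono mult_left_mono add_mono b' g') auto
 also have "... = en (real DIM('a)*(C*(e + e)))"
  using C0 e by (simp add: ennreal_of_nat_eq_real_of_nat flip: ennreal_plus ennreal_mult)
 also have "real DIM('a)*(C*(e + e)) = 2*real DIM('a)*C*e" by simp
 finally show ?thesis .
qed

text \<open>The bound \<open>K\<close> of the approximate solutions comes from the data alone, hence
  is uniform in the mollification, while \<open>div (phi b)\<close> converges in the mean for each
  test function.\<close>

lemma existence_nonneg:
 fixes b :: "real => 'a::euclidean_space => 'a"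
 assumes bg: "W11_field b g" and bz: "!!t x. t ~: {0<..<T} ==> b t x = 0"
  and u0: "u0 : BM" "!!x. 0 <= u0 x" "!!x. u0 x <= K"
 shows "EX u. jm u & (ALL t x. \<bar>u t x\<bar> <= K) & clean_solution T b g u0 u"
proof -
 note b = W11_fieldD[OF bg]
 have K0: "0 <= K" using u0(2,3) by (rule order_trans)
 have bl: "loc_int (b t)" and gl: "i : Basis ==> loc_int (g i t)" for t i using b(5)[of t] by (auto simp: weak_grad_def)
 obtain Crho where "!!eps. eps > 0 ==> EX rho::'a => real. mollifier eps Crho rho" using mollifier_exists by blast
 then have "ALL n. EX rho::'a => real. mollifier (1 / (real n + 1)) Crho rho" by simp
 then obtain rho :: "nat => 'a => real" where rho: "!!n. mollifier (1 / (real n + 1)) Crho (rho n)" by (meson choice)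
 have rhot: "tf (rho n)" for n using rho[of n] by (simp add: mollifier_def)
 define b' where "b' = (%n t. mollify (rho n) (b t))"
 define g' where "g' = (%n i t. mollify (rho n) (g i t))"
 have bg': "W11_field (b' n) (g' n)" for n unfolding b'_def g'_def by (rule W11_field_mollify[OF bg rhot])
 have "EX u. jm u & (ALL t x. \<bar>u t x\<bar> <= K) & clean_solution T (b' n) (g' n) u0 u" for n
 proof (rule existence_locally_bounded[OF bg' _ _ u0])
  show "b' n t x = 0" if "t ~: {0<..<T}" for t x using bz[OF that] by (simp add: b'_def mollify_def)
  show "EX M. Lint M & (ALL t. 0 <= M t) & (ALL t x. norm x < r --> norm (b' n t x) <= M t)" for r
  unfolding b'_def by (rule mollify_locally_bounded[OF b(1) b(3) bl rhot])
 qed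
 then have "EX u. ALL n. jm (u n) & (ALL t x. \<bar>u n t x\<bar> <= K) & clean_solution T (b' n) (g' n) u0 (u n)"
  by (intro choice allI)
 then obtain u where u: "!!n. jm (u n)" "!!n t x. \<bar>u n t x\<bar> <= K"
  "!!n. clean_solution T (b' n) (g' n) u0 (u n)" by blast
 show ?thesis
 proof (rule clean_solution_limit[OF bg u(1,2)])
  fix phi phit :: "real => 'a => real" and D phi0 R C assume adm: "admissible T phi phit D phi0 R C"
  note a = admissibleD[OF adm]
  have C0: "0 <= C" using a(10)[of 0 0] by linarith
  show "(%n. LB p. u n@@p*(phit@@p + div_prod b g phi D@@p))
  ----> - (LB x. u0 x*phi0 x)"
  proof (rule LIMSEQ_I)
  fix e :: real assume e: "0 < e"
  \<comment> \<open>\<open>A\<close> strictly exceeds the factor \<open>2 n C K\<close> of the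
    error; the final 1 keeps it positive when \<open>C\<close> is 0.\<close>
  define A where "A = 2*real DIM('a)*C*(K + 1) + 1"
  have A: "0 < A" "K*(2*real DIM('a)*C) < A" proof -
  have "0 <= real DIM('a)*C" "0 <= real DIM('a)*C*K" using C0 K0 by auto
  moreover have "A = 2*(real DIM('a)*C*K) + 2*(real DIM('a)*C) + 1" "K*(2*real DIM('a)*C) = 2*(real DIM('a)*C*K)"
  by (simp_all add: A_def algebra_simps)
  ultimately show "0 < A" "K*(2*real DIM('a)*C) < A" by linarith+
  qed
  define e' where "e' = e / A"
  have e': "0 < e'" using e A by (simp add: e'_def)
  obtain d0 where d0: "d0 > 0" "!!eps C rho. eps < d0 ==> mollifier eps C rho ==> (NN t. NN x. norm (indc R x *R (mollify rho (b t) x - b t x))) <= en e'"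
  using mollify_close[OF b(1) b(3) bl e', of R] by blast
  have "ALL i:Basis. EX d>0. ALL eps C rho. eps < d & mollifier eps C rho --> (NN t. NN x. norm (indc R x *R (mollify rho (g i t) x - g i t x))) <= en e'"
  using mollify_close[OF b(2) b(4) gl e', of _ R] by blast
  from bchoice[OF this] obtain d where d: "!!i. i : Basis ==> d i > 0"
  "!!i eps C rho. i : Basis ==> eps < d i ==> mollifier eps C rho ==> (NN t. NN x. norm (indc R x *R (mollify rho (g i t) x - g i t x))) <= en e'"
  by blast
  define del0 where "del0 = min d0 (Min (d ` Basis))"
  have del0: "del0 > 0" "del0 <= d0" "!!i. i : Basis ==> del0 <= d i" using d(1) d0(1) by (auto simp: del0_def intro: min.coboundedI2)
  have "(%n. 1 / (real n + 1)) ----> 0" by real_asymp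
  then have "\<forall>\<^sub>F n in sequentially. 1 / (real n + 1) < del0" using del0(1) by (intro order_tendstoD(2)) auto
  then obtain n0 where n0: "!!n. n0 <= n ==> 1 / (real n + 1) < del0" by (auto simp: eventually_sequentially)
  show "EX no. ALL n>=no. norm ((LB p. u n@@p*(phit@@p + div_prod b g phi D@@p)) - - (LB x. u0 x*phi0 x)) < e"
  proof (intro exI[of _ n0] allI impI)
  fix n assume n: "n0 <= n"
  have "(NN t. NN x. en \<bar>div_prod b g phi D t x - div_prod (b' n) (g' n) phi D t x\<bar>) <= en (2*real DIM('a)*C*e')"
  proof (rule div_prod_close[OF bg bg' adm])
  show "(NN t. NN x. norm (indc R x *R (b' n t x - b t x))) <= en e'"
  unfolding b'_def by (rule d0(2)[OF _ rho]) (use n0[OF n] del0(2) in linarith)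
  show "(NN t. NN x. norm (indc R x *R (g' n i t x - g i t x))) <= en e'" if "i : Basis" for i
  unfolding g'_def by (rule d(2)[OF that _ rho]) (use n0[OF n] del0(3)[OF that] in linarith)
  qed (use e' in simp)
  then have le: "(NN t. NN x. en \<bar>(phit t x + div_prod b g phi D t x) - (phit t x + div_prod (b' n) (g' n) phi D t x)\<bar>) <= en (2*real DIM('a)*C*e')"
  by simp
  have i: "Lint (%p. phit@@p + div_prod b g phi D@@p)"
  using admissible_integrable[OF bg adm] by simp
  have Gm: "case_prod (%t x. phit t x + div_prod (b' n) (g' n) phi D t x) : BM"
  proof -
  note [measurable (raw)] = meas2[OF div_prod_measurable[OF bg' adm]] meas2[OF a(2)]
  show ?thesis unfolding meas2_iff by measurable
  qed
  have e2: "0 <= 2*real DIM('a)*C*e'" using e' C0 by simp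
  have "\<bar>(LB p. u n@@p*(phit@@p + div_prod b g phi D@@p))
  - (LB p. u n@@p*(phit@@p + div_prod (b' n) (g' n) phi D@@p))\<bar> <= K*(2*real DIM('a)*C*e')"
  by (rule spacetime_integral_diff_le(2)[where F="%t x. phit t x + div_prod b g phi D t x" and G="%t x. phit t x + div_prod (b' n) (g' n) phi D t x", OF u(1,2) i Gm le e2])
  also have "K*(2*real DIM('a)*C*e') = (K*(2*real DIM('a)*C))*e'" by simp
  also have "... < A*e'" using A(2) e' by (intro mult_strict_right_mono)
  also have "A*e' = e" using A(1) by (simp add: e'_def)
  finally show "norm ((LB p. u n@@p*(phit@@p + div_prod b g phi D@@p)) - - (LB x. u0 x*phi0 x)) < e"
  using u(3)[of n] adm unfolding clean_solution_def by auto
  qed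
  qed
 qed
qed

text \<open>The scheme was set up for nonnegative data. By linearity the positive and negative parts
  are solved separately, which doubles the bound.\<close>

lemma clean_solution_exists:
 fixes b :: "real => 'a::euclidean_space => 'a"
 assumes bg: "W11_field b g" and bz: "!!t x. t ~: {0<..<T} ==> b t x = 0"
  and u0: "u0 : BM" "!!x. \<bar>u0 x\<bar> <= K"
 shows "EX u. jm u & (ALL t x. \<bar>u t x\<bar> <= 2*K) & clean_solution T b g u0 u"
proof -
 note [measurable] = u0(1)
 have K0: "0 <= K" using u0(2)[of 0] by linarith
 let ?p = "%x. max 0 (u0 x)" and ?q = "%x. max 0 (- u0 x)"
 have pm: "?p : BM" "?q : BM" by measurable
 have pb: "?p x <= K" "?q x <= K" for x using u0(2)[of x] K0 by auto
 obtain v where v: "jm v" "!!t x. \<bar>v t x\<bar> <= K" "clean_solution T b g ?p v"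
 proof -
  have "EX u. jm u & (ALL t x. \<bar>u t x\<bar> <= K) & clean_solution T b g ?p u"
  by (rule existence_nonneg[OF bg bz pm(1) _ pb(1)]) auto
  then show thesis using that by blast
 qed
 obtain w where w: "jm w" "!!t x. \<bar>w t x\<bar> <= K" "clean_solution T b g ?q w"
 proof -
  have "EX u. jm u & (ALL t x. \<bar>u t x\<bar> <= K) & clean_solution T b g ?q u"
  by (rule existence_nonneg[OF bg bz pm(2) _ pb(2)]) auto
  then show thesis using that by blast
 qed
 note [measurable (raw)] = meas2[OF v(1)] meas2[OF w(1)]
 show ?thesis
 proof (intro exI[of _ "%t x. v t x - w t x"] conjI allI)
  show "jm (%t x. v t x - w t x)" unfolding meas2_iff by measurable
  show "\<bar>v t x - w t x\<bar> <= 2*K" for t x using v(2)[of t x] w(2)[of t x] by linarith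
  show "clean_solution T b g u0 (%t x. v t x - w t x)" unfolding clean_solution_def
  proof (intro allI impI)
  fix phi phit :: "real => 'a => real" and D phi0 R C assume adm: "admissible T phi phit D phi0 R C"
  note ad = adm[unfolded admissible_def]
  have [measurable]: "phi0 : BM" using ad by blast
  let ?f = "%p. phit@@p + div_prod b g phi D@@p"
  have fi: "Lint ?f" using admissible_integrable[OF bg adm] by simp
  have vm: "(%p. v@@p) : BM" "(%p. w@@p) : BM" by measurable
  have i0: "Lint phi0"
  by (rule integrable_bounded_support[where C=C and r=R]) (use ad in auto)
  have "(LB p. (v@@p - w@@p)*?f p) = (LB p. v@@p*?f p) - (LB p. w@@p*?f p)"
  unfolding left_diff_distrib
  by (rule L_diff[OF Lint_mult[OF fi vm(1) v(2)] Lint_mult[OF fi vm(2) w(2)]])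
  also have "... = - (LB x. ?p x*phi0 x) + (LB x. ?q x*phi0 x)"
  proof -
  have "(LB p. v@@p*?f p) = - (LB x. ?p x*phi0 x)"
  using v(3) adm unfolding clean_solution_def by blast
  moreover have "(LB p. w@@p*?f p) = - (LB x. ?q x*phi0 x)"
  using w(3) adm unfolding clean_solution_def by blast
  ultimately show ?thesis by linarith
  qed
  also have "... = - ((LB x. ?p x*phi0 x) - (LB x. ?q x*phi0 x))" by simp
  also have "(LB x. ?p x*phi0 x) - (LB x. ?q x*phi0 x) = (LB x. ?p x*phi0 x - ?q x*phi0 x)"
  by (rule L_diff[symmetric, OF Lint_mult[where K=K, OF i0 pm(1)] Lint_mult[where K=K, OF i0 pm(2)]])
  (use pb in \<open>auto simp: abs_if\<close>)
  also have "(%x. ?p x*phi0 x - ?q x*phi0 x) = (%x. u0 x*phi0 x)" by (auto simp: max_def left_diff_distrib[symmetric])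
  finally show "(LB p. (v@@p - w@@p)*?f p) = - (LB x. u0 x*phi0 x)" .
  qed
 qed
qed

section \<open>Averages over shifts and moments of mollifiers\<close>

text \<open>Tonelli reduces an average over shifts to a bound for each single shift, asked for only
  where the kernel is nonzero, that is, for small shifts.\<close>

lemma weighted_nn_integral_le:
 fixes N :: "'a::euclidean_space => real => 'b::euclidean_space => ennreal"
 assumes N: "(%(w, t, x). N w t x) : bm (borel \<Otimes>\<^sub>M (borel \<Otimes>\<^sub>M borel))"
  and [measurable]: "kap : BM"
  and B: "!!w. kap w ~= 0 ==> (NN t. NN x. N w t x) <= B w"
 shows "(NN t. NN x. NN w. kap w*N w t x) <= (NN w. kap w*B w)"
proof -
 have [measurable (raw)]: "(%z. N (f z) (g z) (h z)) : bm M"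
  if "f : bm M" "g : bm M" "h : bm M" for f g h and M :: "'z measure"
  using measurable_compose[OF measurable_Pair[OF that(1) measurable_Pair[OF that(2,3)]] N] by simp
 have "(NN t. NN x. NN w. kap w*N w t x) = (NN t. NN w. NN x. kap w*N w t x)"
  by (intro nn_integral_cong lborel_pair.Fubini') measurable
 also have "... = (NN w. NN t. NN x. kap w*N w t x)"
  by (intro lborel_pair.Fubini') measurable
 also have "... = (NN w. kap w*(NN t. NN x. N w t x))"
  by (simp add: nn_integral_cmult)
 also have "... <= (NN w. kap w*B w)"
 proof (rule nn_integral_mono)
  fix w show "kap w*(NN t. NN x. N w t x) <= kap w*B w"
  by (cases "kap w = 0") (use B[of w] in \<open>auto intro!: mult_left_mono\<close>)
 qed
 finally show ?thesis .
qed

text \<open>The convolution of \<open>psi\<close> with the constant 1 does not depend on the point,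
  so its derivative, the integral in question up to a reflection, is zero.\<close>

lemma integral_frechet_test_function:
 fixes psi :: "'a::euclidean_space => real"
 assumes "tf psi" shows "(LB x. FD psi (at x) h) = 0"
proof -
 have m: "(%x. FD psi (at x) h) : BM" "psi : BM"
  using tf_measurable[OF tf_FD[OF assms]] tf_measurable[OF assms] by auto
 have "((%x. LB y. psi (x - y)*1) has_derivative (%h. LB y. FD psi (at (x - y)) h*1)) (at x)" for x
  by (rule conv_has_derivative[OF assms, where K=1]) auto
 from this[of 0] have "((%x::'a. LB y. psi y) has_derivative (%h. LB y. FD psi (at (0 - y)) h)) (at 0)"
  by (simp add: integral_lborel_reflect[OF m(2)])
 moreover have "((%x::'a. LB y. psi y) has_derivative (%h. 0)) (at 0)" by simp
 ultimately have "(%h. LB y. FD psi (at (0 - y)) h) = (%h. 0)" by (rule has_derivative_unique)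
 from fun_cong[OF this, of h] show ?thesis using integral_lborel_reflect[OF m(1), of 0] by simp
qed

lemma smooth_on_inner: "smooth_on S (%x::'a::euclidean_space. x \<bullet> j)"
 unfolding smooth_on_def by (intro allI Ck_on_bounded_linear bounded_linear_inner_left)

text \<open>The derivative of \<open>(w \<bullet> j) * rho w\<close> has integral zero. These
  moments are what makes the linear part of \<open>b\<close> cancel against the divergence in the
  commutator.\<close>

lemma mollifier_moment:
 fixes rho :: "'a::euclidean_space => real"
 assumes rho: "tf rho" and i: "i : Basis"
 shows "Lint (%w. FD rho (at w) i*(w \<bullet> j))"
  and "(LB w. FD rho (at w) i*(w \<bullet> j)) = - (i \<bullet> j)*(LB w. rho w)"
proof -
 have s: "smooth_on UNIV rho" using rho by (simp add: test_function_def)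
 have t: "tf (%w. (w \<bullet> j)*rho w)" by (rule tf_mult_smooth[OF rho smooth_on_inner])
 have d: "FD (%w. w \<bullet> j) (at x) i = i \<bullet> j" for x :: 'a
  by (subst frechet_derivative_at[symmetric, of "%w. w \<bullet> j" "%h. h \<bullet> j"]) (auto intro!: derivative_eq_intros)
 have i1: "Lint (%w. (w \<bullet> j)*FD rho (at w) i)"
  by (rule tf_integrable[OF tf_mult_smooth[OF tf_FD[OF rho] smooth_on_inner]])
 then show "Lint (%w. FD rho (at w) i*(w \<bullet> j))" by (simp add: mult.commute)
 have i2: "Lint (%w. (i \<bullet> j)*rho w)" using tf_integrable[OF rho] by simp
 have "0 = (LB w. (w \<bullet> j)*FD rho (at w) i + (i \<bullet> j)*rho w)"
  using integral_frechet_test_function[OF t, of i] by (simp add: FD_mult[OF smooth_on_inner s] d)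
 also have "... = (LB w. (w \<bullet> j)*FD rho (at w) i) + (i \<bullet> j)*(LB w. rho w)"
  using L_add[OF i1 i2] by simp
 finally show "(LB w. FD rho (at w) i*(w \<bullet> j)) = - (i \<bullet> j)*(LB w. rho w)"
  by (simp add: mult.commute)
qed

section \<open>The commutator and renormalization\<close>

definition field_div :: "('a::euclidean_space => real => 'a => 'a) => real => 'a => real" where
 "field_div g t x = (SUM i:Basis. g i t x \<bullet> i)"

lemma loc_int_sum: "finite A ==> (!!i. i : A ==> loc_int (f i)) ==> loc_int (%x. SUM i:A. f i x)"
proof (induction A rule: finite_induct)
 case empty then show ?case by (simp add: loc_int_def)
next
 case (insert a A) then show ?case using loc_int_add[of "f a" "%x. SUM i:A. f i x"] by simp
qed

lemma field_div_props:
 assumes bg: "W11_field b g"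
 shows "jm (field_div g)" "loc_int (field_div g t)"
  "Lint (%(t, x). indc r x *R field_div g t x)"
proof -
 note b = W11_fieldD[OF bg]
 show "jm (field_div g)"
 proof -
  have [measurable (raw)]: "(%p. g i@@p) : bm (borel \<Otimes>\<^sub>M borel)" if "i : Basis" for i
  using b(2)[OF that] by (simp add: meas2_iff)
  show ?thesis unfolding meas2_iff field_div_def by measurable
 qed
 have l: "loc_int (g i t)" if "i : Basis" for i using b(5)[of t] that by (auto simp: weak_grad_def)
 have "loc_int (%x. SUM i:Basis. 1*(g i t x \<bullet> i))" by (intro loc_int_sum loc_int_mult_inner[OF l]) auto
 then show "loc_int (field_div g t)" by (simp add: field_div_def[abs_def])
 have "Lint (%p. SUM i:Basis. (case_prod (%t x. indc r x *R g i t x) p) \<bullet> i)"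
  by (intro I_sum integrable_inner_left b(4))
 then show "Lint (%(t, x). indc r x *R field_div g t x)"
  by (simp add: field_div_def case_prod_beta' sum_distrib_left)
qed

text \<open>The commutator of mollification with the transport operator; \<open>transport_part\<close> is the mollified
 distribution \<open>v div b - div (b v)\<close>, i.e. \<open>-b \<cdot> \<nabla>v\<close>.\<close>

definition transport_part where
 "transport_part rho b g v t x = mollify rho (%y. v t y*field_div g t y) x
  + (SUM i:Basis. - mollify (%w. FD rho (at w) i) (%y. v t y*(b t y \<bullet> i)) x)"

definition commutator where
 "commutator rho b g v t x = transport_part rho b g v t x
  + (SUM i:Basis. (b t x \<bullet> i)*mollify (%w. FD rho (at w) i) (v t) x)"

lemma loc_int_bounded:
 fixes v :: "'a::euclidean_space => real"
 assumes [measurable]: "v : BM" and "!!x. \<bar>v x\<bar> <= K"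
 shows "loc_int v"
proof -
 have "Lint (%x. indc r x *R v x)" for r
  by (rule integrable_bounded_support[where C=K and r="r+1"])
  (use assms(2) order_trans[OF abs_ge_zero assms(2)] in \<open>auto simp: indicator_def\<close>)
 then show ?thesis using assms by (simp add: loc_int_def)
qed

lemma mollify_integrand_integrable:
 fixes f :: "'a::euclidean_space => 'b::euclidean_space"
 assumes f: "loc_int f" and rho: "tf rho"
 shows "Lint (%w. rho w *R f (x - w))"
proof -
 have [measurable]: "f : BM" "rho : BM"
  using f tf_measurable[OF rho] by (auto simp: loc_int_def)
 show ?thesis
  using integrable_lborel_reflect_iff[of "%y. rho (x - y) *R f y" x] loc_int_tf[OF f tf_reflect[OF rho]] by simp
qed

lemma commutator_bound:
 fixes b :: "real => 'a::euclidean_space => 'a"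
 assumes bg: "W11_field b g" and vm: "v t : BM" and K: "!!x. \<bar>v t x\<bar> <= K" and rho: "mollifier eps C rho"
 defines "q \<equiv> %w. SUM i:Basis. \<bar>FD rho (at w) i\<bar>"
 shows "en \<bar>commutator rho b g v t x\<bar> <=
  (NN w. en (rho w)*en (K*\<bar>field_div g t (x - w) - field_div g t x\<bar>))
  + (NN w. en (q w)*en (K*norm (b t (x - w) - b t x - (SUM j:Basis. (- w \<bullet> j) *R g j t x))))
  + (NN w. en (rho w + norm w*q w)*en (\<bar>v t (x - w) - v t x\<bar>*(SUM j:Basis. norm (g j t x))))"
proof -
 have rhot: "tf rho" and rho0: "!!x. 0 <= rho x" and rhoI: "(LB x. rho x) = 1" using rho by (auto simp: mollifier_def)
 have K0: "0 <= K" using K[of 0] by linarith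
 note W = W11_fieldD[OF bg]
 let ?d = "field_div g t"
 let ?r = "%i w. FD rho (at w) i"
 have bl: "loc_int (b t)" and gl: "i : Basis ==> loc_int (g i t)" for i using W(5)[of t] by (auto simp: weak_grad_def)
 note dl = field_div_props(2)[OF bg, of t]
 have [measurable]: "rho : BM" "b t : BM" "field_div g t : BM"
  using tf_measurable[OF rhot] bl dl by (auto simp: loc_int_def)
 note [measurable] = vm
 have [measurable]: "(%w. FD rho (at w) i) : BM" for i
  by (rule tf_measurable[OF tf_FD[OF rhot]])
 have vd: "loc_int (%y. v t y*?d y)" using loc_int_mult_inner[OF dl vm K, of 1] by simp
 have vb: "loc_int (%y. v t y*(b t y \<bullet> i))" for i by (rule loc_int_mult_inner[OF bl vm K])
 have vl: "loc_int (v t)" by (rule loc_int_bounded[OF vm K])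
 \<comment> \<open>The first-order part of \<open>b t x - b t (x - w)\<close>.\<close>
 define S where "S = (%w. SUM j:Basis. (w \<bullet> j) *R g j t x)"
 define I1 where "I1 = (%w. rho w*(v t (x - w)*?d (x - w)) + (SUM i:Basis. ?r i w * v t (x - w)*((b t x - b t (x - w)) \<bullet> i)))"
 define Th where "Th = (%w. rho w*?d x + (SUM i:Basis. ?r i w*(S w \<bullet> i)))"
 have j1: "Lint (%w. rho w*(v t (x - w)*?d (x - w)))"
  using mollify_integrand_integrable[OF vd rhot, of x] by simp
 have j2: "Lint (%w. ?r i w*(v t (x - w)*(b t (x - w) \<bullet> i)))" for i
  using mollify_integrand_integrable[where x=x, OF vb[of i] tf_FD[OF rhot, of i]] by simp
 have j3: "Lint (%w. ?r i w * v t (x - w))" for i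
  using mollify_integrand_integrable[where x=x, OF vl tf_FD[OF rhot, of i]] by simp
 have eqi: "?r i w * v t (x - w)*((b t x - b t (x - w)) \<bullet> i) = (b t x \<bullet> i)*(?r i w * v t (x - w)) - ?r i w*(v t (x - w)*(b t (x - w) \<bullet> i))" for i w
  by (simp add: algebra_simps)
 have j4: "Lint (%w. ?r i w * v t (x - w)*((b t x - b t (x - w)) \<bullet> i))" for i
  unfolding eqi by (intro I_diff integrable_mult_right j2 j3)
 have v4: "(LB w. ?r i w * v t (x - w)*((b t x - b t (x - w)) \<bullet> i))
  = (b t x \<bullet> i)*(LB w. ?r i w * v t (x - w)) - (LB w. ?r i w*(v t (x - w)*(b t (x - w) \<bullet> i)))" for i
  unfolding eqi using L_diff[OF integrable_mult_right[OF j3] j2] by simp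
 have I1i: "Lint I1" unfolding I1_def by (intro I_add j1 I_sum j4)
 have I1v: "(LB w. I1 w) = commutator rho b g v t x"
  unfolding I1_def L_add[OF j1 I_sum[OF j4]] L_sum[OF j4] v4
  by (simp add: commutator_def transport_part_def mollify_def sum_subtractf sum_negf)
 have eqT: "?r i w*(S w \<bullet> i) = (SUM j:Basis. (g j t x \<bullet> i)*(?r i w*(w \<bullet> j)))" for i w
  by (simp add: S_def inner_sum_left sum_distrib_left algebra_simps)
 have t1: "Lint (%w. ?r i w*(S w \<bullet> i))" if "i : Basis" for i
  unfolding eqT by (intro I_sum integrable_mult_right mollifier_moment(1)[OF rhot that])
 have t2: "(LB w. ?r i w*(S w \<bullet> i)) = - (g i t x \<bullet> i)" if i: "i : Basis" for i
 proof -
  have "(LB w. ?r i w*(S w \<bullet> i)) = (SUM j:Basis. (g j t x \<bullet> i)*(LB w. ?r i w*(w \<bullet> j)))"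
  unfolding eqT
  by (subst L_sum) (auto intro!: integrable_mult_right mollifier_moment(1)[OF rhot i])
  also have "... = (SUM j:Basis. (if j = i then - (g i t x \<bullet> i) else 0))"
  unfolding mollifier_moment(2)[OF rhot i] rhoI using i by (intro sum.cong refl) (auto simp: inner_Basis)
  also have "... = - (g i t x \<bullet> i)" using i by simp
  finally show ?thesis .
 qed
 have t0: "Lint (%w. rho w*?d x)" using tf_integrable[OF rhot] by simp
 have Thi: "Lint Th" unfolding Th_def by (intro I_add t0 I_sum t1)
 have Thv: "(LB w. Th w) = 0"
 proof -
  have "(LB w. Th w) = (LB w. rho w*?d x) + (SUM i:Basis. LB w. ?r i w*(S w \<bullet> i))"
  unfolding Th_def by (subst L_add[OF t0 I_sum[OF t1]])
  (auto simp: L_sum[OF t1])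
  also have "... = ?d x + (SUM i:Basis. - (g i t x \<bullet> i))" using t2 rhoI by simp
  finally show ?thesis by (simp add: field_div_def sum_negf)
 qed
 have req: "commutator rho b g v t x = (LB w. I1 w - v t x*Th w)"
  using L_diff[OF I1i integrable_mult_right[OF Thi, of "v t x"]] I1v Thv by simp
 have sumle: "\<bar>SUM i:Basis. ?r i w*(z \<bullet> i)\<bar> <= q w*norm z" for w z
 proof -
  have "\<bar>SUM i:Basis. ?r i w*(z \<bullet> i)\<bar> <= (SUM i:Basis. \<bar>?r i w\<bar>*norm z)"
  by (rule order_trans[OF sum_abs]) (auto simp: abs_mult intro!: sum_mono mult_left_mono Basis_le_norm)
  then show ?thesis by (simp add: q_def sum_distrib_right)
 qed
 have q0: "0 <= q w" for w unfolding q_def by (intro sum_nonneg) auto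
 define Gs where "Gs = (SUM j:Basis. norm (g j t x))"
 have Gs0: "0 <= Gs" unfolding Gs_def by (intro sum_nonneg) auto
 have dGs: "\<bar>?d x\<bar> <= Gs" unfolding field_div_def Gs_def by (rule order_trans[OF sum_abs]) (intro sum_mono Basis_le_norm)
 have SGs: "norm (S w) <= norm w*Gs" for w
  unfolding S_def Gs_def sum_distrib_left
  by (rule order_trans[OF norm_sum]) (auto intro!: sum_mono mult_right_mono Basis_le_norm)
 have Thle: "\<bar>Th w\<bar> <= (rho w + norm w*q w)*Gs" for w
 proof -
  have "\<bar>Th w\<bar> <= rho w*\<bar>?d x\<bar> + q w*norm (S w)" unfolding Th_def
  using sumle[of w "S w"] rho0[of w] abs_triangle_ineq[of "rho w*?d x" "SUM i:Basis. ?r i w*(S w \<bullet> i)"] by (simp add: abs_mult)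
  also have "... <= rho w*Gs + q w*(norm w*Gs)"
  using dGs SGs[of w] rho0[of w] q0[of w] by (intro add_mono mult_left_mono) auto
  finally show ?thesis by (simp add: algebra_simps)
 qed
 let ?A = "%w. rho w*(K*\<bar>?d (x - w) - ?d x\<bar>)"
 let ?B = "%w. q w*(K*norm (b t (x - w) - b t x - (SUM j:Basis. (- w \<bullet> j) *R g j t x)))"
 let ?C = "%w. (rho w + norm w*q w)*(\<bar>v t (x - w) - v t x\<bar>*Gs)"
 have Iw: "\<bar>I1 w - v t x*Th w\<bar> <= ?A w + ?B w + ?C w" for w
 proof -
  define E where "E = b t x - b t (x - w) - S w"
  have nE: "norm E = norm (b t (x - w) - b t x - (SUM j:Basis. (- w \<bullet> j) *R g j t x))"
  proof -
  have "b t (x - w) - b t x - (SUM j:Basis. (- w \<bullet> j) *R g j t x) = - E"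
  by (simp add: E_def S_def sum_negf)
  then show ?thesis by (simp add: norm_minus_cancel)
  qed
  have e1: "I1 w = rho w*(v t (x - w)*?d (x - w)) + v t (x - w)*(SUM i:Basis. ?r i w*((b t x - b t (x - w)) \<bullet> i))"
  unfolding I1_def by (simp add: sum_distrib_left algebra_simps)
  have e2: "(SUM i:Basis. ?r i w*((b t x - b t (x - w)) \<bullet> i)) = (SUM i:Basis. ?r i w*(E \<bullet> i)) + (SUM i:Basis. ?r i w*(S w \<bullet> i))"
  unfolding sum.distrib[symmetric] by (intro sum.cong refl) (simp add: E_def algebra_simps)
  have "I1 w - v t x*Th w = v t (x - w)*(rho w*(?d (x - w) - ?d x)) + v t (x - w)*(SUM i:Basis. ?r i w*(E \<bullet> i)) + (v t (x - w) - v t x)*Th w"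
  unfolding e1 e2 Th_def by (simp add: algebra_simps)
  then have "\<bar>I1 w - v t x*Th w\<bar> <= \<bar>v t (x - w)*(rho w*(?d (x - w) - ?d x))\<bar> + \<bar>v t (x - w)*(SUM i:Basis. ?r i w*(E \<bullet> i))\<bar> + \<bar>(v t (x - w) - v t x)*Th w\<bar>"
  by linarith
  also have "... <= K*(rho w*\<bar>?d (x - w) - ?d x\<bar>) + K*(q w*norm E) + \<bar>v t (x - w) - v t x\<bar>*((rho w + norm w*q w)*Gs)"
  unfolding abs_mult using K[of "x - w"] K0 sumle[of w E] Thle[of w] rho0[of w]
  by (intro add_mono mult_mono) (auto simp: q0)
  also have "... = ?A w + ?B w + ?C w" unfolding nE by (simp add: algebra_simps)
  finally show ?thesis .
 qed
 have [measurable]: "q : BM" unfolding q_def by measurable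
 have "en \<bar>commutator rho b g v t x\<bar> <= (NN w. en \<bar>I1 w - v t x*Th w\<bar>)"
  unfolding req using norm_LB_le[of lborel "%w. I1 w - v t x*Th w"] by simp
 also have "... <= (NN w. en (?A w) + en (?B w) + en (?C w))"
 proof (rule nn_integral_mono)
  fix w
  have "0 <= ?A w" "0 <= ?B w" "0 <= ?C w" using rho0[of w] q0[of w] K0 Gs0 by auto
  then show "en \<bar>I1 w - v t x*Th w\<bar> <= en (?A w) + en (?B w) + en (?C w)"
  using Iw[of w] by (simp flip: ennreal_plus add: ennreal_leI)
 qed
 also have "... = (NN w. en (?A w)) + (NN w. en (?B w)) + (NN w. en (?C w))"
  by (simp add: nn_integral_add)
 finally show ?thesis using rho0 q0 K0 Gs0 unfolding Gs_def[symmetric] by (simp add: ennreal_mult)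
qed

lemma mollify_bounded:
 fixes v :: "'a::euclidean_space => real"
 assumes vm: "v : BM" and K: "!!x. \<bar>v x\<bar> <= K" and rho: "mollifier eps C rho"
 shows "\<bar>mollify rho v x\<bar> <= K"
proof -
 have rhot: "tf rho" and rho0: "!!x. 0 <= rho x" and rhoI: "(LB x. rho x) = 1" using rho by (auto simp: mollifier_def)
 have "\<bar>mollify rho v x\<bar> <= (LB w. rho w*K)" unfolding mollify_def
 proof (rule order_trans[OF integral_abs_bound integral_mono])
  show "Lint (%w. \<bar>rho w *R v (x - w)\<bar>)"
  using mollify_integrand_integrable[OF loc_int_bounded[OF vm K] rhot] by (rule integrable_abs)
  show "Lint (%w. rho w*K)" using tf_integrable[OF rhot] by simp
  show "\<bar>rho w *R v (x - w)\<bar> <= rho w*K" for w using rho0[of w] K[of "x - w"] by (auto simp: abs_mult intro!: mult_left_mono)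
 qed
 then show ?thesis using rhoI by simp
qed

text \<open>The uniform bound on \<open>v\<close> allows a weight \<open>F\<close> that is merely
  integrable; it will be \<open>div (psi b)\<close> as well as a test function.\<close>

lemma mollify_bounded_close:
 fixes v F :: "real => 'a::euclidean_space => real"
 assumes vm: "jm v" and K: "!!t x. \<bar>v t x\<bar> <= K"
  and F: "Lint (%p. F@@p)" and e: "0 < e"
 shows "EX del0>0. ALL eps C rho. eps < del0 & mollifier eps C rho -->
  (NN t. NN x. en (\<bar>mollify rho (v t) x - v t x\<bar>*\<bar>F t x\<bar>)) <= en e"
proof -
 have F': "Lint (case_prod F)" using F by (simp add: case_prod_beta')
 have Fm: "jm F" using F' by (auto dest: Lint_meas)
 note [measurable (raw)] = meas2[OF Fm] meas2[OF vm]
 obtain del0 where del0: "del0 > 0" "!!w. norm w < del0 ==> (NN t. NN x. norm ((v t (x + w) - v t x) *R F t x)) <= en e"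
  using st_bounded_translation[OF F' vm K e] by blast
 have "(NN t. NN x. en (\<bar>mollify rho (v t) x - v t x\<bar>*\<bar>F t x\<bar>)) <= en e"
  if H: "eps < del0 & mollifier eps C rho" for eps C rho
 proof -
  from H have rhot: "tf rho" and rho0: "!!x. 0 <= rho x" and rho1: "!!x. eps <= norm x ==> rho x = 0"
  and rhoI: "(LB x. rho x) = 1" by (auto simp: mollifier_def)
  have [measurable]: "rho : BM" using tf_measurable[OF rhot] .
  let ?N = "%w t x. en (norm ((v t (x + - w) - v t x) *R F t x))"
  have "en (\<bar>mollify rho (v t) x - v t x\<bar>*\<bar>F t x\<bar>) <= (NN w. en (rho w)*?N w t x)" for t x
  proof -
  have vt: "v t : BM" by measurable
  note i1 = mollify_integrand_integrable[OF loc_int_bounded[OF vt K] rhot, of x]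
  have "mollify rho (v t) x - v t x = (LB w. rho w*(v t (x - w) - v t x))"
  using i1 tf_integrable[OF rhot] rhoI by (simp add: mollify_def right_diff_distrib)
  then have eq: "(mollify rho (v t) x - v t x)*F t x = (LB w. rho w*(v t (x - w) - v t x)*F t x)" by simp
  have "en \<bar>(mollify rho (v t) x - v t x)*F t x\<bar> <= (NN w. norm (rho w*(v t (x - w) - v t x)*F t x))"
  unfolding eq using norm_LB_le[of lborel "%w. rho w*(v t (x - w) - v t x)*F t x"] by (simp only: real_norm_def)
  also have "... = (NN w. en (rho w)*?N w t x)"
  using rho0 by (intro nn_integral_cong) (simp add: abs_mult mult.assoc ennreal_mult')
  finally show ?thesis by (simp add: abs_mult)
  qed
  then have "(NN t. NN x. en (\<bar>mollify rho (v t) x - v t x\<bar>*\<bar>F t x\<bar>))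
  <= (NN t. NN x. NN w. en (rho w)*?N w t x)" by (intro nn_integral_mono)
  also have "... <= (NN w. en (rho w)*en e)"
  proof (rule weighted_nn_integral_le)
  fix w :: 'a assume "en (rho w) ~= 0"
  then have "norm (- w) < del0" using rho1[of w] H by force
  then show "(NN t. NN x. ?N w t x) <= en e" by (rule del0(2))
  qed (unfold case_prod_beta', measurable, measurable)
  also have "... = en e" using mollifier_nn_integral[of eps C rho] H by (simp add: nn_integral_multc)
  finally show ?thesis .
 qed
 with del0(1) show ?thesis by blast
qed

lemma mollifier_moment_nn_integral:
 fixes rho :: "'a::euclidean_space => real"
 assumes rho: "mollifier eps C rho"
 defines "q \<equiv> %w. SUM i:Basis. \<bar>FD rho (at w) i\<bar>"
 shows "(NN w. en (norm w*q w)) <= en (real DIM('a)*\<bar>C\<bar>)"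
proof -
 have rhot: "tf rho" and rhoC: "!!i. i : Basis ==> (LB x. norm x*\<bar>FD rho (at x) i\<bar>) <= C"
  using rho by (auto simp: mollifier_def)
 have i: "Lint (%w. norm w*\<bar>FD rho (at w) i\<bar>)" for i
 proof -
  note t = tf_FD[OF rhot, of i]
  note [measurable] = tf_measurable[OF t]
  obtain r where r: "r > 0" "!!x. r <= norm x ==> FD rho (at x) i = 0" using t unfolding tf_alt by blast
  obtain B where B: "B > 0" "!!x. \<bar>FD rho (at x) i\<bar> <= B" using tf_bounded[OF t] by blast
  show ?thesis
  proof (rule integrable_bounded_support[where C="r*B" and r=r])
  show "norm (norm x*\<bar>FD rho (at x) i\<bar>) <= r*B" for x
  by (cases "r <= norm x") (use r B in \<open>auto simp: abs_mult intro!: mult_mono\<close>)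
  qed (use r(2) in auto)
 qed
 have "(NN w. en (norm w*q w)) = en (LB w. norm w*q w)"
  using i unfolding q_def sum_distrib_left
  by (intro nn_integral_eq_integral) (auto intro!: I_sum sum_nonneg)
 also have "(LB w. norm w*q w) = (SUM i:Basis. LB w. norm w*\<bar>FD rho (at w) i\<bar>)"
  unfolding q_def sum_distrib_left by (rule L_sum[OF i])
 also have "... <= (SUM i:(Basis::'a set). \<bar>C\<bar>)" using rhoC by (intro sum_mono) force
 finally show ?thesis by (simp add: ennreal_leI)
qed

text \<open>The increments in all three parts are small by continuity of translations. The gradient
  of \<open>rho\<close> appears without a factor \<open>norm w\<close> only in the second part, and
  there the expansion of \<open>b\<close> supplies \<open>e' * norm w\<close>; the resulting first
  moment is bounded independently of \<open>eps\<close>.\<close>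

lemma commutator_converges:
 fixes b :: "real => 'a::euclidean_space => 'a"
 assumes bg: "W11_field b g" and vm: "jm v" and K: "!!t x. \<bar>v t x\<bar> <= K" and e: "0 < e"
 shows "EX del0>0. ALL eps rho. eps < del0 & mollifier eps C rho -->
  (NN t. NN x. indc R x*en \<bar>commutator rho b g v t x\<bar>) <= en e"
proof -
 note W = W11_fieldD[OF bg]
 note dm = field_div_props(1)[OF bg] and di = field_div_props(3)[OF bg]
 have K0: "0 <= K" using K[of 0 0] by linarith
 define nC where "nC = real DIM('a)*\<bar>C\<bar>"
 \<comment> \<open>The three summands are the coefficients of \<open>e'\<close> in the bounds for
   the three parts.\<close>
 define A where "A = K + K*nC + (1 + nC)"
 have nC0: "0 <= nC" by (simp add: nC_def)
 have A0: "0 < A" using K0 nC0 mult_nonneg_nonneg[OF K0 nC0] unfolding A_def by linarith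
 define e' where "e' = e / A"
 have e': "0 < e'" using e A0 by (simp add: e'_def)
 define G where "G = (%t x. ind (cball 0 (R + 1)) x *R field_div g t x)"
 have Gi: "Lint (case_prod G)" using di[of "R + 1"] by (simp add: G_def)
 have Gm: "jm G" using Gi by (auto dest: Lint_meas)
 define F where "F = (%t x. indc R x*(SUM j:Basis. norm (g j t x)))"
 have Fi: "Lint (case_prod F)"
 proof -
  have "Lint (%p. SUM j:Basis. norm (case p of (t, x) => indc R x *R g j t x))"
  by (intro I_sum integrable_norm W(4))
  then show ?thesis by (simp add: F_def case_prod_beta' sum_distrib_left)
 qed
 have Fm: "jm F" using Fi by (auto dest: Lint_meas)
 note [measurable (raw)] = meas2[OF Fm] meas2[OF vm] meas2[OF Gm]
  meas2[OF dm] meas2[OF W(1)] meas2[OF W(2)]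
 obtain d1 where d1: "d1 > 0" "!!w. norm w < d1 ==> (NN t. NN x. norm (G t (x + w) - G t x)) <= en e'"
  using st_translation[OF Gi e'] by blast
 obtain d2 where d2: "d2 > 0" "!!w. norm w < d2 ==> (NN t. NN x. norm (indc R x *R
  (b t (x + w) - b t x - (SUM i:Basis. (w \<bullet> i) *R g i t x)))) <= en (e'*norm w)"
  using W11_field_difference[OF bg e', of R] by blast
 obtain d3 where d3: "d3 > 0" "!!w. norm w < d3 ==> (NN t. NN x. norm ((v t (x + w) - v t x) *R F t x)) <= en e'"
  using st_bounded_translation[OF Fi vm K e'] by blast
 define del0 where "del0 = min (min d1 d2) (min d3 1)"
 have del0: "del0 > 0" "del0 <= d1" "del0 <= d2" "del0 <= d3" "del0 <= 1" using d1 d2 d3 by (auto simp: del0_def)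
 have main: "(NN t. NN x. indc R x*en \<bar>commutator rho b g v t x\<bar>) <= en e"
  if H: "eps < del0 & mollifier eps C rho" for eps rho
 proof -
  from H have rho: "mollifier eps C rho" and rhot: "tf rho" and rho0: "!!x. 0 <= rho x" and rho1: "!!x. eps <= norm x ==> rho x = 0"
  and rhoI: "(LB x. rho x) = 1" by (auto simp: mollifier_def)
  have [measurable]: "rho : BM" using tf_measurable[OF rhot] .
  have [measurable]: "(%w. FD rho (at w) i) : BM" for i
  by (rule tf_measurable[OF tf_FD[OF rhot]])
  define q where "q = (%w. SUM i:Basis. \<bar>FD rho (at w) i\<bar>)"
  have [measurable]: "q : BM" unfolding q_def by measurable
  have q0: "0 <= q w" for w unfolding q_def by (intro sum_nonneg) auto
  have q1: "q w = 0" if "eps < norm w" for w using FD_eq_0[OF rho1 that] by (simp add: q_def)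
  let ?I = "%x::'a. indc R x :: ennreal"
  let ?A = "%w t x. ?I x*en (K*\<bar>field_div g t (x - w) - field_div g t x\<bar>)"
  let ?B = "%w t x. ?I x*en (K*norm (b t (x - w) - b t x - (SUM j:Basis. (- w \<bullet> j) *R g j t x)))"
  let ?C = "%w t x. ?I x*en (\<bar>v t (x - w) - v t x\<bar>*(SUM j:Basis. norm (g j t x)))"
  have pt: "?I x*en \<bar>commutator rho b g v t x\<bar> <= (NN w. en (rho w)*?A w t x)
  + (NN w. en (q w)*?B w t x) + (NN w. en (rho w + norm w*q w)*?C w t x)" for t x
  proof -
  have vt: "v t : BM" by measurable
  show ?thesis
  using commutator_bound[where v=v and t=t and x=x and K=K, OF bg vt K rho] by (cases "x : cball 0 R") (simp_all add: q_def)
  qed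
  have "(NN t. NN x. ?I x*en \<bar>commutator rho b g v t x\<bar>)
  <= (NN t. NN x. (NN w. en (rho w)*?A w t x)
  + (NN w. en (q w)*?B w t x) + (NN w. en (rho w + norm w*q w)*?C w t x))"
  by (intro nn_integral_mono pt)
  also have "... = (NN t. NN x. NN w. en (rho w)*?A w t x)
  + (NN t. NN x. NN w. en (q w)*?B w t x)
  + (NN t. NN x. NN w. en (rho w + norm w*q w)*?C w t x)"
  by (simp add: nn_integral_add)
  also have "... <= en (K*e') + en (K*nC*e') + en ((1 + nC)*e')"
  proof (intro add_mono)
  have "(NN t. NN x. NN w. en (rho w)*?A w t x) <= (NN w. en (rho w)*(en K*en e'))"
  proof (rule weighted_nn_integral_le)
  fix w :: 'a assume "en (rho w) ~= 0"
  then have "norm w < eps" using rho1[of w] by force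
  then have w: "norm (- w) < d1" "norm w < 1" using H del0 by auto
  have "(NN t. NN x. ?A w t x) <= (NN t. NN x. en K*en (norm (G t (x + - w) - G t x)))"
  proof (intro nn_integral_mono)
  fix t x
  show "?A w t x <= en K*en (norm (G t (x + - w) - G t x))"
  proof (cases "x : cball 0 R")
  case True
  then have "x - w : cball 0 (R + 1)" "x : cball 0 (R + 1)" using norm_triangle_ineq4[of x w] w by simp_all
  then show ?thesis using True K0 by (simp add: G_def ennreal_mult)
  qed simp
  qed
  also have "... = en K*(NN t. NN x. norm (G t (x + - w) - G t x))" by (simp add: nn_integral_cmult)
  also have "... <= en K*en e'" by (intro mult_left_mono d1(2) w) auto
  finally show "(NN t. NN x. ?A w t x) <= en K*en e'" .
  qed (unfold case_prod_beta', measurable, measurable)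
  also have "... = en (K*e')" using mollifier_nn_integral[OF rho] K0 e' by (simp add: nn_integral_multc ennreal_mult)
  finally show "(NN t. NN x. NN w. en (rho w)*?A w t x) <= en (K*e')" .
  next
  have "(NN t. NN x. NN w. en (q w)*?B w t x) <= (NN w. en (q w)*(en K*en (e'*norm w)))"
  proof (rule weighted_nn_integral_le)
  fix w :: 'a assume "en (q w) ~= 0"
  then have "norm w <= eps" using q1[of w] by force
  then have w: "norm (- w) < d2" using H del0 by auto
  have "(NN t. NN x. ?B w t x) = (NN t. NN x. en K*en (norm (indc R x *R
  (b t (x + - w) - b t x - (SUM i:Basis. (- w \<bullet> i) *R g i t x)))))"
  using K0 by (intro nn_integral_cong) (simp add: ennreal_mult split: split_indicator)
  also have "... = en K*(NN t. NN x. en (norm (indc R x *R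
  (b t (x + - w) - b t x - (SUM i:Basis. (- w \<bullet> i) *R g i t x)))))" by (simp add: nn_integral_cmult)
  also have "... <= en K*en (e'*norm (- w))" by (intro mult_left_mono d2(2) w) auto
  finally show "(NN t. NN x. ?B w t x) <= en K*en (e'*norm w)" by simp
  qed (unfold case_prod_beta', measurable, measurable)
  also have "... = (NN w. en (K*e')*en (norm w*q w))"
  using K0 e' q0 by (intro nn_integral_cong) (simp add: ennreal_mult[symmetric] mult_ac)
  also have "... = en (K*e')*(NN w. en (norm w*q w))" by (simp add: nn_integral_cmult)
  also have "... <= en (K*e')*en nC"
  unfolding nC_def q_def by (intro mult_left_mono mollifier_moment_nn_integral[OF rho]) auto
  also have "... = en (K*nC*e')" using K0 e' nC0 by (simp add: ennreal_mult[symmetric] mult_ac)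
  finally show "(NN t. NN x. NN w. en (q w)*?B w t x) <= en (K*nC*e')" .
  next
  have "(NN t. NN x. NN w. en (rho w + norm w*q w)*?C w t x) <= (NN w. en (rho w + norm w*q w)*en e')"
  proof (rule weighted_nn_integral_le)
  fix w :: 'a assume "en (rho w + norm w*q w) ~= 0"
  then have "norm w <= eps" using q1[of w] rho1[of w] by force
  then have w: "norm (- w) < d3" using H del0 by auto
  have "(NN t. NN x. ?C w t x) = (NN t. NN x. norm ((v t (x + - w) - v t x) *R F t x))"
  by (intro nn_integral_cong) (auto simp: F_def abs_mult sum_nonneg split: split_indicator)
  also have "... <= en e'" by (intro d3(2) w)
  finally show "(NN t. NN x. ?C w t x) <= en e'" .
  qed (unfold case_prod_beta', measurable, measurable)
  also have "... = ((NN w. en (rho w)) + (NN w. en (norm w*q w)))*en e'"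
  using rho0 q0 by (simp add: nn_integral_multc nn_integral_add[symmetric])
  also have "... <= (1 + en nC)*en e'" unfolding mollifier_nn_integral[OF rho]
  unfolding nC_def q_def by (intro mult_right_mono add_left_mono mollifier_moment_nn_integral[OF rho]) auto
  also have "... = en ((1 + nC)*e')" using e' nC0 by (simp add: ennreal_mult ennreal_plus)
  finally show "(NN t. NN x. NN w. en (rho w + norm w*q w)*?C w t x) <= en ((1 + nC)*e')" .
  qed
  also have "... = en (A*e')" using K0 nC0 e' by (simp add: A_def ennreal_plus[symmetric] algebra_simps del: ennreal_plus)
  also have "A*e' = e" using A0 by (simp add: e'_def)
  finally show ?thesis .
 qed
 with del0(1) show ?thesis by blast
qed

section \<open>The equation for the square of the mollified solution\<close>

lemma mollify_convolution:
 fixes v :: "'a::euclidean_space => real"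
 assumes vm: "v : BM" and K: "!!x. \<bar>v x\<bar> <= K" and rho: "tf rho"
 shows "mollify rho v = (%x. LB y. rho (x - y) * v y)"
 using integral_tf_reflect[OF loc_int_bounded[OF vm K] rho] by (simp add: mollify_def fun_eq_iff)

lemma mollify_smooth:
 fixes v :: "'a::euclidean_space => real"
 assumes vm: "v : BM" and K: "!!x. \<bar>v x\<bar> <= K" and rho: "tf rho"
 shows "smooth_on UNIV (mollify rho v)"
  and "FD (mollify rho v) (at x) i = mollify (%w. FD rho (at w) i) v x"
proof -
 show "smooth_on UNIV (mollify rho v)"
  unfolding mollify_convolution[OF vm K rho] by (rule convolution_smooth[OF rho vm K])
 show "FD (mollify rho v) (at x) i = mollify (%w. FD rho (at w) i) v x"
  unfolding mollify_convolution[OF vm K rho] mollify_convolution[OF vm K tf_FD[OF rho]]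
  by (subst frechet_derivative_at[OF conv_has_derivative[OF rho vm K], symmetric]) simp
qed

lemma weak_grad_div:
 fixes f :: "'a::euclidean_space => 'a"
 assumes fg: "weak_grad f g" and psi: "tf psi"
 shows "Lint (%x. SUM i:Basis. FD psi (at x) i*(f x \<bullet> i))"
  and "Lint (%x. psi x*(SUM i:Basis. g i x \<bullet> i))"
  and "(LB x. (SUM i:Basis. FD psi (at x) i*(f x \<bullet> i))) = - (LB x. psi x*(SUM i:Basis. g i x \<bullet> i))"
proof -
 have lf: "loc_int f" and lg: "!!i. i : Basis ==> loc_int (g i)" using fg by (auto simp: weak_grad_def)
 note i1 = loc_int_tf[OF lf tf_FD[OF psi]] and i2 = loc_int_tf[OF lg psi]
 have j1: "Lint (%x. FD psi (at x) i*(f x \<bullet> i))" for i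
  using integrable_inner_left[OF i1, of i i] by simp
 have j2: "Lint (%x. psi x*(g i x \<bullet> i))" if "i : Basis" for i
  using integrable_inner_left[OF i2[OF that], of i] by simp
 show "Lint (%x. SUM i:Basis. FD psi (at x) i*(f x \<bullet> i))"
  by (intro I_sum j1)
 show "Lint (%x. psi x*(SUM i:Basis. g i x \<bullet> i))"
  unfolding sum_distrib_left by (intro I_sum j2)
 have e: "(LB x. FD psi (at x) i*(f x \<bullet> i)) = - (LB x. psi x*(g i x \<bullet> i))" if i: "i : Basis" for i
 proof -
  have "(LB x. FD psi (at x) i *R f x) = - (LB x. psi x *R g i x)"
  using fg i psi by (simp add: weak_grad_def)
  then have "(LB x. FD psi (at x) i *R f x) \<bullet> i = - ((LB x. psi x *R g i x) \<bullet> i)" by simp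
  then show ?thesis
  using integral_inner_left[OF i1, of i i] integral_inner_left[OF i2[OF i], of i] by simp
 qed
 show "(LB x. (SUM i:Basis. FD psi (at x) i*(f x \<bullet> i))) = - (LB x. psi x*(SUM i:Basis. g i x \<bullet> i))"
 proof -
  have "(LB x. (SUM i:Basis. psi x*(g i x \<bullet> i))) = (SUM i:Basis. LB x. psi x*(g i x \<bullet> i))"
  by (rule L_sum[OF j2])
  then show ?thesis unfolding sum_distrib_left L_sum[OF j1] using e by (simp add: sum_negf)
 qed
qed

text \<open>For a test function \<open>psi\<close> this is \<open>div (psi b)\<close>.\<close>

definition test_div ::
  "(real => 'a::euclidean_space => 'a) => ('a => real => 'a => 'a) => ('a => real) => real => 'a => real" where
 "test_div b g psi t x = psi x*field_div g t x + (SUM i:Basis. FD psi (at x) i*(b t x \<bullet> i))"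

lemma test_div_integrable:
 fixes b :: "real => 'a::euclidean_space => 'a"
 assumes bg: "W11_field b g" and psi: "tf psi"
 shows "Lint (%p. test_div b g psi@@p)" "Lint (test_div b g psi t)"
  "jm (test_div b g psi)"
proof -
 note W = W11_fieldD[OF bg] and d = field_div_props[OF bg]
 obtain r where r: "r > 0" "!!x. r <= norm x ==> psi x = 0" using psi unfolding tf_alt by blast
 obtain B where B: "B > 0" "!!x. \<bar>psi x\<bar> <= B" using tf_bounded[OF psi] by blast
 obtain B' where B': "B' > 0" "!!x h. \<bar>FD psi (at x) h\<bar> <= B'*norm h" using tf_FD_bounded[OF psi] by blast
 have fr: "FD psi (at x) i = 0" if "r + 1 <= norm x" for x i
  using FD_eq_0[of r psi x] r(2) that by auto
 note [measurable] = tf_measurable[OF psi] tf_measurable[OF tf_FD[OF psi]]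
 have i1: "Lint (%p. (%t. psi)@@p*(field_div g@@p \<bullet> 1))"
  by (rule st_mult_inner_integrable[OF d(3) d(1), where R=r and C=B]) (use r B in \<open>auto simp: meas2_iff\<close>)
 have i2: "Lint (%p. (%t x. FD psi (at x) i)@@p*(b@@p \<bullet> i))" if i: "i : Basis" for i
  by (rule st_mult_inner_integrable[OF W(3) W(1), where R="r+1" and C=B']) (use fr B'(2)[of _ i] i in \<open>auto simp: meas2_iff\<close>)
 show "Lint (%p. test_div b g psi@@p)" unfolding test_div_def
  using i1 i2 by (auto intro!: I_add I_sum)
 then show "jm (test_div b g psi)"
  by (auto dest!: Lint_meas simp: case_prod_beta')
 show "Lint (test_div b g psi t)"
  unfolding test_div_def[abs_def] field_div_def by (intro I_add weak_grad_div(1,2)[OF W(5) psi])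
qed

text \<open>The last claim is the essential one: at \<open>x\<close> the transport part is the
  moment of \<open>v\<close> against \<open>div (psi b)\<close> with
  \<open>psi y = rho (x - y)\<close>, so the moment equation becomes, at each fixed
  \<open>x\<close>, an equation in time for the mollified solution.\<close>

lemma transport_part_props:
 fixes b :: "real => 'a::euclidean_space => 'a"
 assumes bg: "W11_field b g" and vm: "jm v" and K: "!!t x. \<bar>v t x\<bar> <= K" and rho: "tf rho"
 shows "jm (transport_part rho b g v)" (is ?A)
  "Lint (%(t, x). indc r x *R transport_part rho b g v t x)" (is ?B)
  "loc_int (transport_part rho b g v t)" (is ?C)
  "transport_part rho b g v t x = (LB y. v t y*test_div b g (%y. rho (x - y)) t y)" (is ?D)
proof -
 note W = W11_fieldD[OF bg] and d = field_div_props[OF bg]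
 note [measurable (raw)] = meas2[OF W(1)] meas2[OF d(1)] meas2[OF vm]
 have vt: "v t : BM" for t by measurable
 have vp: "(%p. v@@p) : BM" unfolding borel_prod[symmetric] by measurable
 have bl: "loc_int (b t)" for t using W(5)[of t] by (simp add: weak_grad_def)
 let ?r = "%i w. FD rho (at w) i"
 note rhoi = tf_FD[OF rho]
 let ?f = "%t y. v t y*field_div g t y" and ?h = "%i t y. v t y*(b t y \<bullet> i)"
 have fm: "case_prod ?f : BM" "jm (?h i)" for i
  unfolding meas2_iff by measurable
 have fi: "Lint (%(t, x). indc r x *R ?f t x)" for r
  using Lint_mult[OF d(3)[of r] vp K] by (simp add: case_prod_beta' mult_ac)
 have hi: "Lint (%(t, x). indc r x *R ?h i t x)" for r i
  using Lint_mult[OF integrable_inner_left[OF W(3)[of r], of i] vp K] by (simp add: case_prod_beta' mult_ac)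
 have lf: "loc_int (?f t)" for t using loc_int_mult_inner[OF d(2)[of t] vt[of t] K, of 1] by simp
 have lh: "loc_int (?h i t)" for i t by (rule loc_int_mult_inner[OF bl[of t] vt[of t] K])
 note M1 = mollify_st_integrable[OF fm(1) fi rho] and M2 = mollify_st_integrable[OF fm(2) hi rhoi]
 note [measurable (raw)] = meas2[OF M1(1)] meas2[OF M2(1)]
 show ?A unfolding meas2_iff transport_part_def by measurable
 have "Lint (%p. (case p of (t, x) => indc r x *R mollify rho (?f t) x)
  + (SUM i:Basis. - (case p of (t, x) => indc r x *R mollify (?r i) (?h i t) x)))"
  by (intro I_add I_sum I_minus M1(2) M2(2))
 then show ?B by (simp add: transport_part_def case_prod_beta' sum_distrib_left algebra_simps)
 have neg: "loc_int (%x. - 1*(mollify (?r i) (?h i t) x \<bullet> 1))" for i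
  by (rule loc_int_mult_inner[where C=1, OF mollify_loc_int[OF lh rhoi]]) auto
 show ?C unfolding transport_part_def[abs_def]
  using neg by (intro loc_int_add loc_int_sum mollify_loc_int[OF lf rho]) auto
 have srho: "smooth_on UNIV rho" using rho by (simp add: test_function_def)
 have j1: "Lint (%y. rho (x - y)*?f t y)" using loc_int_tf[OF lf tf_reflect[OF rho]] by simp
 have j2: "Lint (%y. ?r i (x - y)*?h i t y)" for i using loc_int_tf[OF lh[of t i] tf_reflect[OF rhoi]] by simp
 have "(LB y. v t y*test_div b g (%y. rho (x - y)) t y)
  = (LB y. rho (x - y)*?f t y + (SUM i:Basis. - (?r i (x - y)*?h i t y)))"
  unfolding test_div_def FD_reflect[OF srho] by (intro L_cong refl) (simp add: algebra_simps sum_distrib_left)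
 also have "... = (LB y. rho (x - y)*?f t y) + (SUM i:Basis. LB y. - (?r i (x - y)*?h i t y))"
  using j1 j2 by (subst L_add) (auto intro!: I_sum simp: L_sum)
 also have "... = transport_part rho b g v t x"
  unfolding transport_part_def mollify_def
  using integral_tf_reflect[OF lf rho, of t x] integral_tf_reflect[OF lh rhoi] by (simp add: sum_negf)
 finally show ?D ..
qed

text \<open>At fixed \<open>x\<close> the mollified solution is a primitive in time, so its square
  obeys the product rule for primitives. Multiplying by \<open>psi\<close> and integrating in
  \<open>x\<close> gives the claim up to the integral of a divergence.\<close>

lemma renormalized_mollified:
 fixes b :: "real => 'a::euclidean_space => 'a"
 assumes bg: "W11_field b g" and vm: "jm v" and K: "!!t x. \<bar>v t x\<bar> <= K"
  and z: "!!t x. t ~: {0<..<T} ==> b t x = 0" "!!t x i. t ~: {0<..<T} ==> i : Basis ==> g i t x = 0"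
  and eq: "!!psi. tf psi ==> AEL t. t : {0<..<T} -->
  (LB x. v t x*psi x) = prim (%s. LB x. v s x*test_div b g psi s x) t"
  and rho: "mollifier eps C rho" and psi: "tf psi"
 shows "AEL t. t : {0<..<T} --> (LB x. (mollify rho (v t) x)^2*psi x)
  = prim (%s. LB x. 2*mollify rho (v s) x*psi x * commutator rho b g v s x + (mollify rho (v s) x)^2*test_div b g psi s x) t"
proof -
 have rhot: "tf rho" using rho by (simp add: mollifier_def)
 have srho: "smooth_on UNIV rho" using rhot by (simp add: test_function_def)
 have spsi: "smooth_on UNIV psi" using psi by (simp add: test_function_def)
 note W = W11_fieldD[OF bg]
 note [measurable (raw)] = meas2[OF vm]
 have vt: "v t : BM" for t by measurable
 define G where "G = transport_part rho b g v"
 note Gp = transport_part_props[OF bg vm K rhot, folded G_def]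
 define V where "V = (%t. mollify rho (v t))"
 have VK: "\<bar>V t x\<bar> <= K" for t x unfolding V_def by (rule mollify_bounded[OF vt K rho])
 have Vm: "jm V"
 proof -
  have [measurable]: "rho : BM" using tf_measurable[OF rhot] .
  show ?thesis unfolding V_def meas2_iff mollify_def by measurable
 qed
 note [measurable (raw)] = meas2[OF Vm] meas2[OF Gp(1)]
 note [measurable] = tf_measurable[OF psi]
 have Vs: "smooth_on UNIV (V t)" for t unfolding V_def by (rule mollify_smooth(1)[OF vt K rhot])
 have Gz: "G s x = 0" if "s ~: {0<..<T}" for s x
  using z[OF that] by (simp add: G_def transport_part_def mollify_def field_div_def)
 have Veq: "AEL t. t : {0<..<T} --> V t x = prim (%s. G s x) t" for x
 proof -
  have l: "(LB y. v t y*rho (x - y)) = V t x" for t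
  unfolding V_def mollify_convolution[OF vt K rhot] by (simp add: mult.commute)
  show ?thesis using eq[OF tf_reflect[OF rhot, of x]] unfolding Gp(4)[symmetric] l .
 qed
 obtain r where r: "r > 0" "!!x. r <= norm x ==> psi x = 0" using psi unfolding tf_alt by blast
 obtain B where B: "B > 0" "!!x. \<bar>psi x\<bar> <= B" using tf_bounded[OF psi] by blast
 define H where "H = (%s x. 2*V s x*psi x*G s x)"
 have Hm: "jm H" unfolding H_def meas2_iff by measurable
 note [measurable (raw)] = meas2[OF Hm]
 have Hi: "Lint (%p. H@@p)"
 proof -
  have i: "Lint (%p. psi (snd p)*(G@@p \<bullet> 1))"
  by (rule st_mult_inner_integrable[OF Gp(2) Gp(1), where R=r and C=B and a="%t. psi"])
  (use r B in \<open>auto simp: meas2_iff\<close>)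
  have "Lint (%p. V@@p*(2*(psi (snd p)*G@@p)))"
  by (rule Lint_mult[where K=K]) (use i VK in \<open>auto simp: borel_prod[symmetric]\<close>)
  then show ?thesis by (simp add: H_def mult_ac)
 qed
 have AEx: "AEL x. AEL t. t : {0<..<T} --> (V t x)^2*psi x = prim (%s. H s x) t"
 proof -
  have "Lint (%p. indc r (snd p)*G@@p)" using Gp(2)[of r] by (simp add: case_prod_beta')
  from st_AE'[of "%t x. indc r x*G t x", OF this]
  show ?thesis
  proof eventually_elim
  case (elim x)
  show ?case
  proof (cases "x : cball 0 r")
  case True
  with elim have gi: "Lint (%s. G s x)" by simp
  have A: "prim (%s. H s x) t = psi x*(prim (%s. G s x) t*prim (%s. G s x) t)" for t
  proof -
  have [measurable]: "(%s. G s x) : BM" by measurable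
  have "prim (%s. H s x) t = prim (%s. psi x*(G s x*prim (%s. G s x) s + prim (%s. G s x) s*G s x)) t"
  proof (rule prim_cong_AE)
  show "AEL s. H s x = psi x*(G s x*prim (%s. G s x) s + prim (%s. G s x) s*G s x)"
  using Veq[of x]
  proof eventually_elim
  case (elim s) then show ?case using Gz[of s x] by (cases "s : {0<..<T}") (auto simp: H_def)
  qed
  qed measurable
  also have "... = psi x*(prim (%s. G s x) t*prim (%s. G s x) t)"
  unfolding prim_cmult prim_mult[OF gi gi] ..
  finally show ?thesis .
  qed
  show ?thesis using Veq[of x] unfolding A by eventually_elim (auto simp: power2_eq_square)
  next
  case False
  then have "psi x = 0" using r(2)[of x] by simp
  then show ?thesis by (simp add: H_def prim_def)
  qed
  qed
 qed
 \<comment> \<open>So far the null set of times depends on \<open>x\<close>; measurability of the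
   set of good pairs permits exchanging the two almost everywhere quantifiers.\<close>
 have AEt: "AEL t. AEL x. t : {0<..<T} --> (V t x)^2*psi x = prim (%s. H s x) t"
 proof (rule iffD1[OF lborel_pair.AE_commute AEx])
  have [measurable]: "(%p. prim (%s. H s (fst p)) (snd p)) : bm ((lborel :: 'a measure) \<Otimes>\<^sub>M (lborel :: real measure))"
  by (rule borel_measurable_prim2[OF Hm]) auto
  show "{p : space (lborel \<Otimes>\<^sub>M lborel). snd p : {0<..<T} --> (V (snd p) (fst p))^2*psi (fst p) = prim (%s. H s (fst p)) (snd p)}
  : sets ((lborel :: 'a measure) \<Otimes>\<^sub>M (lborel :: real measure))"
  by measurable
 qed
 have Hs: "(LB x. H s x) = (LB x. 2*V s x*psi x * commutator rho b g v s x + (V s x)^2*test_div b g psi s x)" for s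
 proof -
  have sV2: "smooth_on UNIV (%x. V s x*V s x)" by (rule smooth_on_mult[OF Vs Vs])
  let ?P = "%x. (V s x*V s x)*psi x"
  have tP: "tf ?P" by (rule tf_mult_smooth[OF psi sV2])
  note wd = weak_grad_div[OF W(5)[of s] tP]
  \<comment> \<open>\<open>Z\<close> is \<open>div (V^2 psi b)\<close> and has integral zero; adding
    it exchanges \<open>transport_part\<close> for the commutator.\<close>
  define Z where "Z = (%x. ?P x*field_div g s x + (SUM i:Basis. FD ?P (at x) i*(b s x \<bullet> i)))"
  have Zi: "Lint Z" unfolding Z_def field_div_def by (intro I_add wd(1,2))
  have Z0: "(LB x. Z x) = 0" unfolding Z_def field_div_def
  by (subst L_add[OF wd(2,1)]) (simp add: wd(3))
  have Hsi: "Lint (H s)"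
  proof -
  have "Lint (%x. psi x*G s x)" using loc_int_tf[OF Gp(3)[of s] psi] by simp
  from Lint_mult[OF this _ VK[of s]] have "Lint (%x. V s x*(psi x*G s x))" by measurable
  from integrable_mult_right[OF this, of 2] show ?thesis by (simp add: H_def[abs_def] mult_ac)
  qed
  have pt: "2*V s x*psi x * commutator rho b g v s x + (V s x)^2*test_div b g psi s x = H s x + Z x" for x
  proof -
  have m: "mollify (%w. FD rho (at w) i) (v s) x = FD (V s) (at x) i" for i
  unfolding V_def by (rule mollify_smooth(2)[OF vt K rhot, symmetric])
  show ?thesis
  unfolding commutator_def G_def[symmetric] m Z_def test_div_def H_def FD_mult[OF sV2 spsi] FD_mult[OF Vs Vs]
  by (simp add: algebra_simps sum.distrib sum_distrib_left sum_distrib_right power2_eq_square)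
  qed
  show ?thesis unfolding pt using L_add[OF Hsi Zi] Z0 by simp
 qed
 from AEt show ?thesis
 proof eventually_elim
  case (elim t)
  show ?case
  proof
  assume t: "t : {0<..<T}"
  have "(LB x. (V t x)^2*psi x) = (LB x. prim (%s. H s x) t)"
  by (rule integral_cong_AE) (use elim t in auto)
  also have "... = (LB x. LB s. ind {..t} s*H s x)" by (simp add: prim_def)
  also have "... = (LB s. LB x. ind {..t} s*H s x)"
  proof -
  have "Lint (%p. ind {..t} (fst p)*H@@p)"
  by (rule Lint_mult[OF Hi, where K=1]) (auto simp: borel_prod[symmetric] indicator_def)
  from st_tx[of "%s x. ind {..t} s*H s x", OF this] st_xt[of "%s x. ind {..t} s*H s x", OF this]
  show ?thesis by simp
  qed
  also have "... = prim (%s. LB x. H s x) t" by (simp add: prim_def)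
  finally show "(LB x. (mollify rho (v t) x)^2*psi x)
  = prim (%s. LB x. 2*mollify rho (v s) x*psi x * commutator rho b g v s x + (mollify rho (v s) x)^2*test_div b g psi s x) t"
  unfolding Hs V_def .
  qed
 qed
qed

text \<open>The claimed identity is compared with the one for the mollified solution in the mean
  over \<open>(0, T)\<close>: the defect is at most \<open>c * e\<close> for every \<open>e\<close>.
  Since both functions are bounded by \<open>K\<close>, squaring costs only the Lipschitz constant
  \<open>2 K\<close>.\<close>

lemma renormalization:
 fixes b :: "real => 'a::euclidean_space => 'a"
 assumes bg: "W11_field b g" and vm: "jm v" and K: "!!t x. \<bar>v t x\<bar> <= K" and T: "0 < T"
  and z: "!!t x. t ~: {0<..<T} ==> b t x = 0" "!!t x i. t ~: {0<..<T} ==> i : Basis ==> g i t x = 0"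
  and eq: "!!psi. tf psi ==> AEL t. t : {0<..<T} -->
  (LB x. v t x*psi x) = prim (%s. LB x. v s x*test_div b g psi s x) t"
  and psi: "tf psi"
 shows "AEL t. t : {0<..<T} -->
  (LB x. (v t x)^2*psi x) = prim (%s. LB x. (v s x)^2*test_div b g psi s x) t"
proof -
 have K0: "0 <= K" using K[of 0 0] by linarith
 note [measurable (raw)] = meas2[OF vm] meas2[OF test_div_integrable(3)[OF bg psi]]
 note [measurable] = tf_measurable[OF psi]
 have vt: "v t : BM" for t by measurable
 obtain r where r: "r > 0" "!!x. r <= norm x ==> psi x = 0" using psi unfolding tf_alt by blast
 obtain B where B: "B > 0" "!!x. \<bar>psi x\<bar> <= B" using tf_bounded[OF psi] by blast
 obtain Crho where Crho: "!!eps. eps > 0 ==> EX rho::'a => real. mollifier eps Crho rho" using mollifier_exists by blast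
 \<comment> \<open>The indicator makes the weight \<open>psi\<close> integrable over time and
   space.\<close>
 define Phi where "Phi = (%t x. ind {0<..<T} t*psi x)"
 have Phim: "jm Phi" unfolding Phi_def meas2_iff by measurable
 have Phii: "Lint (%p. Phi@@p)"
  by (rule st_bound[OF Phim, of "ind {0<..<T}" "%x. \<bar>psi x\<bar>"])
  (use T tf_integrable[OF psi] in \<open>auto simp: Phi_def abs_mult\<close>)
 let ?H = "test_div b g psi"
 note Hi = test_div_integrable[OF bg psi]
 have sqK: "\<bar>z^2\<bar> <= K^2" if "\<bar>z\<bar> <= K" for z using power_mono[OF that, of 2] by simp
 have v2i: "Lint (%x. (v t x)^2*psi x)" for t
  by (rule Lint_mult[OF tf_integrable[OF psi], where K="K^2"])
  (use sqK[OF K] vt in auto)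
 define F where "F = (%t. LB x. (v t x)^2*psi x)"
 define P where "P = prim (%s. LB x. (v s x)^2*?H s x)"
 have [measurable]: "F : BM" "P : BM" unfolding F_def P_def by measurable
 let ?X = "NN t. ind {0<..<T} t*en \<bar>F t - P t\<bar>"
 \<comment> \<open>The first \<open>2 K\<close> is for replacing \<open>V^2\<close> by
   \<open>v^2\<close> against \<open>psi\<close>. The factor \<open>T\<close> integrates in time the
   error of the primitives: \<open>2 K B\<close> from the commutator, \<open>2 K\<close> from
   \<open>V^2 - v^2\<close> against \<open>div (psi b)\<close>.\<close>
 define c where "c = 2*K + T*(2*K*B + 2*K)"
 have c0: "0 <= c" using K0 T B by (simp add: c_def)
 have small: "?X <= en (c*e)" if e: "0 < e" for e
 proof -
  obtain d1 where d1: "d1 > 0" "!!eps C rho. eps < d1 ==> mollifier eps C rho ==>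
  (NN t. NN x. en (\<bar>mollify rho (v t) x - v t x\<bar>*\<bar>Phi t x\<bar>)) <= en e"
  using mollify_bounded_close[OF vm K Phii e] by blast
  obtain d2 where d2: "d2 > 0" "!!eps C rho. eps < d2 ==> mollifier eps C rho ==>
  (NN t. NN x. en (\<bar>mollify rho (v t) x - v t x\<bar>*\<bar>?H t x\<bar>)) <= en e"
  using mollify_bounded_close[OF vm K Hi(1) e] by blast
  obtain d3 where d3: "d3 > 0" "!!eps rho. eps < d3 ==> mollifier eps Crho rho ==>
  (NN t. NN x. indc r x*en \<bar>commutator rho b g v t x\<bar>) <= en e"
  using commutator_converges[OF bg vm K e, of Crho r] by blast
  define eps where "eps = min d1 (min d2 d3) / 2"
  have eps: "0 < eps" "eps < d1" "eps < d2" "eps < d3" using d1 d2 d3 by (auto simp: eps_def)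
  obtain rho :: "'a => real" where rho: "mollifier eps Crho rho" using Crho[OF eps(1)] by blast
  have rhot: "tf rho" using rho by (simp add: mollifier_def)
  note [measurable] = tf_measurable[OF rhot]
  define V where "V = (%t. mollify rho (v t))"
  have VK: "\<bar>V t x\<bar> <= K" for t x unfolding V_def by (rule mollify_bounded[OF vt K rho])
  have Vm: "jm V"
  unfolding V_def meas2_iff mollify_def by measurable
  have rm: "jm (commutator rho b g v)"
  proof -
  note [measurable (raw)] = meas2[OF transport_part_props(1)[OF bg vm K rhot]] meas2[OF W11_fieldD(1)[OF bg]]
  have [measurable]: "(%w. FD rho (at w) i) : BM" for i
  by (rule tf_measurable[OF tf_FD[OF rhot]])
  show ?thesis unfolding commutator_def meas2_iff mollify_def by measurable
  qed
  note [measurable (raw)] = meas2[OF Vm] meas2[OF rm]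
  let ?r = "commutator rho b g v"
  have sq: "\<bar>(V t x)^2 - (v t x)^2\<bar> <= 2*K*\<bar>V t x - v t x\<bar>" for t x
  proof -
  have "\<bar>(V t x)^2 - (v t x)^2\<bar> = \<bar>V t x + v t x\<bar>*\<bar>V t x - v t x\<bar>"
  by (simp add: abs_mult[symmetric] power2_eq_square algebra_simps)
  also have "... <= (2*K)*\<bar>V t x - v t x\<bar>" using VK[of t x] K[of t x] by (intro mult_right_mono) linarith+
  finally show ?thesis by simp
  qed
  have V2i: "Lint (%x. (V t x)^2*psi x)" for t
  by (rule Lint_mult[OF tf_integrable[OF psi], where K="K^2"])
  (use sqK[OF VK] in auto)
  define J where "J = (%s x. 2*V s x*psi x*?r s x + (V s x)^2*?H s x)"
  define E where "E = (%s x. J s x - (v s x)^2*?H s x)"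
  define D where "D = (NN s. NN x. en \<bar>E s x\<bar>)"
  have [measurable (raw)]: "(%w. J (g w) (h w)) : bm M" "(%w. E (g w) (h w)) : bm M"
  if "g : bm M" "h : bm M" for g h and M :: "'z measure"
  using that unfolding E_def J_def by measurable
  have Ele: "\<bar>E s x\<bar> <= 2*K*B*(indc r x*\<bar>?r s x\<bar>) + 2*K*(\<bar>V s x - v s x\<bar>*\<bar>?H s x\<bar>)" for s x
  proof -
  have "E s x = 2*V s x*psi x*?r s x + ((V s x)^2 - (v s x)^2)*?H s x" by (simp add: E_def J_def algebra_simps)
  then have "\<bar>E s x\<bar> <= 2*(\<bar>V s x\<bar>*\<bar>psi x\<bar>)*\<bar>?r s x\<bar> + \<bar>(V s x)^2 - (v s x)^2\<bar>*\<bar>?H s x\<bar>"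
  using abs_triangle_ineq[of "2*V s x*psi x*?r s x" "((V s x)^2 - (v s x)^2)*?H s x"] by (simp add: abs_mult)
  also have "... <= 2*(K*(B*indc r x))*\<bar>?r s x\<bar> + (2*K*\<bar>V s x - v s x\<bar>)*\<bar>?H s x\<bar>"
  proof (intro add_mono mult_right_mono sq mult_left_mono mult_mono VK)
  show "\<bar>psi x\<bar> <= B*indc r x" using r(2)[of x] B(2)[of x] by (cases "norm x <= r") auto
  qed (use K0 in auto)
  finally show ?thesis by (simp add: mult_ac)
  qed
  have Dle: "D <= en (2*K*B*e + 2*K*e)"
  proof -
  have "D <= (NN s. NN x. en (2*K*B)*(indc r x*en \<bar>?r s x\<bar>) + en (2*K)*en (\<bar>V s x - v s x\<bar>*\<bar>?H s x\<bar>))"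
  unfolding D_def
  proof (intro nn_integral_mono)
  fix s x
  show "en \<bar>E s x\<bar> <= en (2*K*B)*(indc r x*en \<bar>?r s x\<bar>) + en (2*K)*en (\<bar>V s x - v s x\<bar>*\<bar>?H s x\<bar>)"
  using ennreal_leI[OF Ele[of s x]] K0 B(1)
  by (cases "x : cball 0 r") (simp_all add: ennreal_mult'[symmetric] ennreal_plus[symmetric] del: ennreal_plus)
  qed
  also have "... = en (2*K*B)*(NN s. NN x. indc r x*en \<bar>?r s x\<bar>)
  + en (2*K)*(NN s. NN x. en (\<bar>V s x - v s x\<bar>*\<bar>?H s x\<bar>))"
  by (simp add: nn_integral_add nn_integral_cmult)
  also have "... <= en (2*K*B)*en e + en (2*K)*en e"
  using d2(2)[OF eps(3) rho] d3(2)[OF eps(4) rho] by (intro add_mono mult_left_mono) (auto simp: V_def)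
  also have "... = en (2*K*B*e + 2*K*e)" using K0 B(1) e by (simp add: ennreal_mult[symmetric] ennreal_plus[symmetric] del: ennreal_plus)
  finally show ?thesis .
  qed
  have EI: "Lint (%p. E@@p)"
  proof (rule integrableI_bounded)
  show "(%p. E@@p) : bm lborel" by (simp add: borel_prod[symmetric])
  have "(NN p. en (norm (E@@p))) = D" unfolding D_def
  by (subst st_nn[of "%s x. en (norm (E s x))"]) (auto simp: meas2_iff)
  then show "(NN p. en (norm (E@@p))) < \<infinity>" using Dle by (simp add: le_less_trans)
  qed
  have hI: "Lint (%p. (v@@p)^2*?H@@p)"
  by (rule Lint_mult[OF Hi(1), where K="K^2"])
  (use sqK[OF K] in \<open>auto simp: borel_prod[symmetric]\<close>)
  have JI: "Lint (%p. J@@p)"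
  using I_add[OF EI hI] by (simp add: E_def)
  note JI' = st_t[of J, OF JI] and hI' = st_t[of "%s x. (v s x)^2*?H s x", OF hI]
  have Pdiff: "en \<bar>prim (%s. LB x. J s x) t - P t\<bar> <= D" for t
  proof -
  have "prim (%s. LB x. J s x) t - P t
  = (LB s. ind {..t} s*(LB x. J s x) - ind {..t} s*(LB x. (v s x)^2*?H s x))"
  unfolding P_def prim_def using L_diff[OF prim_integrable[OF JI', of t] prim_integrable[OF hI', of t]] by simp
  then have "en \<bar>prim (%s. LB x. J s x) t - P t\<bar>
  <= (NN s. norm (ind {..t} s*(LB x. J s x) - ind {..t} s*(LB x. (v s x)^2*?H s x)))"
  using norm_LB_le[of lborel "%s. ind {..t} s*(LB x. J s x) - ind {..t} s*(LB x. (v s x)^2*?H s x)"]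
  by (simp only: real_norm_def)
  also have "... <= D" unfolding D_def
  proof (rule nn_integral_mono_AE)
  show "AEL s. en (norm (ind {..t} s*(LB x. J s x) - ind {..t} s*(LB x. (v s x)^2*?H s x)))
  <= (NN x. en \<bar>E s x\<bar>)"
  using st_AE[of J, OF JI] st_AE[of "%s x. (v s x)^2*?H s x", OF hI]
  proof eventually_elim
  case (elim s)
  have "\<bar>ind {..t} s*(LB x. J s x) - ind {..t} s*(LB x. (v s x)^2*?H s x)\<bar> <= \<bar>LB x. E s x\<bar>"
  unfolding E_def L_diff[OF elim] by (simp add: indicator_def)
  then show ?case using norm_LB_le[of lborel "E s"]
  by (simp only: real_norm_def) (meson ennreal_leI order_trans)
  qed
  qed
  finally show ?thesis .
  qed
  have ren: "AEL t. t : {0<..<T} --> (LB x. (V t x)^2*psi x) = prim (%s. LB x. J s x) t"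
  unfolding V_def J_def by (rule renormalized_mollified[OF bg vm K z eq rho psi])
  have pt: "AEL t. ind {0<..<T} t*en \<bar>F t - P t\<bar>
  <= en (2*K)*(NN x. en (\<bar>V t x - v t x\<bar>*\<bar>Phi t x\<bar>)) + ind {0<..<T} t*D"
  using ren
  proof eventually_elim
  case (elim t)
  show ?case
  proof (cases "t : {0<..<T}")
  case True
  then have Fe: "(LB x. (V t x)^2*psi x) = prim (%s. LB x. J s x) t" using elim by simp
  have "en \<bar>F t - P t\<bar> <= en \<bar>(LB x. (V t x)^2*psi x) - F t\<bar> + en \<bar>prim (%s. LB x. J s x) t - P t\<bar>"
  unfolding Fe by (simp flip: ennreal_plus add: ennreal_leI)
  also have "... <= en (2*K)*(NN x. en (\<bar>V t x - v t x\<bar>*\<bar>Phi t x\<bar>)) + D"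
  proof (intro add_mono Pdiff)
  have "(LB x. (V t x)^2*psi x) - F t = (LB x. (V t x)^2*psi x - (v t x)^2*psi x)"
  unfolding F_def by (rule L_diff[symmetric, OF V2i v2i])
  then have "en \<bar>(LB x. (V t x)^2*psi x) - F t\<bar> <= (NN x. norm ((V t x)^2*psi x - (v t x)^2*psi x))"
  using norm_LB_le[of lborel "%x. (V t x)^2*psi x - (v t x)^2*psi x"] by (simp only: real_norm_def)
  also have "... <= (NN x. en (2*K)*en (\<bar>V t x - v t x\<bar>*\<bar>Phi t x\<bar>))"
  proof (rule nn_integral_mono)
  fix x
  have "norm ((V t x)^2*psi x - (v t x)^2*psi x) = \<bar>(V t x)^2 - (v t x)^2\<bar>*\<bar>psi x\<bar>"
  by (simp add: left_diff_distrib[symmetric] abs_mult)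
  also have "... <= 2*K*\<bar>V t x - v t x\<bar>*\<bar>psi x\<bar>" by (rule mult_right_mono[OF sq]) simp
  also have "... = (2*K)*(\<bar>V t x - v t x\<bar>*\<bar>Phi t x\<bar>)" using True by (simp add: Phi_def)
  finally show "en (norm ((V t x)^2*psi x - (v t x)^2*psi x)) <= en (2*K)*en (\<bar>V t x - v t x\<bar>*\<bar>Phi t x\<bar>)"
  using K0 by (simp add: ennreal_mult[symmetric] ennreal_leI)
  qed
  also have "... = en (2*K)*(NN x. en (\<bar>V t x - v t x\<bar>*\<bar>Phi t x\<bar>))"
  using Phim by (intro nn_integral_cmult) (auto simp: Phi_def)
  finally show "en \<bar>(LB x. (V t x)^2*psi x) - F t\<bar> <= en (2*K)*(NN x. en (\<bar>V t x - v t x\<bar>*\<bar>Phi t x\<bar>))" .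
  qed
  finally show ?thesis using True by simp
  qed simp
  qed
  note [measurable (raw)] = meas2[OF Phim]
  have "?X <= (NN t. en (2*K)*(NN x. en (\<bar>V t x - v t x\<bar>*\<bar>Phi t x\<bar>)) + ind {0<..<T} t*D)"
  by (rule nn_integral_mono_AE[OF pt])
  also have "... = en (2*K)*(NN t. NN x. en (\<bar>V t x - v t x\<bar>*\<bar>Phi t x\<bar>)) + en T*D"
  using T by (simp add: nn_integral_add nn_integral_cmult nn_integral_multc)
  also have "... <= en (2*K)*en e + en T*en (2*K*B*e + 2*K*e)"
  using d1(2)[OF eps(2) rho] Dle by (intro add_mono mult_left_mono) (auto simp: V_def)
  also have "... = en (c*e)"
  using K0 B(1) e T by (simp add: ennreal_mult[symmetric] ennreal_plus[symmetric] c_def algebra_simps del: ennreal_plus)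
  finally show ?thesis .
 qed
 have "?X = 0"
 proof (rule ennreal_eq_0I)
  fix e :: real assume e: "0 < e"
  have "?X <= en (c*(e / (c + 1)))" by (rule small) (use e c0 in auto)
  also have "... <= en e" using e c0 by (intro ennreal_leI) (simp add: field_simps)
  finally show "?X <= en e" .
 qed
 then have "AEL t. ind {0<..<T} t*en \<bar>F t - P t\<bar> = 0" by (simp add: nn_integral_0_iff_AE)
 then show ?thesis unfolding F_def P_def by eventually_elim (auto simp: indicator_def)
qed

section \<open>Uniqueness\<close>

text \<open>With the dimension as exponent the weight is integrable, and it decays slowly enough
  that its gradient is at most \<open>2 n * norm x / (R^2 + (norm x)^2)\<close> times the weight
  itself, as Gronwall's inequality requires.\<close>

definition weight :: "real => 'a::euclidean_space => real" where
 "weight R x = inverse ((1 + (norm x)^2 / R^2) ^ DIM('a))"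

lemma weight_base_pos: "0 < 1 + (norm (x :: 'a::euclidean_space))^2 / R^2"
 by (intro add_pos_nonneg) auto

lemma weight_bounds: "0 < weight R x" "weight R x <= 1"
 using weight_base_pos[of x R] by (auto simp: weight_def inverse_le_1_iff)

lemma weight_smooth: "smooth_on S (weight R)"
proof -
 have eq: "(%x::'a. 1 + (norm x)^2 / R^2) = (%x. 1 + inverse (R^2)*(norm x)^2)" by (simp add: field_simps)
 have c: "Ck_on k S (%x::'a. 1 + (norm x)^2 / R^2)" for k unfolding eq
  using smooth_on_norm_sq[of S] by (intro Ck_on_add Ck_on_mult Ck_on_const) (auto simp: smooth_on_def)
 have nz: "1 + (norm (x::'a))^2 / R^2 ~= 0" for x using weight_base_pos[of x R] by simp
 show ?thesis unfolding smooth_on_def weight_def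
  by (intro allI Ck_on_inverse Ck_on_power c) (use nz in auto)
qed

lemma weight_derivative_le:
 fixes x :: "'a::euclidean_space"
 assumes R: "0 < R"
 shows "\<bar>FD (weight R) (at x) h\<bar> <= 2*real DIM('a)*(norm x / (R^2 + (norm x)^2))*norm h*weight R x"
proof -
 let ?n = "DIM('a)"
 let ?p = "1 + (norm x)^2 / R^2"
 have p: "0 < ?p" by (rule weight_base_pos)
 define c where "c = inverse (R^2)"
 have eq: "weight R = (%x::'a. inverse ((1 + c*(x \<bullet> x)) ^ ?n))"
  by (simp add: weight_def fun_eq_iff c_def power2_norm_eq_inner field_simps)
 have pc: "?p = 1 + c*(x \<bullet> x)" by (simp add: c_def power2_norm_eq_inner field_simps)
 have "((%x::'a. inverse ((1 + c*(x \<bullet> x)) ^ ?n)) has_derivative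
  (%h. - (inverse ((1 + c*(x \<bullet> x)) ^ ?n)*(real ?n*(1 + c*(x \<bullet> x)) ^ (?n - 1)*(c*(2*(x \<bullet> h))))*inverse ((1 + c*(x \<bullet> x)) ^ ?n)))) (at x)"
  using p unfolding pc by (auto intro!: derivative_eq_intros ext simp: inner_commute)
 then have D: "(weight R has_derivative (%h. - (weight R x*(real ?n*?p ^ (?n - 1)*((2*(x \<bullet> h)) / R^2))*weight R x))) (at x)"
  unfolding eq pc by (simp add: c_def divide_inverse mult.commute)
 have w: "?p ^ (?n - 1)*weight R x = inverse ?p"
 proof -
  have "?p ^ ?n = ?p*?p ^ (?n - 1)" by (rule power_eq_if[THEN trans]) simp
  then have "weight R x = inverse (?p*?p ^ (?n - 1))" by (simp add: weight_def)
  moreover have "q*inverse (r*q) = inverse r" if "q ~= 0" for q r :: real using that by simp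
  ultimately show ?thesis using p by simp
 qed
 have pe: "inverse ?p / R^2 = 1 / (R^2 + (norm x)^2)"
 proof -
  have "R^2*?p = R^2 + (norm x)^2" using R by (simp add: distrib_left)
  moreover have "inverse r / q = 1 / (q*r)" for q r :: real by (simp add: divide_inverse mult.commute)
  ultimately show ?thesis by simp
 qed
 have "FD (weight R) (at x) h = - (weight R x*(real ?n*?p ^ (?n - 1)*((2*(x \<bullet> h)) / R^2))*weight R x)"
  by (subst frechet_derivative_at[OF D, symmetric]) simp
 also have "... = - (2*real ?n*(x \<bullet> h)*((?p ^ (?n - 1)*weight R x) / R^2)*weight R x)" by simp
 also have "... = - (2*real ?n*(x \<bullet> h)*(1 / (R^2 + (norm x)^2))*weight R x)" unfolding w pe ..
 finally have "\<bar>FD (weight R) (at x) h\<bar> = 2*real ?n*\<bar>x \<bullet> h\<bar>*(1 / (R^2 + (norm x)^2))*weight R x"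
  using weight_bounds(1)[of R x] by (simp add: abs_mult)
 also have "... <= 2*real ?n*(norm x*norm h)*(1 / (R^2 + (norm x)^2))*weight R x"
  using weight_bounds(1)[of R x] Cauchy_Schwarz_ineq2[of x h] by (intro mult_right_mono mult_left_mono) auto
 finally show ?thesis by (simp add: mult_ac)
qed

lemma weight_mono: "0 < R ==> R <= R' ==> weight R x <= weight R' x"
 unfolding weight_def using weight_base_pos[of x R']
 by (intro le_imp_inverse_le power_mono add_left_mono divide_left_mono) (auto intro!: power_mono zero_less_power mult_pos_pos)

lemma weight_integrable_R:
 assumes R: "1 <= R" shows "Lint (weight R :: 'a::euclidean_space => real)"
proof (rule I_bound)
 show "Lint (%x::'a. (R^2) ^ DIM('a)*inverse ((1 + (norm x)^2) ^ DIM('a)))"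
  by (intro integrable_mult_right weight_integrable)
 show "weight R : bm lborel" unfolding weight_def by measurable
 show "AE x::'a in lborel. norm (weight R x) <= norm ((R^2) ^ DIM('a)*inverse ((1 + (norm x)^2) ^ DIM('a)))"
 proof (rule AE_I2)
  fix x :: 'a
  have p: "0 < 1 + (norm x)^2" by (intro add_pos_nonneg) auto
  have "(1 + (norm x)^2) / R^2 <= 1 + (norm x)^2 / R^2"
  using one_le_power[OF R, of 2] by (auto simp: add_divide_distrib divide_le_eq)
  then have "((1 + (norm x)^2) / R^2) ^ DIM('a) <= (1 + (norm x)^2 / R^2) ^ DIM('a)" by (intro power_mono) auto
  then have "weight R x <= inverse (((1 + (norm x)^2) / R^2) ^ DIM('a))"
  unfolding weight_def using R p by (intro le_imp_inverse_le) auto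
  also have "... = (R^2) ^ DIM('a)*inverse ((1 + (norm x)^2) ^ DIM('a))" by (simp only: power_divide inverse_divide) (simp only: divide_inverse)
  finally show "norm (weight R x) <= norm ((R^2) ^ DIM('a)*inverse ((1 + (norm x)^2) ^ DIM('a)))"
  using weight_bounds(1)[of R x] by simp
 qed
qed

text \<open>Against the linear growth of \<open>b\<close> the gradient of the weight costs at most a
  factor 2, uniformly in \<open>R >= 1\<close>.\<close>

lemma ratio_bounds:
 assumes R: "1 <= R" and x: "0 <= (x::real)"
 shows "0 <= x / (R^2 + x^2)*(1 + x)" "x / (R^2 + x^2)*(1 + x) <= 2"
proof -
 have p: "0 < R^2 + x^2" using R by (intro add_pos_nonneg) auto
 show "0 <= x / (R^2 + x^2)*(1 + x)" using p x by auto
 have "x <= 1 + x^2" using sum_squares_ge_zero[of "x - 1" 0] zero_le_power2[of x] x by (simp add: power2_eq_square algebra_simps)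
 moreover have "1 <= R^2" using R by (simp add: one_le_power)
 ultimately have "x*(1 + x) <= 2*(R^2 + x^2)" by (simp add: power2_eq_square algebra_simps)
 then show "x / (R^2 + x^2)*(1 + x) <= 2" using p by (simp add: field_simps)
qed

text \<open>For \<open>s > k\<close> one has \<open>s <= 2 sinh (s / 2)\<close>, which equals
  \<open>exp (- s / 2) * (exp s - 1)\<close>. The exponent 1/2 leaves room for the later loss
  \<open>exp (k / 4)\<close>.\<close>

lemma truncated_exp_bound:
 assumes "0 <= (s::real)" "0 <= k"
 shows "s <= k + exp (- k / 2)*(exp s - 1)"
proof (cases "s <= k")
 case True
 then show ?thesis using assms by (simp add: add_increasing2)
next
 case False
 have i: "z <= exp z - 1" for z :: real using exp_ge_add_one_self[of z] by linarith
 have "s = 2*(s / 2)" by simp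
 also have "s / 2 <= (exp (s/2) - exp (- (s/2))) / 2"
 proof -
  have "(%x. exp x - exp (- x) - 2*x) 0 <= (%x::real. exp x - exp (- x) - 2*x) (s / 2)"
  proof (rule DERIV_nonneg_imp_nondecreasing[of 0 "s / 2" "%x::real. exp x - exp (- x) - 2*x"])
  fix x :: real assume "0 <= x" "x <= s / 2"
  have "((%x::real. exp x - exp (- x) - 2*x) has_real_derivative (exp x + exp (- x) - 2)) (at x)"
  by (auto intro!: derivative_eq_intros)
  moreover have "0 <= exp x + exp (- x) - 2" using exp_ge_add_one_self[of x] exp_ge_add_one_self[of "- x"] by linarith
  ultimately show "EX y. ((%x::real. exp x - exp (- x) - 2*x) has_real_derivative y) (at x) & 0 <= y" by blast
  qed (use assms in simp)
  then show ?thesis by simp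
 qed
 finally have "s <= exp (s/2) - exp (- (s/2))" by simp
 also have "... = exp (- (s/2))*(exp s - 1)" by (simp add: algebra_simps exp_add[symmetric])
 also have "... <= exp (- k / 2)*(exp s - 1)" using False assms by (intro mult_right_mono) auto
 finally show ?thesis using assms by linarith
qed

section \<open>Vanishing of solutions with zero initial value\<close>

text \<open>\<open>v\<close> stands for the difference of two solutions, given by its moment
  equations with zero initial value. \<open>a\<close> collects the parts of growth and divergence
  that are bounded in space, \<open>gam\<close> is the integrable part of the growth, and
  \<open>beta * sig\<close> is the \<open>Exp L\<close> part of the divergence, with
  \<open>sig\<close> normalised at almost every time.\<close>

locale transport_uniqueness =
 fixes T K :: real and b :: "real => 'a::euclidean_space => 'a" and g and v :: "real => 'a => real"
  and a beta :: "real => real" and gam sig :: "real => 'a => real"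
 assumes bg: "W11_field b g" and vm: "jm v" and K: "!!t x. \<bar>v t x\<bar> <= K" and T: "0 < T"
  and betaz: "!!t. t <= 0 ==> beta t = 0"
  and z: "!!t x. t ~: {0<..<T} ==> b t x = 0" "!!t x i. t ~: {0<..<T} ==> i : Basis ==> g i t x = 0"
  and eq: "!!psi. tf psi ==> AEL t. t : {0<..<T} -->
  (LB x. v t x*psi x) = prim (%s. LB x. v s x*test_div b g psi s x) t"
  and a: "Lint a" "!!t. 0 <= a t" and beta: "Lint beta" "!!t. 0 <= beta t"
  and gam: "Lint (%p. gam@@p)" "!!t x. 0 <= gam t x"
  and sig: "jm sig" "!!t x. 0 <= sig t x"
  "AEL t. (NN x. en (exp (sig t x) - 1)) <= 1"
  and growth: "!!t x. norm (b t x) <= (1 + norm x)*(gam t x + a t)"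
  and div: "!!t x. \<bar>field_div g t x\<bar> <= a t + beta t * sig t x"
begin

abbreviation (input) ratio :: "real => 'a => real" where "ratio R x \<equiv> norm x / (R^2 + (norm x)^2)*(1 + norm x)"

text \<open>This is \<open>div (weight R * b)\<close>.\<close>

definition "weighted_div R s x = weight R x*field_div g s x + FD (weight R) (at x) (b s x)"

lemma w0: "0 <= weight R (x::'a)" using weight_bounds(1)[of R x] by simp

lemma K0: "0 <= K" using K[of 0 0] by linarith

lemma meas: "jm b" "jm gam" "jm (field_div g)"
 "a : BM" "beta : BM" "(weight R :: 'a => real) : BM"
 using W11_fieldD(1)[OF bg] Lint_meas[OF gam(1)] field_div_props(1)[OF bg] a(1) beta(1)
 by (auto simp: case_prod_beta' weight_def[abs_def])

lemma sq_bound: "\<bar>(v t x)^2\<bar> <= K^2" using power_mono[OF K[of t x] abs_ge_zero, of 2] by simp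

lemma weighted_div_meas: "jm (weighted_div R)"
proof -
 note [measurable (raw)] = meas2[OF meas(1)] meas2[OF meas(3)]
 have [measurable]: "(%x::'a. FD (weight R) (at x) i) : BM" for i
 proof -
  have "Ck_on 0 UNIV (%x::'a. FD (weight R) (at x) i)"
  using smooth_on_frechet[OF weight_smooth[of UNIV R]] unfolding smooth_on_def by blast
  then show ?thesis by (simp add: borel_measurable_continuous_onI)
 qed
 note [measurable] = meas(6)
 show ?thesis unfolding weighted_div_def meas2_iff FD_Basis[OF weight_smooth[of UNIV], of R _ "b _ _"] by measurable
qed

lemma weight_deriv_field_le:
 assumes R: "1 <= R"
 shows "\<bar>FD (weight R) (at x) (b s x)\<bar> <= 2*real DIM('a)*ratio R x*(gam s x + a s)*weight R x"
proof -
 have "\<bar>FD (weight R) (at x) (b s x)\<bar> <= 2*real DIM('a)*(norm x / (R^2 + (norm x)^2))*norm (b s x)*weight R x"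
  by (rule weight_derivative_le) (use R in simp)
 also have "... <= 2*real DIM('a)*(norm x / (R^2 + (norm x)^2))*((1 + norm x)*(gam s x + a s))*weight R x"
  using weight_bounds(1)[of R x] by (intro mult_right_mono mult_left_mono growth) auto
 finally show ?thesis by (simp only: mult_ac)
qed

lemma exp_sigma:
 shows "Lint (%p. beta (fst p) * sig@@p)"
  and "AEL t. Lint (%x. exp (sig t x) - 1) & (LB x. exp (sig t x) - 1) <= 1"
proof -
 note [measurable (raw)] = meas2[OF sig(1)] and [measurable] = meas(5)
 have s: "sig t x <= exp (sig t x) - 1" for t x using exp_ge_add_one_self[of "sig t x"] by linarith
 show "AEL t. Lint (%x. exp (sig t x) - 1) & (LB x. exp (sig t x) - 1) <= 1"
  using sig(3)
 proof eventually_elim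
  case (elim t)
  have nn: "0 <= exp (sig t x) - 1" for x using s[of t x] sig(2)[of t x] by linarith
  have i: "Lint (%x. exp (sig t x) - 1)"
  using elim nn by (intro integrableI_bounded) (auto simp: le_less_trans)
  have "en (LB x. exp (sig t x) - 1) <= 1" using elim nn by (subst nn_integral_eq_integral[symmetric, OF i]) auto
  then show ?case using i by simp
 qed
 show "Lint (%p. beta (fst p) * sig@@p)"
 proof (rule integrableI_bounded)
  show "(%p. beta (fst p) * sig@@p) : bm lborel" by (simp add: borel_prod[symmetric])
  have "(NN p. en (norm (beta (fst p) * sig@@p))) = (NN t. NN x. en (norm (beta t * sig t x)))"
  by (rule st_nn[of "%t x. en (norm (beta t * sig t x))"]) (simp add: meas2_iff)
  also have "... = (NN t. en (beta t)*(NN x. en (sig t x)))"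
  using beta(2) sig(2) by (simp add: ennreal_mult nn_integral_cmult)
  also have "... <= (NN t. en (beta t)*1)"
  proof (rule nn_integral_mono_AE)
  show "AEL t. en (beta t)*(NN x. en (sig t x)) <= en (beta t)*1"
  using sig(3)
  proof eventually_elim
  case (elim t)
  have "(NN x. en (sig t x)) <= (NN x. en (exp (sig t x) - 1))" by (intro nn_integral_mono ennreal_leI s)
  then show ?case using elim by (intro mult_left_mono) (auto intro: order_trans)
  qed
  qed
  also have "... < \<infinity>" using beta by (simp add: integrable_iff_bounded)
  finally show "(NN p. en (norm (beta (fst p) * sig@@p))) < \<infinity>" .
 qed
qed

text \<open>The majorant for the dominated convergence arguments with the weight; \<open>c1\<close>
  and \<open>c2\<close> adapt it to the constants at hand.\<close>

lemma dominating_integrable: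
 assumes R: "1 <= R"
 shows "Lint (%p. c1*(weight R (snd p)*(a (fst p) + beta (fst p) * sig@@p))
  + c2*(weight R (snd p)*(gam@@p + a (fst p))))"
proof -
 note [measurable] = meas(4,5,6)
 have [measurable]: "(%p::real \<times> 'a. weight R (snd p)) : BM" unfolding borel_prod[symmetric] by measurable
 have w: "\<bar>weight R x\<bar> <= 1" for x :: 'a using weight_bounds[of R x] by simp
 have i1: "Lint (%p. weight R (snd p :: 'a)*a (fst p))"
 proof -
  have "Lint (%p. (%t x. weight R x*a t) (fst p) (snd p :: 'a))"
  by (rule st_bound[OF _ a(1) weight_integrable_R[OF R]])
  (auto simp: meas2_iff abs_mult abs_of_pos[OF weight_bounds(1)] a(2) mult.commute)
  then show ?thesis by simp
 qed
 have i2: "Lint (%p. weight R (snd p)*(beta (fst p) * sig@@p))"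
  by (rule Lint_mult[OF exp_sigma(1)]) (auto intro: w)
 have i3: "Lint (%p. weight R (snd p)*gam@@p)"
  by (rule Lint_mult[OF gam(1)]) (auto intro: w)
 show ?thesis unfolding distrib_left[of "weight _ _"] by (intro I_add integrable_mult_right i1 i2 i3)
qed

lemma weighted_div_le:
 assumes R: "1 <= R"
 shows "\<bar>weighted_div R s x\<bar> <= 1*(weight R x*(a s + beta s * sig s x)) + 4*real DIM('a)*(weight R x*(gam s x + a s))"
proof -
 have "\<bar>weighted_div R s x\<bar> <= weight R x*\<bar>field_div g s x\<bar> + \<bar>FD (weight R) (at x) (b s x)\<bar>"
  using weight_bounds(1)[of R x] abs_triangle_ineq[of "weight R x*field_div g s x"] by (simp add: weighted_div_def abs_mult)
 also have "... <= weight R x*(a s + beta s * sig s x) + 2*real DIM('a)*ratio R x*(gam s x + a s)*weight R x"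
  using weight_bounds(1)[of R x] by (intro add_mono mult_left_mono div weight_deriv_field_le[OF R]) auto
 also have "2*real DIM('a)*ratio R x*(gam s x + a s)*weight R x <= 2*real DIM('a)*2*(gam s x + a s)*weight R x"
  using weight_bounds(1)[of R x] gam(2)[of s x] a(2)[of s] by (intro mult_right_mono mult_left_mono ratio_bounds[OF R]) auto
 finally show ?thesis by (simp add: mult_ac)
qed

lemma weighted_div_integrable:
 assumes R: "1 <= R"
 shows "Lint (%p. (v@@p)^2*weighted_div R@@p)"
proof -
 note [measurable (raw)] = meas2[OF vm] meas2[OF weighted_div_meas[of R]]
 have "Lint (%p. weighted_div R@@p)"
 proof (rule I_bound[OF dominating_integrable[OF R, of 1 "4*real DIM('a)"]])
  show "(%p. weighted_div R@@p) : bm lborel" by (simp add: borel_prod[symmetric])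
  show "AEL p. norm (weighted_div R@@p) <= norm (1*(weight R (snd p)*(a (fst p) + beta (fst p) * sig@@p)) + 4*real DIM('a)*(weight R (snd p)*(gam@@p + a (fst p))))"
  using weighted_div_le[OF R] by (intro AE_I2) (auto intro: order_trans[OF _ abs_ge_self])
 qed
 then show ?thesis by (rule Lint_mult[where K="K^2"]) (auto simp: borel_prod[symmetric] sq_bound[simplified])
qed

text \<open>The weight is not compactly supported and is therefore approximated by its products with
  cut-offs at scale \<open>S k\<close>. The gradient of a cut-off is of order
  \<open>1 / S k\<close>, and on its support \<open>1 + norm x <= 2 * S k\<close>; its product with
  \<open>b\<close> is thus dominated by a multiple of \<open>gam + a\<close>, and it tends to 0
  pointwise.\<close>

lemma weighted_identity:
 assumes R: "1 <= R"
 shows "AEL t. t : {0<..<T} -->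
  (LB x. (v t x)^2*weight R x) = prim (%s. LB x. (v s x)^2*weighted_div R s x) t"
proof -
 note [measurable (raw)] = meas2[OF vm] meas2[OF weighted_div_meas[of R]]
 note [measurable] = meas(6)
 obtain eta :: "'a => real" where eta: "tf eta" "!!x. 0 <= eta x" "!!x. 1 <= norm x ==> eta x = 0" "!!x. norm x < 1 ==> 0 < eta x"
  using bump_exists by blast
 \<comment> \<open>Normalised at the origin only: the rescaled cut-offs converge pointwise to
   \<open>kap1 0 = 1\<close>, which is all that dominated convergence uses.\<close>
 define kap1 where "kap1 = (%x. inverse (eta 0)*eta x)"
 have t1: "tf kap1" unfolding kap1_def by (rule tf_mult_smooth[OF eta(1) smooth_on_const])
 have one: "kap1 0 = 1" using eta(4)[of 0] by (simp add: kap1_def)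
 have out1: "kap1 x = 0" if "1 <= norm x" for x using eta(3)[OF that] by (simp add: kap1_def)
 obtain B where B: "B > 0" "!!x. \<bar>kap1 x\<bar> <= B" using tf_bounded[OF t1] by blast
 obtain B' where B': "B' > 0" "!!x h. \<bar>FD kap1 (at x) h\<bar> <= B'*norm h" using tf_FD_bounded[OF t1] by blast
 define S where "S = (%k. real k + 1)"
 have S: "1 <= S k" for k by (simp add: S_def)
 define kap where "kap = (%k x. kap1 (x /\<^sub>R S k))"
 have s1: "smooth_on UNIV kap1" using t1 by (simp add: test_function_def)
 have skap: "smooth_on UNIV (kap k)" for k unfolding kap_def smooth_on_def
 proof (intro allI)
  fix m
  show "Ck_on m UNIV (%x. kap1 (x /\<^sub>R S k))"
  using Ck_on_compose_affine[of m UNIV kap1 "%x. x /\<^sub>R S k" UNIV 0] s1 by (simp add: smooth_on_def bounded_linear_scaleR_right)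
 qed
 have out: "kap k x = 0" if "S k <= norm x" for k x
  unfolding kap_def using S[of k] that by (intro out1) (simp add: field_simps)
 have tkap: "tf (kap k)" for k unfolding tf_alt using skap out[of k] S[of k] by (intro conjI exI[of _ "S k"]) auto
 have Dkap: "FD (kap k) (at x) h = FD kap1 (at (x /\<^sub>R S k)) (h /\<^sub>R S k)" for k x h
 proof -
  have "(kap k has_derivative (%h. FD kap1 (at (x /\<^sub>R S k)) (h /\<^sub>R S k))) (at x)"
  unfolding kap_def
  by (rule has_derivative_compose[of "%x. x /\<^sub>R S k" "%h. h /\<^sub>R S k", OF _ smooth_has_derivative[OF s1]])
  (auto intro!: derivative_eq_intros)
  from frechet_derivative_at[OF this] show ?thesis by metis
 qed
 have kapB: "\<bar>kap k x\<bar> <= B" for k x unfolding kap_def by (rule B(2))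
 have D0: "FD (kap k) (at x) h = 0" if "S k < norm x" for k x h
  using FD_eq_0[OF out that] by simp
 have Dle: "\<bar>FD (kap k) (at x) (b s x)\<bar> <= 2*B'*(gam s x + a s)" for k x s
 proof (cases "S k < norm x")
  case False
  have "\<bar>FD (kap k) (at x) (b s x)\<bar> <= B'*norm (b s x /\<^sub>R S k)" unfolding Dkap by (rule B'(2))
  also have "norm (b s x /\<^sub>R S k) = norm (b s x) / S k" using S[of k] by (simp add: divide_inverse mult.commute)
  also have "norm (b s x) / S k <= (1 + norm x)*(gam s x + a s) / S k"
  using S[of k] by (intro divide_right_mono growth) simp
  also have "... = (1 + norm x) / S k*(gam s x + a s)" by simp
  also have "... <= 2*(gam s x + a s)"
  using S[of k] False gam(2)[of s x] a(2)[of s] by (intro mult_right_mono) (auto simp: field_simps)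
  finally show ?thesis using B'(1) by (simp add: algebra_simps)
 next
  case True
  have "0 <= 2*B'*(gam s x + a s)" using B'(1) gam(2)[of s x] a(2)[of s] by auto
  then show ?thesis using D0[OF True] by simp
 qed
 have SL: "(%k. inverse (S k)) ----> 0" unfolding S_def by real_asymp
 have kaplim: "(%k. kap k x) ----> 1" for x
 proof -
  have "isCont kap1 0" using tf_continuous[OF t1] by (simp add: continuous_on_eq_continuous_at)
  moreover have "(%k. x /\<^sub>R S k) ----> 0" using tendsto_scaleR[OF SL tendsto_const, of x] by simp
  ultimately have "(%k. kap1 (x /\<^sub>R S k)) ----> kap1 0" by (rule isCont_tendsto_compose)
  then show ?thesis unfolding kap_def one .
 qed
 have Dlim: "(%k. FD (kap k) (at x) h) ----> 0" for x h
 proof (rule Lim_null_comparison)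
  show "\<forall>\<^sub>F k in sequentially. norm (FD (kap k) (at x) h) <= B'*(inverse (S k)*norm h)"
  proof (rule always_eventually, rule allI)
  fix k show "norm (FD (kap k) (at x) h) <= B'*(inverse (S k)*norm h)"
  using B'(2)[of "x /\<^sub>R S k" "h /\<^sub>R S k"] S[of k] by (simp add: Dkap)
  qed
  show "(%k. B'*(inverse (S k)*norm h)) ----> 0" using tendsto_mult[OF tendsto_const tendsto_mult[OF SL tendsto_const], of B' "norm h"] by simp
 qed
 define psi where "psi = (%k x. weight R x*kap k x)"
 have tpsi: "tf (psi k)" for k unfolding psi_def by (rule tf_mult_smooth[OF tkap weight_smooth])
 have td: "test_div b g (psi k) s x = kap k x*weighted_div R s x + weight R x*FD (kap k) (at x) (b s x)" for k s x
 proof -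
  have spsi: "smooth_on UNIV (psi k)" using tpsi by (simp add: test_function_def)
  have "test_div b g (psi k) s x = psi k x*field_div g s x + FD (psi k) (at x) (b s x)"
  unfolding test_div_def FD_Basis[OF spsi, of x "b s x"] by (simp add: mult.commute)
  then show ?thesis unfolding psi_def FD_mult[OF weight_smooth skap] by (simp add: weighted_div_def algebra_simps)
 qed
 have "AEL t. ALL k. t : {0<..<T} --> (LB x. (v t x)^2*psi k x) = prim (%s. LB x. (v s x)^2*test_div b g (psi k) s x) t"
  unfolding AE_all_countable using renormalization[OF bg vm K T z eq tpsi] by blast
 then show ?thesis
 proof eventually_elim
  case (elim t)
  show ?case
  proof
  assume t: "t : {0<..<T}"
  have L: "(%k. LB x. (v t x)^2*psi k x) ----> (LB x. (v t x)^2*weight R x)"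
  proof (rule integral_dominated_convergence[where w="%x. K^2*(weight R x*B)"])
  show "Lint (%x::'a. K^2*(weight R x*B))" by (intro integrable_mult_right integrable_mult_left weight_integrable_R R)
  have [measurable]: "psi k : BM" for k using tf_measurable[OF tpsi] .
  show "(%x. (v t x)^2*psi k x) : bm lborel" for k by measurable
  show "AEL x. (%k. (v t x)^2*psi k x) ----> (v t x)^2*weight R x"
  proof (rule AE_I2)
  fix x show "(%k. (v t x)^2*psi k x) ----> (v t x)^2*weight R x"
  using tendsto_mult_left[OF tendsto_mult_left[OF kaplim, of "weight R x"], of "(v t x)^2" x] by (simp add: psi_def)
  qed
  show "AEL x. norm ((v t x)^2*psi k x) <= K^2*(weight R x*B)" for k
  proof (rule AE_I2)
  fix x
  have "\<bar>psi k x\<bar> <= weight R x*B" using weight_bounds(1)[of R x] kapB[of k x] by (simp add: psi_def abs_mult)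
  then show "norm ((v t x)^2*psi k x) <= K^2*(weight R x*B)"
  using mult_mono[OF sq_bound[of t x], of "\<bar>psi k x\<bar>" "weight R x*B"] by (simp add: abs_mult)
  qed
  qed measurable
  \<comment> \<open>The primitive is read as one integral over time and space, so that a single
    majorant \<open>?M\<close> suffices for the limit.\<close>
  let ?f = "%k p. ind {..t} (fst p)*((v@@p)^2*test_div b g (psi k)@@p)"
  let ?F = "%p. ind {..t} (fst p)*((v@@p)^2*weighted_div R@@p)"
  let ?M = "%p. K^2*(B*(weight R (snd p)*(a (fst p) + beta (fst p) * sig@@p)) + (B*(4*real DIM('a)) + 2*B')*(weight R (snd p)*(gam@@p + a (fst p))))"
  have [measurable (raw)]: "(%w. test_div b g (psi k) (p w) (q w)) : bm M"
  if "p : bm M" "q : bm M" for k p q and M :: "'z measure"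
  by (rule meas2[OF test_div_integrable(3)[OF bg tpsi] that])
  have dom: "norm (?f k p) <= ?M p" for k p
  proof -
  obtain s x where p: "p = (s, x)" by fastforce
  have "\<bar>test_div b g (psi k) s x\<bar> <= \<bar>kap k x\<bar>*\<bar>weighted_div R s x\<bar> + weight R x*\<bar>FD (kap k) (at x) (b s x)\<bar>"
  unfolding td using weight_bounds(1)[of R x] abs_triangle_ineq[of "kap k x*weighted_div R s x" "weight R x*FD (kap k) (at x) (b s x)"] by (simp add: abs_mult)
  also have "... <= B*(1*(weight R x*(a s + beta s * sig s x)) + 4*real DIM('a)*(weight R x*(gam s x + a s))) + weight R x*(2*B'*(gam s x + a s))"
  using B(1) weight_bounds(1)[of R x] by (intro add_mono mult_mono kapB Dle weighted_div_le[OF R]) auto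
  also have "... = B*(weight R x*(a s + beta s * sig s x)) + (B*(4*real DIM('a)) + 2*B')*(weight R x*(gam s x + a s))" by (simp add: algebra_simps)
  finally have le: "\<bar>test_div b g (psi k) s x\<bar> <= ..." .
  have "norm (?f k p) <= (v s x)^2*\<bar>test_div b g (psi k) s x\<bar>" by (simp add: p indicator_def abs_mult)
  also have "... <= ?M p" using mult_mono[OF sq_bound[of s x] le] by (simp add: p)
  finally show ?thesis .
  qed
  have Rr: "(%k. LB p. ?f k p) ----> (LB p. ?F p)"
  proof (rule integral_dominated_convergence[where w="?M"])
  show "Lint ?M" by (intro integrable_mult_right dominating_integrable[OF R])
  show "?f k : bm lborel" for k by (simp add: borel_prod[symmetric])
  show "?F : bm lborel" by (simp add: borel_prod[symmetric])
  show "AEL p. norm (?f k p) <= ?M p" for k by (intro AE_I2 dom)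
  show "AEL p. (%k. ?f k p) ----> ?F p"
  proof (rule AE_I2)
  fix p :: "real \<times> 'a"
  have "(%k. test_div b g (psi k)@@p) ----> 1*weighted_div R@@p + weight R (snd p)*0"
  unfolding td by (intro tendsto_intros kaplim Dlim)
  then have "(%k. test_div b g (psi k)@@p) ----> weighted_div R@@p" by simp
  then show "(%k. ?f k p) ----> ?F p" by (intro tendsto_intros)
  qed
  qed
  have fi: "Lint (?f k)" for k
  proof (rule I_bound)
  show "Lint ?M" by (intro integrable_mult_right dominating_integrable[OF R])
  show "?f k : bm lborel" by (simp add: borel_prod[symmetric])
  show "AEL p. norm (?f k p) <= norm (?M p)"
  proof (rule AE_I2)
  fix p show "norm (?f k p) <= norm (?M p)" by (rule order_trans[OF dom]) (simp only: real_norm_def abs_ge_self)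
  qed
  qed
  have Fi: "Lint ?F"
  by (rule Lint_mult[OF weighted_div_integrable[OF R], where K=1]) (auto simp: borel_prod[symmetric] indicator_def)
  have e1: "prim (%s. LB x. (v s x)^2*test_div b g (psi k) s x) t = (LB p. ?f k p)" for k
  using st_tx[of "%s x. ind {..t} s*((v s x)^2*test_div b g (psi k) s x)", OF fi[of k]] by (simp add: prim_def)
  have e2: "prim (%s. LB x. (v s x)^2*weighted_div R s x) t = (LB p. ?F p)"
  using st_tx[of "%s x. ind {..t} s*((v s x)^2*weighted_div R s x)", OF Fi] by (simp add: prim_def)
  have "(%k. LB x. (v t x)^2*psi k x) = (%k. LB p. ?f k p)" using elim t e1 by auto
  then show "(LB x. (v t x)^2*weight R x) = prim (%s. LB x. (v s x)^2*weighted_div R s x) t"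
  using LIMSEQ_unique[OF L] Rr e2 by simp
  qed
 qed
qed

text \<open>\<open>beta1\<close> may replace \<open>beta\<close> at times when \<open>v\<close> is
  already known to vanish, since the divergence contributes nothing there. The two contributions
  without a factor \<open>v^2 * weight\<close>, namely \<open>gam\<close> and the exponential tail,
  are put into the initial value of Gronwall's inequality.\<close>

lemma weighted_gronwall:
 assumes R: "1 <= R" and k: "0 <= k" and beta1: "Lint beta1" "!!s. 0 <= beta1 s"
  and vs: "AEL s. s : {0<..<T} --> beta1 s = beta s \<or> (AEL x. v s x = 0)"
 shows "AEL t. t : {0<..<T} --> (LB x. (v t x)^2*weight R x)
  <= ((LB p. K^2*(2*real DIM('a)*ratio R (snd p))*gam@@p) + K^2*exp (- k / 2)*(LB s. beta1 s))
  * exp (prim (%s. (1 + 4*real DIM('a))*a s + k*beta1 s) t)"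
proof -
 note [measurable (raw)] = meas2[OF vm] meas2[OF weighted_div_meas[of R]] meas2[OF meas(2)]
 note [measurable] = meas(4,6)
 have [measurable]: "beta1 : BM" using beta1 by auto
 define y where "y = (%t. ind {0<..<T} t*(LB x. (v t x)^2*weight R x))"
 \<comment> \<open>The 1 is from the divergence, \<open>4 n\<close> from the gradient of the weight
   with the ratio bound 2, and \<open>k * beta1\<close> from the truncation of
   \<open>sig\<close>.\<close>
 define A where "A = (%s. (1 + 4*real DIM('a))*a s + k*beta1 s)"
 define rr where "rr = (%x::'a. K^2*(2*real DIM('a)*ratio R x))"
 have rr0: "0 <= rr x" "rr x <= K^2*(2*real DIM('a)*2)" for x
 proof -
  note r = ratio_bounds[OF R norm_ge_zero, of x]
  show "0 <= rr x" unfolding rr_def using r(1) by (intro mult_nonneg_nonneg) auto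
  show "rr x <= K^2*(2*real DIM('a)*2)" unfolding rr_def using r(2) by (intro mult_left_mono) auto
 qed
 have [measurable]: "rr : BM" unfolding rr_def by measurable
 have ri: "Lint (%p. rr (snd p)*gam@@p)"
  by (rule Lint_mult[OF gam(1), where K="K^2*(2*real DIM('a)*2)"]) (use rr0 in \<open>auto simp: borel_prod[symmetric]\<close>)
 note ri' = st_t[of "%s x. rr x*gam s x", OF ri]
 define e1 where "e1 = (%s. (LB x. rr x*gam s x) + K^2*exp (- k / 2)*beta1 s)"
 have e1i: "Lint e1" unfolding e1_def by (intro I_add ri' integrable_mult_right beta1)
 have e10: "0 <= e1 s" for s unfolding e1_def using rr0 gam(2) beta1(2) by (intro add_nonneg_nonneg L_nonneg) auto
 have Ai: "Lint A" unfolding A_def by (intro I_add integrable_mult_right beta1 a)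
 have A0: "0 <= A s" for s unfolding A_def using a(2)[of s] beta1(2)[of s] k by auto
 have wI: "Lint (%x. (v t x)^2*weight R x)" for t
  by (rule Lint_mult[OF weight_integrable_R[OF R], where K="K^2"]) (use sq_bound[of t, simplified] in auto)
 have y0: "0 <= y t" for t unfolding y_def using w0[of R] by (intro mult_nonneg_nonneg L_nonneg) (auto simp: less_imp_le)
 have yY: "y t <= K^2*(LB x. weight R (x::'a))" for t
 proof -
  have "(LB x. (v t x)^2*weight R x) <= (LB x. K^2*weight R (x::'a))"
  by (rule integral_mono[OF wI]) (use weight_integrable_R[OF R] sq_bound[of t, simplified] w0[of R] in \<open>auto intro!: mult_right_mono simp: less_imp_le\<close>)
  moreover have "0 <= (LB x. weight R (x::'a))" using w0[of R] by (intro L_nonneg) (auto simp: less_imp_le)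
  ultimately show ?thesis by (simp add: y_def indicator_def)
 qed
 have ym: "y : BM" unfolding y_def by measurable
 have key: "AEL s. (LB x. (v s x)^2*weighted_div R s x) <= e1 s + A s*y s"
  using st_AE[of "%s x. (v s x)^2*weighted_div R s x", OF weighted_div_integrable[OF R]]
  st_AE[of "%s x. rr x*gam s x", OF ri] exp_sigma(2) vs
 proof eventually_elim
  case (elim s)
  show ?case
  proof (cases "s : {0<..<T}")
  case False
  have "weighted_div R s x = 0" for x
  using z(1)[OF False] z(2)[OF False] by (simp add: weighted_div_def field_div_def FD_Basis[OF weight_smooth[of UNIV], of R x 0])
  then show ?thesis using e10[of s] A0[of s] y0[of s] by simp
  next
  case True
  let ?ex = "K^2*exp (- k / 2)*beta1 s"
  have "AEL x. v s x = 0 \<or> beta1 s = beta s" using elim(4) True by (auto elim: eventually_mono)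
  then have pt: "AEL x. (v s x)^2*weighted_div R s x <= (rr x*gam s x + A s*((v s x)^2*weight R x)) + ?ex*(exp (sig s x) - 1)"
  proof eventually_elim
  case (elim x)
  have ex0: "0 <= exp (sig s x) - 1" using sig(2)[of s x] by simp
  have W0: "0 < weight R x" "weight R x <= 1" using weight_bounds[of R x] by auto
  show ?case
  proof (cases "v s x = 0")
  case True
  have "0 <= rr x*gam s x" using rr0[of x] gam(2)[of s x] by simp
  moreover have "0 <= ?ex*(exp (sig s x) - 1)" using beta1(2)[of s] ex0 by simp
  ultimately show ?thesis using True by simp
  next
  case False
  with elim have b1: "beta s = beta1 s" by simp
  let ?u = "(v s x)^2*weight R x"
  have u: "0 <= ?u" "?u <= K^2"
  using W0 sq_bound[of s x, simplified] mult_mono[of "(v s x)^2" "K^2" "weight R x" 1] by auto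
  have rn: "0 <= ratio R x" "ratio R x <= 2" using ratio_bounds[OF R, of "norm x"] by auto
  have "weighted_div R s x <= weight R x*(a s + beta1 s * sig s x) + 2*real DIM('a)*ratio R x*(gam s x + a s)*weight R x"
  unfolding weighted_div_def
  proof (rule add_mono)
  show "weight R x*field_div g s x <= weight R x*(a s + beta1 s * sig s x)"
  using W0 abs_le_D1[OF div[of s x]] b1 by (intro mult_left_mono) auto
  show "FD (weight R) (at x) (b s x) <= 2*real DIM('a)*ratio R x*(gam s x + a s)*weight R x"
  using weight_deriv_field_le[OF R, of x s] by (rule abs_le_D1)
  qed
  then have "(v s x)^2*weighted_div R s x <= (v s x)^2*(weight R x*(a s + beta1 s * sig s x) + 2*real DIM('a)*ratio R x*(gam s x + a s)*weight R x)"
  by (rule mult_left_mono) simp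
  also have "... = ?u*a s + ?u*(beta1 s * sig s x) + (2*real DIM('a)*ratio R x*gam s x)*?u + (2*real DIM('a)*ratio R x)*(?u*a s)"
  by (simp only: ring_distribs mult_ac add_ac)
  also have "... <= ?u*a s + (?u*(beta1 s*k) + ?ex*(exp (sig s x) - 1)) + (2*real DIM('a)*ratio R x*gam s x)*K^2 + (2*real DIM('a)*2)*(?u*a s)"
  proof (intro add_mono order_refl)
  \<comment> \<open>In the bounded part \<open>k\<close> the factor \<open>?u\<close> is kept for
    Gronwall's inequality; in the tail it is replaced by \<open>K^2\<close>, since the integral of
    \<open>exp sig - 1\<close> is at most 1.\<close>
  have "?u*(beta1 s * sig s x) <= ?u*(beta1 s*(k + exp (- k / 2)*(exp (sig s x) - 1)))"
  using u beta1(2)[of s] by (intro mult_left_mono truncated_exp_bound sig(2) k) auto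
  also have "... = ?u*(beta1 s*k) + ?u*(beta1 s*(exp (- k / 2)*(exp (sig s x) - 1)))" by (simp only: distrib_left)
  also have "?u*(beta1 s*(exp (- k / 2)*(exp (sig s x) - 1))) <= K^2*(beta1 s*(exp (- k / 2)*(exp (sig s x) - 1)))"
  using u beta1(2)[of s] ex0 by (intro mult_right_mono) auto
  also have "K^2*(beta1 s*(exp (- k / 2)*(exp (sig s x) - 1))) = ?ex*(exp (sig s x) - 1)" by (simp only: mult_ac)
  finally show "?u*(beta1 s * sig s x) <= ?u*(beta1 s*k) + ?ex*(exp (sig s x) - 1)" by simp
  show "(2*real DIM('a)*ratio R x*gam s x)*?u <= (2*real DIM('a)*ratio R x*gam s x)*K^2"
  using u rn gam(2)[of s x] by (intro mult_left_mono) (auto intro!: mult_nonneg_nonneg)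
  show "(2*real DIM('a)*ratio R x)*(?u*a s) <= (2*real DIM('a)*2)*(?u*a s)"
  using u rn a(2)[of s] by (intro mult_right_mono mult_left_mono) (auto intro!: mult_nonneg_nonneg)
  qed
  also have "... = (rr x*gam s x + A s*?u) + ?ex*(exp (sig s x) - 1)"
  proof -
  have "rr x*gam s x = (2*real DIM('a)*ratio R x*gam s x)*K^2" unfolding rr_def by (simp only: mult_ac)
  moreover have "A s*?u = ?u*a s + ?u*(beta1 s*k) + (2*real DIM('a)*2)*(?u*a s)"
  unfolding A_def by (simp add: algebra_simps)
  ultimately show ?thesis by linarith
  qed
  finally show ?thesis .
  qed
  qed
  have iR: "Lint (%x. (rr x*gam s x + A s*((v s x)^2*weight R x)) + ?ex*(exp (sig s x) - 1))"
  using elim(2,3) wI by (intro I_add integrable_mult_right) auto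
  have "(LB x. (v s x)^2*weighted_div R s x) <= (LB x. (rr x*gam s x + A s*((v s x)^2*weight R x)) + ?ex*(exp (sig s x) - 1))"
  by (rule integral_mono_AE[OF elim(1) iR pt])
  also have "... = ((LB x. rr x*gam s x) + A s*(LB x. (v s x)^2*weight R x)) + ?ex*(LB x. exp (sig s x) - 1)"
  using elim(2,3) wI[of s]
  by (subst L_add) (auto intro!: I_add integrable_mult_right simp: L_add)
  also have "... <= ((LB x. rr x*gam s x) + A s*(LB x. (v s x)^2*weight R x)) + ?ex*1"
  using elim(3) beta1(2)[of s] by (intro add_left_mono mult_left_mono) auto
  also have "... = e1 s + A s*y s" using True by (simp add: e1_def y_def)
  finally show ?thesis .
  qed
 qed
 define del0 where "del0 = (LB s. e1 s)"
 have del00: "0 <= del0" unfolding del0_def using e10 by (intro L_nonneg) auto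
 have Ayi: "Lint (%s. A s*y s)"
  by (rule integrable_mult_prim[OF Ai, where C="K^2*(LB x. weight R (x::'a))"]) (use ym y0 yY in auto)
 have ineq: "AEL t. y t <= del0 + prim (%s. A s*y s) t"
  using weighted_identity[OF R]
 proof eventually_elim
  case (elim t)
  have nn: "0 <= prim (%s. A s*y s) t" using A0 y0 by (intro prim_nonneg) auto
  show ?case
  proof (cases "t : {0<..<T}")
  case True
  then have "y t = prim (%s. LB x. (v s x)^2*weighted_div R s x) t" using elim by (simp add: y_def)
  also have "... <= prim (%s. e1 s + A s*y s) t"
  by (rule prim_mono_AE[OF st_t[of "%s x. (v s x)^2*weighted_div R s x", OF weighted_div_integrable[OF R]] _ key])
  (intro I_add e1i Ayi)
  also have "... = prim e1 t + prim (%s. A s*y s) t" by (rule prim_add[OF e1i Ayi])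
  also have "prim e1 t <= del0" using abs_prim_le[OF e1i, of t] e10 by (simp add: del0_def)
  finally show ?thesis by simp
  qed (use nn del00 in \<open>simp add: y_def\<close>)
 qed
 have gr: "AEL t. y t <= del0*exp (prim A t)"
  by (rule gronwall[OF Ai A0 ym y0 yY del00 ineq])
 have del0: "del0 = (LB p. rr (snd p)*gam@@p) + K^2*exp (- k / 2)*(LB s. beta1 s)"
  unfolding del0_def e1_def st_tx[of "%s x. rr x*gam s x", OF ri]
  using L_add[OF ri' integrable_mult_right[OF beta1(1), of "K^2*exp (- k / 2)"]] by simp
 from gr show ?thesis
 proof eventually_elim
  case (elim t)
  show ?case
  proof
  assume t: "t : {0<..<T}"
  then have "(LB x. (v t x)^2*weight R x) = y t" by (simp add: y_def)
  with elim show "(LB x. (v t x)^2*weight R x)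
  <= ((LB p. K^2*(2*real DIM('a)*ratio R (snd p))*gam@@p) + K^2*exp (- k / 2)*(LB s. beta1 s))
  * exp (prim (%s. (1 + 4*real DIM('a))*a s + k*beta1 s) t)"
  unfolding del0 A_def rr_def by (simp only:)
  qed
 qed
qed

text \<open>The weighted integral at \<open>R = 1\<close> is below that at any larger
  \<open>R\<close>. Letting \<open>R\<close> grow for fixed \<open>k\<close> removes the
  \<open>gam\<close> term by dominated convergence; then \<open>exp (- k / 2)\<close> times
  \<open>exp (k / 4)\<close> tends to 0 as \<open>k\<close> grows.\<close>

lemma vanishing_step:
 assumes beta1: "Lint beta1" "!!s. 0 <= beta1 s"
  and vs: "AEL s. s : {0<..<T} --> beta1 s = beta s \<or> (AEL x. v s x = 0)"
 shows "AEL t. t : {0<..<T} --> prim beta1 t <= 1 / 4 --> (AEL x. v t x = 0)"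
proof -
 let ?d = "%R. LB p. K^2*(2*real DIM('a)*ratio R (snd p))*gam@@p"
 let ?I = "LB s. beta1 s"
 note [measurable (raw)] = meas2[OF vm] meas2[OF meas(2)]
 note [measurable] = meas(6)
 have dlim: "(%j. ?d (real j + 1)) ----> (LINT p|(lborel :: (real \<times> 'a) measure). 0)"
 proof (rule integral_dominated_convergence[where w="%p. K^2*(2*real DIM('a)*2)*gam@@p"])
  show "Lint (%p. K^2*(2*real DIM('a)*2)*gam@@p)" by (intro integrable_mult_right gam)
  show "(%p. K^2*(2*real DIM('a)*ratio (real j + 1) (snd p))*gam@@p) : bm lborel" for j
  by (simp add: borel_prod[symmetric])
  show "AEL p. (%j. K^2*(2*real DIM('a)*ratio (real j + 1) (snd p))*gam@@p) ----> 0"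
  proof (rule AE_I2)
  fix p :: "real \<times> 'a"
  have "(%j. c / ((real j + 1)^2 + d)) ----> 0" for c d :: real by real_asymp
  then have "(%j. norm (snd p) / ((real j + 1)^2 + (norm (snd p))^2)) ----> 0" by blast
  then have "(%j. K^2*(2*real DIM('a)*ratio (real j + 1) (snd p))*gam@@p) ----> K^2*(2*real DIM('a)*(0*(1 + norm (snd p))))*gam@@p"
  by (intro tendsto_intros)
  then show "(%j. K^2*(2*real DIM('a)*ratio (real j + 1) (snd p))*gam@@p) ----> 0" by simp
  qed
  show "AEL p. norm (K^2*(2*real DIM('a)*ratio (real j + 1) (snd p))*gam@@p) <= K^2*(2*real DIM('a)*2)*gam@@p" for j
  proof (rule AE_I2)
  fix p :: "real \<times> 'a"
  have r: "0 <= ratio (real j + 1) (snd p)" "ratio (real j + 1) (snd p) <= 2" using ratio_bounds[of "real j + 1" "norm (snd p)"] by auto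
  have "K^2*(2*real DIM('a)*ratio (real j + 1) (snd p))*gam@@p <= K^2*(2*real DIM('a)*2)*gam@@p"
  using r gam(2)[of "fst p" "snd p"] by (intro mult_right_mono mult_left_mono) auto
  moreover have "0 <= K^2*(2*real DIM('a)*ratio (real j + 1) (snd p))*gam@@p"
  using r(1) gam(2)[of "fst p" "snd p"] by (intro mult_nonneg_nonneg) auto
  ultimately show "norm (K^2*(2*real DIM('a)*ratio (real j + 1) (snd p))*gam@@p) <= K^2*(2*real DIM('a)*2)*gam@@p"
  by (simp only: real_norm_def abs_of_nonneg)
  qed
 qed simp
 have I0: "0 <= ?I" using beta1(2) by (intro L_nonneg) auto
 define cA where "cA = (1 + 4*real DIM('a))*(LB s. a s)"
 \<comment> \<open>Only the countably many values \<open>R = j + 1\<close> and \<open>k\<close> are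
   used, so that one null set of times serves all of them.\<close>
 have "AEL t. ALL j k. t : {0<..<T} --> (LB x. (v t x)^2*weight (real j + 1) x)
  <= (?d (real j + 1) + K^2*exp (- real k / 2)*?I)*exp (prim (%s. (1 + 4*real DIM('a))*a s + real k*beta1 s) t)"
  unfolding AE_all_countable
 proof (intro allI)
  fix j k :: nat
  show "AEL t. t : {0<..<T} --> (LB x. (v t x)^2*weight (real j + 1) x)
  <= (?d (real j + 1) + K^2*exp (- real k / 2)*?I)*exp (prim (%s. (1 + 4*real DIM('a))*a s + real k*beta1 s) t)"
  by (rule weighted_gronwall[OF _ _ beta1 vs]) auto
 qed
 then show ?thesis
 proof eventually_elim
  case (elim t)
  show ?case
  proof (intro impI)
  assume t: "t : {0<..<T}" and small: "prim beta1 t <= 1 / 4"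
  have wI: "Lint (%x. (v t x)^2*weight R x)" if "1 <= R" for R
  by (rule Lint_mult[OF weight_integrable_R[OF that], where K="K^2"]) (use sq_bound[of t, simplified] in auto)
  let ?y = "LB x. (v t x)^2*weight 1 x"
  have d0: "0 <= ?d (real j + 1)" for j :: nat
  proof (rule L_nonneg)
  fix p :: "real \<times> 'a"
  show "0 <= K^2*(2*real DIM('a)*ratio (real j + 1) (snd p))*gam@@p"
  using ratio_bounds(1)[of "real j + 1" "norm (snd p)"] gam(2)[of "fst p" "snd p"] by (intro mult_nonneg_nonneg) auto
  qed
  have est: "?y <= (?d (real j + 1) + K^2*exp (- real k / 2)*?I)*exp (cA + real k / 4)" for j k :: nat
  proof -
  have "?y <= (LB x. (v t x)^2*weight (real j + 1) x)"
  by (rule integral_mono[OF wI wI]) (auto intro!: mult_left_mono weight_mono)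
  also have "... <= (?d (real j + 1) + K^2*exp (- real k / 2)*?I)*exp (prim (%s. (1 + 4*real DIM('a))*a s + real k*beta1 s) t)"
  using elim t by blast
  also have "... <= (?d (real j + 1) + K^2*exp (- real k / 2)*?I)*exp (cA + real k / 4)"
  proof (rule mult_left_mono)
  have "prim (%s. (1 + 4*real DIM('a))*a s + real k*beta1 s) t = (1 + 4*real DIM('a))*prim a t + real k*prim beta1 t"
  using prim_add[OF integrable_mult_right[OF a(1)] integrable_mult_right[OF beta1(1)], of "1 + 4*real DIM('a)" "real k" t] by (simp add: prim_cmult)
  also have "... <= cA + real k*(1 / 4)" unfolding cA_def
  using abs_prim_le[OF a(1), of t] a(2) small by (intro add_mono mult_left_mono) auto
  finally show "exp (prim (%s. (1 + 4*real DIM('a))*a s + real k*beta1 s) t) <= exp (cA + real k / 4)" by simp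
  show "0 <= ?d (real j + 1) + K^2*exp (- real k / 2)*?I" using d0[of j] I0 by auto
  qed
  finally show ?thesis .
  qed
  have est2: "?y <= (0 + K^2*exp (- real k / 2)*?I)*exp (cA + real k / 4)" for k :: nat
  proof (rule LIMSEQ_le_const)
  show "(%j. (?d (real j + 1) + K^2*exp (- real k / 2)*?I)*exp (cA + real k / 4)) ----> (0 + K^2*exp (- real k / 2)*?I)*exp (cA + real k / 4)"
  using dlim by (intro tendsto_intros) simp
  show "EX N. ALL j>=N. ?y <= (?d (real j + 1) + K^2*exp (- real k / 2)*?I)*exp (cA + real k / 4)" using est by blast
  qed
  have "?y <= 0"
  proof (rule LIMSEQ_le_const)
  have "(%k. exp (- real k / 4)) ----> 0" by real_asymp
  then have "(%k. (K^2*?I*exp cA)*exp (- real k / 4)) ----> (K^2*?I*exp cA)*0" by (intro tendsto_intros)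
  then show "(%k. (K^2*?I*exp cA)*exp (- real k / 4)) ----> 0" by simp
  have "(0 + K^2*exp (- real k / 2)*?I)*exp (cA + real k / 4) = (K^2*?I*exp cA)*exp (- real k / 4)" for k :: nat
  proof -
  have "exp (- real k / 2)*exp (real k / 4) = exp (- real k / 4)" by (simp add: exp_add[symmetric])
  then show ?thesis by (simp add: exp_add mult_ac)
  qed
  then show "EX N. ALL k>=N. ?y <= (K^2*?I*exp cA)*exp (- real k / 4)" using est2 by metis
  qed
  moreover have nn: "0 <= (v t x)^2*weight 1 x" for x using weight_bounds(1)[of 1 x] by simp
  moreover have "0 <= ?y" by (rule L_nonneg) (rule nn)
  ultimately have "?y = 0" by linarith
  then have "AEL x. (v t x)^2*weight 1 x = 0"
  using integral_nonneg_eq_0_iff_AE[OF wI[of 1]] nn by simp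
  then show "AEL x. v t x = 0"
  proof eventually_elim
  case (elim x) then show ?case using weight_bounds(1)[of 1 x] by simp
  qed
  qed
 qed
qed

text \<open>Induction over the levels \<open>m / 4\<close> of \<open>prim beta\<close>. Up to the
  level already treated \<open>v\<close> vanishes, so only the part \<open>beta1\<close> of
  \<open>beta\<close> beyond it counts, and its integral up to the next level is at most
  1/4.\<close>

lemma vanishing: "AEL t. t : {0<..<T} --> (AEL x. v t x = 0)"
proof -
 note [measurable] = meas(5)
 have mono: "prim beta s <= prim beta t" if "s <= t" for s t
  unfolding prim_def by (rule integral_mono[OF prim_integrable[OF beta(1)] prim_integrable[OF beta(1)]]) (use that beta(2) in \<open>auto simp: indicator_def\<close>)
 have step: "AEL t. t : {0<..<T} --> prim beta t <= real m / 4 --> (AEL x. v t x = 0)" for m :: nat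
 proof (induction m)
  case 0
  have "AEL t. t : {0<..<T} --> prim beta t <= 1 / 4 --> (AEL x. v t x = 0)"
  by (rule vanishing_step[OF beta]) auto
  then show ?case by eventually_elim auto
 next
  case (Suc m)
  define beta1 where "beta1 = (%s. ind {s. real m / 4 < prim beta s} s*beta s)"
  have [measurable]: "{s. real m / 4 < prim beta s} : sets borel" by measurable
  have beta1i: "Lint beta1" unfolding beta1_def by (rule integrable_indicator_mult[OF beta(1)]) simp
  have beta10: "0 <= beta1 s" for s using beta(2) by (simp add: beta1_def)
  have "AEL t. t : {0<..<T} --> prim beta1 t <= 1 / 4 --> (AEL x. v t x = 0)"
  proof (rule vanishing_step[OF beta1i beta10])
  show "AEL s. s : {0<..<T} --> beta1 s = beta s \<or> (AEL x. v s x = 0)"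
  using Suc by eventually_elim (auto simp: beta1_def)
  qed
  then show ?case
  proof eventually_elim
  case (elim t)
  show ?case
  proof (intro impI)
  assume t: "t : {0<..<T}" and le: "prim beta t <= real (Suc m) / 4"
  have "prim beta1 t <= 1 / 4"
  proof (cases "prim beta t <= real m / 4")
  case True
  have "prim beta1 t <= 0" unfolding prim_def
  proof -
  have "(%s. ind {..t} s*beta1 s) = (%s. 0)"
  proof
  fix s show "ind {..t} s*beta1 s = 0" using mono[of s t] True by (auto simp: indicator_def beta1_def)
  qed
  then show "(LB s. ind {..t} s*beta1 s) <= 0" by simp
  qed
  then show ?thesis by simp
  next
  case False
  have p0: "prim beta 0 = 0"
  proof -
  have "(%s. ind {..0} s*beta s) = (%s. 0)"
  proof
  fix s show "ind {..0} s*beta s = 0" using betaz[of s] by (auto simp: indicator_def)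
  qed
  then show ?thesis by (simp add: prim_def)
  qed
  \<comment> \<open>\<open>tau\<close> is a time at which the previous level is reached; before it
    \<open>beta1\<close> vanishes, so \<open>prim beta1 t\<close> is bounded by the increase of
    \<open>prim beta\<close> from \<open>tau\<close> to \<open>t\<close>.\<close>
  have "EX tau. 0 <= tau & tau <= t & prim beta tau = real m / 4"
  by (rule IVT') (use p0 False t prim_continuous[OF beta(1)] in \<open>auto intro: continuous_on_subset\<close>)
  then obtain tau where tau: "tau <= t" "prim beta tau = real m / 4" by blast
  have "prim beta1 t <= (LB s. ind {..t} s*beta s - ind {..tau} s*beta s)" unfolding prim_def
  proof (rule integral_mono)
  fix s
  show "ind {..t} s*beta1 s <= ind {..t} s*beta s - ind {..tau} s*beta s"
  using mono[of s tau] tau beta(2)[of s] by (auto simp: indicator_def beta1_def)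
  qed (intro prim_integrable I_diff beta1i beta)+
  also have "... = prim beta t - prim beta tau" unfolding prim_def
  by (rule L_diff[OF prim_integrable[OF beta(1)] prim_integrable[OF beta(1)]])
  finally show ?thesis using tau le by simp
  qed
  then show "AEL x. v t x = 0" using elim t by blast
  qed
  qed
 qed
 obtain m :: nat where m: "4*(LB s. \<bar>beta s\<bar>) <= real m" using real_arch_simple by blast
 show ?thesis using step[of m]
 proof eventually_elim
  case (elim t)
  then show ?case using abs_prim_le[OF beta(1), of t] m by auto
 qed
qed

end

section \<open>Test functions on the closed slab\<close>

text \<open>Derivatives on the closed slab are one-sided in time at the ends. Spatial slices are
  full spaces and yield genuine derivatives, temporal slices only derivatives within
  \<open>{0..T}\<close>.\<close>

lemma slab_slice_derivative:
 fixes F :: "real \<times> 'a::euclidean_space => real"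
 assumes F: "(F has_derivative F') (at (t, x) within ({0..T} \<times> UNIV))" and t: "t : {0..T}"
 shows "((%x. F (t, x)) has_derivative (%h. F' (0, h))) (at x)"
  and "((%s. F (s, x)) has_vector_derivative F' (1, 0)) (at t within {0..T})"
proof -
 have "((%x. F (t, x)) has_derivative (%h. F' (0, h))) (at x within UNIV)"
 proof (rule has_derivative_in_compose[of "%x. (t, x)" "%h. (0, h)" x UNIV F F'])
  show "((%x. (t, x)) has_derivative (%h. (0, h))) (at x)" by (auto intro!: derivative_eq_intros)
  show "(F has_derivative F') (at (t, x) within range (%x. (t, x)))"
  by (rule has_derivative_subset[OF F]) (use t in auto)
 qed
 then show "((%x. F (t, x)) has_derivative (%h. F' (0, h))) (at x)" by simp
 have "((%s. F (s, x)) has_derivative (%h. F' (h, 0))) (at t within {0..T})"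
 proof (rule has_derivative_in_compose[of "%s. (s, x)" "%h. (h, 0)" t "{0..T}" F F'])
  show "((%s. (s, x)) has_derivative (%h. (h, 0))) (at t within {0..T})" by (auto intro!: derivative_eq_intros)
  show "(F has_derivative F') (at (t, x) within (%s. (s, x)) ` {0..T})"
  by (rule has_derivative_subset[OF F]) auto
 qed
 moreover have "(%h. F' (h, 0)) = (%h. h *R F' (1, 0))"
 proof
  fix h show "F' (h, 0) = h *R F' (1, 0)"
  proof -
  have "F' (h *R (1, 0)) = h *R F' (1, 0)" using has_derivative_linear[OF F] by (simp only: linear_cmul)
  then show ?thesis by simp
  qed
 qed
 ultimately show "((%s. F (s, x)) has_vector_derivative F' (1, 0)) (at t within {0..T})"
  unfolding has_vector_derivative_def by (rule back_subst[of "%D. ((%s. F (s, x)) has_derivative D) (at t within {0..T})"])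
qed

lemma slab_measurable:
 fixes F :: "real \<times> 'a::euclidean_space => real"
 assumes "continuous_on ({0..T} \<times> UNIV) F"
 shows "case_prod (%t x. ind {0<..<T} t*F (t, x)) : BM"
proof -
 have "open ({0<..<T} \<times> (UNIV :: 'a set))" by (intro open_Times) auto
 then have "(%p. ind ({0<..<T} \<times> UNIV) p *R F p) : BM"
  by (intro borel_measurable_continuous_on_indicator continuous_on_subset[OF assms]) auto
 then show ?thesis by (simp add: case_prod_beta' indicator_times)
qed

text \<open>All bounds come from compactness. Two orders of derivatives are extracted because second
  differences are controlled through the Lipschitz constant of the spatial gradient.\<close>

lemma transport_admissible:
 fixes phi :: "real \<times> 'a::euclidean_space => real"
 assumes phi: "transport_test_function T phi" and T: "0 < T"
 shows "EX phit D R C. admissible T (%t x. ind {0<..<T} t*phi (t, x)) phit D (%x. phi (0, x)) R C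
  & (ALL t:{0<..<T}. ALL x. deriv (%s. phi (s, x)) t = phit t x)"
proof -
 define S where "S = {0..T} \<times> (UNIV :: 'a set)"
 have sm: "smooth_on S phi" using phi by (simp add: transport_test_function_def S_def)
 obtain K where K: "compact K" "K \<subseteq> {0..<T} \<times> UNIV" "!!p. p : S - K ==> phi p = 0"
  using phi by (auto simp: transport_test_function_def S_def)
 have "bounded (snd ` K)" using K(1) by (intro compact_imp_bounded compact_continuous_image continuous_intros)
 then obtain R0 where R0: "0 < R0" "!!p. p : K ==> norm (snd p) <= R0" by (auto simp: bounded_pos)
 have out0: "phi (t, x) = 0" if "t : {0..T}" "R0 < norm x" for t x
  using K(3)[of "(t, x)"] R0(2)[of "(t, x)"] that by (force simp: S_def)
 have outT: "phi (T, x) = 0" for x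
 proof -
  have "(T, x) ~: K" using K(2) by auto
  then show ?thesis using K(3)[of "(T, x)"] T by (simp add: S_def)
 qed
 have "Ck_on (Suc (Suc 0)) S phi" using sm unfolding smooth_on_def by blast
 then have "EX f'. (ALL x:S. (phi has_derivative f' x) (at x within S)) & (ALL i:Basis. Ck_on (Suc 0) S (%x. f' x i))"
  by (simp only: Ck_on.simps(2)[of "Suc 0"])
 then obtain f1 where f1': "ALL x:S. (phi has_derivative f1 x) (at x within S)" and f1C': "ALL i:Basis. Ck_on (Suc 0) S (%x. f1 x i)"
  by (elim exE conjE)
 have f1: "(phi has_derivative f1 p) (at p within S)" if "p : S" for p by (rule bspec[OF f1' that])
 have f1C: "Ck_on (Suc 0) S (%p. f1 p i)" if "i : Basis" for i by (rule bspec[OF f1C' that])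
 have f1c: "continuous_on S (%p. f1 p i)" if "i : Basis" for i using Ck_on_SucD[OF f1C[OF that]] by simp
 have "ALL i:Basis. EX f2. (ALL p:S. ((%p. f1 p i) has_derivative f2 p) (at p within S)) & (ALL j:Basis. continuous_on S (%p. f2 p j))"
 proof
  fix i :: "real \<times> 'a" assume "i : Basis"
  from f1C[OF this] show "EX f2. (ALL p:S. ((%p. f1 p i) has_derivative f2 p) (at p within S)) & (ALL j:Basis. continuous_on S (%p. f2 p j))"
  by (simp only: Ck_on.simps)
 qed
 from bchoice[OF this] obtain f2 where f2: "!!i p. i : Basis ==> p : S ==> ((%p. f1 p i) has_derivative f2 i p) (at p within S)"
  and f2c: "!!i j. i : Basis ==> j : Basis ==> continuous_on S (%p. f2 i p j)" by blast
 have bx: "(0, i) : (Basis :: (real \<times> 'a) set)" if "i : Basis" for i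
  using that by (auto simp: Basis_prod_def)
 have bt: "(1, 0) : (Basis :: (real \<times> 'a) set)" by (auto simp: Basis_prod_def)
 have phic: "continuous_on S phi" using sm unfolding smooth_on_def Ck_on.simps(1)[symmetric] by blast
 have tt: "tf (%x. phi (t, x))" if t: "t : {0..T}" for t
 proof -
  have "Ck_on k UNIV (%x. phi (t, x))" for k
  using Ck_on_compose_affine[of k S phi "%x. (0, x)" UNIV "(t, 0)"] sm t
  by (simp add: smooth_on_def S_def bounded_linear_Pair bounded_linear_zero bounded_linear_ident)
  then show ?thesis unfolding tf_alt smooth_on_def
  using out0[OF t] R0(1) by (intro conjI allI exI[of _ "R0 + 1"]) auto
 qed
 \<comment> \<open>A derivative is known to vanish only strictly outside the ball carrying the
   function, hence one unit of margin for each of the two spatial differentiations.\<close>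
 define R1 where "R1 = R0 + 1"
 define R2 where "R2 = R1 + 1"
 have fr: "FD (%x. phi (t, x)) (at x) h = f1 (t, x) (0, h)" if t: "t : {0..T}" for t x h
 proof -
  have "((%x. phi (t, x)) has_derivative (%h. f1 (t, x) (0, h))) (at x)"
  by (rule slab_slice_derivative(1)[OF _ t]) (use f1[of "(t, x)"] t in \<open>simp add: S_def\<close>)
  from frechet_derivative_at[OF this] show ?thesis by metis
 qed
 have fr2: "FD (%x. f1 (t, x) (0, i)) (at x) h = f2 (0, i) (t, x) (0, h)" if t: "t : {0..T}" and i: "i : Basis" for t x h i
 proof -
  have "((%x. f1 (t, x) (0, i)) has_derivative (%h. f2 (0, i) (t, x) (0, h))) (at x)"
  by (rule slab_slice_derivative(1)[OF _ t]) (use f2[OF bx[OF i], of "(t, x)"] t in \<open>simp add: S_def\<close>)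
  from frechet_derivative_at[OF this] show ?thesis by metis
 qed
 have D_out: "f1 (t, x) (0, h) = 0" if t: "t : {0..T}" and x: "R1 <= norm x" for t x h
  using FD_eq_0[of "R0 + 1/2" "%x. phi (t, x)" x] out0[OF t] x fr[OF t, of x h] by (simp add: R1_def)
 have D2_out: "f2 (0, i) (t, x) (0, h) = 0" if t: "t : {0..T}" and x: "R2 <= norm x" and i: "i : Basis" for t x h i
  using FD_eq_0[of "R1" "%x. f1 (t, x) (0, i)" x] D_out[OF t] x fr2[OF t i, of x h] by (simp add: R2_def)
 have tD: "((%s. phi (s, x)) has_vector_derivative f1 (t, x) (1, 0)) (at t within {0..T})" if t: "t : {0..T}" for t x
  by (rule slab_slice_derivative(2)[OF _ t]) (use f1[of "(t, x)"] t in \<open>simp add: S_def\<close>)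
 have t_out: "f1 (t, x) (1, 0) = 0" if t: "t : {0..T}" and x: "R1 <= norm x" for t x
 proof -
  have "((%s. phi (s, x)) has_vector_derivative 0) (at t within {0..T})"
  by (rule has_vector_derivative_transform[OF t _ has_vector_derivative_const[of 0]]) (use out0[of _ x] x in \<open>simp add: R1_def\<close>)
  with tD[OF t, of x] show ?thesis
  using vector_derivative_unique_within_closed_interval[of 0 T t "%s. phi (s, x)" "f1 (t, x) (1, 0)" 0] T t by (simp add: cbox_interval)
 qed
 \<comment> \<open>A function that chooses a bound for every continuous \<open>G\<close> at once
   replaces separate constants for the many partial derivatives.\<close>
 have "ALL G :: real \<times> 'a => real. EX c. continuous_on S G --> 0 <= c & (ALL t:{0..T}. ALL x. norm x <= R2 --> \<bar>G (t, x)\<bar> <= c)"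
 proof
  fix G :: "real \<times> 'a => real"
  show "EX c. continuous_on S G --> 0 <= c & (ALL t:{0..T}. ALL x. norm x <= R2 --> \<bar>G (t, x)\<bar> <= c)"
  proof (cases "continuous_on S G")
  case True
  have "bounded (G ` ({0..T} \<times> cball 0 R2))"
  by (intro compact_imp_bounded compact_continuous_image continuous_on_subset[OF True] compact_Times) (auto simp: S_def)
  then obtain c where c: "c > 0" "ALL y:G ` ({0..T} \<times> cball 0 R2). norm y <= c" unfolding bounded_pos by blast
  have "\<bar>G (t, x)\<bar> <= c" if "t : {0..T}" "norm x <= R2" for t x
  using bspec[OF c(2) imageI[of "(t, x)"]] that by simp
  then show ?thesis using c(1) by (intro exI[where x=c]) simp
  qed simp
 qed
 from choice[OF this] obtain bd where bd': "ALL G :: real \<times> 'a => real. continuous_on S G --> 0 <= bd G & (ALL t:{0..T}. ALL x. norm x <= R2 --> \<bar>G (t, x)\<bar> <= bd G)" ..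
 have bd: "0 <= bd G" "!!t x. t : {0..T} ==> norm x <= R2 ==> \<bar>G (t, x)\<bar> <= bd G" if "continuous_on S G" for G :: "real \<times> 'a => real"
 proof -
  have *: "0 <= bd G & (ALL t:{0..T}. ALL x. norm x <= R2 --> \<bar>G (t, x)\<bar> <= bd G)"
  by (rule mp[OF spec[OF bd'] that])
  then show "0 <= bd G" ..
  show "\<bar>G (t, x)\<bar> <= bd G" if "t : {0..T}" "norm x <= R2" for t x using*that by simp
 qed
 define M where "M = (SUM i:(Basis::'a set). SUM j:(Basis::'a set). bd (%p. f2 (0, i) p (0, j)))"
 define CD where "CD = (SUM i:(Basis::'a set). bd (%p. f1 p (0, i)))"
 have f2b: "0 <= bd (%p. f2 (0, i) p (0, j))" if "i : Basis" "j : Basis" for i j by (rule bd(1)[OF f2c[OF bx[OF that(1)] bx[OF that(2)]]])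
 have f1b: "0 <= bd (%p. f1 p (0, i))" if "i : Basis" for i by (rule bd(1)[OF f1c[OF bx[OF that]]])
 have M0: "0 <= M" unfolding M_def by (intro sum_nonneg f2b)
 have CD0: "0 <= CD" unfolding CD_def by (intro sum_nonneg f1b)
 have D_bd: "\<bar>f1 (t, x) (0, i)\<bar> <= CD" if t: "t : {0..T}" and i: "i : Basis" for t x i
 proof (cases "norm x <= R2")
  case True
  have "\<bar>f1 (t, x) (0, i)\<bar> <= bd (%p. f1 p (0, i))" using bd(2)[OF f1c[OF bx[OF i]] t True] by simp
  also have "... <= CD" unfolding CD_def by (rule member_le_sum[OF i]) (auto intro: f1b)
  finally show ?thesis .
 next
  case False then show ?thesis using D_out[OF t, of x i] CD0 by (simp add: R2_def)
 qed
 have smt: "smooth_on UNIV (%x. phi (t, x))" if "t : {0..T}" for t using tt[OF that] by (simp add: test_function_def)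
 have tDi: "tf (%x. f1 (t, x) (0, i))" if t: "t : {0..T}" for t i
  using tf_FD[OF tt[OF t], of i] unfolding fr[OF t] .
 have lip: "\<bar>f1 (t, x) (0, i) - f1 (t, y) (0, i)\<bar> <= M*norm (x - y)" if t: "t : {0..T}" and i: "i : Basis" for t x y i
 proof -
  have sD: "smooth_on UNIV (%x. f1 (t, x) (0, i))" using tDi[OF t] by (simp add: test_function_def)
  have "norm (f1 (t, x) (0, i) - f1 (t, y) (0, i)) <= M*norm (x - y)"
  proof (rule differentiable_bound[of UNIV])
  show "((%x. f1 (t, x) (0, i)) has_derivative FD (%x. f1 (t, x) (0, i)) (at z)) (at z within UNIV)" for z
  using smooth_has_derivative[OF sD] by simp
  show "onorm (FD (%x. f1 (t, x) (0, i)) (at z)) <= M" for z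
  proof (rule onorm_le)
  fix h :: 'a
  show "norm (FD (%x. f1 (t, x) (0, i)) (at z) h) <= M*norm h"
  proof (cases "norm z <= R2")
  case True
  have "FD (%x. f1 (t, x) (0, i)) (at z) h = (SUM j:Basis. (h \<bullet> j)*f2 (0, i) (t, z) (0, j))"
  using FD_Basis[OF sD, of z h] by (simp only: fr2[OF t i])
  then have "norm (FD (%x. f1 (t, x) (0, i)) (at z) h) <= (SUM j:Basis. \<bar>(h \<bullet> j)*f2 (0, i) (t, z) (0, j)\<bar>)"
  by (simp add: sum_abs)
  also have "... <= (SUM j:Basis. norm h*bd (%p. f2 (0, i) p (0, j)))"
  proof (rule sum_mono)
  fix j :: 'a assume j: "j : Basis"
  show "\<bar>(h \<bullet> j)*f2 (0, i) (t, z) (0, j)\<bar> <= norm h*bd (%p. f2 (0, i) p (0, j))"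
  unfolding abs_mult using bd(2)[OF f2c[OF bx[OF i] bx[OF j]] t True] j by (intro mult_mono Basis_le_norm) auto
  qed
  also have "... = norm h*(SUM j:Basis. bd (%p. f2 (0, i) p (0, j)))" by (simp add: sum_distrib_left)
  also have "... <= norm h*M" unfolding M_def
  by (intro mult_left_mono member_le_sum[OF i, of "%i. SUM j:Basis. bd (%p. f2 (0, i) p (0, j))"]) (auto intro!: sum_nonneg f2b)
  finally show ?thesis by (simp add: mult.commute)
  next
  case False
  then show ?thesis using D2_out[OF t _ i, of z h] M0 by (simp add: fr2[OF t i])
  qed
  qed
  qed auto
  then show ?thesis by simp
 qed
 define L where "L = real DIM('a)*M"
 have L0: "0 <= L" using M0 by (simp add: L_def)
 \<comment> \<open>The Taylor bounds for \<open>w\<close> and \<open>- w\<close> are added; the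
   linear parts cancel, whence the factor 2.\<close>
 have sec: "\<bar>phi (t, x + w) + phi (t, x - w) - 2*phi (t, x)\<bar> <= 2*L*(norm w)^2" if t: "t : {0..T}" for t x w
 proof -
  let ?f = "%x. phi (t, x)"
  have lin: "\<bar>FD ?f (at x) h - FD ?f (at y) h\<bar> <= L*norm (x - y)*norm h" for x y h
  proof -
  have "FD ?f (at x) h - FD ?f (at y) h = (SUM i:Basis. (h \<bullet> i)*(f1 (t, x) (0, i) - f1 (t, y) (0, i)))"
  proof -
  have "f1 (t, z) (0, h) = (SUM i:Basis. (h \<bullet> i)*f1 (t, z) (0, i))" for z
  using FD_Basis[OF smt[OF t], of z h] by (simp only: fr[OF t])
  from this[of x] this[of y] show ?thesis unfolding fr[OF t] by (simp add: sum_subtractf right_diff_distrib)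
  qed
  then have "\<bar>FD ?f (at x) h - FD ?f (at y) h\<bar> <= (SUM i:Basis. \<bar>(h \<bullet> i)*(f1 (t, x) (0, i) - f1 (t, y) (0, i))\<bar>)"
  by (simp add: sum_abs)
  also have "... <= (SUM i:(Basis::'a set). norm h*(M*norm (x - y)))"
  unfolding abs_mult by (intro sum_mono mult_mono Basis_le_norm lip[OF t]) auto
  finally show ?thesis by (simp add: L_def mult_ac)
  qed
  have hd: "(?f has_derivative FD ?f (at x)) (at x)" for x by (rule smooth_has_derivative[OF smt[OF t]])
  have tb: "\<bar>?f (x + h) - ?f x - FD ?f (at x) h\<bar> <= L*(norm h)^2" for h
  by (rule taylor2_bound[OF hd lin L0])
  have "FD ?f (at x) (- w) = - FD ?f (at x) w"
  using has_derivative_linear[OF hd[of x]] by (simp add: linear_neg)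
  then have "\<bar>phi (t, x - w) - phi (t, x) + FD ?f (at x) w\<bar> <= L*(norm w)^2"
  using tb[of "- w"] by simp
  with tb[of w] show ?thesis by linarith
 qed
 define phit where "phit = (%t x. ind {0<..<T} t*f1 (t, x) (1, 0))"
 define D where "D = (%i t x. ind {0<..<T} t*f1 (t, x) (0, i))"
 define C where "C = bd phi + bd (%p. f1 p (1, 0)) + CD + 2*L"
 have C0: "0 <= bd phi" "0 <= bd (%p. f1 p (1, 0))" using bd(1) phic f1c[OF bt] by auto
 have phib: "\<bar>phi (t, x)\<bar> <= bd phi" if "t : {0..T}" for t x
  using bd(2)[OF phic that, of x] out0[OF that, of x] C0 by (cases "norm x <= R2") (auto simp: R1_def R2_def)
 have phitb: "\<bar>f1 (t, x) (1, 0)\<bar> <= bd (%p. f1 p (1, 0))" if "t : {0..T}" for t x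
  using bd(2)[OF f1c[OF bt] that, of x] t_out[OF that, of x] C0 by (cases "norm x <= R2") (auto simp: R2_def)
 have ftc: "prim (%s. phit s x) t = phi (t, x) - phi (0, x)" if t: "t : {0..T}" for t x
 proof -
  have c: "continuous_on {0..t} (%s. f1 (s, x) (1, 0))"
  by (rule continuous_on_compose2[OF f1c[OF bt], of "{0..t}" "%s. (s, x)"]) (use t in \<open>auto simp: S_def intro!: continuous_intros\<close>)
  have e: "(LB s. ind {0..t} s *R f1 (s, x) (1, 0)) = phi (t, x) - phi (0, x)"
  proof (rule integral_FTC_atLeastAtMost)
  fix s assume "0 <= s" "s <= t"
  then show "((%s. phi (s, x)) has_vector_derivative f1 (s, x) (1, 0)) (at s within {0..t})"
  using t by (intro has_vector_derivative_within_subset[OF tD]) auto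
  qed (use t c in auto)
  have [measurable]: "(%s. ind {0..t} s *R f1 (s, x) (1, 0)) : BM"
  by (rule borel_measurable_continuous_on_indicator[OF _ c]) simp
  have pm: "jm phit"
  using slab_measurable[OF f1c[OF bt, unfolded S_def]] by (simp add: phit_def)
  note [measurable (raw)] = meas2[OF pm]
  have "prim (%s. phit s x) t = (LB s. ind {0..t} s *R f1 (s, x) (1, 0))" unfolding prim_def
  proof (rule integral_cong_AE)
  show "AEL s. ind {..t} s*phit s x = ind {0..t} s *R f1 (s, x) (1, 0)"
  using AE_lborel_singleton[of 0] AE_lborel_singleton[of T]
  by eventually_elim (use t in \<open>auto simp: phit_def indicator_def\<close>)
  qed measurable
  then show ?thesis using e by simp
 qed
 have adm: "admissible T (%t x. ind {0<..<T} t*phi (t, x)) phit D (%x. phi (0, x)) R2 C"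
  unfolding admissible_def
 proof (intro conjI ballI allI impI)
  show "case_prod (%t x. ind {0<..<T} t*phi (t, x)) : BM"
  by (rule slab_measurable[OF phic[unfolded S_def]])
  show "jm phit"
  unfolding phit_def by (rule slab_measurable[OF f1c[OF bt, unfolded S_def]])
  show "jm (D i)" if "i : Basis" for i
  unfolding D_def by (rule slab_measurable[OF f1c[OF bx[OF that], unfolded S_def]])
  show "(%x. phi (0, x)) : BM" using tf_measurable[OF tt[of 0]] T by simp
  show "tf (%x. ind {0<..<T} t*phi (t, x))" if "t : {0<..<T}" for t using tt[of t] that by simp
  show "FD (%x. ind {0<..<T} t*phi (t, x)) (at x) i = D i t x" if "t : {0<..<T}" for t x i
  using fr[of t x i] that by (simp add: D_def)
  show "ind {0<..<T} t*phi (t, x) = phi (0, x) + prim (%s. phit s x) t" if "t : {0<..<T}" for t x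
  using ftc[of t x] that by simp
  show "phi (0, x) + prim (%s. phit s x) T = 0" for x using ftc[of T x] outT[of x] T by simp
  show "\<bar>ind {0<..<T} t*phi (t, x)\<bar> <= C" for t x
  using phib[of t x] C0 CD0 L0 by (auto simp: C_def indicator_def)
  show "\<bar>phit t x\<bar> <= C" for t x using phitb[of t x] C0 CD0 L0 by (auto simp: C_def phit_def indicator_def)
  show "\<bar>phi (0, x)\<bar> <= C" for x using phib[of 0 x] C0 CD0 L0 T by (simp add: C_def)
  show "\<bar>D i t x\<bar> <= C" if "i : Basis" for i t x using D_bd[OF _ that, of t x] C0 CD0 L0 by (auto simp: C_def D_def indicator_def)
  show "\<bar>ind {0<..<T} t*phi (t, x + w) + ind {0<..<T} t*phi (t, x - w) - 2*(ind {0<..<T} t*phi (t, x))\<bar> <= C*(norm w)^2" for t x w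
  proof (cases "t : {0<..<T}")
  case True
  then have "\<bar>phi (t, x + w) + phi (t, x - w) - 2*phi (t, x)\<bar> <= 2*L*(norm w)^2" using sec[of t x w] by simp
  also have "... <= C*(norm w)^2" using C0 CD0 by (intro mult_right_mono) (auto simp: C_def)
  finally show ?thesis using True by simp
  qed (use C0 CD0 L0 in \<open>simp add: C_def\<close>)
  show "ind {0<..<T} t*phi (t, x) = 0" if "R2 <= norm x" for t x using out0[of t x] that by (auto simp: indicator_def R1_def R2_def)
  show "phit t x = 0" if "R2 <= norm x" for t x using t_out[of t x] that by (auto simp: phit_def indicator_def R2_def)
  show "phi (0, x) = 0" if "R2 <= norm x" for x using out0[of 0 x] that T by (auto simp: R1_def R2_def)
  show "D i t x = 0" if "R2 <= norm x" for i t x using D_out[of t x i] that by (auto simp: D_def indicator_def R2_def)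
 qed (auto simp: phit_def D_def)
 have "deriv (%s. phi (s, x)) t = phit t x" if t: "t : {0<..<T}" for t x
 proof -
  have "((%s. phi (s, x)) has_vector_derivative f1 (t, x) (1, 0)) (at t)"
  using tD[of t x] t at_within_Icc_at[of 0 t T] by simp
  then have "((%s. phi (s, x)) has_field_derivative f1 (t, x) (1, 0)) (at t)" by (simp add: has_real_derivative_iff_has_vector_derivative)
  then show ?thesis using t by (simp add: DERIV_imp_deriv phit_def)
 qed
 then have d: "ALL t:{0<..<T}. ALL x. deriv (%s. phi (s, x)) t = phit t x" by simp
 show ?thesis
  by (rule exI[of _ phit], rule exI[of _ D], rule exI[of _ R2], rule exI[of _ C], rule conjI[OF adm d])
qed

section \<open>Weak solutions and Borel representatives\<close>

lemma AE_lebesgue_on_iff: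
 assumes "S : sets borel"
 shows "(AE x in lebesgue_on S. P x) \<longleftrightarrow> (AEL x. x : S --> P x)"
 using assms by (simp add: AE_restrict_space_iff AE_completion_iff)

lemma slab_sets [measurable]: "{0<..<T::real} \<times> (UNIV :: 'a::euclidean_space set) : sets borel"
 by (intro borel_open open_Times) auto

lemma borel_representative:
 fixes f :: "'a::euclidean_space => 'b::euclidean_space"
 assumes f: "f : bm lebesgue"
 shows "EX F:BM. AEL x. f x = F x"
proof -
 have "ALL i:Basis. EX F. F : bm lborel & (AEL x. f x \<bullet> i = F x)"
 proof
  fix i :: 'b assume "i : Basis"
  have "(%x. f x \<bullet> i) : bm (completion lborel)" using f by measurable
  from completion_ex_borel_measurable_real[OF this]
  show "EX F. F : bm lborel & (AEL x. f x \<bullet> i = F x)" by blast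
 qed
 from bchoice[OF this] obtain F where F: "ALL i:Basis. F i : bm lborel & (AEL x. f x \<bullet> i = F i x)" ..
 show ?thesis
 proof (rule bexI)
  have "AEL x. ALL i:Basis. f x \<bullet> i = F i x" using F by (intro eventually_ball_finite) auto
  then show "AEL x. f x = (SUM i:Basis. F i x *R i)"
  proof eventually_elim
  case (elim x)
  then have "(SUM i:Basis. F i x *R i) = (SUM i:Basis. (f x \<bullet> i) *R i)" by simp
  then show ?case by (simp add: euclidean_representation)
  qed
  have [measurable]: "F i : BM" if "i : Basis" for i using F that by simp
  show "(%x. SUM i:Basis. F i x *R i) : BM" by measurable
 qed
qed

text \<open>Preimages under \<open>f\<close> differ from Borel sets by subsets of a null set, and
  these are Lebesgue measurable by completeness.\<close>

lemma lebesgue_measurable_AE: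
 fixes f :: "'a::euclidean_space => 'b::topological_space"
 assumes F: "F : BM" and AE: "AEL x. f x = F x"
 shows "f : bm lebesgue"
proof (rule measurableI)
 obtain N where N: "{x : space lborel. f x ~= F x} \<subseteq> N" "N : null_sets lborel"
  using AE_E[OF AE] by (metis null_setsI)
 fix A :: "'b set" assume A: "A : sets borel"
 have N': "f -` A \<inter> N : sets lebesgue" using null_sets_completion_subset[OF _ null_sets_completionI[OF N(2)], of "f -` A \<inter> N"] by auto
 have "F -` A : sets borel" using measurable_sets[OF F A] by simp
 then have "F -` A - N : sets lebesgue" using N(2) by (intro sets.Diff sets_completionI_sets) auto
 moreover have "f -` A \<inter> space lebesgue = (F -` A - N) \<union> (f -` A \<inter> N)" using N(1) by auto
 ultimately show "f -` A \<inter> space lebesgue : sets lebesgue" using N' by (simp only: sets.Un)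
qed simp

lemma integral_lebesgue_AE:
 fixes f F :: "'a::euclidean_space => 'b::{banach, second_countable_topology}"
 assumes F: "F : BM" and AE: "AEL x. f x = F x"
 shows "(LINT x|lebesgue. f x) = (LB x. F x)"
proof -
 have "(LINT x|lebesgue. f x) = (LINT x|lebesgue. F x)"
  using lebesgue_measurable_AE[OF F AE] F AE by (intro integral_cong_AE) (auto intro: AE_completion measurable_completion)
 then show ?thesis using F by (simp add: integral_completion)
qed

lemma integral_lebesgue_on_AE:
 fixes h H :: "real => real"
 assumes H: "H : BM" and AE: "AEL t. t : {0<..<T} --> h t = H t"
 shows "(LINT t|lebesgue_on {0<..<T}. h t) = (LB t. ind {0<..<T} t*H t)"
proof -
 have "(LINT t|lebesgue_on {0<..<T}. h t) = (LINT t|lebesgue. ind {0<..<T} t*h t)"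
  by (subst integral_restrict_space) auto
 also have "... = (LB t. ind {0<..<T} t*H t)"
 proof (rule integral_lebesgue_AE)
  note [measurable] = H
  show "(%t. ind {0<..<T} t*H t) : BM" by measurable
  show "AEL t. ind {0<..<T} t*h t = ind {0<..<T} t*H t"
  using AE by eventually_elim (auto simp: indicator_def)
 qed
 finally show ?thesis .
qed

lemma spacetime_AE_slices:
 assumes "AE p in (lborel :: (real \<times> 'a::euclidean_space) measure). fst p : S --> P@@p"
 shows "AEL t. t : S --> (AEL x. P t x)"
proof -
 have "AE p in lborel \<Otimes>\<^sub>M lborel. fst p : S --> P@@p" unfolding lborel_prod by (rule assms)
 from lborel_pair.AE_pair[OF this] show ?thesis by eventually_elim auto
qed

lemma spacetime_representative:
 fixes f :: "real => 'a::euclidean_space => 'b::euclidean_space"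
 assumes f: "(%(t, x). f t x) : bm (lebesgue_on ({0<..<T} \<times> UNIV))"
 shows "EX F. jm F & (ALL t x. t ~: {0<..<T} --> F t x = 0)
  & (AEL p. fst p : {0<..<T} --> f@@p = F@@p)"
proof -
 let ?S = "{0<..<T} \<times> (UNIV :: 'a set)"
 have "(%p. ind ?S p *R (case p of (t, x) => f t x)) : bm lebesgue"
  using f by (subst (asm) borel_measurable_restrict_space_iff) auto
 from borel_representative[OF this] obtain G where G: "G : BM"
  "AEL p. ind ?S p *R (case p of (t, x) => f t x) = G p" by blast
 show ?thesis
 proof (rule exI[of _ "%t x. ind ?S (t, x) *R G (t, x)"], intro conjI)
  have "(%p. ind ?S p *R G p) : BM" using G(1) by measurable
  then show "case_prod (%t x. ind ?S (t, x) *R G (t, x)) : BM" by (simp add: case_prod_beta')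
  show "AEL p. fst p : {0<..<T} --> f@@p = ind ?S (fst p, snd p) *R G (fst p, snd p)"
  using G(2)
  proof eventually_elim
  case (elim p)
  show ?case using elim by (cases p) (auto simp: indicator_def)
  qed
 qed auto
qed

lemma L1loc_measurable:
 fixes f :: "'a::euclidean_space => 'b::euclidean_space"
 assumes "f : L1loc" shows "f : bm lebesgue"
proof (rule borel_measurable_LIMSEQ_metric)
 show "(%x. ind (ball 0 (real n)) x *R f x) : bm lebesgue" for n
  using assms unfolding L1loc_def set_integrable_def by (auto dest: Lint_meas)
 fix x :: 'a
 obtain n0 :: nat where n0: "norm x < real n0" using reals_Archimedean2 by blast
 have "\<forall>\<^sub>F n in sequentially. ind (ball 0 (real n)) x *R f x = f x"
  using eventually_ge_at_top[of n0] by eventually_elim (use n0 in \<open>auto simp: indicator_def\<close>)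
 then show "(%n. ind (ball 0 (real n)) x *R f x) ----> f x" by (rule tendsto_eventually)
qed

lemma L1loc_loc_int:
 fixes f :: "'a::euclidean_space => 'b::euclidean_space"
 assumes f: "f : L1loc" and F: "F : BM" and AE: "AEL x. f x = F x"
 shows "loc_int F"
 unfolding loc_int_def
proof (intro conjI F allI)
 fix r
 note [measurable] = F
 have "integrable lebesgue (%x. ind (ball 0 (r + 1)) x *R f x)" using f by (simp add: L1loc_def set_integrable_def)
 then have "integrable lebesgue (%x. ind (ball 0 (r + 1)) x *R F x)"
 proof (rule integrable_cong_AE_imp)
  show "(%x. ind (ball 0 (r + 1)) x *R F x) : bm lebesgue" by (rule measurable_completion) measurable
  show "AE x in lebesgue. ind (ball 0 (r + 1)) x *R f x = ind (ball 0 (r + 1)) x *R F x"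
  using AE_completion[OF AE] by eventually_elim simp
 qed
 then have "Lint (%x. ind (ball 0 (r + 1)) x *R F x)"
  by (subst (asm) integrable_completion) auto
 then show "Lint (%x. indc r x *R F x)"
  by (rule I_bound) (auto intro!: AE_I2 simp: indicator_def)
qed

lemma loc_int_L1loc:
 fixes F :: "'a::euclidean_space => 'b::euclidean_space"
 assumes F: "loc_int F" shows "F : L1loc"
 unfolding L1loc_def set_integrable_def
proof (intro CollectI allI)
 fix a :: 'a and r :: real
 have [measurable]: "F : BM" using F by (simp add: loc_int_def)
 have "Lint (%x. ind (cball 0 (norm a + \<bar>r\<bar>)) x *R F x)" using F by (simp add: loc_int_def)
 then have "Lint (%x. ind (ball a r) x *R F x)"
 proof (rule I_bound)
  show "AEL x. norm (ind (ball a r) x *R F x) <= norm (ind (cball 0 (norm a + \<bar>r\<bar>)) x *R F x)"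
  proof (rule AE_I2)
  fix x :: 'a
  have "norm x <= norm a + dist a x" by (metis dist_norm norm_minus_commute norm_triangle_sub)
  then show "norm (ind (ball a r) x *R F x) <= norm (ind (cball 0 (norm a + \<bar>r\<bar>)) x *R F x)"
  by (auto simp: indicator_def)
  qed
 qed measurable
 then show "integrable lebesgue (%x. ind (ball a r) x *R F x)" by (subst integrable_completion) auto
qed

lemma L1loc_mult:
 fixes f :: "'a::euclidean_space => 'b::euclidean_space"
 assumes f: "f : L1loc" and [measurable]: "phi : BM" and C: "!!x. \<bar>phi x\<bar> <= C"
 shows "(%x. phi x *R f x) : L1loc"
 unfolding L1loc_def set_integrable_def
proof (intro CollectI allI)
 fix a r
 have "integrable lebesgue (%x. ind (ball a r) x *R f x)" using f by (simp add: L1loc_def set_integrable_def)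
 then have "integrable lebesgue (%x. C *R (ind (ball a r) x *R f x))" by (rule integrable_scaleR_right)
 then show "integrable lebesgue (%x. ind (ball a r) x *R phi x *R f x)"
 proof (rule I_bound)
  have [measurable]: "f : bm lebesgue" by (rule L1loc_measurable[OF f])
  have [measurable]: "phi : bm lebesgue" "(%x. ind (ball a r) x :: real) : bm lebesgue" by (auto intro: measurable_completion)
  show "(%x. ind (ball a r) x *R phi x *R f x) : bm lebesgue" by measurable
  show "AE x in lebesgue. norm (ind (ball a r) x *R phi x *R f x) <= norm (C *R (ind (ball a r) x *R f x))"
  using C order_trans[OF C abs_ge_self] by (intro AE_I2) (auto simp: indicator_def intro!: mult_right_mono)
 qed
qed

section \<open>From weak derivatives of classes to Borel fields\<close>

lemma has_weak_deriv_weak_grad: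
 fixes f :: "'a::euclidean_space => 'b::euclidean_space"
 assumes d: "!!i. i : Basis ==> has_weak_deriv i f (g i)"
  and F: "F : BM" "AEL x. f x = F x"
  and G: "!!i. i : Basis ==> G i : BM" "!!i. i : Basis ==> AEL x. g i x = G i x"
 shows "weak_grad F G"
 unfolding weak_grad_def
proof (intro conjI ballI allI impI)
 obtain i0 :: 'a where "i0 : Basis" using nonempty_Basis by blast
 then have "f : L1loc" using d[of i0] by (simp add: has_weak_deriv_def)
 then show "loc_int F" by (rule L1loc_loc_int[OF _ F])
 fix i :: 'a assume i: "i : Basis"
 show "loc_int (G i)" using d[OF i] L1loc_loc_int[OF _ G[OF i]] by (simp add: has_weak_deriv_def)
 fix psi :: "'a => real" assume psi: "tf psi"
 note [measurable] = F(1) G(1)[OF i] tf_measurable[OF psi] tf_measurable[OF tf_FD[OF psi]]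
 have "(LB x. FD psi (at x) i *R F x) = (LINT x|lebesgue. FD psi (at x) i *R f x)"
  by (rule integral_lebesgue_AE[symmetric]) (use F(2) in \<open>auto elim: eventually_mono\<close>)
 also have "... = - (LINT x|lebesgue. psi x *R g i x)" using d[OF i] psi by (simp add: has_weak_deriv_def)
 also have "(LINT x|lebesgue. psi x *R g i x) = (LB x. psi x *R G i x)"
  by (rule integral_lebesgue_AE) (use G(2)[OF i] in \<open>auto elim: eventually_mono\<close>)
 finally show "(LB x. FD psi (at x) i *R F x) = - (LB x. psi x *R G i x)" .
qed

text \<open>The difference is orthogonal to all test functions. This identifies the divergence
  \<open>d\<close> that a weak solution merely asserts to exist.\<close>

lemma has_weak_div_unique:
 assumes "has_weak_div v d" "has_weak_div v d'"
 shows "AEL x. d x = d' x"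
proof -
 have l: "d : L1loc" "d' : L1loc" using assms by (auto simp: has_weak_div_def)
 obtain D where D: "D : BM" "AEL x. d x = D x" using borel_representative[OF L1loc_measurable[OF l(1)]] by blast
 obtain D' where D': "D' : BM" "AEL x. d' x = D' x" using borel_representative[OF L1loc_measurable[OF l(2)]] by blast
 note [measurable] = D(1) D'(1)
 note L = L1loc_loc_int[OF l(1) D] and L' = L1loc_loc_int[OF l(2) D']
 have L'm: "loc_int (%x. - 1*(D' x \<bullet> 1))" by (rule loc_int_mult_inner[OF L', of _ 1]) auto
 have "AEL x. D x + - 1*(D' x \<bullet> 1) = 0"
 proof (rule fundamental_lemma[OF loc_int_add[OF L L'm]])
  fix psi :: "'a => real" assume psi: "tf psi"
  note [measurable] = tf_measurable[OF psi]
  have "(LINT x|lebesgue. psi x*d x) = (LINT x|lebesgue. psi x*d' x)"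
  using assms psi by (simp add: has_weak_div_def)
  moreover have "(LINT x|lebesgue. psi x*d x) = (LB x. psi x*D x)"
  by (rule integral_lebesgue_AE) (use D(2) in \<open>auto elim: eventually_mono\<close>)
  moreover have "(LINT x|lebesgue. psi x*d' x) = (LB x. psi x*D' x)"
  by (rule integral_lebesgue_AE) (use D'(2) in \<open>auto elim: eventually_mono\<close>)
  ultimately show "(LB x. psi x *R (D x + - 1*(D' x \<bullet> 1))) = 0"
  using loc_int_tf[OF L psi] loc_int_tf[OF L' psi] by (simp add: right_diff_distrib)
 qed
 then show ?thesis using D(2) D'(2) by eventually_elim simp
qed

lemma weak_div_field:
 assumes wg: "weak_grad (b t) (%i. g i t)" and f: "f : L1loc" and AE: "AEL x. f x = b t x"
 shows "has_weak_div f (field_div g t)"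
 unfolding has_weak_div_def
proof (intro conjI allI impI f)
 have lf: "loc_int (b t)" and lg: "!!i. i : Basis ==> loc_int (g i t)" using wg by (auto simp: weak_grad_def)
 have "loc_int (%x. SUM i:Basis. 1*(g i t x \<bullet> i))" by (intro loc_int_sum loc_int_mult_inner[OF lg]) auto
 then have l: "loc_int (field_div g t)" by (simp add: field_div_def[abs_def])
 then show "field_div g t : L1loc" by (rule loc_int_L1loc)
 fix psi :: "'a => real" assume psi: "tf psi"
 have s: "smooth_on UNIV psi" using psi by (simp add: test_function_def)
 have [measurable]: "b t : BM" "field_div g t : BM" using lf l by (auto simp: loc_int_def)
 note [measurable] = tf_measurable[OF psi] tf_measurable[OF tf_FD[OF psi]]
 have "(LINT x|lebesgue. FD psi (at x) (f x)) = (LB x. (SUM i:Basis. FD psi (at x) i*(b t x \<bullet> i)))"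
 proof (rule integral_lebesgue_AE)
  show "AEL x. FD psi (at x) (f x) = (SUM i:Basis. FD psi (at x) i*(b t x \<bullet> i))"
  using AE
  proof eventually_elim
  case (elim x) show ?case unfolding elim by (subst FD_Basis[OF s]) (simp add: mult.commute)
  qed
 qed measurable
 also have "... = - (LB x. psi x*field_div g t x)"
  using weak_grad_div(3)[OF wg psi] by (simp add: field_div_def)
 also have "(LB x. psi x*field_div g t x) = (LINT x|lebesgue. psi x*field_div g t x)"
  by (rule integral_lebesgue_AE[symmetric]) auto
 finally show "(LINT x|lebesgue. FD psi (at x) (f x)) = - (LINT x|lebesgue. psi x*field_div g t x)" .
qed

text \<open>The product rule, obtained by testing the gradient of \<open>b t\<close> with
  \<open>psi * phi\<close>; the given slice \<open>f\<close> need only agree with the Borel slice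
  almost everywhere.\<close>

lemma weak_div_product:
 assumes wg: "weak_grad (b t) (%i. g i t)" and f: "f : L1loc" and AE: "AEL x. f x = b t x" and phi: "tf phi"
 shows "has_weak_div (%x. phi x *R f x) (test_div b g phi t)"
 unfolding has_weak_div_def
proof (intro conjI allI impI)
 have lf: "loc_int (b t)" and lg: "!!i. i : Basis ==> loc_int (g i t)" using wg by (auto simp: weak_grad_def)
 have "loc_int (%x. SUM i:Basis. 1*(g i t x \<bullet> i))" by (intro loc_int_sum loc_int_mult_inner[OF lg]) auto
 then have l: "loc_int (field_div g t)" by (simp add: field_div_def[abs_def])
 have sphi: "smooth_on UNIV phi" using phi by (simp add: test_function_def)
 note [measurable] = tf_measurable[OF phi] tf_measurable[OF tf_FD[OF phi]]
 obtain C where C: "!!x. \<bar>phi x\<bar> <= C" using tf_bounded[OF phi] by blast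
 show "(%x. phi x *R f x) : L1loc" by (rule L1loc_mult[OF f _ C]) measurable
 have l1: "loc_int (%x. phi x*(field_div g t x \<bullet> 1))" by (rule loc_int_mult_inner[OF l _ C]) measurable
 have l2: "loc_int (%x. FD phi (at x) i*(b t x \<bullet> i))" for i
 proof -
  obtain C' where C': "!!x. \<bar>FD phi (at x) i\<bar> <= C'" using tf_bounded[OF tf_FD[OF phi]] by blast
  show ?thesis by (rule loc_int_mult_inner[OF lf _ C']) measurable
 qed
 have l3: "loc_int (test_div b g phi t)" unfolding test_div_def[abs_def]
  using l1 l2 by (intro loc_int_add loc_int_sum) auto
 then show "test_div b g phi t : L1loc" by (rule loc_int_L1loc)
 have [measurable]: "b t : BM" "test_div b g phi t : BM" using lf l3 by (auto simp: loc_int_def)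
 fix psi :: "'a => real" assume psi: "tf psi"
 have s: "smooth_on UNIV psi" using psi by (simp add: test_function_def)
 note [measurable] = tf_measurable[OF psi] tf_measurable[OF tf_FD[OF psi]]
 have tP: "tf (%x. psi x*phi x)" by (rule tf_mult_smooth[OF phi s])
 note w = weak_grad_div[OF wg tP]
 have eq: "(SUM i:Basis. FD psi (at x) i*(phi x*(b t x \<bullet> i)))
  = (SUM i:Basis. FD (%x. psi x*phi x) (at x) i*(b t x \<bullet> i)) + psi x*phi x*(SUM i:Basis. g i t x \<bullet> i) - psi x*test_div b g phi t x" for x
  unfolding test_div_def field_div_def FD_mult[OF s sphi]
  by (simp add: algebra_simps sum.distrib sum_distrib_left sum_distrib_right)
 have i3: "Lint (%x. psi x*test_div b g phi t x)" using loc_int_tf[OF l3 psi] by simp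
 have "(LINT x|lebesgue. FD psi (at x) (phi x *R f x)) = (LB x. (SUM i:Basis. FD psi (at x) i*(phi x*(b t x \<bullet> i))))"
 proof (rule integral_lebesgue_AE)
  show "AEL x. FD psi (at x) (phi x *R f x) = (SUM i:Basis. FD psi (at x) i*(phi x*(b t x \<bullet> i)))"
  using AE
  proof eventually_elim
  case (elim x) show ?case unfolding elim by (subst FD_Basis[OF s]) (simp add: mult.commute)
  qed
 qed measurable
 also have "... = - (LB x. psi x*test_div b g phi t x)"
  unfolding eq L_diff[OF I_add[OF w(1,2)] i3] L_add[OF w(1,2)] w(3) by simp
 also have "(LB x. psi x*test_div b g phi t x) = (LINT x|lebesgue. psi x*test_div b g phi t x)"
  by (rule integral_lebesgue_AE[symmetric]) auto
 finally show "(LINT x|lebesgue. FD psi (at x) (phi x *R f x)) = - (LINT x|lebesgue. psi x*test_div b g phi t x)" .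
qed

lemma L1_L1loc_integrable:
 fixes f :: "real => 'a::euclidean_space => 'b::euclidean_space"
 assumes f: "f : L1_L1loc T" and F: "jm F" and z: "!!t x. t ~: {0<..<T} ==> F t x = 0"
  and AE: "AEL t. t : {0<..<T} --> (AEL x. f t x = F t x)"
 shows "Lint (%(t, x). indc r x *R F t x)"
proof (rule integrableI_bounded)
 note [measurable (raw)] = meas2[OF F]
 let ?L = "%t. L1_norm (ball 0 (r + 1)) (f t)"
 show "(%(t, x). indc r x *R F t x) : bm lborel" by (simp add: borel_prod[symmetric])
 have "(NN p. en (norm (case p of (t, x) => indc r x *R F t x)))
  = (NN t. NN x. en (norm (indc r x *R F t x)))"
  using st_nn[of "%t x. en (norm (indc r x *R F t x))"]
  by (simp add: meas2_iff case_prod_beta')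
 also have "... <= (NN t. ?L t*ind {0<..<T} t)"
 proof (rule nn_integral_mono_AE)
  show "AEL t. (NN x. en (norm (indc r x *R F t x))) <= ?L t*ind {0<..<T} t"
  using AE
  proof eventually_elim
  case (elim t)
  show ?case
  proof (cases "t : {0<..<T}")
  case True
  have "(NN x. en (norm (indc r x *R F t x))) <= (NN x. en (norm (f t x))*ind (ball 0 (r + 1)) x)"
  by (rule nn_integral_mono_AE) (use elim True in \<open>auto elim!: eventually_mono simp: indicator_def\<close>)
  also have "... = ?L t" unfolding L1_norm_def by (subst nn_integral_restrict_space) (auto simp: nn_integral_completion)
  finally show ?thesis using True by simp
  qed (simp add: z)
  qed
 qed
 also have "... = (\<integral>\<^sup>+t. ?L t \<partial>lebesgue_on {0<..<T})" by (subst nn_integral_restrict_space) (auto simp: nn_integral_completion)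
 also have "... < \<infinity>" using f by (simp add: L1_L1loc_def L1_time_def)
 finally show "(NN p. en (norm (case p of (t, x) => indc r x *R F t x))) < \<infinity>" .
qed

text \<open>\<open>GS\<close> is a Borel set of full measure in \<open>(0, T)\<close> on which all
  almost everywhere statements in time hold simultaneously; \<open>P\<close> is the place for
  further ones. Setting the field and its gradient to zero outside \<open>GS\<close> makes the weak
  gradient identity true at every time.\<close>

lemma field_representative:
 fixes b :: "real => 'a::euclidean_space => 'a"
 assumes b: "b : L1_W11loc T" and P: "AEL t. t : {0<..<T} --> P t"
 shows "EX b' g GS. W11_field b' g & (ALL t x. t ~: GS --> b' t x = 0) & (ALL t x. ALL i:Basis. t ~: GS --> g i t x = 0)
  & GS : sets borel & GS \<subseteq> {0<..<T} & (AEL t. t : {0<..<T} --> t : GS)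
  & (ALL t:GS. P t & b t : L1loc & (AEL x. b t x = b' t x))"
proof -
 have bL: "b : L1_L1loc T" using b by (simp add: L1_W11loc_def)
 have joint: "(%(t, x). f t x) : bm (lebesgue_on ({0<..<T} \<times> UNIV))" if "f : L1_L1loc T" for f :: "real => 'a => 'a"
  using that by (simp add: L1_L1loc_def L1_time_def time_measurable_def)
 from spacetime_representative[OF joint[OF bL]] obtain B where B: "jm B"
  "AEL p. fst p : {0<..<T} --> b@@p = B@@p" by blast
 have "ALL i:Basis. EX h. h : L1_L1loc T & (AE t in lebesgue_on {0<..<T}. has_weak_deriv i (b t) (h t))"
  using b by (auto simp: L1_W11loc_def)
 from bchoice[OF this] obtain h where h: "ALL i:Basis. h i : L1_L1loc T & (AE t in lebesgue_on {0<..<T}. has_weak_deriv i (b t) (h i t))" ..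
 have "ALL i:Basis. EX G. jm G & (AEL p. fst p : {0<..<T} --> h i@@p = G@@p)"
 proof
  fix i :: 'a assume "i : Basis"
  then have "h i : L1_L1loc T" using h by blast
  from spacetime_representative[OF joint[OF this]]
  show "EX G. jm G & (AEL p. fst p : {0<..<T} --> h i@@p = G@@p)" by blast
 qed
 from bchoice[OF this] obtain G where G: "ALL i:Basis. jm (G i) & (AEL p. fst p : {0<..<T} --> h i@@p = G i@@p)" ..
 let ?Q = "%t. t : {0<..<T} --> P t & (AEL x. b t x = B t x) & (ALL i:Basis. has_weak_deriv i (b t) (h i t)) & (ALL i:Basis. AEL x. h i t x = G i t x)"
 have 1: "AEL t. t : {0<..<T} --> (AEL x. b t x = B t x)" by (rule spacetime_AE_slices[OF B(2)])
 have 2: "AEL t. ALL i:Basis. t : {0<..<T} --> has_weak_deriv i (b t) (h i t)"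
  using h by (intro eventually_ball_finite) (auto simp: AE_lebesgue_on_iff)
 have 3: "AEL t. ALL i:Basis. t : {0<..<T} --> (AEL x. h i t x = G i t x)"
 proof (intro eventually_ball_finite ballI)
  fix i :: 'a assume "i : Basis"
  then have "AEL p. fst p : {0<..<T} --> h i@@p = G i@@p" using G by blast
  then show "AEL t. t : {0<..<T} --> (AEL x. h i t x = G i t x)" by (rule spacetime_AE_slices)
 qed simp
 have "AEL t. ?Q t" using P 1 2 3 by eventually_elim blast
 from AE_E[OF this] obtain N where N: "{t : space lborel. \<not> ?Q t} \<subseteq> N" "emeasure lborel N = 0" "N : sets lborel" by blast
 define GS where "GS = {0<..<T} - N"
 have [measurable]: "GS : sets borel" using N(3) by (simp add: GS_def)
 have GSI: "GS \<subseteq> {0<..<T}" by (auto simp: GS_def)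
 have Q: "P t" "AEL x. b t x = B t x" "!!i. i : Basis ==> has_weak_deriv i (b t) (h i t)" "!!i. i : Basis ==> AEL x. h i t x = G i t x" if "t : GS" for t
  using that N(1) by (auto simp: GS_def)
 have AEG: "AEL t. t : {0<..<T} --> t : GS"
  by (rule AE_I'[of N]) (use N in \<open>auto simp: GS_def null_sets_def\<close>)
 define b' where "b' = (%t x. ind GS t *R B t x)"
 define g where "g = (%i t x. ind GS t *R G i t x)"
 have b'm: "case_prod b' : BM"
 proof -
  note [measurable (raw)] = meas2[OF B(1)]
  show ?thesis unfolding b'_def meas2_iff by measurable
 qed
 have gm: "jm (g i)" if "i : Basis" for i
 proof -
  have "jm (G i)" using G that by blast
  note [measurable (raw)] = meas2[OF this]
  show ?thesis unfolding g_def meas2_iff by measurable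
 qed
 have bt: "AEL x. b t x = b' t x" if "t : GS" for t using Q(2)[OF that] that by (simp add: b'_def)
 have bL': "b t : L1loc" if "t : GS" for t
 proof -
  obtain i0 :: 'a where "i0 : Basis" using nonempty_Basis by blast
  then show ?thesis using Q(3)[OF that, of i0] by (simp add: has_weak_deriv_def)
 qed
 have sl: "b' t : BM" "i : Basis ==> g i t : BM" for t i
  using meas2[OF b'm measurable_const measurable_ident_sets[OF refl], of t]
  meas2[OF gm measurable_const measurable_ident_sets[OF refl], of i t] by auto
 have W: "W11_field b' g"
  unfolding W11_field_def
 proof (intro conjI ballI allI)
  show "case_prod b' : BM" by (rule b'm)
  show "jm (g i)" if "i : Basis" for i by (rule gm[OF that])
  show "Lint (%(t, x). indc r x *R b' t x)" for r
  proof (rule L1_L1loc_integrable[OF bL b'm])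
  show "AEL t. t : {0<..<T} --> (AEL x. b t x = b' t x)" using AEG by eventually_elim (use bt in auto)
  qed (use GSI in \<open>auto simp: b'_def indicator_def\<close>)
  show "Lint (%(t, x). indc r x *R g i t x)" if i: "i : Basis" for i r
  proof (rule L1_L1loc_integrable[OF _ gm[OF i]])
  show "h i : L1_L1loc T" using h i by blast
  show "AEL t. t : {0<..<T} --> (AEL x. h i t x = g i t x)"
  using AEG by eventually_elim (use Q(4)[OF _ i] in \<open>auto simp: g_def\<close>)
  qed (use GSI in \<open>auto simp: g_def indicator_def\<close>)
  show "weak_grad (b' t) (%i. g i t)" for t
  proof (cases "t : GS")
  case True
  show ?thesis
  proof (rule has_weak_deriv_weak_grad[where f="b t" and g="%i. h i t"])
  show "AEL x. h i t x = g i t x" if "i : Basis" for i using Q(4)[OF True that] True by (simp add: g_def)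
  qed (use Q(3)[OF True] bt[OF True] sl in auto)
  next
  case False
  then show ?thesis by (simp add: weak_grad_def b'_def g_def loc_int_def)
  qed
 qed
 show ?thesis
  by (rule exI[of _ b'], rule exI[of _ g], rule exI[of _ GS])
  (use W GSI AEG Q(1) bL' bt in \<open>auto simp: b'_def g_def\<close>)
qed

section \<open>Bounded representatives and measurability of norms in time\<close>

text \<open>Clamping at the essential bound changes the representative on a null set only and turns
  the essential bound into a pointwise one.\<close>

lemma Linf_time_representative:
 fixes v :: "real => 'a::euclidean_space => real"
 assumes v: "v : Linf_time T Linf_norm"
 shows "EX V M. jm V & (ALL t x. \<bar>V t x\<bar> <= M) & (ALL t x. t ~: {0<..<T} --> V t x = 0)
  & (AEL p. fst p : {0<..<T} --> v@@p = V@@p)"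
proof -
 have "(%(t, x). v t x) : bm (lebesgue_on ({0<..<T} \<times> UNIV))"
  using v by (simp add: Linf_time_def time_measurable_def)
 from spacetime_representative[OF this] obtain F where F: "jm F" "ALL t x. t ~: {0<..<T} --> F t x = 0"
  "AEL p. fst p : {0<..<T} --> v@@p = F@@p" by blast
 define m where "m = esssup (lebesgue_on {0<..<T}) (%t. Linf_norm (v t))"
 define M where "M = enn2real m"
 have M0: "0 <= M" by (simp add: M_def)
 have m: "m < \<infinity>" using v by (simp add: Linf_time_def m_def)
 have "AEL t. t : {0<..<T} --> Linf_norm (v t) <= m"
  using esssup_AE[of "%t. Linf_norm (v t)" "lebesgue_on {0<..<T}"] by (simp add: m_def AE_lebesgue_on_iff)
 then have vM: "AEL t. t : {0<..<T} --> (AEL x. \<bar>v t x\<bar> <= M)"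
 proof eventually_elim
  case (elim t)
  have "AEL x. en (norm (v t x)) <= Linf_norm (v t)"
  using esssup_AE[of "%x. en (norm (v t x))" lebesgue] by (simp add: Linf_norm_def AE_completion_iff)
  then show ?case
  proof (intro impI, elim eventually_mono)
  fix x assume t: "t : {0<..<T}" and le: "en (norm (v t x)) <= Linf_norm (v t)"
  have "en (norm (v t x)) <= en M" using le elim t m by (simp add: M_def)
  then show "\<bar>v t x\<bar> <= M" using M0 by simp
  qed
 qed
 note [measurable (raw)] = meas2[OF F(1)]
 have FM: "AEL p. \<bar>F@@p\<bar> <= M"
 proof -
  have "AEL t. AEL x. \<bar>F t x\<bar> <= M"
  using vM spacetime_AE_slices[of "{0<..<T}" "%t x. v t x = F t x", OF F(3)]
  proof eventually_elim
  case (elim t)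
  show ?case
  proof (cases "t : {0<..<T}")
  case True
  then have "AEL x. \<bar>v t x\<bar> <= M" "AEL x. v t x = F t x" using elim by auto
  then show ?thesis by eventually_elim simp
  qed (use F(2) M0 in simp)
  qed
  moreover have "{p : space (lborel \<Otimes>\<^sub>M lborel). \<bar>F@@p\<bar> <= M} : sets (lborel \<Otimes>\<^sub>M (lborel :: 'a measure))" by measurable
  ultimately show ?thesis using lborel_pair.AE_pair_iff[of "%t x. \<bar>F t x\<bar> <= M"] unfolding lborel_prod by blast
 qed
 show ?thesis
 proof (rule exI[of _ "%t x. max (- M) (min M (F t x))"], rule exI[of _ M], intro conjI allI impI)
  show "case_prod (%t x. max (- M) (min M (F t x))) : BM" unfolding meas2_iff by measurable
  show "AEL p. fst p : {0<..<T} --> v@@p = max (- M) (min M (F@@p))"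
  using F(3) FM by eventually_elim auto
 qed (use M0 F(2) in auto)
qed

lemma Linf_space_representative:
 fixes u :: "'a::euclidean_space => real"
 assumes u: "u : Linf_space"
 shows "EX U M. U : BM & (ALL x. \<bar>U x\<bar> <= M) & (AEL x. u x = U x)"
proof -
 have "u : bm lebesgue" using u by (simp add: Linf_space_def)
 from borel_representative[OF this] obtain F where F: "F : BM" "AEL x. u x = F x" by blast
 define M where "M = enn2real (Linf_norm u)"
 have M0: "0 <= M" by (simp add: M_def)
 have fin: "Linf_norm u < \<infinity>" using u by (simp add: Linf_space_def)
 have "AEL x. en (norm (u x)) <= Linf_norm u"
  using esssup_AE[of "%x. en (norm (u x))" lebesgue] by (simp add: Linf_norm_def AE_completion_iff)
 then have uM: "AEL x. \<bar>u x\<bar> <= M"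
 proof eventually_elim
  case (elim x)
  then have "en (norm (u x)) <= en M" using fin by (simp add: M_def)
  then show ?case using M0 by simp
 qed
 note [measurable] = F(1)
 show ?thesis
 proof (rule exI[of _ "%x. max (- M) (min M (F x))"], rule exI[of _ M], intro conjI allI)
  show "AEL x. u x = max (- M) (min M (F x))" using F(2) uM by eventually_elim auto
  show "(%x. max (- M) (min M (F x))) : BM" by measurable
 qed (use M0 in auto)
qed

text \<open>Sublevel sets of an essential supremum are described by the vanishing of an integral, so
  that its measurability in a parameter follows from Tonelli.\<close>

lemma Linf_norm_le_iff:
 fixes f :: "'a::euclidean_space => real"
 assumes [measurable]: "f : BM"
 shows "Linf_norm f <= c \<longleftrightarrow> (NN x. ind {x. c < en (norm (f x))} x) = 0"
proof -
 have m: "(%x. en (norm (f x))) : bm lebesgue" by (rule measurable_completion) measurable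
 have "Linf_norm f <= c \<longleftrightarrow> (AEL x. en (norm (f x)) <= c)"
 proof
  assume "Linf_norm f <= c"
  moreover have "AEL x. en (norm (f x)) <= Linf_norm f"
  using esssup_AE[of "%x. en (norm (f x))" lebesgue] by (simp add: Linf_norm_def AE_completion_iff)
  ultimately show "AEL x. en (norm (f x)) <= c" by (auto elim!: eventually_mono)
 next
  assume "AEL x. en (norm (f x)) <= c"
  then show "Linf_norm f <= c" unfolding Linf_norm_def using m by (intro esssup_I) (auto simp: AE_completion_iff)
 qed
 also have "... \<longleftrightarrow> (NN x. ind {x. c < en (norm (f x))} x) = 0"
  by (subst nn_integral_0_iff_AE) (auto simp: indicator_eq_0_iff not_less)
 finally show ?thesis .
qed

lemma bounded_borel_spaces:
 fixes U :: "real => 'a::euclidean_space => real"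
 assumes U: "jm U" and M: "!!t x. \<bar>U t x\<bar> <= M"
 shows "U : Linf_time T Linf_norm" "U : L1_L1loc T"
proof -
 note [measurable (raw)] = meas2[OF U]
 have M0: "0 <= M" using M[of 0 0] by linarith
 have j: "(%(t, x). U t x) : bm (lebesgue_on ({0<..<T} \<times> UNIV))"
  by (rule measurable_restrict_space1, rule measurable_completion) (use U in simp)
 have s: "U t : bm lebesgue" for t by (rule measurable_completion) measurable
 have tm: "time_measurable T N U" if "(%t. N (U t)) : BM" for N
  unfolding time_measurable_def using j s that by (auto intro!: measurable_restrict_space1 measurable_completion)
 have "(%t. Linf_norm (U t)) : BM"
 proof (rule borel_measurableI_le)
  fix c :: ennreal
  have eq: "{t : space borel. Linf_norm (U t) <= c} = {t : space borel. (NN x. ind {x. c < en (norm (U t x))} x) = 0}"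
  by (subst Linf_norm_le_iff) auto
  have [measurable]: "(%p. ind {x. c < en (norm (U (fst p) x))} (snd p) :: ennreal) : bm (borel \<Otimes>\<^sub>M borel)"
  proof -
  have "(%p. ind {x. c < en (norm (U (fst p) x))} (snd p) :: ennreal) = (%p. ind {p. c < en (norm (U@@p))} p)"
  by (auto simp: indicator_def)
  then show ?thesis by simp
  qed
  have "(%t. (NN x. ind {x. c < en (norm (U t x))} x)) : BM"
  by (rule lborel.borel_measurable_nn_integral) (simp add: case_prod_beta')
  then show "{t : space borel. Linf_norm (U t) <= c} : sets borel" unfolding eq by measurable
 qed
 note t1 = tm[OF this]
 have "Linf_norm (U t) <= en M" for t
  unfolding Linf_norm_def using s[of t] M by (intro esssup_I) (auto intro!: measurable_completion ennreal_leI)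
 then have "esssup (lebesgue_on {0<..<T}) (%t. Linf_norm (U t)) <= en M"
  using t1 by (intro esssup_I) (auto simp: time_measurable_def)
 then show "U : Linf_time T Linf_norm" using t1 by (simp add: Linf_time_def le_less_trans)
 have L: "L1_norm (ball a r) (U t) = (NN x. en (norm (U t x))*ind (ball a r) x)" for a r t
  unfolding L1_norm_def by (subst nn_integral_restrict_space) (auto simp: nn_integral_completion)
 show "U : L1_L1loc T" unfolding L1_L1loc_def L1_time_def
 proof (intro CollectI allI conjI)
  fix a r
  show "time_measurable T (L1_norm (ball a r)) U" by (rule tm) (simp add: L)
  have "(\<integral>\<^sup>+t. L1_norm (ball a r) (U t) \<partial>lebesgue_on {0<..<T}) <= (\<integral>\<^sup>+t. en M*emeasure lborel (ball a r) \<partial>lebesgue_on {0<..<T})"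
  proof (rule nn_integral_mono)
  fix t
  have "L1_norm (ball a r) (U t) <= (NN x. en M*ind (ball a r) x)"
  unfolding L using M by (intro nn_integral_mono mult_right_mono ennreal_leI) auto
  then show "L1_norm (ball a r) (U t) <= en M*emeasure lborel (ball a r)" by (simp add: nn_integral_cmult)
  qed
  also have "... = en M*emeasure lborel (ball a r)*emeasure lborel {0<..<T}"
  by (subst nn_integral_restrict_space) (auto simp: nn_integral_completion nn_integral_cmult)
  also have "... < \<infinity>"
  using emeasure_bounded_finite[of "ball a r"] emeasure_bounded_finite[of "{0<..<T}"] by (simp add: ennreal_mult_less_top)
  finally show "(\<integral>\<^sup>+t. L1_norm (ball a r) (U t) \<partial>lebesgue_on {0<..<T}) < \<infinity>" .
 qed
qed

text \<open>The values of \<open>h\<close> on \<open>(0, T)\<close> are infinite only on a null set,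
  where \<open>enn2real\<close> gives 0; elsewhere a Borel version of \<open>h\<close> serves as the
  real majorant.\<close>

lemma time_bound_representative:
 fixes h :: "real => ennreal"
 assumes h: "h : bm (lebesgue_on {0<..<T})" and fin: "(\<integral>\<^sup>+t. h t \<partial>lebesgue_on {0<..<T}) < \<infinity>"
 shows "EX a. Lint a & (ALL t. 0 <= a t) & (ALL t. t ~: {0<..<T} --> a t = 0) & (AEL t. t : {0<..<T} --> h t <= en (a t))"
proof -
 have "(%t. h t*ind {0<..<T} t) : bm (completion lborel)"
  using h by (subst (asm) borel_measurable_restrict_space_iff_ennreal) auto
 from completion_ex_borel_measurable[OF this] obtain H where H: "H : BM" "AEL t. h t*ind {0<..<T} t = H t" by auto
 note [measurable] = H(1)
 have "(NN t. H t) = (NN t. h t*ind {0<..<T} t)" using H(2) by (intro nn_integral_cong_AE) (auto elim: eventually_mono)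
 also have "... = (\<integral>\<^sup>+t. h t \<partial>lebesgue_on {0<..<T})" by (subst nn_integral_restrict_space) (auto simp: nn_integral_completion)
 finally have HI: "(NN t. H t) < \<infinity>" using fin by simp
 then have Hf: "AEL t. H t ~= \<infinity>" by (intro nn_integral_noteq_infinite) auto
 define a where "a = (%t. ind {0<..<T} t*enn2real (H t))"
 have "Lint a"
 proof (rule integrableI_bounded)
  have "(NN t. en (norm (a t))) <= (NN t. H t)"
  by (rule nn_integral_mono_AE) (use Hf in \<open>auto elim!: eventually_mono simp: a_def indicator_def ennreal_enn2real_if less_top\<close>)
  then show "(NN t. en (norm (a t))) < \<infinity>" using HI by (rule le_less_trans)
 qed (simp add: a_def)
 moreover have "AEL t. t : {0<..<T} --> h t <= en (a t)"
  using H(2) Hf by eventually_elim (auto simp: a_def less_top)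
 ultimately show ?thesis by (intro exI[of _ a]) (auto simp: a_def)
qed

lemma indicator_mult_eq:
 fixes f :: "'a => real"
 shows "(!!t. t ~: A ==> f t = 0) ==> (%t. ind A t*f t) = f"
 by (auto simp: fun_eq_iff split: split_indicator)

section \<open>From weak solutions to moment equations, and back\<close>

lemma separated_test_function:
 fixes psi :: "'a::euclidean_space => real"
 assumes th: "smooth_on UNIV th" and e: "0 < e" "!!t. T - e <= t ==> th t = 0" and psi: "tf psi"
 shows "transport_test_function T (%p. th (fst p)*psi (snd p))"
 unfolding transport_test_function_def
proof (intro conjI)
 show "smooth_on ({0..T} \<times> UNIV) (%p. th (fst p)*psi (snd p))"
  unfolding smooth_on_def
 proof (intro allI Ck_on_mult)
  fix k
  have "Ck_on k UNIV th" "Ck_on k UNIV psi" using th psi by (auto simp: smooth_on_def test_function_def)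
  then show "Ck_on k ({0..T} \<times> (UNIV :: 'a set)) (%p. th (fst p))" "Ck_on k ({0..T} \<times> (UNIV :: 'a set)) (%p. psi (snd p))"
  using Ck_on_compose_affine[of k UNIV th fst "{0..T} \<times> (UNIV :: 'a set)" 0]
  Ck_on_compose_affine[of k UNIV psi snd "{0..T} \<times> (UNIV :: 'a set)" 0] by (simp_all add: bounded_linear_fst bounded_linear_snd)
 qed
 obtain r where r: "r > 0" "!!x. r <= norm x ==> psi x = 0" using psi unfolding tf_alt by blast
 show "EX K. compact K & K \<subseteq> {0..<T} \<times> UNIV & (ALL p:{0..T} \<times> UNIV - K. th (fst p)*psi (snd p) = 0)"
 proof (rule exI[of _ "{0..T - e} \<times> cball 0 r"], intro conjI ballI)
  show "compact ({0..T - e} \<times> cball (0::'a) r)" by (intro compact_Times) auto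
  show "{0..T - e} \<times> cball 0 r \<subseteq> {0..<T} \<times> UNIV" using e(1) by auto
  fix p :: "real \<times> 'a" assume p: "p : {0..T} \<times> UNIV - {0..T - e} \<times> cball 0 r"
  then consider "T - e <= fst p" | "r <= norm (snd p)" by (cases p) force
  then show "th (fst p)*psi (snd p) = 0" by cases (use e(2) r(2) in auto)
 qed
qed

lemma test_div_scale:
 assumes psi: "tf psi"
 shows "test_div b g (%x. c*psi x) t x = c*test_div b g psi t x"
proof -
 have s: "smooth_on UNIV psi" using psi by (simp add: test_function_def)
 have "FD (%x. c) (at x) = (%_. 0)"
  using frechet_derivative_at[OF has_derivative_const[of c "at x"]] by simp
 then show ?thesis unfolding test_div_def FD_mult[OF smooth_on_const s] by (simp add: sum_distrib_left algebra_simps)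
qed

text \<open>Test functions \<open>th t * psi x\<close> reduce the weak formulation to one in time,
  to which \<open>du_Bois_Reymond\<close> applies. By uniqueness the divergence in the weak
  formulation is \<open>th t\<close> times \<open>test_div\<close>. The initial moment is expressed
  by \<open>u0\<close> itself and so is the same for all weak solutions.\<close>

lemma weak_solution_moment:
 fixes b :: "real => 'a::euclidean_space => 'a"
 assumes T: "0 < T" and bg: "W11_field b' g" and AEG: "AEL t. t : {0<..<T} --> t : GS"
  and GS: "!!t. t : GS ==> b t : L1loc" "!!t. t : GS ==> AEL x. b t x = b' t x"
  and ws: "weak_solution T b u0 v"
  and V: "jm V" "!!t x. \<bar>V t x\<bar> <= M" "!!t x. t ~: {0<..<T} ==> V t x = 0"
  and vV: "AEL t. t : {0<..<T} --> (AEL x. v t x = V t x)"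
  and psi: "tf psi"
 shows "AEL t. t : {0<..<T} --> (LB x. V t x*psi x)
  = (LINT x|lebesgue. u0 x*psi x) + prim (%s. LB x. V s x*test_div b' g psi s x) t"
proof -
 note W = W11_fieldD[OF bg]
 note [measurable (raw)] = meas2[OF V(1)] meas2[OF test_div_integrable(3)[OF bg psi]]
 note [measurable] = tf_measurable[OF psi]
 have Vp: "(%p. V@@p) : BM" unfolding borel_prod[symmetric] by measurable
 define F where "F = (%t. LB x. V t x*psi x)"
 define G where "G = (%t. LB x. V t x*test_div b' g psi t x)"
 have [measurable]: "F : BM" "G : BM" unfolding F_def G_def by measurable
 have Fz: "F t = 0" "G t = 0" if "t ~: {0<..<T}" for t using V(3)[OF that] by (auto simp: F_def G_def)
 have Fi: "Lint F"
 proof -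
  have "jm (%t x. V t x*psi x)" unfolding meas2_iff by measurable
  then have "Lint (%p. V@@p*psi (snd p))"
  proof (rule st_bound[of "%t x. V t x*psi x" "%t. M*ind {0<..<T} t" "%x. \<bar>psi x\<bar>"])
  show "Lint (%t. M*ind {0<..<T} t)" using T by auto
  show "Lint (%x. \<bar>psi x\<bar>)" using tf_integrable[OF psi] by simp
  show "norm (V t x*psi x) <= M*ind {0<..<T} t*\<bar>psi x\<bar>" for t x
  using V(2)[of t x] V(3)[of t x] by (auto simp: indicator_def abs_mult intro!: mult_right_mono)
  qed
  then show ?thesis unfolding F_def by (rule st_t[of "%t x. V t x*psi x"])
 qed
 have Gi: "Lint G" unfolding G_def
  by (rule st_t[of "%t x. V t x*test_div b' g psi t x"]) (rule Lint_mult[OF test_div_integrable(1)[OF bg psi] Vp V(2)])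
 have "AEL t. t : {0<..<T} --> F t = (LINT x|lebesgue. u0 x*psi x) + prim G t"
 proof (rule du_Bois_Reymond[OF Fi Gi _ T])
  show "G t = 0" if "t <= 0" for t using Fz(2)[of t] that by simp
  fix th eta :: "real => real" and e
  assume th: "smooth_on UNIV th" "!!t. (th has_real_derivative eta t) (at t)" and e: "0 < e" "!!t. T - e <= t ==> th t = 0" and eta: "tf eta"
  let ?phi = "%p. th (fst p)*psi (snd p :: 'a)"
  note tt = separated_test_function[OF th(1) e psi]
  obtain d where d: "has_time_div T (%t x. ?phi (t, x) *R b t x) d"
  and eq: "- (LINT t|lebesgue_on {0<..<T}. LINT x|lebesgue. v t x*deriv (%s. ?phi (s, x)) t)
  - (LINT x|lebesgue. u0 x*?phi (0, x)) - (LINT t|lebesgue_on {0<..<T}. LINT x|lebesgue. v t x*d t x) = 0"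
  using ws tt unfolding weak_solution_def by blast
  have thc: "th : BM"
  using th(2) by (intro borel_measurable_continuous_onI continuous_at_imp_continuous_on ballI DERIV_isCont)
  note [measurable] = thc tf_measurable[OF eta]
  have s1: "(LINT t|lebesgue_on {0<..<T}. LINT x|lebesgue. v t x*deriv (%s. ?phi (s, x)) t) = (LB t. F t*eta t)"
  proof -
  have "(LINT t|lebesgue_on {0<..<T}. LINT x|lebesgue. v t x*deriv (%s. ?phi (s, x)) t) = (LB t. ind {0<..<T} t*(F t*eta t))"
  proof (rule integral_lebesgue_on_AE)
  show "AEL t. t : {0<..<T} --> (LINT x|lebesgue. v t x*deriv (%s. ?phi (s, x)) t) = F t*eta t"
  using vV
  proof eventually_elim
  case (elim t)
  show ?case
  proof
  assume t: "t : {0<..<T}"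
  have dv: "deriv (%s. ?phi (s, x)) t = eta t*psi x" for x
  by (rule DERIV_imp_deriv) (use DERIV_cmult_right[OF th(2)[of t], of "psi x"] in simp)
  have "AEL x. v t x = V t x" using elim t by blast
  then have "AEL x. v t x*(eta t*psi x) = (V t x*psi x)*eta t" by eventually_elim simp
  then have "(LINT x|lebesgue. v t x*deriv (%s. ?phi (s, x)) t) = (LB x. (V t x*psi x)*eta t)"
  unfolding dv by (rule integral_lebesgue_AE[rotated]) measurable
  then show "(LINT x|lebesgue. v t x*deriv (%s. ?phi (s, x)) t) = F t*eta t" by (simp add: F_def)
  qed
  qed
  qed measurable
  also have "(%t. ind {0<..<T} t*(F t*eta t)) = (%t. F t*eta t)" by (rule indicator_mult_eq) (use Fz(1) in simp)
  finally show ?thesis .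
  qed
  have s3: "(LINT t|lebesgue_on {0<..<T}. LINT x|lebesgue. v t x*d t x) = (LB t. G t*th t)"
  proof -
  have dAE: "AEL t. t : {0<..<T} --> has_weak_div (%x. ?phi (t, x) *R b t x) (d t)"
  using d by (simp add: has_time_div_def AE_lebesgue_on_iff)
  have "(LINT t|lebesgue_on {0<..<T}. LINT x|lebesgue. v t x*d t x) = (LB t. ind {0<..<T} t*(G t*th t))"
  proof (rule integral_lebesgue_on_AE)
  show "AEL t. t : {0<..<T} --> (LINT x|lebesgue. v t x*d t x) = G t*th t"
  using vV AEG dAE
  proof eventually_elim
  case (elim t)
  show ?case
  proof
  assume t: "t : {0<..<T}"
  then have tG: "t : GS" and wd: "has_weak_div (%x. ?phi (t, x) *R b t x) (d t)" and ae: "AEL x. v t x = V t x" using elim by auto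
  have t2: "tf (%x. th t*psi x)" by (rule tf_mult_smooth[OF psi smooth_on_const])
  have "has_weak_div (%x. (th t*psi x) *R b t x) (test_div b' g (%x. th t*psi x) t)"
  by (rule weak_div_product[where b=b' and g=g and t=t and f="b t", OF W(5) GS[OF tG] t2])
  from has_weak_div_unique[OF _ this, of "d t"] wd
  have "AEL x. d t x = th t*test_div b' g psi t x" by (simp add: test_div_scale[OF psi])
  then have "AEL x. v t x*d t x = (V t x*test_div b' g psi t x)*th t" using ae by eventually_elim simp
  then have "(LINT x|lebesgue. v t x*d t x) = (LB x. (V t x*test_div b' g psi t x)*th t)"
  by (rule integral_lebesgue_AE[rotated]) measurable
  then show "(LINT x|lebesgue. v t x*d t x) = G t*th t" by (simp add: G_def)
  qed
  qed
  qed measurable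
  also have "(%t. ind {0<..<T} t*(G t*th t)) = (%t. G t*th t)" by (rule indicator_mult_eq) (use Fz(2) in simp)
  finally show ?thesis .
  qed
  have s2: "(LINT x|lebesgue. u0 x*?phi (0, x)) = (LINT x|lebesgue. u0 x*psi x)*th 0"
  proof -
  have "(%x. u0 x*?phi (0, x)) = (%x. (u0 x*psi x)*th 0)" by (simp add: mult_ac)
  then show ?thesis by simp
  qed
  show "(LB t. F t*eta t) + (LINT x|lebesgue. u0 x*psi x)*th 0 + (LB t. G t*th t) = 0"
  using eq unfolding s1 s2 s3 by linarith
 qed
 then show ?thesis unfolding F_def G_def .
qed

text \<open>Each transport test function yields an admissible tuple, and \<open>div_prod\<close> is
  the explicit witness for the divergence of \<open>b\<close> times the test function.\<close>

lemma clean_solution_weak_solution: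
 fixes b :: "real => 'a::euclidean_space => 'a"
 assumes T: "0 < T" and bg: "W11_field b' g" and AEG: "AEL t. t : {0<..<T} --> t : GS"
  and GS: "!!t. t : GS ==> b t : L1loc" "!!t. t : GS ==> AEL x. b t x = b' t x"
  and U0: "U0 : BM" "AEL x. u0 x = U0 x"
  and U: "jm U" "!!t x. \<bar>U t x\<bar> <= M" and cs: "clean_solution T b' g U0 U"
 shows "weak_solution T b u0 U"
 unfolding weak_solution_def
proof (intro conjI allI impI)
 show "U : L1_L1loc T" by (rule bounded_borel_spaces(2)[OF U])
 fix phi :: "real \<times> 'a => real" assume phi: "transport_test_function T phi"
 define Phi where "Phi = (%t x. ind {0<..<T} t*phi (t, x))"
 from transport_admissible[OF phi T] obtain phit D R C where adm: "admissible T Phi phit D (%x. phi (0, x)) R C"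
  and dv: "!!t x. t : {0<..<T} ==> deriv (%s. phi (s, x)) t = phit t x" unfolding Phi_def by blast
 note a = admissibleD[OF adm] and W = W11_fieldD[OF bg]
 define d where "d = div_prod b' g Phi D"
 have dm: "jm d" unfolding d_def by (rule div_prod_measurable[OF bg adm])
 note [measurable (raw)] = meas2[OF U(1)] meas2[OF dm] meas2[OF a(2)]
 have Up: "(%p. U@@p) : BM" unfolding borel_prod[symmetric] by measurable
 have dz: "d t x = 0" if "t ~: {0<..<T}" for t x using a(5,7)[OF that] by (simp add: d_def div_prod_def)
 have dt: "d t = test_div b' g (Phi t) t" if "t : {0<..<T}" for t
  unfolding d_def div_prod_def test_div_def field_div_def fun_eq_iff
  using a(9)[OF that] by (simp add: sum.distrib sum_distrib_left)
 have di: "Lint (%p. d@@p)" and ti: "Lint (%p. phit@@p)"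
  using admissible_integrable[OF bg adm] by (auto simp: d_def)
 have Udi: "Lint (%p. U@@p*d@@p)" by (rule Lint_mult[OF di Up U(2)])
 have Uti: "Lint (%p. U@@p*phit@@p)" by (rule Lint_mult[OF ti Up U(2)])
 show "EX d. has_time_div T (%t x. phi (t, x) *R b t x) d &
  integrable (lebesgue_on ({0<..<T} \<times> UNIV)) (%(t, x). U t x*d t x) &
  - (LINT t|lebesgue_on {0<..<T}. LINT x|lebesgue. U t x*deriv (%s. phi (s, x)) t)
  - (LINT x|lebesgue. u0 x*phi (0, x)) - (LINT t|lebesgue_on {0<..<T}. LINT x|lebesgue. U t x*d t x) = 0"
 proof (rule exI[of _ d], intro conjI)
  show "has_time_div T (%t x. phi (t, x) *R b t x) d"
  unfolding has_time_div_def
  proof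
  show "(%(t, x). d t x) : bm (lebesgue_on ({0<..<T} \<times> UNIV))"
  by (rule measurable_restrict_space1, rule measurable_completion) (use dm in simp)
  have "AEL t. t : {0<..<T} --> has_weak_div (%x. phi (t, x) *R b t x) (d t)"
  using AEG
  proof eventually_elim
  case (elim t)
  show ?case
  proof
  assume t: "t : {0<..<T}"
  then have tG: "t : GS" using elim by simp
  have "has_weak_div (%x. Phi t x *R b t x) (d t)"
  unfolding dt[OF t] by (rule weak_div_product[where b=b' and g=g and t=t and f="b t", OF W(5) GS[OF tG] a(8)[OF t]])
  then show "has_weak_div (%x. phi (t, x) *R b t x) (d t)" using t by (simp add: Phi_def)
  qed
  qed
  then show "AE t in lebesgue_on {0<..<T}. has_weak_div (%x. phi (t, x) *R b t x) (d t)" by (simp add: AE_lebesgue_on_iff)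
  qed
  have "Lint (%p. ind ({0<..<T} \<times> UNIV) p*(U@@p*d@@p))"
  by (rule integrable_indicator_mult[OF Udi]) simp
  moreover have "(%p. ind ({0<..<T} \<times> UNIV) p*(U@@p*d@@p)) : bm lborel"
  using calculation by (rule Lint_meas)
  ultimately have "integrable lebesgue (%p. ind ({0<..<T} \<times> UNIV) p*(U@@p*d@@p))"
  by (subst integrable_completion) auto
  then show "integrable (lebesgue_on ({0<..<T} \<times> UNIV)) (%(t, x). U t x*d t x)"
  by (subst integrable_restrict_space) (auto simp: case_prod_beta')
  have bor: "(LINT x|lebesgue. f x) = (LB x. f x)" if "f : BM" for f :: "'a => real"
  using that by (simp add: integral_completion)
  have s1: "(LINT t|lebesgue_on {0<..<T}. LINT x|lebesgue. U t x*deriv (%s. phi (s, x)) t) = (LB p. U@@p*phit@@p)"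
  proof -
  have "(LINT t|lebesgue_on {0<..<T}. LINT x|lebesgue. U t x*deriv (%s. phi (s, x)) t) = (LB t. ind {0<..<T} t*(LB x. U t x*phit t x))"
  proof (rule integral_lebesgue_on_AE)
  show "AEL t. t : {0<..<T} --> (LINT x|lebesgue. U t x*deriv (%s. phi (s, x)) t) = (LB x. U t x*phit t x)"
  proof (intro AE_I2 impI)
  fix t assume t: "t : {0<..<T}"
  show "(LINT x|lebesgue. U t x*deriv (%s. phi (s, x)) t) = (LB x. U t x*phit t x)"
  unfolding dv[OF t] by (rule bor) measurable
  qed
  qed measurable
  also have "(%t. ind {0<..<T} t*(LB x. U t x*phit t x)) = (%t. LB x. U t x*phit t x)"
  by (rule indicator_mult_eq) (use a(6) in simp)
  finally show ?thesis using st_tx[of "%t x. U t x*phit t x", OF Uti] by simp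
  qed
  have s3: "(LINT t|lebesgue_on {0<..<T}. LINT x|lebesgue. U t x*d t x) = (LB p. U@@p*d@@p)"
  proof -
  have "(LINT t|lebesgue_on {0<..<T}. LINT x|lebesgue. U t x*d t x) = (LB t. ind {0<..<T} t*(LB x. U t x*d t x))"
  proof (rule integral_lebesgue_on_AE)
  show "AEL t. t : {0<..<T} --> (LINT x|lebesgue. U t x*d t x) = (LB x. U t x*d t x)"
  proof (intro AE_I2 impI)
  fix t show "(LINT x|lebesgue. U t x*d t x) = (LB x. U t x*d t x)" by (rule bor) measurable
  qed
  qed measurable
  also have "(%t. ind {0<..<T} t*(LB x. U t x*d t x)) = (%t. LB x. U t x*d t x)"
  by (rule indicator_mult_eq) (use dz in simp)
  finally show ?thesis using st_tx[of "%t x. U t x*d t x", OF Udi] by simp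
  qed
  have s2: "(LINT x|lebesgue. u0 x*phi (0, x)) = (LB x. U0 x*phi (0, x))"
  proof (rule integral_lebesgue_AE)
  note [measurable] = U0(1) a(4)
  show "(%x. U0 x*phi (0, x)) : BM" by measurable
  show "AEL x. u0 x*phi (0, x) = U0 x*phi (0, x)" using U0(2) by eventually_elim simp
  qed
  have "(LB p. U@@p*(phit@@p + d@@p)) = - (LB x. U0 x*phi (0, x))"
  using cs adm unfolding clean_solution_def d_def by blast
  then have "(LB p. U@@p*phit@@p) + (LB p. U@@p*d@@p) = - (LB x. U0 x*phi (0, x))"
  unfolding distrib_left L_add[OF Uti Udi] .
  then show "- (LINT t|lebesgue_on {0<..<T}. LINT x|lebesgue. U t x*deriv (%s. phi (s, x)) t)
  - (LINT x|lebesgue. u0 x*phi (0, x)) - (LINT t|lebesgue_on {0<..<T}. LINT x|lebesgue. U t x*d t x) = 0"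
  unfolding s1 s2 s3 by linarith
 qed
qed

section \<open>The exponential class and the well-posedness theorem\<close>

text \<open>Strictness yields a competitor \<open>l < c\<close> below the infimum's upper bound, and
  the exponential integral decreases when \<open>l\<close> grows to \<open>c\<close>.\<close>

lemma ExpL_norm_lessD:
 assumes "ExpL_norm f < en c"
 shows "(NN x. en (exp (\<bar>f x\<bar> / c) - 1)) <= 1"
proof -
 obtain l where l: "0 < l" "en l < en c" "(\<integral>\<^sup>+x. en (exp (\<bar>f x\<bar> / l) - 1) \<partial>lebesgue) <= 1"
  using assms unfolding ExpL_norm_def Inf_less_iff by auto
 have lc: "l < c" using l(1,2) by (simp add: ennreal_less_iff)
 have "(NN x. en (exp (\<bar>f x\<bar> / c) - 1)) <= (NN x. en (exp (\<bar>f x\<bar> / l) - 1))"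
  using l(1) lc by (intro nn_integral_mono ennreal_leI) (simp add: divide_left_mono)
 then show ?thesis using l(3) by (simp add: nn_integral_completion)
qed

lemma Linf_norm_AE_le:
 assumes "Linf_norm f <= en c" "0 <= c"
 shows "AEL x. norm (f x) <= c"
proof -
 have "AEL x. en (norm (f x)) <= Linf_norm f"
  using esssup_AE[of "%x. en (norm (f x))" lebesgue] by (simp add: Linf_norm_def AE_completion_iff)
 then show ?thesis
 proof eventually_elim
  case (elim x)
  then have "en (norm (f x)) <= en c" using assms(1) by (rule order_trans)
  then show ?case using assms(2) by simp
 qed
qed

lemma transport_well_posed:
 fixes b :: "real => 'a::euclidean_space => 'a" and u0 :: "'a => real"
 assumes T: "0 < T" and b: "b : L1_W11loc T"
  and growth: "(%t x. norm (b t x) / (1 + norm x)) : L1_time T (L1_norm UNIV) + L1_time T Linf_norm"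
  and div: "EX d. has_time_div T b d & d : L1_time T Linf_norm + L1_time T ExpL_norm"
  and u0: "u0 : Linf_space"
 shows "EX u. (u : Linf_time T Linf_norm & weak_solution T b u0 u) &
  (ALL v. v : Linf_time T Linf_norm & weak_solution T b u0 v -->
  (AE (t, x) in lebesgue_on ({0<..<T} \<times> UNIV). v t x = u t x))"
proof -
 obtain f1 f2 where f: "f1 : L1_time T (L1_norm UNIV)" "f2 : L1_time T Linf_norm"
  "(%t x. norm (b t x) / (1 + norm x)) = f1 + f2" using growth by (rule set_plus_elim)
 have feq: "norm (b t x) / (1 + norm x) = f1 t x + f2 t x" for t x using fun_cong[OF fun_cong[OF f(3)], of t x] by simp
 obtain d where d: "has_time_div T b d" "d : L1_time T Linf_norm + L1_time T ExpL_norm" using div by blast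
 obtain d1 d2 where dd: "d1 : L1_time T Linf_norm" "d2 : L1_time T ExpL_norm" "d = d1 + d2" using d(2) by (rule set_plus_elim)
 have deq: "d t x = d1 t x + d2 t x" for t x using dd(3) by simp
 have rep: "EX a. Lint a & (ALL t. 0 <= a t) & (ALL t. t ~: {0<..<T} --> a t = 0) & (AEL t. t : {0<..<T} --> N (h t) <= en (a t))"
  if "h : L1_time T N" for h :: "real => 'a => real" and N
  using that by (intro time_bound_representative) (auto simp: L1_time_def time_measurable_def)
 from rep[OF f(2)] obtain a1 where a1: "Lint a1" "ALL t. 0 <= a1 t" "ALL t. t ~: {0<..<T} --> a1 t = 0"
  "AEL t. t : {0<..<T} --> Linf_norm (f2 t) <= en (a1 t)" by blast
 from rep[OF dd(1)] obtain a2 where a2: "Lint a2" "ALL t. 0 <= a2 t" "ALL t. t ~: {0<..<T} --> a2 t = 0"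
  "AEL t. t : {0<..<T} --> Linf_norm (d1 t) <= en (a2 t)" by blast
 from rep[OF dd(2)] obtain a3 where a3: "Lint a3" "ALL t. 0 <= a3 t" "ALL t. t ~: {0<..<T} --> a3 t = 0"
  "AEL t. t : {0<..<T} --> ExpL_norm (d2 t) <= en (a3 t)" by blast
 \<comment> \<open>All hypotheses on time slices, collected so that they hold at every time of the
   good set.\<close>
 define P where "P = (%t. Linf_norm (f2 t) <= en (a1 t) & Linf_norm (d1 t) <= en (a2 t) & ExpL_norm (d2 t) <= en (a3 t) & has_weak_div (b t) (d t))"
 have "AEL t. t : {0<..<T} --> has_weak_div (b t) (d t)" using d(1) by (simp add: has_time_div_def AE_lebesgue_on_iff)
 then have PAE: "AEL t. t : {0<..<T} --> P t" using a1(4) a2(4) a3(4) by eventually_elim (simp add: P_def)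
 from field_representative[OF b PAE] obtain b' g GS where bg: "W11_field b' g"
  and bz: "ALL t x. t ~: GS --> b' t x = 0" and gz: "ALL t x. ALL i:Basis. t ~: GS --> g i t x = 0"
  and GSm: "GS : sets borel" and GSI: "GS \<subseteq> {0<..<T}" and AEG: "AEL t. t : {0<..<T} --> t : GS"
  and GS: "ALL t:GS. P t & b t : L1loc & (AEL x. b t x = b' t x)" by blast
 have GSD: "P t" "b t : L1loc" "AEL x. b t x = b' t x" if "t : GS" for t using GS that by auto
 have z: "!!t x. t ~: {0<..<T} ==> b' t x = 0" "!!t x i. t ~: {0<..<T} ==> i : Basis ==> g i t x = 0"
  using bz gz GSI by (meson subsetD)+
 obtain U0 M0 where U0: "U0 : BM" "!!x. \<bar>U0 x\<bar> <= M0" "AEL x. u0 x = U0 x"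
  using Linf_space_representative[OF u0] by blast
 obtain U where U: "jm U" "!!t x. \<bar>U t x\<bar> <= 2*M0" "clean_solution T b' g U0 U"
  using clean_solution_exists[of b' g T U0 M0, OF bg z(1) U0(1,2)] by blast
 note ws = clean_solution_weak_solution[OF T bg AEG GSD(2,3) U0(1,3) U]
 \<comment> \<open>The 1 serves twice: it makes \<open>beta\<close> strictly larger than the
   \<open>Exp L\<close> norm, as \<open>ExpL_norm_lessD\<close> asks, and positive on
   \<open>(0, T)\<close> for the division in \<open>sig\<close>.\<close>
 define beta where "beta = (%t. ind {0<..<T} t*(a3 t + 1))"
 define a where "a = (%t. a1 t + a2 t)"
 \<comment> \<open>The excess of the growth over \<open>a\<close>: it is Borel because
   \<open>b'\<close> is, and at each good time at most \<open>norm (f1 t x)\<close> for almost every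
   \<open>x\<close>, hence integrable.\<close>
 define gam where "gam = (%t x. max 0 (norm (b' t x) / (1 + norm x) - a t))"
 \<comment> \<open>The excess of the divergence over \<open>a\<close>, in units of
   \<open>beta\<close>; at almost every time it is at most \<open>\<bar>d2\<bar> / beta\<close>
   almost everywhere, which gives the normalisation in \<open>Exp L\<close>.\<close>
 define sig where "sig = (%t x. if 0 < beta t then max 0 ((\<bar>field_div g t x\<bar> - a t) / beta t) else 0)"
 note W = W11_fieldD[OF bg] and fd = field_div_props[OF bg]
 have ai: "Lint a" unfolding a_def by (intro I_add a1 a2)
 have a0: "0 <= a t" for t using a1(2) a2(2) by (simp add: a_def)
 have "Lint (ind {0<..<T} :: real => real)" using T by simp
 from I_add[OF integrable_indicator_mult[OF a3(1), of "{0<..<T}"] this]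
 have betai: "Lint beta" by (simp add: beta_def distrib_left)
 have beta0: "0 <= beta t" for t using a3(2) by (simp add: beta_def)
 have betapos: "0 < beta t" if "t : {0<..<T}" for t using a3(2) that by (simp add: beta_def add_nonneg_pos)
 note [measurable (raw)] = meas2[OF W(1)] meas2[OF fd(1)] meas2[OF U(1)]
 have [measurable]: "a : BM" "beta : BM" using ai betai by (auto dest: Lint_meas)
 have gamm: "jm gam" unfolding gam_def meas2_iff by measurable
 have sigm: "jm sig" unfolding sig_def meas2_iff by measurable
 note [measurable (raw)] = meas2[OF gamm] meas2[OF sigm]
 have gami: "Lint (%p. gam@@p)"
 proof (rule integrableI_bounded)
  show "(%p. gam@@p) : bm lborel" by (simp add: borel_prod[symmetric])
  have "(NN p. en (norm (gam@@p))) = (NN t. NN x. en (norm (gam t x)))"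
  by (rule st_nn[of "%t x. en (norm (gam t x))"]) (simp add: meas2_iff)
  also have "... <= (NN t. L1_norm UNIV (f1 t)*ind {0<..<T} t)"
  proof (rule nn_integral_mono)
  fix t
  show "(NN x. en (norm (gam t x))) <= L1_norm UNIV (f1 t)*ind {0<..<T} t"
  proof (cases "t : GS")
  case True
  have "AEL x. norm (f2 t x) <= a1 t" using GSD(1)[OF True] a1(2) by (intro Linf_norm_AE_le) (auto simp: P_def)
  then have "AEL x. norm (gam t x) <= norm (f1 t x)" using GSD(3)[OF True]
  proof eventually_elim
  case (elim x)
  have "norm (b' t x) / (1 + norm x) <= norm (f1 t x) + a1 t" using feq[of t x] elim abs_ge_self[of "f1 t x"] abs_ge_self[of "f2 t x"] by simp
  then show ?case using a2(2)[rule_format, of t] by (simp add: gam_def a_def)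
  qed
  then have "(NN x. en (norm (gam t x))) <= (NN x. en (norm (f1 t x)))"
  by (intro nn_integral_mono_AE) (auto elim!: eventually_mono intro: ennreal_leI)
  also have "(NN x. en (norm (f1 t x))) = L1_norm UNIV (f1 t)"
  unfolding L1_norm_def by (subst nn_integral_restrict_space) (auto simp: nn_integral_completion)
  finally show ?thesis using subsetD[OF GSI True] by simp
  next
  case False
  then have "gam t x = 0" for x using bz a0[of t] by (simp add: gam_def)
  then show ?thesis by simp
  qed
  qed
  also have "... = (\<integral>\<^sup>+t. L1_norm UNIV (f1 t) \<partial>lebesgue_on {0<..<T})" by (subst nn_integral_restrict_space) (auto simp: nn_integral_completion)
  also have "... < \<infinity>" using f(1) by (simp add: L1_time_def)
  finally show "(NN p. en (norm (gam@@p))) < \<infinity>" .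
 qed
 have sig1: "AEL t. (NN x. en (exp (sig t x) - 1)) <= 1"
  using AEG
 proof eventually_elim
  case (elim t)
  show ?case
  proof (cases "t : {0<..<T}")
  case True
  then have tG: "t : GS" using elim by simp
  have bp: "0 < beta t" by (rule betapos[OF True])
  have wd: "has_weak_div (b t) (d t)" and l1: "Linf_norm (d1 t) <= en (a2 t)" and l2: "ExpL_norm (d2 t) <= en (a3 t)"
  using GSD(1)[OF tG] by (auto simp: P_def)
  have "AEL x. d t x = field_div g t x"
  by (rule has_weak_div_unique[OF wd weak_div_field[where b=b' and g=g and t=t and f="b t", OF W(5) GSD(2,3)[OF tG]]])
  moreover have "AEL x. norm (d1 t x) <= a2 t" using l1 a2(2) by (intro Linf_norm_AE_le) auto
  ultimately have "AEL x. sig t x <= \<bar>d2 t x\<bar> / beta t"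
  proof eventually_elim
  case (elim x)
  have "\<bar>field_div g t x\<bar> - a t <= \<bar>d2 t x\<bar>" using elim deq[of t x] a1(2)[rule_format, of t] by (simp add: a_def)
  then have "(\<bar>field_div g t x\<bar> - a t) / beta t <= \<bar>d2 t x\<bar> / beta t" using bp by (intro divide_right_mono) auto
  then show ?case using bp by (simp add: sig_def)
  qed
  then have "(NN x. en (exp (sig t x) - 1)) <= (NN x. en (exp (\<bar>d2 t x\<bar> / beta t) - 1))"
  by (intro nn_integral_mono_AE) (auto elim!: eventually_mono intro: ennreal_leI)
  also have "... <= 1"
  proof (rule ExpL_norm_lessD)
  have "en (a3 t) < en (beta t)" using True a3(2) by (simp add: beta_def ennreal_less_iff)
  with l2 show "ExpL_norm (d2 t) < en (beta t)" by (rule le_less_trans)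
  qed
  finally show ?thesis .
  qed (simp add: sig_def beta_def)
 qed
 have gr: "norm (b' t x) <= (1 + norm x)*(gam t x + a t)" for t x
 proof -
  have p: "0 < 1 + norm x" by (simp add: add_pos_nonneg)
  have "norm (b' t x) / (1 + norm x) <= gam t x + a t" by (simp add: gam_def)
  then show ?thesis using p by (simp add: pos_divide_le_eq mult.commute)
 qed
 have dv: "\<bar>field_div g t x\<bar> <= a t + beta t * sig t x" for t x
 proof (cases "0 < beta t")
  case True
  have "(\<bar>field_div g t x\<bar> - a t) / beta t <= sig t x" using True by (simp add: sig_def)
  then show ?thesis using True by (simp add: pos_divide_le_eq mult.commute)
 next
  case False
  then have "t ~: {0<..<T}" using betapos by blast
  then show ?thesis using z(2) a0[of t] beta0[of t] by (simp add: field_div_def sig_def)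
 qed
 \<comment> \<open>A weak solution is arbitrary outside \<open>(0, T)\<close>, while
   \<open>weak_solution_moment\<close> expects a representative that vanishes there.\<close>
 let ?U = "%t x. ind {0<..<T} t*U t x"
 show ?thesis
 proof (rule exI[of _ U], intro conjI allI impI)
  show "U : Linf_time T Linf_norm" by (rule bounded_borel_spaces(1)[OF U(1,2)])
  show "weak_solution T b u0 U" by (rule ws)
  fix v assume v: "v : Linf_time T Linf_norm & weak_solution T b u0 v"
  from Linf_time_representative[OF conjunct1[OF v]] obtain V M where V: "jm V"
  "!!t x. \<bar>V t x\<bar> <= M" "!!t x. t ~: {0<..<T} ==> V t x = 0" and vV: "AEL p. fst p : {0<..<T} --> v@@p = V@@p" by blast
  note [measurable (raw)] = meas2[OF V(1)]
  have Um: "case_prod ?U : BM" unfolding meas2_iff by measurable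
  have Ub: "\<bar>?U t x\<bar> <= 2*M0" for t x using U(2)[of t x] by (auto simp: indicator_def)
  define w where "w = (%t x. V t x - ?U t x)"
  have wm: "jm w" unfolding w_def meas2_iff by measurable
  note [measurable (raw)] = meas2[OF wm]
  have wK: "\<bar>w t x\<bar> <= M + 2*M0" for t x using V(2)[of t x] Ub[of t x] unfolding w_def by linarith
  have eq: "AEL t. t : {0<..<T} --> (LB x. w t x*psi x) = prim (%s. LB x. w s x*test_div b' g psi s x) t"
  if psi: "tf psi" for psi
  proof -
  have mV: "AEL t. t : {0<..<T} --> (LB x. V t x*psi x)
  = (LINT x|lebesgue. u0 x*psi x) + prim (%s. LB x. V s x*test_div b' g psi s x) t"
  by (rule weak_solution_moment[OF T bg AEG GSD(2,3) conjunct2[OF v] V _ psi], assumption+)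
  (rule spacetime_AE_slices[OF vV])
  have mU: "AEL t. t : {0<..<T} --> (LB x. ?U t x*psi x)
  = (LINT x|lebesgue. u0 x*psi x) + prim (%s. LB x. ?U s x*test_div b' g psi s x) t"
  by (rule weak_solution_moment[OF T bg AEG GSD(2,3) ws Um Ub _ _ psi]) auto
  note td = test_div_integrable[OF bg psi]
  have Vt: "V t : BM" "?U t : BM" for t by measurable
  have Vp: "(%p. V@@p) : BM" "(%p. ?U@@p) : BM"
  unfolding borel_prod[symmetric] by measurable
  have e1: "(LB x. w t x*psi x) = (LB x. V t x*psi x) - (LB x. ?U t x*psi x)" for t
  unfolding w_def left_diff_distrib
  by (rule L_diff[OF Lint_mult[OF tf_integrable[OF psi] Vt(1) V(2)] Lint_mult[OF tf_integrable[OF psi] Vt(2) Ub]])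
  have e2: "(LB x. w t x*test_div b' g psi t x) = (LB x. V t x*test_div b' g psi t x) + (- 1)*(LB x. ?U t x*test_div b' g psi t x)" for t
  unfolding w_def left_diff_distrib
  using L_diff[OF Lint_mult[OF td(2) Vt(1) V(2)] Lint_mult[OF td(2) Vt(2) Ub]] by simp
  note i1 = st_t[of "%t x. V t x*test_div b' g psi t x", OF Lint_mult[OF td(1) Vp(1) V(2)]]
  note i2 = st_t[of "%t x. ?U t x*test_div b' g psi t x", OF Lint_mult[OF td(1) Vp(2) Ub]]
  have e3: "prim (%s. LB x. w s x*test_div b' g psi s x) t
  = prim (%s. LB x. V s x*test_div b' g psi s x) t + (- 1)*prim (%s. LB x. ?U s x*test_div b' g psi s x) t" for t
  unfolding e2 prim_add[OF i1 integrable_mult_right[OF i2]] prim_cmult ..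
  show ?thesis using mV mU by eventually_elim (auto simp: e1 e3)
  qed
  interpret transport_uniqueness T "M + 2*M0" b' g w a beta gam sig
  proof
  show "0 <= gam t x" for t x by (simp add: gam_def)
  show "0 <= sig t x" for t x by (simp add: sig_def)
  show "beta t = 0" if "t <= 0" for t using that by (simp add: beta_def)
  qed (use bg wm wK T z eq ai a0 betai beta0 gami sigm sig1 gr dv in auto)
  have "AEL t. AEL x. w t x = 0"
  using vanishing
  proof eventually_elim
  case (elim t)
  show ?case
  proof (cases "t : {0<..<T}")
  case False
  then have "w t x = 0" for x using V(3)[OF False] by (simp add: w_def)
  then show ?thesis by simp
  qed (use elim in simp)
  qed
  moreover have "{p : space (lborel \<Otimes>\<^sub>M lborel). w@@p = 0} : sets (lborel \<Otimes>\<^sub>M (lborel :: 'a measure))" by measurable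
  ultimately have "AEL p. w@@p = 0"
  using lborel_pair.AE_pair_iff[of "%t x. w t x = 0"] unfolding lborel_prod by blast
  then have "AEL p. p : {0<..<T} \<times> UNIV --> v@@p = U@@p"
  using vV by eventually_elim (auto simp: w_def)
  then show "AE (t, x) in lebesgue_on ({0<..<T} \<times> UNIV). v t x = U t x"
  by (subst AE_lebesgue_on_iff) (auto simp: case_prod_beta')
 qed
qed

theorem corollary4:
  fixes T :: real
    and b :: "real \<Rightarrow> real ^ 'n \<Rightarrow> real ^ 'n"
    and u\<^sub>0 :: "real ^ 'n \<Rightarrow> real"
  assumes "0 < T"
    and "b \<in> L1_W11loc T"
    and "(\<lambda>t x. norm (b t x) / (1 + norm x)) \<in> L1_time T (L1_norm UNIV) + L1_time T Linf_norm"
    and "\<exists>d. has_time_div T b d \<and> d \<in> L1_time T Linf_norm + L1_time T ExpL_norm"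
    and "u\<^sub>0 \<in> Linf_space"
  shows "\<exists>u. (u \<in> Linf_time T Linf_norm \<and> weak_solution T b u\<^sub>0 u) \<and>
           (\<forall>v. v \<in> Linf_time T Linf_norm \<and> weak_solution T b u\<^sub>0 v \<longrightarrow>
              (AE (t, x) in lebesgue_on ({0<..<T} \<times> UNIV). v t x = u t x))"
  using assms by (rule transport_well_posed)

end
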